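(* Let $(M,d)$ be a compact metric space and $\varphi:M\to M$ continuous satisfying (S) and (USCE). Let $\{\mathbb P_n\}\subset\mathcal P(M)$ and $\mathcal G=\{G_n\}\in\mathcal A(M)$ be such that: (C1) for all $V\in C(M)$, $\lim_{n\to\infty}\frac1n\log\int_Me^{S_nV}\,d\mathbb P_n=\mathfrak p_\varphi(\mathcal G_V)-\mathfrak p_\varphi(\mathcal G)$, where $\mathcal G_V=\{G_n+S_nV\}$; (C2) for every sufficiently small $\delta>0$ there are an integer $n_0(\delta)\ge1$ and sequences $K_n(\delta)\ge1$, $m_\delta(n)\in\mathbb N$ such that $K_n(\delta)^{-1}e^{G_n(x)-n\mathfrak p_\varphi(\mathcal G)}\le\mathbb P_n(B_{n-m_\delta(n)}(x,\delta))$ for all $x\in M$, $n\ge n_0(\delta)$, and $\lim_{\delta\downarrow0}\limsup_{n}\frac1n(\log K_n(\delta)+m_\delta(n))=0$. Then: (1) the empirical measures $\mu_n^x$ under $\mathbb P_n$ satisfy the LDP: for every Borel $\Gamma\subset\mathcal P(M)$, $-\inf_{\mathrm{int}\Gamma}\mathbb I\le\liminf_n\frac1n\log\mathbb P_n\{\mu_n^\cdot\in\Gamma\}\le\limsup_n\frac1n\log\mathbb P_n\{\mu_n^\cdot\in\Gamma\}\le-\inf_{\overline\Gamma}\mathbb I$, with $\mathbb I(\mathbb Q)=-\mathcal G(\mathbb Q)-h_\varphi(\mathbb Q)+\mathfrak p_\varphi(\mathcal G)$ for $\mathbb Q\in\mathcal P_\varphi(M)$ and $+\infty$ otherwise; (2)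 for any $\mathcal V=\{V_n\}\in\mathcal A(M)$, $n^{-1}V_n$ under $\mathbb P_n$ satisfies the LDP (same form of bounds on Borel sets of $\mathbb R$) with the good convex rate function $I(s)=\inf\{\mathbb I(\mathbb Q):\mathbb Q\in\mathcal P_\varphi(M),\mathcal V(\mathbb Q)=s\}$, and $I$ is the Legendre transform of $\alpha\mapsto\mathfrak p_\varphi(\mathcal G+\alpha\mathcal V)-\mathfrak p_\varphi(\mathcal G)$.
   Context: Notation: $C(M),B(M)$ continuous/bounded Borel real functions with sup norm; $\mathcal P(M)$ Borel probability measures (weak topology), $\mathcal P_\varphi(M)$ invariant ones; $h_\varphi$ Kolmogorov–Sinai entropy, $h_{\rm Top}$ topological entropy; $S_nG=\sum_{k<n}G\circ\varphi^k$; $\mu_n^x=\frac1n\sum_{k<n}\delta_{\varphi^kx}$; $B_n(x,\epsilon)=\{y:d(\varphi^ky,\varphi^kx)<\epsilon,\ 0\le k<n\}$. $\mathcal A(M)$: $\{G_n\}\subset B(M)$ such that some $\{G^{(k)}\}\subset C(M)$ has $\lim_k\limsup_nn^{-1}\|G_n-S_nG^{(k)}\|_\infty=0$; $\mathcal G(\mathbb Q)=\lim_nn^{-1}\int G_nd\mathbb Q$ for $\mathbb Q\in\mathcal P_\varphi(M)$ (exists). Pressure $\mathfrak p_\varphi(\mathcal G)=\lim_{\epsilon\downarrow0}\limsup_nn^{-1}\log\inf\{\sum_{x\in E}e^{G_n(x)}:E\text{ finite},\bigcup_{x\in E}B_n(x,\epsilon)=M\}$. (USCE): $h_{\rm Top}(\varphi)<\infty$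 and $h_\varphi$ upper semicontinuous on $\mathcal P_\varphi(M)$. (S): for every $\delta>0$ there is $N(\delta)\ge1$ such that for any finite family of orbit segments $\{\varphi^kx_i\}_{k\in I_i}$, $I_i\subset\mathbb Z_+$ integer intervals pairwise at distance $\ge N(\delta)$, some $x\in M$ satisfies $d(\varphi^kx,\varphi^kx_i)<\delta$ for all $i$ and $k\in I_i$. *)

theory Defs
  imports "HOL-Analysis.Analysis" "HOL-Probability.Probability"
begin

definition birkhoff :: "('a \<Rightarrow> 'a) \<Rightarrow> nat \<Rightarrow> ('a \<Rightarrow> real) \<Rightarrow> 'a \<Rightarrow> real" where
  "birkhoff \<phi> n f x = (\<Sum>k<n. f ((\<phi> ^^ k) x))"

definition bowen :: "'a::metric_space set \<Rightarrow> ('a \<Rightarrow> 'a) \<Rightarrow> nat \<Rightarrow> 'a \<Rightarrow> real \<Rightarrow> 'a set" where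
  "bowen M \<phi> n x \<epsilon> = {y \<in> M. \<forall>k<n. dist ((\<phi> ^^ k) y) ((\<phi> ^^ k) x) < \<epsilon>}"

definition probs :: "'a::metric_space set \<Rightarrow> 'a measure set" where
  "probs M = {Q. prob_space Q \<and> sets Q = sets (restrict_space borel M)}"

definition inv_probs :: "'a::metric_space set \<Rightarrow> ('a \<Rightarrow> 'a) \<Rightarrow> 'a measure set" where
  "inv_probs M \<phi> = {Q \<in> probs M. \<forall>A \<in> sets Q. emeasure Q (\<phi> -` A \<inter> M) = emeasure Q A}"

definition weak_top :: "'a::metric_space set \<Rightarrow> 'a measure topology" where
  "weak_top M = subtopology
     (topology_generated_by
        {{Q \<in> probs M. (\<integral>x. f x \<partial>Q) \<in> U} | (f :: 'a \<Rightarrow> real) (U :: real set). continuous_on M f \<and> open U})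
     (probs M)"

definition weak_borel :: "'a::metric_space set \<Rightarrow> 'a measure set set" where
  "weak_borel M = sigma_sets (probs M) {U. openin (weak_top M) U}"

definition empirical :: "'a::metric_space set \<Rightarrow> ('a \<Rightarrow> 'a) \<Rightarrow> nat \<Rightarrow> 'a \<Rightarrow> 'a measure" where
  "empirical M \<phi> n x = measure_of M (sets (restrict_space borel M))
     (\<lambda>A. ennreal (real (card {k \<in> {..<n}. (\<phi> ^^ k) x \<in> A}) / real n))"

definition finite_partition :: "'a measure \<Rightarrow> 'a set set \<Rightarrow> bool" where
  "finite_partition Q \<xi> \<longleftrightarrow> finite \<xi> \<and> \<xi> \<subseteq> sets Q \<and> disjoint \<xi> \<and> \<Union>\<xi> = space Q"

definition part_entropy :: "'a measure \<Rightarrow> 'a set set \<Rightarrow> real" where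
  "part_entropy Q \<xi> = - (\<Sum>A\<in>\<xi>. measure Q A * ln (measure Q A))"

definition join_part :: "'a set \<Rightarrow> ('a \<Rightarrow> 'a) \<Rightarrow> nat \<Rightarrow> 'a set set \<Rightarrow> 'a set set" where
  "join_part M \<phi> n \<xi> = {M \<inter> (\<Inter>k<n. (\<phi> ^^ k) -` (a k)) | a. \<forall>k<n. a k \<in> \<xi>}"

definition ks_entropy :: "'a::metric_space set \<Rightarrow> ('a \<Rightarrow> 'a) \<Rightarrow> 'a measure \<Rightarrow> ereal" where
  "ks_entropy M \<phi> Q = (SUP \<xi> \<in> {\<xi>. finite_partition Q \<xi>}.
      ereal (lim (\<lambda>n. part_entropy Q (join_part M \<phi> n \<xi>) / real n)))"

definition cover_sum :: "'a::metric_space set \<Rightarrow> ('a \<Rightarrow> 'a) \<Rightarrow> (nat \<Rightarrow> 'a \<Rightarrow> real) \<Rightarrow> nat \<Rightarrow> real \<Rightarrow> real" where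
  "cover_sum M \<phi> G n \<epsilon> = Inf {(\<Sum>x\<in>E. exp (G n x)) | E.
      finite E \<and> E \<subseteq> M \<and> M \<subseteq> (\<Union>x\<in>E. bowen M \<phi> n x \<epsilon>)}"

definition pressure_ereal :: "'a::metric_space set \<Rightarrow> ('a \<Rightarrow> 'a) \<Rightarrow> (nat \<Rightarrow> 'a \<Rightarrow> real) \<Rightarrow> ereal" where
  "pressure_ereal M \<phi> G = Lim (at_right (0::real))
      (\<lambda>\<epsilon>. limsup (\<lambda>n. ereal (ln (cover_sum M \<phi> G n \<epsilon>) / real n)))"

text \<open>Real-valued pressure (finite under the standing assumptions).\<close>
definition pressure :: "'a::metric_space set \<Rightarrow> ('a \<Rightarrow> 'a) \<Rightarrow> (nat \<Rightarrow> 'a \<Rightarrow> real) \<Rightarrow> real" where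
  "pressure M \<phi> G = real_of_ereal (pressure_ereal M \<phi> G)"

definition htop :: "'a::metric_space set \<Rightarrow> ('a \<Rightarrow> 'a) \<Rightarrow> ereal" where
  "htop M \<phi> = pressure_ereal M \<phi> (\<lambda>n x. 0)"

definition asym_add :: "'a::metric_space set \<Rightarrow> ('a \<Rightarrow> 'a) \<Rightarrow> (nat \<Rightarrow> 'a \<Rightarrow> real) \<Rightarrow> bool" where
  "asym_add M \<phi> G \<longleftrightarrow>
     (\<forall>n. G n \<in> borel_measurable (restrict_space borel M) \<and> bounded (G n ` M)) \<and>
     (\<exists>Gk. (\<forall>k. continuous_on M (Gk k)) \<and>
        ((\<lambda>k. limsup (\<lambda>n. (SUP x\<in>M. ereal \<bar>G n x - birkhoff \<phi> n (Gk k) x\<bar>) / ereal (real n)))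
           \<longlonglongrightarrow> 0))"

definition seq_functional :: "(nat \<Rightarrow> 'a \<Rightarrow> real) \<Rightarrow> 'a measure \<Rightarrow> real" where
  "seq_functional G Q = lim (\<lambda>n. (\<integral>x. G n x \<partial>Q) / real n)"

definition USCE :: "'a::metric_space set \<Rightarrow> ('a \<Rightarrow> 'a) \<Rightarrow> bool" where
  "USCE M \<phi> \<longleftrightarrow> htop M \<phi> < \<infinity> \<and>
     (\<forall>Q \<in> inv_probs M \<phi>. \<forall>c. ks_entropy M \<phi> Q < c \<longrightarrow>
        (\<exists>U. openin (weak_top M) U \<and> Q \<in> U \<and>
             (\<forall>Q' \<in> U \<inter> inv_probs M \<phi>. ks_entropy M \<phi> Q' < c)))"

definition spec_S :: "'a::metric_space set \<Rightarrow> ('a \<Rightarrow> 'a) \<Rightarrow> bool" where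
  "spec_S M \<phi> \<longleftrightarrow> (\<forall>\<delta>>0. \<exists>N\<ge>1. \<forall>(m::nat) (xs :: nat \<Rightarrow> 'a) (a::nat \<Rightarrow> nat) (b::nat \<Rightarrow> nat).
     (\<forall>i<m. xs i \<in> M) \<longrightarrow>
     (\<forall>i<m. \<forall>j<m. i \<noteq> j \<longrightarrow> (\<forall>k\<in>{a i..b i}. \<forall>l\<in>{a j..b j}. N \<le> (if k \<le> l then l - k else k - l))) \<longrightarrow>
     (\<exists>x\<in>M. \<forall>i<m. \<forall>k\<in>{a i..b i}. dist ((\<phi> ^^ k) x) ((\<phi> ^^ k) (xs i)) < \<delta>))"

definition elog :: "real \<Rightarrow> ereal" where
  "elog p = (if p = 0 then -\<infinity> else ereal (ln p))"

definition rate_fun :: "'a::metric_space set \<Rightarrow> ('a \<Rightarrow> 'a) \<Rightarrow> (nat \<Rightarrow> 'a \<Rightarrow> real) \<Rightarrow> 'a measure \<Rightarrow> ereal" where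
  "rate_fun M \<phi> G Q = (if Q \<in> inv_probs M \<phi>
      then ereal (- seq_functional G Q) - ks_entropy M \<phi> Q + ereal (pressure M \<phi> G)
      else \<infinity>)"

definition good_rate_function :: "(real \<Rightarrow> ereal) \<Rightarrow> bool" where
  "good_rate_function I \<longleftrightarrow> (\<forall>s. 0 \<le> I s) \<and> (\<forall>c::real. compact {s. I s \<le> ereal c})"

definition convex_ereal_fun :: "(real \<Rightarrow> ereal) \<Rightarrow> bool" where
  "convex_ereal_fun I \<longleftrightarrow> (\<forall>x y t. 0 \<le> t \<and> t \<le> 1 \<longrightarrow>
      I (t * x + (1 - t) * y) \<le> ereal t * I x + ereal (1 - t) * I y)"

end

theory Submission
  imports Defs
begin

text \<open>
  Write \<open>F Q = G(Q) + h(Q)\<close> on invariant measures, so that the rate function is \<open>p(G) - F Q\<close>.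

  Lower bound. Let \<open>Q\<close> be invariant, not necessarily ergodic. Take a maximal \<open>(l,\<delta>)\<close>-separated set \<open>E\<close>
  and code points by elements of \<open>E\<close>; the \<open>Q\<close>-entropy of this coding is at least \<open>l c\<close> for any
  \<open>c < h(Q)\<close> once \<open>\<delta>\<close> is small. Words over \<open>E\<close> that are typical for the i.i.d. law with this
  marginal number about \<open>exp (L l c)\<close>, and specification glues each of them to an orbit whose empirical
  measure is close to \<open>Q\<close>. The glued orbits are separated, so (C2) bounds the probability from below.
  Drawing the blocks independently replaces ergodic decomposition.

  The lower bound and (C1) give \<open>F Q + Q(V) \<le> p(G_V)\<close>; the reverse inequality \<open>p(G_V) \<le> sup (F + V)\<close>
  is Misiurewicz's argument. Since \<open>F\<close> is concave and upper semicontinuous, a separation argument turns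
  these two facts into \<open>p(G) - F Q = sup {Q(V) - p(G_V) + p(G)}\<close>, which yields the upper bound by
  Chernoff's inequality and compactness, and the Legendre formula for observables.
\<close>

subsection \<open>Probability measures on a compact metric space\<close>

text \<open>Two devices keep the argument elementary. A weak neighbourhood involves finitely many
  test functions, so semicontinuity at one measure leaves a separation problem in a
  finite-dimensional space, and no duality on a space of signed measures enters. And the product law
  on words need not resemble Q: it has the right block averages and enough entropy per letter, which
  is all that weak closeness and counting ask for, so no pointwise ergodic theorem is used. The
  obstacle in gluing is that specification keeps the clock: a segment placed at time k must start at
  the time-k image of some point. Coding therefore takes place on the eventual range, which has full
  measure for every invariant measure. Finiteness of h(Q) comes out of the lower bound itself: with
  V = 0 it gives G(Q) + c \<le> p(G) for every c < h(Q). At a measure that is not invariant the rate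
  is infinite; there multiples of a coboundary serve as V, since they do not raise the pressure
  while their integral can be made arbitrarily large.\<close>

locale compact_metric =
  fixes M :: "'a::metric_space set"
  assumes cpt: "compact M"
begin

abbreviation BM :: "'a measure" where "BM \<equiv> restrict_space borel M"

lemma closed_M: "closed M"
  using cpt by (rule compact_imp_closed)

lemma space_BM [simp]: "space BM = M"
  by (simp add: space_restrict_space)

lemma sets_BM_iff: "A \<in> sets BM \<longleftrightarrow> A \<subseteq> M \<and> A \<in> sets borel"
  using borel_closed[OF closed_M] by (auto simp: sets_restrict_space_iff)

lemma probs_prob_space: "Q \<in> probs M \<Longrightarrow> prob_space Q"
  and probs_sets: "Q \<in> probs M \<Longrightarrow> sets Q = sets BM"
  by (auto simp: probs_def)

lemma probs_space: "Q \<in> probs M \<Longrightarrow> space Q = M"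
  using sets_eq_imp_space_eq[OF probs_sets] by simp

lemma probs_measurable: "Q \<in> probs M \<Longrightarrow> measurable Q N = measurable BM N"
  by (intro measurable_cong_sets probs_sets refl)

lemma continuous_borel: "continuous_on M f \<Longrightarrow> f \<in> borel_measurable BM"
  for f :: "'a \<Rightarrow> 'b::topological_space"
  by (rule borel_measurable_continuous_on_restrict)

lemma continuous_bound:
  fixes f :: "'a \<Rightarrow> real"
  assumes "continuous_on M f" obtains B where "0 < B" "\<And>x. x \<in> M \<Longrightarrow> \<bar>f x\<bar> \<le> B"
  using compact_imp_bounded[OF compact_continuous_image[OF assms cpt]]
  by (auto simp: bounded_pos)

lemma probs_integrable_bounded:
  fixes f :: "'a \<Rightarrow> real"
  assumes Q: "Q \<in> probs M" and f: "f \<in> borel_measurable BM" and B: "\<And>x. x \<in> M \<Longrightarrow> \<bar>f x\<bar> \<le> B"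
  shows "integrable Q f"
proof -
  interpret prob_space Q using probs_prob_space[OF Q] .
  show ?thesis using f B probs_space[OF Q] probs_measurable[OF Q]
    by (intro integrable_const_bound[where B=B]) (auto intro!: AE_I2)
qed

lemma probs_integrable:
  fixes f :: "'a \<Rightarrow> real"
  assumes Q: "Q \<in> probs M" and f: "continuous_on M f"
  shows "integrable Q f"
  using continuous_bound[OF f] probs_integrable_bounded[OF Q continuous_borel[OF f]] by blast

lemma probs_integral_le:
  fixes f :: "'a \<Rightarrow> real"
  assumes Q: "Q \<in> probs M" and f: "integrable Q f" and B: "\<And>x. x \<in> M \<Longrightarrow> f x \<le> B"
  shows "(\<integral>x. f x \<partial>Q) \<le> B"
proof -
  interpret prob_space Q using probs_prob_space[OF Q] .
  show ?thesis using f B probs_space[OF Q] by (intro integral_le_const AE_I2) auto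
qed

lemma probs_integral_abs_le:
  fixes f :: "'a \<Rightarrow> real"
  assumes Q: "Q \<in> probs M" and f: "f \<in> borel_measurable BM" and B: "\<And>x. x \<in> M \<Longrightarrow> \<bar>f x\<bar> \<le> B"
  shows "\<bar>\<integral>x. f x \<partial>Q\<bar> \<le> B"
proof -
  have i: "integrable Q f" by (rule probs_integrable_bounded[OF Q f B])
  have "f x \<le> B" "- f x \<le> B" if "x \<in> M" for x using B[OF that] by auto
  then show ?thesis using probs_integral_le[OF Q i, of B] probs_integral_le[OF Q, of "\<lambda>x. - f x" B] i by auto
qed

lemma nonempty_M: "Q \<in> probs M \<Longrightarrow> M \<noteq> {}"
  using prob_space.not_empty[OF probs_prob_space] probs_space by blast

section \<open>Tent functions: masses of closed sets as limits of continuous integrals\<close>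

definition tent :: "'a set \<Rightarrow> nat \<Rightarrow> 'a \<Rightarrow> real" where
  "tent F k x = max 0 (1 - real k * infdist x F)"

lemma continuous_tent: "continuous_on S (tent F k)"
  unfolding tent_def by (intro continuous_intros)

lemma tent_range: "0 \<le> tent F k x" "tent F k x \<le> 1"
  unfolding tent_def by (auto simp: infdist_nonneg)

lemma tent_eq_1: "x \<in> F \<Longrightarrow> tent F k x = 1"
  unfolding tent_def by simp

lemma tent_tendsto:
  assumes "closed F" "F \<noteq> {}"
  shows "(\<lambda>k. tent F k x) \<longlonglongrightarrow> indicator F x"
proof (cases "x \<in> F")
  case True then show ?thesis by (simp add: tent_eq_1)
next
  case False
  then have d: "0 < infdist x F"
    using assms by (metis in_closed_iff_infdist_zero infdist_nonneg less_eq_real_def)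
  obtain K :: nat where K: "1 / infdist x F < K" using reals_Archimedean2 by blast
  have "tent F k x = 0" if "k \<ge> K" for k
  proof -
    have "1 / infdist x F < k" using K that by linarith
    then show ?thesis using d by (simp add: tent_def field_simps)
  qed
  then have "\<forall>\<^sub>F k in sequentially. tent F k x = indicator F x"
    using False by (auto simp: eventually_sequentially)
  then show ?thesis by (rule tendsto_eventually)
qed

lemma tent_integral_tendsto:
  assumes Q: "Q \<in> probs M" and F: "closed F"  "F \<noteq> {}"
  shows "(\<lambda>k. \<integral>x. tent F k x \<partial>Q) \<longlonglongrightarrow> measure Q (F \<inter> M)"
proof -
  interpret prob_space Q using probs_prob_space[OF Q] .
  have "(\<lambda>k. \<integral>x. tent F k x \<partial>Q) \<longlonglongrightarrow> (\<integral>x. indicator F x \<partial>Q)"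
  proof (rule integral_dominated_convergence[where w="\<lambda>_. 1"])
    show "(indicator F :: 'a \<Rightarrow> real) \<in> borel_measurable Q"
      unfolding probs_measurable[OF Q] using F by (intro measurable_restrict_space1) auto
    show "tent F k \<in> borel_measurable Q" for k
      unfolding probs_measurable[OF Q] by (rule continuous_borel[OF continuous_tent])
    show "AE x in Q. (\<lambda>k. tent F k x) \<longlonglongrightarrow> indicator F x" using tent_tendsto[OF F] by simp
    show "AE x in Q. norm (tent F k x) \<le> 1" for k using tent_range by auto
  qed simp
  then show ?thesis using probs_space[OF Q] by simp
qed

lemma sets_BM_sigma: "sets BM = sigma_sets M ((\<inter>) M ` Collect closed)"
proof -
  have "sets (borel :: 'a measure) = sigma_sets UNIV (Collect closed)"
    by (simp add: borel_eq_closed)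
  moreover have "(\<inter>) M ` sigma_sets UNIV (Collect closed) = sigma_sets M ((\<inter>) M ` Collect closed)"
    using closed_M by (intro sigma_sets_Int) auto
  ultimately show ?thesis by (simp add: sets_restrict_space)
qed

lemma closed_Int_sets: "closed F \<Longrightarrow> F \<inter> M \<in> sets BM"
  and open_Int_sets: "open U \<Longrightarrow> U \<inter> M \<in> sets BM"
  using closed_M by (auto simp: sets_BM_iff)

text \<open>The traces of closed sets on \<open>M\<close> form an intersection-stable generator of
  the Borel sets, and the mass of each is a limit of integrals of tents.\<close>

lemma probs_eqI:
  assumes Q: "Q \<in> probs M" and R: "R \<in> probs M"
    and eq: "\<And>f :: 'a \<Rightarrow> real. continuous_on M f \<Longrightarrow> (\<integral>x. f x \<partial>Q) = (\<integral>x. f x \<partial>R)"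
  shows "Q = R"
proof -
  interpret Q: prob_space Q using probs_prob_space[OF Q] .
  interpret R: prob_space R using probs_prob_space[OF R] .
  have closed_eq: "emeasure Q (M \<inter> F) = emeasure R (M \<inter> F)" if "closed F" for F
  proof (cases "F = {}")
    case False
    have "measure Q (F \<inter> M) = measure R (F \<inter> M)"
      using tent_integral_tendsto[OF Q that False] tent_integral_tendsto[OF R that False]
      unfolding eq[OF continuous_tent] by (rule LIMSEQ_unique)
    then show ?thesis by (simp add: Q.emeasure_eq_measure R.emeasure_eq_measure Int_commute)
  qed simp
  show ?thesis
  proof (rule measure_eqI_generator_eq[where E="(\<inter>) M ` Collect closed" and \<Omega>=M and A="\<lambda>_. M"])
    show "Int_stable ((\<inter>) M ` Collect closed)"
    proof (rule Int_stableI)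
      fix a b assume "a \<in> (\<inter>) M ` Collect closed" "b \<in> (\<inter>) M ` Collect closed"
      then obtain F F' where "closed F" "closed F'" "a = M \<inter> F" "b = M \<inter> F'" by auto
      then have "a \<inter> b = M \<inter> (F \<inter> F')" "closed (F \<inter> F')" by auto
      then show "a \<inter> b \<in> (\<inter>) M ` Collect closed" by blast
    qed
    show "range (\<lambda>_::nat. M) \<subseteq> (\<inter>) M ` Collect closed" using closed_UNIV by (auto intro!: image_eqI[where x=UNIV])
  qed (use closed_eq probs_sets[OF Q] probs_sets[OF R] sets_BM_sigma Q.emeasure_finite in auto)
qed

text \<open>Good sets principle: the sets squeezed between a closed and an open set of nearly equal
  mass include the closed ones and form a sigma-algebra. \<open>U\<close> is open in the whole
  space, hence the intersection with \<open>M\<close>.\<close>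

lemma regular_approx:
  assumes Q: "Q \<in> probs M" and A: "A \<in> sets Q" and e: "0 < (e::real)"
  obtains F U where "closed F" "open U" "F \<subseteq> A" "A \<subseteq> U" "F \<subseteq> M" "measure Q (U \<inter> M - F) < e"
proof -
  interpret prob_space Q using probs_prob_space[OF Q] .
  have sQ: "sets Q = sets BM" by (rule probs_sets[OF Q])
  have meas [simp]: "closed F \<Longrightarrow> F \<inter> M \<in> sets Q" "open U \<Longrightarrow> U \<inter> M \<in> sets Q" for F U
    using sQ closed_Int_sets open_Int_sets by auto
  have fmeas: "closed F \<Longrightarrow> F \<subseteq> M \<Longrightarrow> F \<in> sets Q" for F using meas(1)[of F] by (simp add: Int_absorb2)
  have "A \<in> sigma_sets M ((\<inter>) M ` Collect closed)" using A sQ sets_BM_sigma by simp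
  then have "\<forall>e>0. \<exists>F U. closed F \<and> open U \<and> F \<subseteq> A \<and> A \<subseteq> U \<and> F \<subseteq> M \<and> measure Q (U \<inter> M - F) < e"
  proof induction
    case (Basic a)
    then obtain F0 where F0: "closed F0" "a = M \<inter> F0" by auto
    define F where "F = F0 \<inter> M"
    have F: "closed F" "a = F" "F \<subseteq> M" using F0 closed_M by (auto simp: F_def)
    show ?case
    proof (cases "F = {}")
      case True
      then show ?thesis using F by (intro allI impI exI[of _ "{}"]) auto
    next
      case False
      \<comment> \<open>Open neighbourhoods shrinking to \<open>F\<close>; their masses inside
        \<open>M\<close> decrease to that of \<open>F\<close>.\<close>
      define U where "U k = {x. infdist x F < 1 / real (Suc k)}" for k
      have oU: "open (U k)" for k unfolding U_def by (intro open_Collect_less continuous_intros)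
      have FU: "F \<subseteq> U k" for k by (auto simp: U_def)
      have "(\<Inter>k. U k \<inter> M) = F"
      proof -
        have "x \<in> F" if "\<forall>k. x \<in> U k" for x
        proof (rule ccontr)
          assume "x \<notin> F"
          then have "0 < infdist x F" using F False
            by (metis in_closed_iff_infdist_zero infdist_nonneg less_eq_real_def)
          then obtain k where "1 / real (Suc k) < infdist x F" using nat_approx_posE by blast
          then show False using that unfolding U_def by (auto dest!: spec[of _ k])
        qed
        then have "(\<Inter>k. U k \<inter> M) \<subseteq> F" by (intro subsetI) simp
        moreover have "F \<subseteq> (\<Inter>k. U k \<inter> M)" using FU F(3) by (simp add: INT_greatest)
        ultimately show ?thesis by (rule equalityI)
      qed
      moreover have "decseq (\<lambda>k. U k \<inter> M)"
        unfolding decseq_def U_def by (auto intro: less_le_trans simp: frac_le)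
      ultimately have "(\<lambda>k. measure Q (U k \<inter> M)) \<longlonglongrightarrow> measure Q F"
        using finite_Lim_measure_decseq[of "\<lambda>k. U k \<inter> M", OF image_subsetI] oU by auto
      then have lim: "(\<lambda>k. measure Q (U k \<inter> M) - measure Q F) \<longlonglongrightarrow> 0"
        by (simp add: LIM_zero)
      show ?thesis
      proof (intro allI impI)
        fix e :: real assume "e > 0"
        then obtain k where "measure Q (U k \<inter> M) - measure Q F < e"
          using order_tendstoD(2)[OF lim, of e] by (auto simp: eventually_sequentially)
        moreover have "measure Q (U k \<inter> M - F) = measure Q (U k \<inter> M) - measure Q F"
          using FU F fmeas oU by (intro finite_measure_Diff) auto
        ultimately show "\<exists>F U. closed F \<and> open U \<and> F \<subseteq> a \<and> a \<subseteq> U \<and> F \<subseteq> M \<and> measure Q (U \<inter> M - F) < e"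
          using F FU[of k] oU[of k] by (intro exI[of _ F] exI[of _ "U k"]) auto
      qed
    qed
  next
    case Empty
    show ?case by (intro allI impI exI[of _ "{}"]) auto
  next
    case (Compl a)
    show ?case
    proof (intro allI impI)
      fix e :: real assume "e > 0"
      then obtain F U where FU: "closed F" "open U" "F \<subseteq> a" "a \<subseteq> U" "F \<subseteq> M" "measure Q (U \<inter> M - F) < e"
        using Compl by meson
      \<comment> \<open>Complementation exchanges the inner and the outer set and keeps the gap
        between them.\<close>
      have "- F \<inter> M - (M - U) = U \<inter> M - F" by auto
      then show "\<exists>F U. closed F \<and> open U \<and> F \<subseteq> M - a \<and> M - a \<subseteq> U \<and> F \<subseteq> M \<and> measure Q (U \<inter> M - F) < e"
        using FU closed_M by (intro exI[of _ "M - U"] exI[of _ "- F"]) auto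
    qed
  next
    case (Union a)
    show ?case
    proof (intro allI impI)
      fix e :: real assume e: "e > 0"
      \<comment> \<open>The geometric shares sum to \<open>e / 2\<close>. The other half pays for
        keeping only finitely many inner sets, since the union of all of them need not be
        closed.\<close>
      have "\<exists>F U. closed F \<and> open U \<and> F \<subseteq> a i \<and> a i \<subseteq> U \<and> F \<subseteq> M \<and> measure Q (U \<inter> M - F) < e / 2 * (1/2) ^ Suc i" for i
        using e by (intro Union.IH[of i, rule_format]) auto
      then obtain F U where FU: "\<And>i. closed (F i)" "\<And>i. open (U i)" "\<And>i. F i \<subseteq> a i" "\<And>i. a i \<subseteq> U i"
          "\<And>i. F i \<subseteq> M" "\<And>i. measure Q (U i \<inter> M - F i) < e / 2 * (1/2) ^ Suc i" by metis
      let ?D = "\<lambda>n. (\<Union>i. U i) \<inter> M - (\<Union>i<n. F i)"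
      have Dm: "?D n \<in> sets Q" for n using FU fmeas by (intro sets.Diff sets.finite_UN meas open_UN) auto
      have "(\<lambda>n. measure Q (?D n)) \<longlonglongrightarrow> measure Q (\<Inter>n. ?D n)"
        using Dm by (intro finite_Lim_measure_decseq) (auto simp: decseq_def)
      moreover have "measure Q (\<Inter>n. ?D n) \<le> e / 2"
      proof -
        have sm: "U i \<inter> M - F i \<in> sets Q" for i using FU fmeas by auto
        have ss: "(\<lambda>i. e / 2 * (1/2) ^ Suc i) sums (e/2)" using sums_mult[OF power_half_series, of "e/2"] by simp
        have summ: "summable (\<lambda>i. measure Q (U i \<inter> M - F i))"
          using FU(6) by (intro summable_comparison_test[OF _ sums_summable[OF ss]]) (auto intro!: exI[of _ 0] simp: less_imp_le)
        have "measure Q (\<Inter>n. ?D n) \<le> measure Q (\<Union>i. U i \<inter> M - F i)"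
          using sm by (intro finite_measure_mono) auto
        also have "\<dots> \<le> (\<Sum>i. measure Q (U i \<inter> M - F i))"
          using sm summ by (intro finite_measure_subadditive_countably) auto
        also have "\<dots> \<le> (\<Sum>i. e / 2 * (1/2) ^ Suc i)"
          using FU(6) summ ss by (intro suminf_le sums_summable[OF ss]) (auto simp: less_imp_le)
        also have "\<dots> = e / 2" using ss by (simp add: sums_iff)
        finally show ?thesis .
      qed
      ultimately obtain n where "measure Q (?D n) < e"
        using order_tendstoD(2)[of "\<lambda>n. measure Q (?D n)" "measure Q (\<Inter>n. ?D n)" sequentially e] e
        by (auto simp: eventually_sequentially)
      then show "\<exists>F U. closed F \<and> open U \<and> F \<subseteq> (\<Union>i. a i) \<and> (\<Union>i. a i) \<subseteq> U \<and> F \<subseteq> M \<and> measure Q (U \<inter> M - F) < e"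
        using FU(1-5) by (intro exI[of _ "\<Union>i<n. F i"] exI[of _ "\<Union>i. U i"] conjI closed_UN open_UN UN_mono UN_least) auto
    qed
  qed
  then show ?thesis using e that by meson
qed

subsection \<open>Weak convergence\<close>

definition wconv :: "(nat \<Rightarrow> 'a measure) \<Rightarrow> 'a measure \<Rightarrow> bool" where
  "wconv X Q \<longleftrightarrow> (\<forall>f :: 'a \<Rightarrow> real. continuous_on M f \<longrightarrow> (\<lambda>n. \<integral>x. f x \<partial>X n) \<longlonglongrightarrow> (\<integral>x. f x \<partial>Q))"

text \<open>Closed-set half of the portmanteau theorem: every tent lies above the indicator of
  \<open>F\<close>, and a late tent has \<open>Q\<close>-integral within \<open>e\<close> of the
  mass of \<open>F\<close>.\<close>

lemma wconv_closed:
  assumes X: "\<And>n. X n \<in> probs M" and Q: "Q \<in> probs M" and w: "wconv X Q" and F: "closed F" and e: "0 < (e::real)"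
  shows "\<forall>\<^sub>F n in sequentially. measure (X n) (F \<inter> M) < measure Q (F \<inter> M) + e"
proof (cases "F = {}")
  case True then show ?thesis using e by simp
next
  case False
  obtain k where k: "(\<integral>x. tent F k x \<partial>Q) < measure Q (F \<inter> M) + e"
    using order_tendstoD(2)[OF tent_integral_tendsto[OF Q F False], of "measure Q (F \<inter> M) + e"] e
    by (auto simp: eventually_sequentially)
  have "\<forall>\<^sub>F n in sequentially. (\<integral>x. tent F k x \<partial>X n) < measure Q (F \<inter> M) + e"
    using w k continuous_tent unfolding wconv_def by (intro order_tendstoD(2)) auto
  moreover have "measure (X n) (F \<inter> M) \<le> (\<integral>x. tent F k x \<partial>X n)" for n
  proof -
    interpret prob_space "X n" using probs_prob_space[OF X] .
    have "measure (X n) (F \<inter> M) = (\<integral>x. indicator F x \<partial>X n)" using probs_space[OF X] by simp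
    also have "\<dots> \<le> (\<integral>x. tent F k x \<partial>X n)"
    proof (rule integral_mono)
      show "integrable (X n) (indicator F :: 'a \<Rightarrow> real)"
        using F by (intro probs_integrable_bounded[OF X, where B=1] measurable_restrict_space1) (auto simp: indicator_def)
      show "integrable (X n) (tent F k)" by (rule probs_integrable[OF X continuous_tent])
    qed (auto simp: indicator_def tent_range tent_eq_1)
    finally show ?thesis .
  qed
  ultimately show ?thesis by (auto elim!: eventually_mono intro: le_less_trans)
qed

text \<open>A null boundary is expressed by a closed set above \<open>A\<close> and an open set
  below it, which spares topology relative to \<open>M\<close>. The closed-set bound for
  \<open>F\<close> gives the upper estimate, the one for the complement of \<open>U\<close> the
  lower.\<close>

lemma wconv_continuity_set:
  assumes X: "\<And>n. X n \<in> probs M" and Q: "Q \<in> probs M" and w: "wconv X Q"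
    and F: "closed F" and U: "open U" and UA: "U \<inter> M \<subseteq> A" and AF: "A \<subseteq> F \<inter> M" and A: "A \<in> sets BM"
    and null: "measure Q ((F - U) \<inter> M) = 0"
  shows "(\<lambda>n. measure (X n) A) \<longlonglongrightarrow> measure Q A"
proof -
  interpret Q: prob_space Q using probs_prob_space[OF Q] .
  interpret X: prob_space "X n" for n using probs_prob_space[OF X] .
  note sX = probs_sets[OF X] probs_sets[OF Q]
  have FA: "measure Q (F \<inter> M) \<le> measure Q A"
  proof -
    have "measure Q (F \<inter> M) \<le> measure Q (A \<union> (F - U) \<inter> M)"
      using UA A F U sX closed_M by (intro Q.finite_measure_mono) (auto simp: sets_BM_iff)
    also have "\<dots> \<le> measure Q A + measure Q ((F - U) \<inter> M)"
      using A F U sX closed_M by (intro measure_Un_le) (auto simp: sets_BM_iff)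
    finally show ?thesis using null by simp
  qed
  have UA': "measure Q (- U \<inter> M) \<le> 1 - measure Q A"
  proof -
    have sets: "A \<in> sets Q" "M \<in> sets Q" "F \<inter> M \<in> sets Q" "(F - U) \<inter> M \<in> sets Q" "- U \<inter> M \<in> sets Q"
      using A F U sX closed_M by (auto simp: sets_BM_iff)
    have "measure Q (- U \<inter> M) \<le> measure Q ((M - A) \<union> ((F - U) \<inter> M))"
      using AF sets by (intro Q.finite_measure_mono) auto
    also have "\<dots> \<le> measure Q (M - A) + 0"
      unfolding null[symmetric] using sets by (intro measure_Un_le) auto
    also have "measure Q (M - A) = 1 - measure Q A"
      using sets probs_space[OF Q] Q.prob_compl[of A] by simp
    finally show ?thesis by simp
  qed
  show ?thesis
  proof (rule LIMSEQ_I)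
    fix r :: real assume r: "0 < r"
    have up: "\<forall>\<^sub>F n in sequentially. measure (X n) A < measure Q A + r"
      using wconv_closed[OF X Q w F r]
    proof eventually_elim
      case (elim n)
      have "measure (X n) A \<le> measure (X n) (F \<inter> M)"
        using AF F sX closed_Int_sets by (intro X.finite_measure_mono) auto
      then show ?case using elim FA by simp
    qed
    have cU: "closed (- U)" using U by auto
    have lo: "\<forall>\<^sub>F n in sequentially. 1 - measure (X n) A < 1 - measure Q A + r"
      using wconv_closed[OF X Q w cU r]
    proof eventually_elim
      case (elim n)
      have "1 - measure (X n) A = measure (X n) (M - A)"
        using A sX probs_space[OF X] X.prob_compl[of A n] by simp
      also have "\<dots> \<le> measure (X n) (- U \<inter> M)"
        using UA cU sX closed_Int_sets by (intro X.finite_measure_mono) auto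
      finally show ?case using elim UA' by simp
    qed
    have "\<forall>\<^sub>F n in sequentially. norm (measure (X n) A - measure Q A) < r"
      using up lo by eventually_elim (simp add: abs_less_iff)
    then show "\<exists>no. \<forall>n\<ge>no. norm (measure (X n) A - measure Q A) < r" by (simp add: eventually_sequentially)
  qed
qed

end

subsection \<open>Entropy of finitely valued functions\<close>

text \<open>Entropy, in natural units, of the partition into the fibres of \<open>f\<close>. With
  functions in place of partitions, a join is a pair or a list and a coarsening is a
  factorization.\<close>

definition Hfun :: "'a measure \<Rightarrow> ('a \<Rightarrow> 'b) \<Rightarrow> real" where
  "Hfun Q f = - (\<Sum>v\<in>f ` space Q. measure Q (f -` {v} \<inter> space Q) * ln (measure Q (f -` {v} \<inter> space Q)))"

lemma information_space_exp: "prob_space Q \<Longrightarrow> information_space Q (exp 1)"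
  by (simp add: information_space_def information_space_axioms_def)

lemma Hfun_eq_entropy:
  assumes Q: "prob_space Q" and f: "simple_function Q f"
  shows "Hfun Q f = prob_space.entropy Q (exp 1) (count_space (f ` space Q)) f"
proof -
  interpret information_space Q "exp 1" using information_space_exp[OF Q] .
  show ?thesis
    using entropy_simple_distributed[OF simple_distributedI[OF f measure_nonneg refl]]
    by (simp add: Hfun_def log_def)
qed

text \<open>Chain rule, followed by the fact that conditioning does not increase entropy.\<close>

lemma Hfun_pair:
  assumes Q: "prob_space Q" and f: "simple_function Q f" and g: "simple_function Q g"
  shows "Hfun Q (\<lambda>x. (f x, g x)) \<le> Hfun Q f + Hfun Q g"
proof -
  interpret information_space Q "exp 1" using information_space_exp[OF Q] .
  show ?thesis
    using entropy_chain_rule[OF f g] conditional_entropy_less_eq_entropy[OF g f]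
    by (simp add: Hfun_eq_entropy[OF Q] f g simple_function_Pair)
qed

text \<open>On the space, \<open>f\<close> is a function of \<open>g\<close>, so this is the data
  processing inequality.\<close>

lemma Hfun_mono:
  assumes Q: "prob_space Q" and g: "simple_function Q g"
    and fg: "\<And>x y. x \<in> space Q \<Longrightarrow> y \<in> space Q \<Longrightarrow> g x = g y \<Longrightarrow> f x = f y"
  shows "Hfun Q f \<le> Hfun Q g"
proof -
  interpret information_space Q "exp 1" using information_space_exp[OF Q] .
  \<comment> \<open>\<open>u\<close> reads \<open>f\<close> off any representative of a fibre of
    \<open>g\<close>; \<open>fg\<close> makes the choice irrelevant.\<close>
  define u where "u v = f (SOME x. x \<in> space Q \<and> g x = v)" for v
  have u: "u (g x) = f x" if "x \<in> space Q" for x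
  proof -
    have "(SOME y. y \<in> space Q \<and> g y = g x) \<in> space Q \<and> g (SOME y. y \<in> space Q \<and> g y = g x) = g x"
      using that by (intro someI_ex[where P="\<lambda>y. y \<in> space Q \<and> g y = g x"]) auto
    then show ?thesis unfolding u_def using fg that by blast
  qed
  have "Hfun Q f = Hfun Q (u \<circ> g)"
  proof -
    have "f ` space Q = (u \<circ> g) ` space Q" using u by force
    moreover have "f -` {v} \<inter> space Q = (u \<circ> g) -` {v} \<inter> space Q" for v using u by force
    ultimately show ?thesis unfolding Hfun_def by simp
  qed
  also have "\<dots> \<le> Hfun Q g"
    using entropy_data_processing[OF g, of u]
    by (simp add: Hfun_eq_entropy[OF Q] g simple_function_compose)
  finally show ?thesis .
qed

lemma Hfun_le_card:
  assumes Q: "prob_space Q" and f: "simple_function Q f"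
  shows "Hfun Q f \<le> ln (card (f ` space Q))"
proof -
  interpret information_space Q "exp 1" using information_space_exp[OF Q] .
  show ?thesis
    using entropy_le_card[OF simple_distributedI[OF f measure_nonneg refl]]
    by (simp add: Hfun_eq_entropy[OF Q] f log_def)
qed

lemma Hfun_nonneg:
  assumes Q: "prob_space Q"
  shows "0 \<le> Hfun Q f"
proof -
  interpret prob_space Q by (rule Q)
  have "t * ln t \<le> 0" if "0 \<le> t" "t \<le> 1" for t :: real
    using that by (cases "t = 0") (auto simp: mult_le_0_iff)
  then show ?thesis unfolding Hfun_def by (simp add: sum_nonpos)
qed

text \<open>A value that is not attained has an empty fibre, whose term is zero. Summing over a
  common index set makes entropies under different codings or measures comparable term by
  term.\<close>

lemma Hfun_superset:
  assumes "finite T" "f ` space Q \<subseteq> T"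
  shows "Hfun Q f = - (\<Sum>v\<in>T. measure Q (f -` {v} \<inter> space Q) * ln (measure Q (f -` {v} \<inter> space Q)))"
proof -
  have "measure Q (f -` {v} \<inter> space Q) = 0" if "v \<notin> f ` space Q" for v
  proof -
    have "f -` {v} \<inter> space Q = {}" using that by auto
    then show ?thesis by (metis measure_empty)
  qed
  then show ?thesis
    unfolding Hfun_def using assms by (intro arg_cong[where f=uminus] sum.mono_neutral_left) auto
qed

lemma Hfun_cong_AE:
  assumes Q: "prob_space Q" and f: "simple_function Q f" and g: "simple_function Q g"
    and eq: "AE x in Q. f x = g x"
  shows "Hfun Q f = Hfun Q g"
proof -
  interpret prob_space Q by (rule Q)
  let ?T = "f ` space Q \<union> g ` space Q"
  have fin: "finite ?T" using f g by (auto simp: simple_function_def)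
  have "measure Q (f -` {v} \<inter> space Q) = measure Q (g -` {v} \<inter> space Q)" for v
    using eq simple_functionD(2)[OF f, of "{v}"] simple_functionD(2)[OF g, of "{v}"]
    by (intro finite_measure_eq_AE) auto
  then show ?thesis
    using Hfun_superset[OF fin, of f Q] Hfun_superset[OF fin, of g Q] by simp
qed

lemma simple_function_map:
  assumes "\<And>k. k \<in> set ks \<Longrightarrow> simple_function Q (f k)"
  shows "simple_function Q (\<lambda>x. map (\<lambda>k. f k x) ks)"
  using assms
proof (induction ks)
  case (Cons k ks)
  then have "simple_function Q ((\<lambda>(a, b). a # b) \<circ> (\<lambda>x. (f k x, map (\<lambda>k. f k x) ks)))"
    by (intro simple_function_compose simple_function_Pair) auto
  then show ?case by (simp add: comp_def)
qed simp

lemma Hfun_map_le: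
  assumes Q: "prob_space Q" and f: "\<And>k. k \<in> set ks \<Longrightarrow> simple_function Q (f k)"
  shows "Hfun Q (\<lambda>x. map (\<lambda>k. f k x) ks) \<le> (\<Sum>k\<leftarrow>ks. Hfun Q (f k))"
  using f
proof (induction ks)
  case Nil
  interpret prob_space Q by (rule Q)
  have "measure Q (space Q) = 1" by (rule prob_space)
  then show ?case by (simp add: Hfun_def image_constant_conv)
next
  case (Cons k ks)
  have sf: "simple_function Q (\<lambda>x. map (\<lambda>k. f k x) ks)" using Cons.prems by (intro simple_function_map) auto
  have "Hfun Q (\<lambda>x. map (\<lambda>k. f k x) (k # ks)) \<le> Hfun Q (\<lambda>x. (f k x, map (\<lambda>k. f k x) ks))"
    using Cons.prems sf by (intro Hfun_mono[OF Q] simple_function_Pair) auto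
  also have "\<dots> \<le> Hfun Q (f k) + Hfun Q (\<lambda>x. map (\<lambda>k. f k x) ks)"
    using Cons.prems sf by (intro Hfun_pair[OF Q]) auto
  finally show ?case using Cons by force
qed

text \<open>The tangent at \<open>x\<close> lies below the convex function t ln t. At
  \<open>y = 0\<close> the claim reads -x \<le> 0; at \<open>x = 1\<close> it bounds -y ln y by 1 -
  y.\<close>

lemma mult_ln_tangent:
  fixes x y :: real
  assumes "0 < x" "0 \<le> y"
  shows "x * ln x + (1 + ln x) * (y - x) \<le> y * ln y"
proof (cases "y = 0")
  case True then show ?thesis using assms by (simp add: algebra_simps)
next
  case False
  then have y: "0 < y" using assms by simp
  have "ln (x / y) \<le> x / y - 1" using assms y by (intro ln_le_minus_one) auto
  then have "ln x - ln y \<le> x / y - 1" using assms y by (simp add: ln_div)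
  then have "y * (ln x - ln y) \<le> y * (x / y - 1)" using y by simp
  then show ?thesis using y by (simp add: algebra_simps)
qed

text \<open>Weighted sum of the tangent inequalities at the mean \<open>x\<close>; a zero mean
  forces all products \<open>w i * y i\<close> to vanish.\<close>

lemma mult_ln_jensen:
  fixes w y :: "'i \<Rightarrow> real"
  assumes I: "finite I" and w: "\<And>i. i \<in> I \<Longrightarrow> 0 \<le> w i" "sum w I = 1" and y: "\<And>i. i \<in> I \<Longrightarrow> 0 \<le> y i"
  defines "x \<equiv> \<Sum>i\<in>I. w i * y i"
  shows "x * ln x \<le> (\<Sum>i\<in>I. w i * (y i * ln (y i)))"
proof (cases "x = 0")
  case True
  then have "\<And>i. i \<in> I \<Longrightarrow> w i * y i = 0"
    unfolding x_def using sum_nonneg_eq_0_iff[OF I, of "\<lambda>i. w i * y i"] w y by auto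
  then have "(\<Sum>i\<in>I. w i * (y i * ln (y i))) = 0" by (intro sum.neutral) auto
  then show ?thesis using True by simp
next
  case False
  have "0 \<le> x" unfolding x_def using w y by (intro sum_nonneg) auto
  then have x: "0 < x" using False by simp
  have "(\<Sum>i\<in>I. w i * (x * ln x + (1 + ln x) * (y i - x))) \<le> (\<Sum>i\<in>I. w i * (y i * ln (y i)))"
    using mult_ln_tangent[OF x] w y by (intro sum_mono mult_left_mono) auto
  moreover have "(\<Sum>i\<in>I. w i * (A + B * (y i - z))) = A * sum w I + B * ((\<Sum>i\<in>I. w i * y i) - z * sum w I)"
    for A B z :: real
    by (simp add: algebra_simps sum.distrib sum_subtractf sum_distrib_left)
  ultimately show ?thesis using w by (simp add: x_def)
qed

text \<open>Jensen's inequality on each fibre. The family \<open>R\<close> serves twice: as the time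
  shifts of one measure in the pressure estimate, and as a pair of invariant measures in the
  concavity of entropy.\<close>

lemma Hfun_concave:
  fixes w :: "'i \<Rightarrow> real" and R :: "'i \<Rightarrow> 'a measure"
  assumes I: "finite I" and w: "\<And>i. i \<in> I \<Longrightarrow> 0 \<le> w i" "sum w I = 1"
    and sp: "\<And>i. i \<in> I \<Longrightarrow> space (R i) = space Q"
    and mix: "\<And>A. A \<in> sets Q \<Longrightarrow> measure Q A = (\<Sum>i\<in>I. w i * measure (R i) A)"
    and f: "simple_function Q f"
  shows "(\<Sum>i\<in>I. w i * Hfun (R i) f) \<le> Hfun Q f"
proof -
  let ?m = "\<lambda>N v. measure N (f -` {v} \<inter> space Q)"
  have "Hfun Q f = - (\<Sum>v\<in>f ` space Q. (\<Sum>i\<in>I. w i * ?m (R i) v) * ln (\<Sum>i\<in>I. w i * ?m (R i) v))"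
    unfolding Hfun_def using mix simple_functionD(2)[OF f] by (intro arg_cong[where f=uminus] sum.cong) auto
  moreover have "(\<Sum>v\<in>f ` space Q. (\<Sum>i\<in>I. w i * ?m (R i) v) * ln (\<Sum>i\<in>I. w i * ?m (R i) v))
     \<le> (\<Sum>v\<in>f ` space Q. (\<Sum>i\<in>I. w i * (?m (R i) v * ln (?m (R i) v))))"
    by (intro sum_mono mult_ln_jensen I w) auto
  moreover have "\<dots> = - (\<Sum>i\<in>I. w i * Hfun (R i) f)"
    using sp by (subst sum.swap) (simp add: Hfun_def sum_distrib_left sum_negf)
  ultimately show ?thesis by linarith
qed

lemma Hfun_distr:
  assumes u: "u \<in> measurable Q N" and f: "simple_function N f"
  shows "Hfun (distr Q N u) f = Hfun Q (f \<circ> u)"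
proof -
  have fin: "finite (f ` space N)" using f by (auto simp: simple_function_def)
  have "measure (distr Q N u) (f -` {v} \<inter> space N) = measure Q ((f \<circ> u) -` {v} \<inter> space Q)" for v
    using measurable_space[OF u] simple_functionD(2)[OF f, of "{v}"]
    by (subst measure_distr[OF u]) (auto intro!: arg_cong[where f="measure Q"])
  then show ?thesis
    using Hfun_superset[OF fin, of "f \<circ> u" Q] measurable_space[OF u] by (auto simp: Hfun_def image_subset_iff)
qed

subsection \<open>Subadditive sequences\<close>

text \<open>Fekete's lemma. \<open>n\<close> is divided by an almost optimal \<open>m\<close>, and
  the constant \<open>C\<close> bounds \<open>a 0\<close> together with every remainder. The limit
  is the infimum, whence the second claim.\<close>

lemma subadditive_convergent:
  fixes a :: "nat \<Rightarrow> real"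
  assumes sub: "\<And>m n. a (m + n) \<le> a m + a n" and nn: "\<And>n. 0 \<le> a n"
  shows "convergent (\<lambda>n. a n / n)" and "\<And>n. n \<ge> 1 \<Longrightarrow> lim (\<lambda>n. a n / n) \<le> a n / n"
proof -
  define l where "l = (INF n\<in>{1..}. a n / real n)"
  have bdd: "bdd_below ((\<lambda>n. a n / real n) ` {1..})" using nn by (intro bdd_belowI[of _ 0]) auto
  have le: "l \<le> a n / n" if "n \<ge> 1" for n unfolding l_def using bdd that by (intro cINF_lower) auto
  have mult: "a (q * m) \<le> real q * a m + a 0" for q m
  proof (induction q)
    case 0 show ?case by simp
  next
    case (Suc q) then show ?case using sub[of m "q * m"] by (simp add: algebra_simps)
  qed
  have lim: "(\<lambda>n. a n / n) \<longlonglongrightarrow> l"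
  proof (rule LIMSEQ_I)
    fix r :: real assume r: "0 < r"
    obtain m where m: "m \<ge> 1" "a m / m < l + r / 2"
      using cINF_less_iff[of "{1..}" "\<lambda>n. a n / real n" "l + r/2"] bdd r unfolding l_def by force
    define C where "C = a 0 + (\<Sum>k<m. a k)"
    obtain N :: nat where N: "2 * C / r < N" using reals_Archimedean2 by blast
    have "norm (a n / n - l) < r" if n: "n \<ge> max 1 N" for n
    proof -
      have "a n \<le> a (n div m * m) + a (n mod m)" using sub[of "n div m * m" "n mod m"] by simp
      also have "a (n mod m) \<le> C - a 0" unfolding C_def using m nn by (simp, intro member_le_sum) auto
      also have "a (n div m * m) \<le> real (n div m) * a m + a 0" by (rule mult)
      finally have "a n \<le> real (n div m) * real m * (a m / m) + C" using m by simp
      moreover have "real (n div m) * real m \<le> n"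
        by (metis div_times_less_eq_dividend of_nat_le_iff of_nat_mult)
      then have "real (n div m) * real m * (a m / m) \<le> n * (a m / m)"
        using nn by (intro mult_right_mono) auto
      ultimately have "a n \<le> n * (a m / m) + C" by linarith
      then have "a n / n \<le> a m / m + C / n" using n by (simp add: field_simps)
      moreover have "C / n < r / 2"
      proof -
        have "2 * C / r < n" using N n by linarith
        then show ?thesis using r n by (simp add: field_simps)
      qed
      ultimately have "a n / n < l + r" using m by linarith
      moreover have "l \<le> a n / n" using le n by simp
      ultimately show ?thesis by simp
    qed
    then show "\<exists>no. \<forall>n\<ge>no. norm (a n / n - l) < r" by blast
  qed
  show "convergent (\<lambda>n. a n / n)" using lim by (auto simp: convergent_def)
  show "\<And>n. n \<ge> 1 \<Longrightarrow> lim (\<lambda>n. a n / n) \<le> a n / n" using limI[OF lim] le by simp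
qed

section \<open>Sequential compactness of the probability measures, by coding in the Cantor
  set\<close>

lemma ternary_digits_separate:
  fixes a b :: "nat \<Rightarrow> real"
  assumes a: "\<And>i. a i \<in> {0, 1}" and b: "\<And>i. b i \<in> {0, 1}" and ne: "a j \<noteq> b j"
  shows "1 / 3 ^ Suc j \<le> \<bar>(\<Sum>i. 2 * a i / 3 ^ Suc i) - (\<Sum>i. 2 * b i / 3 ^ Suc i)\<bar>"
proof -
  define d where "d i = 2 * (a i - b i) / 3 ^ Suc i" for i
  have geo: "(\<lambda>i. 2 / 3 ^ Suc i :: real) sums 1"
    using sums_mult[OF geometric_sums[of "1/3::real"], of "2/3"] by (simp add: power_divide field_simps)
  have sa: "summable (\<lambda>i. 2 * c i / 3 ^ Suc i)" if "\<And>i. c i \<in> {0, 1}" for c :: "nat \<Rightarrow> real"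
  proof (rule summable_comparison_test[OF _ sums_summable[OF geo]])
    have "norm (2 * c i / 3 ^ Suc i) \<le> 2 / 3 ^ Suc i" for i using that[of i] by auto
    then show "\<exists>N. \<forall>n\<ge>N. norm (2 * c n / 3 ^ Suc n) \<le> 2 / 3 ^ Suc n" by blast
  qed
  have diff: "(\<Sum>i. 2 * a i / 3 ^ Suc i) - (\<Sum>i. 2 * b i / 3 ^ Suc i) = (\<Sum>i. d i)"
    unfolding d_def using suminf_diff[OF sa[of a, OF a] sa[of b, OF b]] by (simp add: algebra_simps diff_divide_distrib)
  have sd: "summable d"
    unfolding d_def using summable_diff[OF sa[of a, OF a] sa[of b, OF b]] by (simp add: algebra_simps diff_divide_distrib)
  \<comment> \<open>At the first differing digit the sums differ by 2 / 3^(k+1), and all later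
    digits together change them by at most half of that: the digits 0 and 2 leave the Cantor
    gap.\<close>
  define k where "k = (LEAST i. a i \<noteq> b i)"
  have k: "a k \<noteq> b k" "k \<le> j" unfolding k_def using LeastI[of "\<lambda>i. a i \<noteq> b i", OF ne] Least_le[of "\<lambda>i. a i \<noteq> b i", OF ne] by auto
  have less: "d i = 0" if "i < k" for i using not_less_Least[of i "\<lambda>i. a i \<noteq> b i"] that by (auto simp: d_def k_def)
  have "(\<Sum>i. d i) = (\<Sum>i. d (i + Suc k)) + (\<Sum>i<Suc k. d i)"
    using suminf_split_initial_segment[OF sd, of "Suc k"] by simp
  also have "(\<Sum>i<Suc k. d i) = d k" using less by simp
  finally have eq: "(\<Sum>i. d i) = (\<Sum>i. d (i + Suc k)) + d k" .
  have dk: "\<bar>d k\<bar> = 2 / 3 ^ Suc k" using k a[of k] b[of k] by (auto simp: d_def)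
  have geo2: "(\<lambda>i. (1 / 3 ^ Suc k) * (2 / 3 ^ Suc i) :: real) sums (1 / 3 ^ Suc k)"
    using sums_mult[OF geo, of "1 / 3 ^ Suc k"] by simp
  have tail: "\<bar>\<Sum>i. d (i + Suc k)\<bar> \<le> 1 / 3 ^ Suc k"
  proof -
    have bd: "norm (d (i + Suc k)) \<le> (1 / 3 ^ Suc k) * (2 / 3 ^ Suc i)" for i
    proof -
      have "\<bar>a (i + Suc k) - b (i + Suc k)\<bar> \<le> 1" using a[of "i + Suc k"] b[of "i + Suc k"] by auto
      then show ?thesis by (simp add: d_def abs_mult power_add field_simps)
    qed
    have "norm (\<Sum>i. d (i + Suc k)) \<le> (\<Sum>i. (1 / 3 ^ Suc k) * (2 / 3 ^ Suc i))"
      by (rule norm_suminf_le[OF bd sums_summable[OF geo2]]) 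
    then show ?thesis using sums_unique[OF geo2] by simp
  qed
  have "1 / 3 ^ Suc j \<le> (1 / 3 ^ Suc k :: real)" using k by (intro divide_left_mono power_increasing) auto
  then show ?thesis unfolding diff using eq dk tail by linarith
qed

context compact_metric
begin

lemma finite_net:
  assumes "0 < (e::real)"
  obtains F where "finite F" "F \<subseteq> M" "\<And>x. x \<in> M \<Longrightarrow> \<exists>p\<in>F. dist x p < e"
proof -
  obtain F where "F \<subseteq> M" "finite F" "M \<subseteq> (\<Union>p\<in>F. ball p e)"
    using compactE_image[OF cpt, of M "\<lambda>p. ball p e"] assms by (auto intro: centre_in_ball[THEN iffD2])
  then show ?thesis using that[of F] by (auto simp: subset_eq dist_commute)
qed

text \<open>The code is only Borel, but its inverse is uniformly continuous; this lets weak limits on the real line be transported back to \<open>M\<close>.\<close>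
lemma borel_code:
  assumes ne: "M \<noteq> {}"
  obtains s :: "'a \<Rightarrow> real" where "s \<in> borel_measurable BM" "\<And>x. x \<in> M \<Longrightarrow> s x \<in> {0..1}"
    "\<And>e. 0 < e \<Longrightarrow> \<exists>h>0. \<forall>x\<in>M. \<forall>y\<in>M. \<bar>s x - s y\<bar> < h \<longrightarrow> dist x y < e"
proof -
  have "\<exists>F. finite F \<and> F \<subseteq> M \<and> (\<forall>x\<in>M. \<exists>p\<in>F. dist x p < 1 / real (Suc n))" for n
    by (rule finite_net[of "1 / real (Suc n)"]) auto
  then obtain F where F: "\<And>n. finite (F n)" "\<And>n. F n \<subseteq> M"
    "\<And>n x. x \<in> M \<Longrightarrow> \<exists>p\<in>F n. dist x p < 1 / real (Suc n)" by metis
  define J where "J = (SIGMA n:UNIV. F n)"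
  have Jc: "countable J" unfolding J_def using F by (intro countable_SIGMA) (auto simp: countable_finite)
  have Jn: "J \<noteq> {}" using ne F(3) unfolding J_def by fastforce
  define e where "e = from_nat_into J"
  \<comment> \<open>Digit \<open>j\<close> tells whether \<open>x\<close> is farther than 1/(n+1)
    from the net point p, where (n, p) is the \<open>j\<close>-th pair of the enumeration.\<close>
  define g where "g j x = (if 1 / real (Suc (fst (e j))) < dist x (snd (e j)) then 1 else 0 :: real)" for j x
  define s where "s x = (\<Sum>i. 2 * g i x / 3 ^ Suc i)" for x
  have g01: "g j x \<in> {0, 1}" for j x by (simp add: g_def)
  have geo: "(\<lambda>i. 2 / 3 ^ Suc i :: real) sums 1"
    using sums_mult[OF geometric_sums[of "1/3::real"], of "2/3"] by (simp add: power_divide field_simps)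
  have bd: "norm (2 * g i x / 3 ^ Suc i) \<le> 2 / 3 ^ Suc i" for i x by (simp add: g_def)
  have summ: "summable (\<lambda>i. 2 * g i x / 3 ^ Suc i)" for x
    using bd by (intro summable_comparison_test[OF _ sums_summable[OF geo]]) blast
  show ?thesis
  proof
    have [measurable]: "(\<lambda>x. dist x p) \<in> borel_measurable borel" for p :: 'a
      by (intro borel_measurable_continuous_onI continuous_intros)
    have gm: "g j \<in> borel_measurable BM" for j
      unfolding g_def by (intro measurable_restrict_space1) measurable
    show "s \<in> borel_measurable BM" unfolding s_def
      by (intro borel_measurable_suminf borel_measurable_divide borel_measurable_times gm) auto
    show "s x \<in> {0..1}" if "x \<in> M" for x
    proof -
      have "0 \<le> s x" unfolding s_def by (intro suminf_nonneg summ) (auto simp: g_def)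
      moreover have "s x \<le> (\<Sum>i. 2 / 3 ^ Suc i)" unfolding s_def
        by (intro suminf_le summ sums_summable[OF geo]) (auto simp: g_def)
      ultimately show ?thesis using sums_unique[OF geo] by simp
    qed
    show "\<exists>h>0. \<forall>x\<in>M. \<forall>y\<in>M. \<bar>s x - s y\<bar> < h \<longrightarrow> dist x y < r" if r: "0 < r" for r
    proof (rule ccontr)
      assume neg: "\<not> ?thesis"
      have "\<exists>x y. x \<in> M \<and> y \<in> M \<and> \<bar>s x - s y\<bar> < 1 / 3 ^ Suc n \<and> \<not> dist x y < r" for n
      proof (rule ccontr)
        assume "\<not> ?thesis"
        then have "\<forall>x\<in>M. \<forall>y\<in>M. \<bar>s x - s y\<bar> < 1 / 3 ^ Suc n \<longrightarrow> dist x y < r" by blast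
        moreover have "(0::real) < 1 / 3 ^ Suc n" by simp
        ultimately show False using neg by blast
      qed
      then obtain x y where xy: "\<And>n. x n \<in> M" "\<And>n. y n \<in> M" "\<And>n. \<bar>s (x n) - s (y n)\<bar> < 1 / 3 ^ Suc n"
          "\<And>n. \<not> dist (x n) (y n) < r" by metis
      have same: "g j (x n) = g j (y n)" if "j \<le> n" for j n
      proof (rule ccontr)
        assume "g j (x n) \<noteq> g j (y n)"
        then have "1 / 3 ^ Suc j \<le> \<bar>s (x n) - s (y n)\<bar>"
          unfolding s_def using g01 by (intro ternary_digits_separate)
        moreover have "1 / 3 ^ Suc n \<le> (1 / 3 ^ Suc j :: real)" using that by (intro divide_left_mono power_increasing) auto
        ultimately show False using xy(3)[of n] by linarith
      qed
      obtain l q where l: "l \<in> M \<times> M" "strict_mono (q :: nat \<Rightarrow> nat)" "((\<lambda>n. (x n, y n)) \<circ> q) \<longlonglongrightarrow> l"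
        using seq_compactE[OF compact_imp_seq_compact[OF compact_Times[OF cpt cpt]], of "\<lambda>n. (x n, y n)"] xy(1,2) by auto
      have lx: "(\<lambda>n. x (q n)) \<longlonglongrightarrow> fst l" and ly: "(\<lambda>n. y (q n)) \<longlonglongrightarrow> snd l"
        using tendsto_fst[OF l(3)] tendsto_snd[OF l(3)] by (simp_all add: comp_def)
      have "r \<le> dist (fst l) (snd l)"
        using xy(4) by (intro tendsto_lowerbound[OF tendsto_dist[OF lx ly]]) (auto simp: not_less)
      \<comment> \<open>A net point \<open>p\<close> within 1/(n+1) of the first limit is then
        farther than 1/(n+1) from the second, both strictly. So the digit of \<open>(n, p)\<close>
        eventually separates the two sequences, against the agreement of their digits.\<close>
      obtain n where n: "2 / real (Suc n) < dist (fst l) (snd l)"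
      proof -
        have "0 < dist (fst l) (snd l) / 2" using r \<open>r \<le> _\<close> by linarith
        then obtain n where "1 / real (Suc n) < dist (fst l) (snd l) / 2" by (rule nat_approx_posE)
        then show ?thesis using that[of n] by simp
      qed
      obtain p where p: "p \<in> F n" "dist (fst l) p < 1 / real (Suc n)" using F(3)[of "fst l" n] l(1) by (auto simp: mem_Times_iff)
      have "(n, p) \<in> J" using p by (simp add: J_def)
      then obtain j where j: "e j = (n, p)" unfolding e_def using from_nat_into_surj[OF Jc] by metis
      have "1 / real (Suc n) < dist (snd l) p"
        using n p(2) dist_triangle[of "fst l" "snd l" p] by (simp add: dist_commute)
      then have "\<forall>\<^sub>F k in sequentially. 1 / real (Suc n) < dist (y (q k)) p"
        by (rule order_tendstoD(1)[OF tendsto_dist[OF ly tendsto_const]])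
      moreover have "\<forall>\<^sub>F k in sequentially. dist (x (q k)) p < 1 / real (Suc n)"
        by (rule order_tendstoD(2)[OF tendsto_dist[OF lx tendsto_const] p(2)])
      moreover have "\<forall>\<^sub>F k in sequentially. j \<le> q k"
        using seq_suble[OF l(2)] by (auto simp: eventually_sequentially intro: le_trans intro!: exI[of _ j])
      ultimately have "\<forall>\<^sub>F k::nat in sequentially. False"
        by eventually_elim (use same j in \<open>fastforce simp: g_def\<close>)
      then show False by simp
    qed
  qed
qed

text \<open>The codes push the measures into the unit interval, where tightness yields a convergent
  subsequence. The code is not continuous, but its inverse extends continuously to the closure of
  the image and carries the limit law back to \<open>M\<close>.\<close>

lemma seq_compact_probs:
  assumes X: "\<And>n. X n \<in> probs M"
  obtains r Q where "strict_mono (r :: nat \<Rightarrow> nat)" "Q \<in> probs M" "wconv (X \<circ> r) Q"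
proof -
  have ne: "M \<noteq> {}" using nonempty_M[OF X] .
  obtain s :: "'a \<Rightarrow> real" where s: "s \<in> borel_measurable BM" "\<And>x. x \<in> M \<Longrightarrow> s x \<in> {0..1}"
    and inv: "\<And>e. 0 < e \<Longrightarrow> \<exists>h>0. \<forall>x\<in>M. \<forall>y\<in>M. \<bar>s x - s y\<bar> < h \<longrightarrow> dist x y < e"
    by (rule borel_code[OF ne]) blast
  interpret X: prob_space "X n" for n using probs_prob_space[OF X] .
  have sm: "s \<in> measurable (X n) borel" for n using s(1) by (simp add: probs_measurable[OF X])
  define \<nu> where "\<nu> n = distr (X n) borel s" for n
  have rd: "real_distribution (\<nu> n)" for n
    unfolding \<nu>_def using X.prob_space_distr[OF sm] by (auto simp: real_distribution_def real_distribution_axioms_def)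
  have "tight \<nu>"
    unfolding tight_def
  proof (intro conjI allI impI rd)
    fix e :: real assume e: "0 < e"
    have "measure (\<nu> n) {-1<..1} = 1" for n
    proof -
      have "s -` {-1<..1} \<inter> space (X n) = space (X n)" using s(2) probs_space[OF X] by force
      then show ?thesis unfolding \<nu>_def using sm X.prob_space by (subst measure_distr) auto
    qed
    then show "\<exists>a b. a < b \<and> (\<forall>n. 1 - e < measure (\<nu> n) {a<..b})" using e by (intro exI[of _ "-1"] exI[of _ 1]) auto
  qed
  then obtain r N where r: "strict_mono (r :: nat \<Rightarrow> nat)" and N: "real_distribution N" "weak_conv_m (\<nu> \<circ> id \<circ> r) N"
    using tight_imp_convergent_subsubsequence[of \<nu> id] strict_mono_id by blast
  interpret N: real_distribution N by (rule N(1))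
  have conv: "(\<lambda>n. \<integral>t. f t \<partial>\<nu> (r n)) \<longlonglongrightarrow> (\<integral>t. f t \<partial>N)"
    if "\<And>t. isCont f t" "\<And>t. \<bar>f t\<bar> \<le> B" for f :: "real \<Rightarrow> real" and B
    using weak_conv_imp_integral_bdd_continuous_conv[of "\<nu> \<circ> id \<circ> r" N f B] N that rd by (simp add: comp_def)
  define C where "C = closure (s ` M)"
  have C: "closed C" "C \<noteq> {}" using ne by (auto simp: C_def)
  \<comment> \<open>The truncated distance to \<open>C\<close> is bounded and continuous and
    integrates to 0 under every \<open>\<nu> n\<close>, hence under the limit.\<close>
  have NC: "AE t in N. t \<in> C"
  proof -
    let ?f = "\<lambda>t. min 1 (infdist t C)"
    have con: "continuous_on UNIV ?f" by (intro continuous_intros)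
    then have cf: "isCont ?f t" for t by (simp add: continuous_on_eq_continuous_at)
    have fm: "?f \<in> borel_measurable borel" using con by (rule borel_measurable_continuous_onI)
    have zero: "(\<integral>t. ?f t \<partial>\<nu> n) = 0" for n
    proof -
      have "(\<integral>t. ?f t \<partial>\<nu> n) = (\<integral>x. ?f (s x) \<partial>X n)" unfolding \<nu>_def by (rule integral_distr[OF sm fm])
      also have "\<dots> = (\<integral>x. 0 \<partial>X n)"
      proof (rule Bochner_Integration.integral_cong[OF refl])
        fix x assume "x \<in> space (X n)"
        then have "s x \<in> C" using probs_space[OF X] closure_subset unfolding C_def by blast
        then show "?f (s x) = 0" by simp
      qed
      finally show ?thesis by simp
    qed
    have "(\<lambda>n. \<integral>t. ?f t \<partial>\<nu> (r n)) \<longlonglongrightarrow> (\<integral>t. ?f t \<partial>N)"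
      by (rule conv[of ?f 1, OF cf]) (simp add: abs_of_nonneg infdist_nonneg)
    then have "(\<integral>t. ?f t \<partial>N) = 0" unfolding zero by (simp add: LIMSEQ_const_iff)
    moreover have "integrable N ?f"
      using fm by (intro N.integrable_const_bound[where B=1]) (auto simp: infdist_nonneg)
    ultimately have "AE t in N. ?f t = 0"
      using integral_nonneg_eq_0_iff_AE[of N ?f] infdist_nonneg by auto
    then show ?thesis
    proof eventually_elim
      case (elim t)
      then have "infdist t C = 0" by (simp add: min_def split: if_splits)
      then show ?case using in_closed_iff_infdist_zero[OF C] by simp
    qed
  qed
  \<comment> \<open>The inverse code, closed up by limits. Uniform continuity of the inverse makes
    this relation single-valued and uniformly continuous; compactness of \<open>M\<close> makes it
    total on \<open>C\<close>.\<close>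
  define is_lim where "is_lim t x \<longleftrightarrow> x \<in> M \<and> (\<exists>u. (\<forall>n. u n \<in> M) \<and> (\<lambda>n. s (u n)) \<longlonglongrightarrow> t \<and> u \<longlonglongrightarrow> x)" for t x
  define c where "c t = (SOME x. is_lim t x)" for t
  have close: "\<exists>h>0. \<forall>t t' x x'. is_lim t x \<longrightarrow> is_lim t' x' \<longrightarrow> \<bar>t - t'\<bar> < h \<longrightarrow> dist x x' < e" if e: "0 < e" for e
  proof -
    obtain h where h: "h > 0" "\<forall>x\<in>M. \<forall>y\<in>M. \<bar>s x - s y\<bar> < h \<longrightarrow> dist x y < e / 2" using inv[of "e/2"] e by auto
    have conc: "dist x x' < e" if xx: "is_lim t x" "is_lim t' x'" "\<bar>t - t'\<bar> < h" for t t' x x'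
    proof -
      obtain u u' where u: "\<And>n. u n \<in> M" "(\<lambda>n. s (u n)) \<longlonglongrightarrow> t" "u \<longlonglongrightarrow> x"
        and u': "\<And>n. u' n \<in> M" "(\<lambda>n. s (u' n)) \<longlonglongrightarrow> t'" "u' \<longlonglongrightarrow> x'" using xx unfolding is_lim_def by blast
      have "(\<lambda>n. \<bar>s (u n) - s (u' n)\<bar>) \<longlonglongrightarrow> \<bar>t - t'\<bar>" using u u' by (intro tendsto_intros)
      then have "\<forall>\<^sub>F n in sequentially. \<bar>s (u n) - s (u' n)\<bar> < h" using xx(3) by (rule order_tendstoD(2))
      then have "\<forall>\<^sub>F n in sequentially. dist (u n) (u' n) \<le> e / 2"
        by eventually_elim (use h u u' in \<open>auto simp: less_imp_le\<close>)
      then have "dist x x' \<le> e / 2" using tendsto_dist[OF u(3) u'(3)] by (intro tendsto_upperbound) auto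
      then show ?thesis using e by simp
    qed
    show ?thesis using h(1) conc by (intro exI[of _ h] conjI allI impI)
  qed
  have uniq: "x = x'" if "is_lim t x" "is_lim t x'" for t x x'
  proof (rule ccontr)
    assume "x \<noteq> x'"
    then show False using close[of "dist x x'"] that by fastforce
  qed
  have c: "is_lim t (c t)" if tC: "t \<in> C" for t
  proof -
    obtain w where w: "\<And>n. w n \<in> s ` M" "w \<longlonglongrightarrow> t" using tC unfolding C_def closure_sequential by blast
    have "\<forall>n. \<exists>x. x \<in> M \<and> w n = s x" using w(1) by blast
    from choice[OF this] obtain u where u: "\<And>n. u n \<in> M" "\<And>n. w n = s (u n)" by blast
    obtain x q where xq: "x \<in> M" "strict_mono (q :: nat \<Rightarrow> nat)" "(u \<circ> q) \<longlonglongrightarrow> x"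
      using seq_compactE[OF compact_imp_seq_compact[OF cpt], of u] u(1) by auto
    have "(\<lambda>n. s ((u \<circ> q) n)) \<longlonglongrightarrow> t" using LIMSEQ_subseq_LIMSEQ[OF w(2) xq(2)] u(2) by (simp add: comp_def)
    then have "is_lim t x" unfolding is_lim_def using xq u(1) by (auto intro!: exI[of _ "u \<circ> q"])
    then show ?thesis unfolding c_def by (rule someI)
  qed
  have cs: "c (s x) = x" if "x \<in> M" for x
  proof -
    have "is_lim (s x) x" unfolding is_lim_def using that by (auto intro!: exI[of _ "\<lambda>_. x"])
    moreover have "is_lim (s x) (c (s x))" using that by (intro c) (auto simp: C_def intro: subsetD[OF closure_subset])
    ultimately show ?thesis using uniq by blast
  qed
  have cM: "c t \<in> M" if "t \<in> C" for t using c[OF that] by (simp add: is_lim_def)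
  have cc: "continuous_on C c"
    unfolding continuous_on_iff
  proof (intro ballI allI impI)
    fix t and e :: real assume t: "t \<in> C" and e: "0 < e"
    obtain h where h: "h > 0" "\<forall>t t' x x'. is_lim t x \<longrightarrow> is_lim t' x' \<longrightarrow> \<bar>t - t'\<bar> < h \<longrightarrow> dist x x' < e"
      using close[OF e] by auto
    show "\<exists>d>0. \<forall>x'\<in>C. dist x' t < d \<longrightarrow> dist (c x') (c t) < e"
      using h(1) by (intro exI[of _ h] conjI ballI impI h(2)[rule_format, OF c c] t) (auto simp: dist_real_def)
  qed
  obtain x0 where x0: "x0 \<in> M" using ne by blast
  \<comment> \<open>\<open>x0\<close> is a default value on the complement of \<open>C\<close>,
    which is null for \<open>N\<close>.\<close>
  define c' where "c' t = (if t \<in> C then c t else x0)" for t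
  have c'm: "c' \<in> measurable N BM"
  proof -
    have "c' \<in> measurable borel borel" unfolding c'_def
      using C cc by (intro borel_measurable_continuous_on_if) (auto intro: continuous_on_const)
    then have "c' \<in> measurable borel BM" using cM x0 by (intro measurable_restrict_space2) (auto simp: c'_def)
    then show ?thesis by (simp add: N.events_eq_borel measurable_cong_sets[OF N.events_eq_borel refl])
  qed
  define Q where "Q = distr N BM c'"
  have Qp: "Q \<in> probs M" unfolding probs_def Q_def using N.prob_space_distr[OF c'm] by simp
  have "wconv (X \<circ> r) Q"
    unfolding wconv_def
  proof (intro allI impI)
    fix f :: "'a \<Rightarrow> real" assume f: "continuous_on M f"
    obtain B where B: "0 < B" "\<And>x. x \<in> M \<Longrightarrow> \<bar>f x\<bar> \<le> B" by (rule continuous_bound[OF f]) blast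
    have "continuous_on C (f \<circ> c)" using cc f cM by (intro continuous_on_compose) (auto intro: continuous_on_subset)
    \<comment> \<open>Tietze extends \<open>f\<close> after decoding from \<open>C\<close> to a
      bounded continuous function on the line, where weak convergence is available.\<close>
    then obtain g where g: "continuous_on UNIV g" "\<And>t. t \<in> C \<Longrightarrow> g t = (f \<circ> c) t" "\<And>t. norm (g t) \<le> B"
      using Tietze[of C "f \<circ> c" UNIV B] C B cM by (auto simp: image_subset_iff)
    have gm: "g \<in> borel_measurable borel" using g(1) by (rule borel_measurable_continuous_onI)
    have "(\<integral>x. f x \<partial>X n) = (\<integral>t. g t \<partial>\<nu> n)" for n
    proof -
      have "(\<integral>t. g t \<partial>\<nu> n) = (\<integral>x. g (s x) \<partial>X n)" unfolding \<nu>_def by (rule integral_distr[OF sm gm])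
      also have "\<dots> = (\<integral>x. f x \<partial>X n)"
      proof (rule Bochner_Integration.integral_cong[OF refl])
        fix x assume "x \<in> space (X n)"
        then have "x \<in> M" using probs_space[OF X] by simp
        then have "s x \<in> C" unfolding C_def by (intro subsetD[OF closure_subset] imageI)
        then show "g (s x) = f x" using g(2) cs \<open>x \<in> M\<close> by simp
      qed
      finally show ?thesis by simp
    qed
    moreover have "(\<integral>x. f x \<partial>Q) = (\<integral>t. g t \<partial>N)"
    proof -
      have "(\<integral>x. f x \<partial>Q) = (\<integral>t. f (c' t) \<partial>N)" unfolding Q_def by (rule integral_distr[OF c'm continuous_borel[OF f]])
      also have "\<dots> = (\<integral>t. g t \<partial>N)"
      proof (rule integral_cong_AE)
        show "(\<lambda>t. f (c' t)) \<in> borel_measurable N" using measurable_compose[OF c'm continuous_borel[OF f]] by (simp add: comp_def)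
        show "g \<in> borel_measurable N" using gm by simp
        show "AE t in N. f (c' t) = g t" using NC by eventually_elim (simp add: g(2) c'_def)
      qed
      finally show ?thesis .
    qed
    ultimately show "(\<lambda>n. \<integral>x. f x \<partial>(X \<circ> r) n) \<longlonglongrightarrow> (\<integral>x. f x \<partial>Q)"
      using conv[of g B] g(1,3) by (simp add: continuous_on_eq_continuous_at)
  qed
  then show ?thesis using that r Qp by blast
qed

end

section \<open>Separability of the continuous functions and basic weak neighbourhoods\<close>

context compact_metric
begin

text \<open>Partitions of unity built on finite nets, with rational coefficients. A countable dense
  family lets sequential compactness of the measures stand in for covering compactness in the upper
  bound.\<close>

lemma countable_dense_functions:
  obtains D :: "('a \<Rightarrow> real) set" where "countable D" "\<And>g. g \<in> D \<Longrightarrow> continuous_on M g"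
    "\<And>f e. continuous_on M f \<Longrightarrow> 0 < e \<Longrightarrow> \<exists>g\<in>D. \<forall>x\<in>M. \<bar>f x - g x\<bar> < e"
proof -
  have "\<exists>F. finite F \<and> F \<subseteq> M \<and> (\<forall>x\<in>M. \<exists>p\<in>F. dist x p < 1 / real (Suc n))" for n
    by (rule finite_net[of "1 / real (Suc n)"]) auto
  then obtain F where F: "\<And>n. finite (F n)" "\<And>n. F n \<subseteq> M"
    "\<And>n x. x \<in> M \<Longrightarrow> \<exists>p\<in>F n. dist x p < 1 / real (Suc n)" by metis
  define u where "u n p x = max 0 (1 / real (Suc n) - dist x p)" for n p and x :: 'a
  define g where "g n c x = (\<Sum>p\<in>F n. c p * u n p x) / (\<Sum>p\<in>F n. u n p x)" for n and c :: "'a \<Rightarrow> real" and x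
  have un: "0 \<le> u n p x" for n p x by (simp add: u_def)
  have us: "0 < (\<Sum>p\<in>F n. u n p x)" if x: "x \<in> M" for n x
  proof -
    obtain p where "p \<in> F n" "dist x p < 1 / real (Suc n)" using F(3)[OF x] by blast
    then show ?thesis using F(1) un by (intro sum_pos2[of _ p]) (auto simp: u_def)
  qed
  have uc: "continuous_on M (u n p)" for n p unfolding u_def by (intro continuous_intros)
  define D where "D = (\<Union>n. g n ` (F n \<rightarrow>\<^sub>E \<rat>))"
  show ?thesis
  proof
    show "countable D" unfolding D_def using F(1)
      by (intro countable_UN countable_image countable_PiE) (auto simp: countable_rat)
    show "continuous_on M h" if h: "h \<in> D" for h
    proof -
      obtain n c where "h = g n c" using h unfolding D_def by auto
      moreover have "continuous_on M (g n c)" unfolding g_def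
        using us by (intro continuous_on_divide continuous_on_sum continuous_on_mult continuous_on_const uc) (metis less_irrefl)
      ultimately show ?thesis by simp
    qed
    show "\<exists>h\<in>D. \<forall>x\<in>M. \<bar>f x - h x\<bar> < e" if f: "continuous_on M f" and e: "0 < e" for f e
    proof -
      have "uniformly_continuous_on M f" using f cpt by (rule compact_uniformly_continuous)
      then obtain d where d: "0 < d" "\<And>x y. x \<in> M \<Longrightarrow> y \<in> M \<Longrightarrow> dist y x < d \<Longrightarrow> dist (f y) (f x) < e / 2"
        unfolding uniformly_continuous_on_def using e by (metis half_gt_zero)
      obtain n where n: "1 / real (Suc n) < d" using d(1) by (rule nat_approx_posE)
      have "\<exists>q\<in>\<rat>. \<bar>f p - q\<bar> < e / 4" for p
      proof -
        obtain q where "f p - e/4 < real_of_rat q" "real_of_rat q < f p + e/4"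
          using of_rat_dense[of "f p - e/4" "f p + e/4"] e by auto
        then have "\<bar>f p - real_of_rat q\<bar> < e / 4" by linarith
        then show ?thesis by (intro bexI[of _ "real_of_rat q"]) auto
      qed
      then obtain q where q: "\<And>p. q p \<in> \<rat>" "\<And>p. \<bar>f p - q p\<bar> < e / 4" by metis
      define c where "c = restrict q (F n)"
      have cD: "g n c \<in> D" unfolding D_def c_def using q by (intro UN_I[of n] imageI) auto
      have "\<bar>f x - g n c x\<bar> < e" if x: "x \<in> M" for x
      proof -
        let ?S = "\<Sum>p\<in>F n. u n p x"
        have S: "0 < ?S" by (rule us[OF x])
        have "f x - g n c x = (\<Sum>p\<in>F n. (f x - c p) * u n p x) / ?S"
          using S by (simp add: g_def field_simps sum_subtractf sum_distrib_left sum_distrib_right)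
        also have "\<bar>\<dots>\<bar> \<le> (\<Sum>p\<in>F n. 3 / 4 * e * u n p x) / ?S"
        proof -
          have "\<bar>\<Sum>p\<in>F n. (f x - c p) * u n p x\<bar> \<le> (\<Sum>p\<in>F n. \<bar>(f x - c p) * u n p x\<bar>)" by (rule sum_abs)
          also have "\<dots> \<le> (\<Sum>p\<in>F n. 3 / 4 * e * u n p x)"
          proof (rule sum_mono)
            fix p assume p: "p \<in> F n"
            \<comment> \<open>A net point near \<open>x\<close> errs by \<open>e / 2\<close> from
              continuity and \<open>e / 4\<close> from rounding; a far one has weight zero.\<close>
            show "\<bar>(f x - c p) * u n p x\<bar> \<le> 3 / 4 * e * u n p x"
            proof (cases "dist x p < d")
              case True
              have "p \<in> M" using F(2) p by blast
              then have "\<bar>f x - f p\<bar> < e / 2" using d(2)[of p x] x True by (simp add: dist_real_def)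
              moreover have "c p = q p" using p by (simp add: c_def)
              ultimately have "\<bar>f x - c p\<bar> \<le> 3 / 4 * e" using q(2)[of p] by linarith
              then show ?thesis using un[of n p x] by (metis abs_mult abs_of_nonneg mult_right_mono)
            next
              case False
              then have "u n p x = 0" using n by (simp add: u_def)
              then show ?thesis by simp
            qed
          qed
          finally show ?thesis using S by (simp add: divide_right_mono)
        qed
        also have "\<dots> = 3 / 4 * e" using S unfolding sum_distrib_left[symmetric] by simp
        finally show ?thesis using e by linarith
      qed
      then show ?thesis using cD by blast
    qed
  qed
qed

lemma openin_weak_top_basic:
  fixes f :: "'a \<Rightarrow> real"
  assumes "continuous_on M f" "open U"
  shows "openin (weak_top M) {Q \<in> probs M. (\<integral>x. f x \<partial>Q) \<in> U}"
proof -
  have "openin (topology_generated_by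
        {{Q \<in> probs M. (\<integral>x. f x \<partial>Q) \<in> U} | (f :: 'a \<Rightarrow> real) (U :: real set). continuous_on M f \<and> open U})
        {Q \<in> probs M. (\<integral>x. f x \<partial>Q) \<in> U}"
    using assms by (intro topology_generated_by_Basis) auto
  then show ?thesis unfolding weak_top_def openin_subtopology
    by (intro exI[of _ "{Q \<in> probs M. (\<integral>x. f x \<partial>Q) \<in> U}"]) auto
qed

lemma topspace_weak_top: "topspace (weak_top M) = probs M"
proof -
  have "openin (weak_top M) {Q \<in> probs M. (\<integral>x. 0 \<partial>Q) \<in> (UNIV :: real set)}"
    by (rule openin_weak_top_basic) auto
  from openin_subset[OF this] show ?thesis by (auto simp: weak_top_def)
qed

text \<open>Induction on the generation of the topology. All later use of weakly open sets passes
  through this finite form.\<close>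

lemma weak_top_nbhd:
  assumes U: "openin (weak_top M) U" and Q: "Q \<in> U"
  obtains Fs e where "finite Fs" "\<And>f. f \<in> Fs \<Longrightarrow> continuous_on M f" "0 < (e::real)"
    "\<And>Q'. Q' \<in> probs M \<Longrightarrow> (\<And>f. f \<in> Fs \<Longrightarrow> \<bar>(\<integral>x. f x \<partial>Q') - (\<integral>x. f x \<partial>Q)\<bar> < e) \<Longrightarrow> Q' \<in> U"
proof -
  let ?S = "{{Q \<in> probs M. (\<integral>x. f x \<partial>Q) \<in> U} | (f :: 'a \<Rightarrow> real) (U :: real set). continuous_on M f \<and> open U}"
  let ?P = "\<lambda>U. \<forall>Q\<in>U. \<exists>Fs e. finite Fs \<and> (\<forall>f\<in>Fs. continuous_on M f) \<and> 0 < (e::real) \<and>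
     (\<forall>Q'\<in>probs M. (\<forall>f\<in>Fs. \<bar>(\<integral>x. f x \<partial>Q') - (\<integral>x. f x \<partial>Q)\<bar> < e) \<longrightarrow> Q' \<in> U)"
  obtain T where T: "openin (topology_generated_by ?S) T" "U = T \<inter> probs M"
    using U unfolding weak_top_def openin_subtopology by auto
  have "generate_topology_on ?S T" using T(1) by (simp add: openin_topology_generated_by)
  then have "?P T"
  proof induction
    case Empty show ?case by simp
  next
    case (Int a b)
    show ?case
    proof
      fix Q assume q: "Q \<in> a \<inter> b"
      from q Int(3) obtain F1 e1 where 1: "finite F1" "\<forall>f\<in>F1. continuous_on M f" "0 < (e1::real)"
        "\<forall>Q'\<in>probs M. (\<forall>f\<in>F1. \<bar>(\<integral>x. f x \<partial>Q') - (\<integral>x. f x \<partial>Q)\<bar> < e1) \<longrightarrow> Q' \<in> a" by auto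
      from q Int(4) obtain F2 e2 where 2: "finite F2" "\<forall>f\<in>F2. continuous_on M f" "0 < (e2::real)"
        "\<forall>Q'\<in>probs M. (\<forall>f\<in>F2. \<bar>(\<integral>x. f x \<partial>Q') - (\<integral>x. f x \<partial>Q)\<bar> < e2) \<longrightarrow> Q' \<in> b" by auto
      show "\<exists>Fs e. finite Fs \<and> (\<forall>f\<in>Fs. continuous_on M f) \<and> 0 < (e::real) \<and>
         (\<forall>Q'\<in>probs M. (\<forall>f\<in>Fs. \<bar>(\<integral>x. f x \<partial>Q') - (\<integral>x. f x \<partial>Q)\<bar> < e) \<longrightarrow> Q' \<in> a \<inter> b)"
        using 1 2 by (intro exI[of _ "F1 \<union> F2"] exI[of _ "min e1 e2"]) auto
    qed
  next
    case (UN K)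
    show ?case
    proof
      fix Q assume "Q \<in> \<Union>K"
      then obtain k where k: "k \<in> K" "Q \<in> k" by blast
      then obtain Fs e where "finite Fs" "\<forall>f\<in>Fs. continuous_on M f" "0 < (e::real)"
        "\<forall>Q'\<in>probs M. (\<forall>f\<in>Fs. \<bar>(\<integral>x. f x \<partial>Q') - (\<integral>x. f x \<partial>Q)\<bar> < e) \<longrightarrow> Q' \<in> k" using UN.IH[OF k(1)] by auto
      then show "\<exists>Fs e. finite Fs \<and> (\<forall>f\<in>Fs. continuous_on M f) \<and> 0 < (e::real) \<and>
         (\<forall>Q'\<in>probs M. (\<forall>f\<in>Fs. \<bar>(\<integral>x. f x \<partial>Q') - (\<integral>x. f x \<partial>Q)\<bar> < e) \<longrightarrow> Q' \<in> \<Union>K)"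
        using k(1) by (intro exI[of _ Fs] exI[of _ e]) auto
    qed
  next
    case (Basis s)
    then obtain f :: "'a \<Rightarrow> real" and V where s: "s = {Q \<in> probs M. (\<integral>x. f x \<partial>Q) \<in> V}" "continuous_on M f" "open V" by auto
    show ?case
    proof
      fix Q assume "Q \<in> s"
      then obtain e where e: "0 < e" "\<forall>y. dist y (\<integral>x. f x \<partial>Q) < e \<longrightarrow> y \<in> V" using s unfolding open_dist by auto
      then show "\<exists>Fs e. finite Fs \<and> (\<forall>f\<in>Fs. continuous_on M f) \<and> 0 < (e::real) \<and>
         (\<forall>Q'\<in>probs M. (\<forall>f\<in>Fs. \<bar>(\<integral>x. f x \<partial>Q') - (\<integral>x. f x \<partial>Q)\<bar> < e) \<longrightarrow> Q' \<in> s)"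
        using s by (intro exI[of _ "{f}"] exI[of _ e]) (auto simp: dist_real_def)
    qed
  qed
  then have "\<exists>Fs e. finite Fs \<and> (\<forall>f\<in>Fs. continuous_on M f) \<and> 0 < (e::real) \<and>
     (\<forall>Q'\<in>probs M. (\<forall>f\<in>Fs. \<bar>(\<integral>x. f x \<partial>Q') - (\<integral>x. f x \<partial>Q)\<bar> < e) \<longrightarrow> Q' \<in> T)"
    using Q T(2) by auto
  then obtain Fs e where "finite Fs" "\<forall>f\<in>Fs. continuous_on M f" "0 < (e::real)"
     "\<forall>Q'\<in>probs M. (\<forall>f\<in>Fs. \<bar>(\<integral>x. f x \<partial>Q') - (\<integral>x. f x \<partial>Q)\<bar> < e) \<longrightarrow> Q' \<in> T" by auto
  then show ?thesis using T(2) by (intro that[of Fs e]) auto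
qed

lemma wconv_eventually_nbhd:
  assumes X: "\<And>n. X n \<in> probs M" and w: "wconv X Q" and U: "openin (weak_top M) U" and Q: "Q \<in> U"
  shows "\<forall>\<^sub>F n in sequentially. X n \<in> U"
proof -
  obtain Fs e where F: "finite Fs" "\<And>f. f \<in> Fs \<Longrightarrow> continuous_on M f" "0 < (e::real)"
    "\<And>Q'. Q' \<in> probs M \<Longrightarrow> (\<And>f. f \<in> Fs \<Longrightarrow> \<bar>(\<integral>x. f x \<partial>Q') - (\<integral>x. f x \<partial>Q)\<bar> < e) \<Longrightarrow> Q' \<in> U"
    by (rule weak_top_nbhd[OF U Q]) blast
  have "\<forall>\<^sub>F n in sequentially. \<forall>f\<in>Fs. \<bar>(\<integral>x. f x \<partial>X n) - (\<integral>x. f x \<partial>Q)\<bar> < e"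
  proof (intro eventually_ball_finite F(1) ballI)
    fix f assume "f \<in> Fs"
    then have "(\<lambda>n. \<integral>x. f x \<partial>X n) \<longlonglongrightarrow> (\<integral>x. f x \<partial>Q)" using w F(2) by (simp add: wconv_def)
    then show "\<forall>\<^sub>F n in sequentially. \<bar>(\<integral>x. f x \<partial>X n) - (\<integral>x. f x \<partial>Q)\<bar> < e"
      using F(3) by (auto dest!: tendstoD simp: dist_real_def)
  qed
  then show ?thesis by eventually_elim (rule F(4)[OF X], blast)
qed

lemma wconv_closure:
  assumes X: "\<And>n. X n \<in> probs M" and w: "wconv X Q" and Q: "Q \<in> probs M" and S: "\<And>n. X n \<in> weak_top M closure_of S"
  shows "Q \<in> weak_top M closure_of S"
proof (rule ccontr)
  let ?C = "weak_top M closure_of S"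
  assume "Q \<notin> ?C"
  then have "Q \<in> probs M - ?C" using Q by simp
  moreover have "openin (weak_top M) (probs M - ?C)"
    using closedin_closure_of[of "weak_top M" S] by (simp add: closedin_def topspace_weak_top)
  ultimately have "\<forall>\<^sub>F n in sequentially. X n \<in> probs M - ?C" by (intro wconv_eventually_nbhd[OF X w])
  then have "\<forall>\<^sub>F n::nat in sequentially. False" by eventually_elim (use S in auto)
  then show False by simp
qed

end

subsection \<open>Dynamics and asymptotically additive sequences\<close>

locale dyn_system = compact_metric M for M :: "'a::metric_space set" +
  fixes \<phi> :: "'a \<Rightarrow> 'a"
  assumes cont: "continuous_on M \<phi>" and maps: "\<phi> ` M \<subseteq> M"
begin

lemma iter_in: "x \<in> M \<Longrightarrow> (\<phi> ^^ k) x \<in> M"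
  using maps by (induction k) auto

lemma iter_cont: "continuous_on M (\<phi> ^^ k)"
proof (induction k)
  case (Suc k)
  have "continuous_on ((\<phi> ^^ k) ` M) \<phi>" by (rule continuous_on_subset[OF cont]) (use iter_in in auto)
  then show ?case using continuous_on_compose[OF Suc] by simp
qed (simp add: continuous_on_id)

lemma comp_iter_cont:
  assumes "continuous_on M f" shows "continuous_on M (\<lambda>x. f ((\<phi> ^^ k) x))"
proof -
  have "continuous_on ((\<phi> ^^ k) ` M) f" by (rule continuous_on_subset[OF assms]) (use iter_in in auto)
  then show ?thesis using continuous_on_compose[OF iter_cont] by (simp add: comp_def)
qed

lemma birkhoff_cont: "continuous_on M f \<Longrightarrow> continuous_on M (birkhoff \<phi> n f)"
  unfolding birkhoff_def by (intro continuous_on_sum comp_iter_cont)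

lemma birkhoff_abs_le:
  assumes "\<And>x. x \<in> M \<Longrightarrow> \<bar>f x\<bar> \<le> B" "x \<in> M"
  shows "\<bar>birkhoff \<phi> n f x\<bar> \<le> real n * B"
proof -
  have "\<bar>birkhoff \<phi> n f x\<bar> \<le> (\<Sum>k<n. \<bar>f ((\<phi> ^^ k) x)\<bar>)" unfolding birkhoff_def by (rule sum_abs)
  also have "\<dots> \<le> (\<Sum>k<n. B)" using assms iter_in by (intro sum_mono) auto
  finally show ?thesis by simp
qed

lemma iter_measurable: "(\<phi> ^^ k) \<in> measurable BM BM"
  using iter_in continuous_borel[OF iter_cont] by (intro measurable_restrict_space2) auto

lemma inv_probs_probs: "Q \<in> inv_probs M \<phi> \<Longrightarrow> Q \<in> probs M"
  by (simp add: inv_probs_def)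

lemma inv_probs_distr:
  assumes Q: "Q \<in> inv_probs M \<phi>"
  shows "distr Q BM (\<phi> ^^ k) = Q"
proof (induction k)
  case 0
  have "distr Q BM (\<lambda>x. x) = Q" using probs_sets[OF inv_probs_probs[OF Q]] by (intro distr_id2) simp
  then show ?case by (simp add: id_def)
next
  case (Suc k)
  note Qp = inv_probs_probs[OF Q]
  have m: "\<phi> \<in> measurable BM BM" using iter_measurable[of 1] by simp
  have "distr Q BM (\<phi> ^^ Suc k) = distr (distr Q BM (\<phi> ^^ k)) BM \<phi>"
    using iter_measurable m by (subst distr_distr) (auto simp: probs_measurable[OF Qp])
  also have "\<dots> = distr Q BM \<phi>" using Suc by simp
  also have "\<dots> = Q"
  proof (rule measure_eqI)
    fix A assume "A \<in> sets (distr Q BM \<phi>)"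
    then have A: "A \<in> sets BM" by simp
    have "emeasure (distr Q BM \<phi>) A = emeasure Q (\<phi> -` A \<inter> space Q)"
      using A m by (intro emeasure_distr) (auto simp: probs_measurable[OF Qp])
    also have "\<dots> = emeasure Q A" using Q A probs_sets[OF Qp] probs_space[OF Qp] by (auto simp: inv_probs_def)
    finally show "emeasure (distr Q BM \<phi>) A = emeasure Q A" .
  qed (simp add: probs_sets[OF Qp])
  finally show ?case .
qed

lemma inv_probs_integral:
  fixes f :: "'a \<Rightarrow> real"
  assumes Q: "Q \<in> inv_probs M \<phi>" and f: "f \<in> borel_measurable BM"
  shows "(\<integral>x. f ((\<phi> ^^ k) x) \<partial>Q) = (\<integral>x. f x \<partial>Q)"
proof -
  have "(\<integral>x. f x \<partial>distr Q BM (\<phi> ^^ k)) = (\<integral>x. f ((\<phi> ^^ k) x) \<partial>Q)"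
    using iter_measurable f by (intro integral_distr) (auto simp: probs_measurable[OF inv_probs_probs[OF Q]])
  then show ?thesis using inv_probs_distr[OF Q] by simp
qed

lemma inv_probs_measure:
  assumes Q: "Q \<in> inv_probs M \<phi>" and A: "A \<in> sets BM"
  shows "measure Q ((\<phi> ^^ k) -` A \<inter> M) = measure Q A"
proof -
  note Qp = inv_probs_probs[OF Q]
  have "measure (distr Q BM (\<phi> ^^ k)) A = measure Q ((\<phi> ^^ k) -` A \<inter> space Q)"
    using iter_measurable A by (intro measure_distr) (auto simp: probs_measurable[OF Qp])
  then show ?thesis using inv_probs_distr[OF Q] probs_space[OF Qp] by simp
qed

text \<open>The image of \<open>Q\<close> under \<open>\<phi>\<close> is then a probability with the
  same continuous integrals, hence equal to \<open>Q\<close>.\<close>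

lemma inv_probsI:
  assumes Q: "Q \<in> probs M"
    and eq: "\<And>f :: 'a \<Rightarrow> real. continuous_on M f \<Longrightarrow> (\<integral>x. f (\<phi> x) \<partial>Q) = (\<integral>x. f x \<partial>Q)"
  shows "Q \<in> inv_probs M \<phi>"
proof -
  interpret prob_space Q using probs_prob_space[OF Q] .
  have m: "\<phi> \<in> measurable Q BM" using iter_measurable[of 1] by (simp add: probs_measurable[OF Q])
  have "distr Q BM \<phi> \<in> probs M" unfolding probs_def using prob_space_distr[OF m] by simp
  then have "distr Q BM \<phi> = Q"
    using eq by (intro probs_eqI Q) (auto simp: integral_distr[OF m continuous_borel])
  then have "emeasure Q (\<phi> -` A \<inter> M) = emeasure Q A" if "A \<in> sets Q" for A
    using emeasure_distr[OF m, of A] that probs_sets[OF Q] probs_space[OF Q] by simp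
  then show ?thesis using Q by (simp add: inv_probs_def)
qed

lemma inv_probs_birkhoff:
  assumes Q: "Q \<in> inv_probs M \<phi>" and f: "continuous_on M f"
  shows "(\<integral>x. birkhoff \<phi> n f x \<partial>Q) = real n * (\<integral>x. f x \<partial>Q)"
  unfolding birkhoff_def using inv_probs_integral[OF Q continuous_borel[OF f]]
  by (subst Bochner_Integration.integral_sum) (auto intro!: probs_integrable[OF inv_probs_probs[OF Q]] comp_iter_cont f)

text \<open>Epsilon form of asymptotic additivity, free of suprema and limits in the extended reals.
  One continuous \<open>g\<close> per tolerance is what every approximation below consumes.\<close>

definition AA :: "(nat \<Rightarrow> 'a \<Rightarrow> real) \<Rightarrow> bool" where
  "AA G \<longleftrightarrow> (\<forall>n. G n \<in> borel_measurable BM \<and> bounded (G n ` M)) \<and>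
     (\<forall>e>0. \<exists>g. continuous_on M g \<and> (\<forall>\<^sub>F n in sequentially. \<forall>x\<in>M. \<bar>G n x - birkhoff \<phi> n g x\<bar> \<le> e * real n))"

lemma asym_add_AA:
  assumes "asym_add M \<phi> G" shows "AA G"
proof -
  obtain Gk where Gk: "\<And>k. continuous_on M (Gk k)"
    "(\<lambda>k. limsup (\<lambda>n. (SUP x\<in>M. ereal \<bar>G n x - birkhoff \<phi> n (Gk k) x\<bar>) / ereal (real n))) \<longlonglongrightarrow> 0"
    using assms unfolding asym_add_def by auto
  have "\<exists>g. continuous_on M g \<and> (\<forall>\<^sub>F n in sequentially. \<forall>x\<in>M. \<bar>G n x - birkhoff \<phi> n g x\<bar> \<le> e * real n)"
    if e: "0 < e" for e
  proof -
    have "\<forall>\<^sub>F k in sequentially. limsup (\<lambda>n. (SUP x\<in>M. ereal \<bar>G n x - birkhoff \<phi> n (Gk k) x\<bar>) / ereal (real n)) < ereal e"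
      using Gk(2) e by (intro order_tendstoD(2)) auto
    then obtain k where "limsup (\<lambda>n. (SUP x\<in>M. ereal \<bar>G n x - birkhoff \<phi> n (Gk k) x\<bar>) / ereal (real n)) < ereal e"
      by (auto simp: eventually_sequentially)
    then have "\<forall>\<^sub>F n in sequentially. (SUP x\<in>M. ereal \<bar>G n x - birkhoff \<phi> n (Gk k) x\<bar>) / ereal (real n) < ereal e"
      by (rule Limsup_lessD)
    then have "\<forall>\<^sub>F n in sequentially. \<forall>x\<in>M. \<bar>G n x - birkhoff \<phi> n (Gk k) x\<bar> \<le> e * real n"
      using eventually_gt_at_top[of 0]
    proof eventually_elim
      case (elim n)
      show ?case
      proof
        fix x assume x: "x \<in> M"
        have "ereal \<bar>G n x - birkhoff \<phi> n (Gk k) x\<bar> / ereal (real n) \<le> (SUP x\<in>M. ereal \<bar>G n x - birkhoff \<phi> n (Gk k) x\<bar>) / ereal (real n)"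
          using x elim(2) by (intro ereal_divide_right_mono SUP_upper) auto
        also have "\<dots> < ereal e" by (rule elim(1))
        finally show "\<bar>G n x - birkhoff \<phi> n (Gk k) x\<bar> \<le> e * real n"
          using elim(2) by (simp add: field_simps)
      qed
    qed
    then show ?thesis using Gk(1) by blast
  qed
  then show ?thesis using assms unfolding asym_add_def AA_def by blast
qed

lemma AA_measurable: "AA G \<Longrightarrow> G n \<in> borel_measurable BM"
  by (simp add: AA_def)

lemma AA_approx:
  assumes "AA G" "0 < e"
  obtains g where "continuous_on M g" "\<forall>\<^sub>F n in sequentially. \<forall>x\<in>M. \<bar>G n x - birkhoff \<phi> n g x\<bar> \<le> e * real n"
  using assms unfolding AA_def by auto

lemma AA_bounded: assumes "AA G" obtains B where "\<And>x. x \<in> M \<Longrightarrow> \<bar>G n x\<bar> \<le> B"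
proof -
  have "bounded (G n ` M)" using assms by (simp add: AA_def)
  then obtain B where "\<forall>y\<in>G n ` M. norm y \<le> B" unfolding bounded_iff by blast
  then show ?thesis using that[of B] by auto
qed

lemma AA_integrable:
  assumes "AA G" "Q \<in> probs M" shows "integrable Q (G n)"
proof -
  obtain B where "\<And>x. x \<in> M \<Longrightarrow> \<bar>G n x\<bar> \<le> B" using AA_bounded[OF assms(1)] by blast
  then show ?thesis by (rule probs_integrable_bounded[OF assms(2) AA_measurable[OF assms(1)]])
qed

lemma AA_birkhoff: assumes V: "continuous_on M V" shows "AA (\<lambda>n. birkhoff \<phi> n V)"
proof -
  have "bounded (birkhoff \<phi> n V ` M)" for n
    using compact_continuous_image[OF birkhoff_cont[OF V] cpt] by (rule compact_imp_bounded)
  moreover have "\<exists>g. continuous_on M g \<and> (\<forall>\<^sub>F n in sequentially. \<forall>x\<in>M. \<bar>birkhoff \<phi> n V x - birkhoff \<phi> n g x\<bar> \<le> e * real n)"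
    if "0 < e" for e :: real
    using V that by (intro exI[of _ V]) auto
  ultimately show ?thesis unfolding AA_def using continuous_borel[OF birkhoff_cont[OF V]] by auto
qed

lemma birkhoff_lin: "birkhoff \<phi> n (\<lambda>x. a * f x + b * g x) x = a * birkhoff \<phi> n f x + b * birkhoff \<phi> n g x"
  by (simp add: birkhoff_def sum.distrib sum_distrib_left)

lemma AA_lin:
  assumes G: "AA G" and H: "AA H"
  shows "AA (\<lambda>n x. a * G n x + b * H n x)"
proof -
  have "(\<lambda>x. a * G n x + b * H n x) \<in> borel_measurable BM" for n
    using AA_measurable[OF G] AA_measurable[OF H] by simp
  moreover have "bounded ((\<lambda>x. a * G n x + b * H n x) ` M)" for n
  proof -
    obtain B where B: "\<And>x. x \<in> M \<Longrightarrow> \<bar>G n x\<bar> \<le> B" using AA_bounded[OF G] by blast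
    obtain C where C: "\<And>x. x \<in> M \<Longrightarrow> \<bar>H n x\<bar> \<le> C" using AA_bounded[OF H] by blast
    have "\<bar>a * G n x + b * H n x\<bar> \<le> \<bar>a\<bar> * B + \<bar>b\<bar> * C" if "x \<in> M" for x
    proof -
      have "\<bar>a * G n x + b * H n x\<bar> \<le> \<bar>a\<bar> * \<bar>G n x\<bar> + \<bar>b\<bar> * \<bar>H n x\<bar>" by (metis abs_mult abs_triangle_ineq)
      also have "\<dots> \<le> \<bar>a\<bar> * B + \<bar>b\<bar> * C" using B[OF that] C[OF that] by (intro add_mono mult_left_mono) auto
      finally show ?thesis .
    qed
    then show ?thesis unfolding bounded_iff by auto
  qed
  moreover have "\<exists>g. continuous_on M g \<and> (\<forall>\<^sub>F n in sequentially. \<forall>x\<in>M. \<bar>(a * G n x + b * H n x) - birkhoff \<phi> n g x\<bar> \<le> e * real n)"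
    if e: "0 < e" for e :: real
  proof -
    define c where "c = e / (\<bar>a\<bar> + \<bar>b\<bar> + 1)"
    have c: "0 < c" using e by (simp add: c_def)
    have ce: "(\<bar>a\<bar> + \<bar>b\<bar>) * c \<le> e" unfolding c_def using e by (simp add: field_simps)
    obtain g where g: "continuous_on M g" "\<forall>\<^sub>F n in sequentially. \<forall>x\<in>M. \<bar>G n x - birkhoff \<phi> n g x\<bar> \<le> c * real n"
      using AA_approx[OF G c] by blast
    obtain h where h: "continuous_on M h" "\<forall>\<^sub>F n in sequentially. \<forall>x\<in>M. \<bar>H n x - birkhoff \<phi> n h x\<bar> \<le> c * real n"
      using AA_approx[OF H c] by blast
    have "\<forall>\<^sub>F n in sequentially. \<forall>x\<in>M. \<bar>(a * G n x + b * H n x) - birkhoff \<phi> n (\<lambda>x. a * g x + b * h x) x\<bar> \<le> e * real n"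
      using g(2) h(2)
    proof eventually_elim
      case (elim n)
      show ?case
      proof
        fix x assume x: "x \<in> M"
        have "(a * G n x + b * H n x) - birkhoff \<phi> n (\<lambda>x. a * g x + b * h x) x
           = a * (G n x - birkhoff \<phi> n g x) + b * (H n x - birkhoff \<phi> n h x)" by (simp add: birkhoff_lin algebra_simps)
        also have "\<bar>\<dots>\<bar> \<le> \<bar>a\<bar> * \<bar>G n x - birkhoff \<phi> n g x\<bar> + \<bar>b\<bar> * \<bar>H n x - birkhoff \<phi> n h x\<bar>"
          by (metis abs_mult abs_triangle_ineq)
        also have "\<dots> \<le> \<bar>a\<bar> * (c * real n) + \<bar>b\<bar> * (c * real n)"
          using elim x by (intro add_mono mult_left_mono) auto
        also have "\<dots> = ((\<bar>a\<bar> + \<bar>b\<bar>) * c) * real n" by (simp add: algebra_simps)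
        also have "\<dots> \<le> e * real n" using ce by (intro mult_right_mono) auto
        finally show "\<bar>(a * G n x + b * H n x) - birkhoff \<phi> n (\<lambda>x. a * g x + b * h x) x\<bar> \<le> e * real n" .
      qed
    qed
    moreover have "continuous_on M (\<lambda>x. a * g x + b * h x)" using g(1) h(1) by (intro continuous_intros)
    ultimately show ?thesis by blast
  qed
  ultimately show ?thesis unfolding AA_def by blast
qed

lemma AA_linear_bound:
  assumes G: "AA G"
  obtains B where "0 < B" "\<forall>\<^sub>F n in sequentially. \<forall>x\<in>M. \<bar>G n x\<bar> \<le> B * real n"
proof -
  obtain g where g: "continuous_on M g" "\<forall>\<^sub>F n in sequentially. \<forall>x\<in>M. \<bar>G n x - birkhoff \<phi> n g x\<bar> \<le> 1 * real n"
    using AA_approx[OF G zero_less_one] by blast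
  obtain B where B: "0 < B" "\<And>x. x \<in> M \<Longrightarrow> \<bar>g x\<bar> \<le> B" by (rule continuous_bound[OF g(1)]) blast
  have "\<forall>\<^sub>F n in sequentially. \<forall>x\<in>M. \<bar>G n x\<bar> \<le> (B + 1) * real n"
    using g(2)
  proof eventually_elim
    case (elim n)
    show ?case
    proof
      fix x assume x: "x \<in> M"
      have "\<bar>birkhoff \<phi> n g x\<bar> \<le> real n * B" by (rule birkhoff_abs_le[OF B(2) x])
      then show "\<bar>G n x\<bar> \<le> (B + 1) * real n" using elim[rule_format, OF x] by (simp add: algebra_simps)
    qed
  qed
  then show ?thesis using B(1) by (intro that[of "B + 1"]) auto
qed

lemma AA_integral_close:
  assumes G: "AA G" and Q: "Q \<in> inv_probs M \<phi>" and g: "continuous_on M g"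
    and ev: "\<forall>\<^sub>F n in sequentially. \<forall>x\<in>M. \<bar>G n x - birkhoff \<phi> n g x\<bar> \<le> e * real n"
  shows "\<forall>\<^sub>F n in sequentially. \<bar>(\<integral>x. G n x \<partial>Q) / real n - (\<integral>x. g x \<partial>Q)\<bar> \<le> e"
  using ev eventually_gt_at_top[of 0]
proof eventually_elim
  case (elim n)
  note Qp = inv_probs_probs[OF Q]
  have "(\<integral>x. G n x \<partial>Q) - real n * (\<integral>x. g x \<partial>Q) = (\<integral>x. G n x - birkhoff \<phi> n g x \<partial>Q)"
    using AA_integrable[OF G Qp] probs_integrable[OF Qp birkhoff_cont[OF g]]
    by (subst Bochner_Integration.integral_diff) (auto simp: inv_probs_birkhoff[OF Q g])
  also have "\<bar>\<dots>\<bar> \<le> e * real n"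
    using elim AA_measurable[OF G] continuous_borel[OF birkhoff_cont[OF g]] by (intro probs_integral_abs_le[OF Qp]) auto
  finally have "\<bar>(\<integral>x. G n x \<partial>Q) - real n * (\<integral>x. g x \<partial>Q)\<bar> / real n \<le> e" using elim(2) by (simp add: field_simps)
  moreover have "(\<integral>x. G n x \<partial>Q) / real n - (\<integral>x. g x \<partial>Q) = ((\<integral>x. G n x \<partial>Q) - real n * (\<integral>x. g x \<partial>Q)) / real n"
    using elim(2) by (simp add: field_simps)
  ultimately show ?case by simp
qed

text \<open>For each tolerance one continuous \<open>g\<close> pins all late terms near the same
  number, its integral; so the sequence is Cauchy.\<close>

lemma seq_functional_tendsto:
  assumes G: "AA G" and Q: "Q \<in> inv_probs M \<phi>"
  shows "(\<lambda>n. (\<integral>x. G n x \<partial>Q) / real n) \<longlonglongrightarrow> seq_functional G Q"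
proof -
  have "Cauchy (\<lambda>n. (\<integral>x. G n x \<partial>Q) / real n)"
  proof (rule metric_CauchyI)
    fix r :: real assume r: "0 < r"
    then have r3: "0 < r / 3" by simp
    obtain g where g: "continuous_on M g" "\<forall>\<^sub>F n in sequentially. \<forall>x\<in>M. \<bar>G n x - birkhoff \<phi> n g x\<bar> \<le> r / 3 * real n"
      using AA_approx[OF G r3] by blast
    obtain N where N: "\<And>n. n \<ge> N \<Longrightarrow> \<bar>(\<integral>x. G n x \<partial>Q) / real n - (\<integral>x. g x \<partial>Q)\<bar> \<le> r / 3"
      using AA_integral_close[OF G Q g] by (auto simp: eventually_sequentially)
    have "dist ((\<integral>x. G m x \<partial>Q) / real m) ((\<integral>x. G n x \<partial>Q) / real n) < r" if "m \<ge> N" "n \<ge> N" for m n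
      using N[OF that(1)] N[OF that(2)] r unfolding dist_real_def by linarith
    then show "\<exists>N. \<forall>m\<ge>N. \<forall>n\<ge>N. dist ((\<integral>x. G m x \<partial>Q) / real m) ((\<integral>x. G n x \<partial>Q) / real n) < r" by blast
  qed
  then have "convergent (\<lambda>n. (\<integral>x. G n x \<partial>Q) / real n)" by (rule Cauchy_convergent)
  then show ?thesis unfolding seq_functional_def by (simp add: convergent_LIMSEQ_iff)
qed

lemma seq_functional_close:
  assumes G: "AA G" and Q: "Q \<in> inv_probs M \<phi>" and g: "continuous_on M g"
    and ev: "\<forall>\<^sub>F n in sequentially. \<forall>x\<in>M. \<bar>G n x - birkhoff \<phi> n g x\<bar> \<le> e * real n"
  shows "\<bar>seq_functional G Q - (\<integral>x. g x \<partial>Q)\<bar> \<le> e"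
proof -
  have "(\<lambda>n. \<bar>(\<integral>x. G n x \<partial>Q) / real n - (\<integral>x. g x \<partial>Q)\<bar>) \<longlonglongrightarrow> \<bar>seq_functional G Q - (\<integral>x. g x \<partial>Q)\<bar>"
    using seq_functional_tendsto[OF G Q] by (intro tendsto_intros)
  then show ?thesis by (rule tendsto_upperbound[OF _ AA_integral_close[OF G Q g ev]]) simp
qed

lemma seq_functional_lin:
  assumes G: "AA G" and H: "AA H" and Q: "Q \<in> inv_probs M \<phi>"
  shows "seq_functional (\<lambda>n x. a * G n x + b * H n x) Q = a * seq_functional G Q + b * seq_functional H Q"
proof -
  have "(\<integral>x. a * G n x + b * H n x \<partial>Q) / real n = a * ((\<integral>x. G n x \<partial>Q) / real n) + b * ((\<integral>x. H n x \<partial>Q) / real n)" for n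
    using AA_integrable[OF G inv_probs_probs[OF Q]] AA_integrable[OF H inv_probs_probs[OF Q]]
    by (simp add: add_divide_distrib)
  moreover have "(\<lambda>n. a * ((\<integral>x. G n x \<partial>Q) / real n) + b * ((\<integral>x. H n x \<partial>Q) / real n))
     \<longlonglongrightarrow> a * seq_functional G Q + b * seq_functional H Q"
    using seq_functional_tendsto[OF G Q] seq_functional_tendsto[OF H Q] by (intro tendsto_intros)
  ultimately show ?thesis using seq_functional_tendsto[OF AA_lin[OF G H] Q, of a b]
    by (intro LIMSEQ_unique[of "\<lambda>n. (\<integral>x. a * G n x + b * H n x \<partial>Q) / real n"]) auto
qed

lemma seq_functional_birkhoff:
  assumes V: "continuous_on M V" and Q: "Q \<in> inv_probs M \<phi>"
  shows "seq_functional (\<lambda>n. birkhoff \<phi> n V) Q = (\<integral>x. V x \<partial>Q)"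
  using seq_functional_close[OF AA_birkhoff[OF V] Q V, of 0] by simp

text \<open>The approximation by integrals of \<open>g\<close> is uniform over the invariant
  measures, so weak continuity is inherited from \<open>g\<close>.\<close>

lemma seq_functional_wconv:
  assumes G: "AA G" and X: "\<And>n. X n \<in> inv_probs M \<phi>" and Q: "Q \<in> inv_probs M \<phi>" and w: "wconv X Q"
  shows "(\<lambda>n. seq_functional G (X n)) \<longlonglongrightarrow> seq_functional G Q"
proof (rule LIMSEQ_I)
  fix r :: real assume r: "0 < r"
  then have r3: "0 < r / 3" by simp
  obtain g where g: "continuous_on M g" "\<forall>\<^sub>F n in sequentially. \<forall>x\<in>M. \<bar>G n x - birkhoff \<phi> n g x\<bar> \<le> r / 3 * real n"
    using AA_approx[OF G r3] by blast
  have "(\<lambda>n. \<integral>x. g x \<partial>X n) \<longlonglongrightarrow> (\<integral>x. g x \<partial>Q)" using w g(1) by (simp add: wconv_def)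
  then obtain N where N: "\<And>n. n \<ge> N \<Longrightarrow> norm ((\<integral>x. g x \<partial>X n) - (\<integral>x. g x \<partial>Q)) < r / 3" using r3 LIMSEQ_D by blast
  have "norm (seq_functional G (X n) - seq_functional G Q) < r" if "n \<ge> N" for n
    using N[OF that] seq_functional_close[OF G X[of n] g] seq_functional_close[OF G Q g] unfolding real_norm_def
    by linarith
  then show "\<exists>N. \<forall>n\<ge>N. norm (seq_functional G (X n) - seq_functional G Q) < r" by blast
qed

lemma wconv_inv_closed:
  assumes X: "\<And>n. X n \<in> inv_probs M \<phi>" and Q: "Q \<in> probs M" and w: "wconv X Q"
  shows "Q \<in> inv_probs M \<phi>"
proof (rule inv_probsI[OF Q])
  fix f :: "'a \<Rightarrow> real" assume f: "continuous_on M f"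
  have f1: "continuous_on M (\<lambda>x. f (\<phi> x))" using comp_iter_cont[OF f, of 1] by simp
  have "(\<integral>x. f (\<phi> x) \<partial>X n) = (\<integral>x. f x \<partial>X n)" for n
    using inv_probs_integral[OF X continuous_borel[OF f], of n 1] by simp
  then show "(\<integral>x. f (\<phi> x) \<partial>Q) = (\<integral>x. f x \<partial>Q)"
    using w f f1 unfolding wconv_def by (intro LIMSEQ_unique[of "\<lambda>n. \<integral>x. f (\<phi> x) \<partial>X n"]) auto
qed

section \<open>Separated and spanning sets for the dynamical metrics\<close>

lemma iter_equicontinuous:
  assumes e: "0 < (e::real)"
  shows "\<exists>d>0. \<forall>x\<in>M. \<forall>y\<in>M. dist x y < d \<longrightarrow> (\<forall>k<n. dist ((\<phi> ^^ k) x) ((\<phi> ^^ k) y) < e)"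
proof (induction n)
  case 0 show ?case by (intro exI[of _ 1]) auto
next
  case (Suc n)
  then obtain d where d: "d > 0" "\<forall>x\<in>M. \<forall>y\<in>M. dist x y < d \<longrightarrow> (\<forall>k<n. dist ((\<phi> ^^ k) x) ((\<phi> ^^ k) y) < e)" by blast
  have "uniformly_continuous_on M (\<phi> ^^ n)" using iter_cont cpt by (rule compact_uniformly_continuous)
  then obtain d' where d': "d' > 0" "\<forall>x\<in>M. \<forall>y\<in>M. dist y x < d' \<longrightarrow> dist ((\<phi> ^^ n) y) ((\<phi> ^^ n) x) < e"
    unfolding uniformly_continuous_on_def using e by blast
  show ?case using d d' by (intro exI[of _ "min d d'"]) (auto simp: less_Suc_eq)
qed

text \<open>A net at the scale of equicontinuity bounds the size of separated sets, so a largest one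
  exists; since it cannot grow, it spans \<open>Y\<close>. The centres lie in \<open>Y\<close>
  itself, which matters when \<open>Y\<close> is the eventual range.\<close>

lemma max_separated:
  assumes Y: "Y \<subseteq> M" and e: "0 < (e::real)"
  obtains E where "finite E" "E \<subseteq> Y"
    "\<And>x y. x \<in> E \<Longrightarrow> y \<in> E \<Longrightarrow> x \<noteq> y \<Longrightarrow> \<exists>k<n. e \<le> dist ((\<phi> ^^ k) x) ((\<phi> ^^ k) y)"
    "\<And>y. y \<in> Y \<Longrightarrow> \<exists>x\<in>E. \<forall>k<n. dist ((\<phi> ^^ k) y) ((\<phi> ^^ k) x) < e"
proof -
  obtain d where d: "d > 0" "\<forall>x\<in>M. \<forall>y\<in>M. dist x y < d \<longrightarrow> (\<forall>k<n. dist ((\<phi> ^^ k) x) ((\<phi> ^^ k) y) < e)"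
    using iter_equicontinuous[OF e] by blast
  have d2: "0 < d / 2" using d by simp
  obtain F where F: "finite F" "F \<subseteq> M" "\<And>x. x \<in> M \<Longrightarrow> \<exists>p\<in>F. dist x p < d / 2" using finite_net[OF d2] by blast
  define sep where "sep E \<longleftrightarrow> finite E \<and> E \<subseteq> Y \<and> (\<forall>x\<in>E. \<forall>y\<in>E. x \<noteq> y \<longrightarrow> (\<exists>k<n. e \<le> dist ((\<phi> ^^ k) x) ((\<phi> ^^ k) y)))" for E
  have card: "card E \<le> card F" if E: "sep E" for E
  proof -
    obtain q where q: "\<And>x. x \<in> M \<Longrightarrow> q x \<in> F" "\<And>x. x \<in> M \<Longrightarrow> dist x (q x) < d / 2" using F(3) by metis
    have "inj_on q E"
    proof (rule inj_onI, rule ccontr)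
      fix x y assume xy: "x \<in> E" "y \<in> E" "q x = q y" "x \<noteq> y"
      then have M: "x \<in> M" "y \<in> M" using E Y by (auto simp: sep_def)
      have "dist x y < d" using q(2)[OF M(1)] q(2)[OF M(2)] xy(3) dist_triangle2[of x y "q x"] by simp
      then have "\<forall>k<n. dist ((\<phi> ^^ k) x) ((\<phi> ^^ k) y) < e" using d(2) M by simp
      moreover obtain k where "k < n" "e \<le> dist ((\<phi> ^^ k) x) ((\<phi> ^^ k) y)" using E xy unfolding sep_def by blast
      ultimately show False using leD by blast
    qed
    moreover have "q ` E \<subseteq> F" using q(1) E Y by (auto simp: sep_def)
    ultimately show ?thesis using F(1) by (intro card_inj_on_le)
  qed
  have "sep {}" by (simp add: sep_def)
  then obtain E where E: "sep E" "\<And>E'. sep E' \<Longrightarrow> card E' \<le> card E"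
    using ex_has_greatest_nat[of sep "{}" card "card F"] card by fastforce
  show ?thesis
  proof (rule that[of E])
    show "finite E" "E \<subseteq> Y" using E(1) by (auto simp: sep_def)
    show "\<exists>k<n. e \<le> dist ((\<phi> ^^ k) x) ((\<phi> ^^ k) y)" if "x \<in> E" "y \<in> E" "x \<noteq> y" for x y
      using E(1) that by (simp add: sep_def)
    show "\<exists>x\<in>E. \<forall>k<n. dist ((\<phi> ^^ k) y) ((\<phi> ^^ k) x) < e" if y: "y \<in> Y" for y
    proof (rule ccontr)
      assume neg: "\<not> ?thesis"
      then have no: "\<exists>k<n. e \<le> dist ((\<phi> ^^ k) y) ((\<phi> ^^ k) x)" if "x \<in> E" for x using that by (auto simp: not_less)
      have "y \<notin> E" using neg e by force
      moreover have "sep (insert y E)"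
        using E(1) y no unfolding sep_def by (auto simp: dist_commute)
      ultimately show False using E(2)[of "insert y E"] E(1) by (simp add: sep_def)
    qed
  qed
qed

end

subsection \<open>Topological pressure\<close>

context dyn_system
begin

definition covers :: "'a set \<Rightarrow> nat \<Rightarrow> real \<Rightarrow> bool" where
  "covers E n e \<longleftrightarrow> finite E \<and> E \<subseteq> M \<and> M \<subseteq> (\<Union>x\<in>E. bowen M \<phi> n x e)"

lemma covers_separated:
  assumes e: "0 < e"
  obtains E where "covers E n e"
    "\<And>x y. x \<in> E \<Longrightarrow> y \<in> E \<Longrightarrow> x \<noteq> y \<Longrightarrow> \<exists>k<n. e \<le> dist ((\<phi> ^^ k) x) ((\<phi> ^^ k) y)"
proof -
  obtain E where E: "finite E" "E \<subseteq> M"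
    "\<And>x y. x \<in> E \<Longrightarrow> y \<in> E \<Longrightarrow> x \<noteq> y \<Longrightarrow> \<exists>k<n. e \<le> dist ((\<phi> ^^ k) x) ((\<phi> ^^ k) y)"
    "\<And>y. y \<in> M \<Longrightarrow> \<exists>x\<in>E. \<forall>k<n. dist ((\<phi> ^^ k) y) ((\<phi> ^^ k) x) < e"
    by (rule max_separated[OF order_refl e, of n]) blast
  have "covers E n e" unfolding covers_def bowen_def using E(1,2,4) by auto
  then show ?thesis using that E(3) by blast
qed

lemma cover_sum_eq: "cover_sum M \<phi> G n e = Inf ((\<lambda>E. \<Sum>x\<in>E. exp (G n x)) ` {E. covers E n e})"
  unfolding cover_sum_def covers_def by (rule arg_cong[where f=Inf]) auto

lemma cover_sum_le: "covers E n e \<Longrightarrow> cover_sum M \<phi> G n e \<le> (\<Sum>x\<in>E. exp (G n x))"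
  unfolding cover_sum_eq by (rule cInf_lower) (auto intro!: bdd_belowI[of _ 0] sum_nonneg)

lemma cover_sum_greatest:
  assumes e: "0 < e" and "\<And>E. covers E n e \<Longrightarrow> c \<le> (\<Sum>x\<in>E. exp (G n x))"
  shows "c \<le> cover_sum M \<phi> G n e"
proof -
  obtain E0 where "covers E0 n e" by (rule covers_separated[OF e]) blast
  then show ?thesis unfolding cover_sum_eq using assms(2) by (intro cInf_greatest) auto
qed

lemma cover_sum_diff:
  assumes e: "0 < e" and le: "\<And>x. x \<in> M \<Longrightarrow> G n x \<le> H n x + c"
  shows "cover_sum M \<phi> G n e \<le> exp c * cover_sum M \<phi> H n e"
proof -
  have "cover_sum M \<phi> G n e / exp c \<le> cover_sum M \<phi> H n e"
  proof (rule cover_sum_greatest[OF e])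
    fix E assume E: "covers E n e"
    have "cover_sum M \<phi> G n e \<le> (\<Sum>x\<in>E. exp (G n x))" by (rule cover_sum_le[OF E])
    also have "\<dots> \<le> (\<Sum>x\<in>E. exp c * exp (H n x))"
    proof (rule sum_mono)
      fix x assume "x \<in> E"
      then have "G n x \<le> c + H n x" using le[of x] E by (auto simp: covers_def)
      then show "exp (G n x) \<le> exp c * exp (H n x)" by (simp add: exp_add[symmetric])
    qed
    also have "\<dots> = exp c * (\<Sum>x\<in>E. exp (H n x))" by (simp add: sum_distrib_left)
    finally show "cover_sum M \<phi> G n e / exp c \<le> (\<Sum>x\<in>E. exp (H n x))" by (simp add: field_simps)
  qed
  then show ?thesis by (simp add: field_simps)
qed

lemma cover_sum_ge:
  assumes e: "0 < e" and ne: "M \<noteq> {}" and B: "\<And>x. x \<in> M \<Longrightarrow> B \<le> G n x"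
  shows "exp B \<le> cover_sum M \<phi> G n e"
proof (rule cover_sum_greatest[OF e])
  fix E assume E: "covers E n e"
  then obtain x where x: "x \<in> E" using ne by (auto simp: covers_def)
  have "exp B \<le> exp (G n x)" using B[of x] x E by (auto simp: covers_def)
  also have "\<dots> \<le> (\<Sum>x\<in>E. exp (G n x))" using x E by (intro member_le_sum) (auto simp: covers_def)
  finally show "exp B \<le> (\<Sum>x\<in>E. exp (G n x))" .
qed

lemma cover_sum_pos:
  assumes "0 < e" "M \<noteq> {}" "AA G"
  shows "0 < cover_sum M \<phi> G n e"
proof -
  obtain B where B: "\<And>x. x \<in> M \<Longrightarrow> \<bar>G n x\<bar> \<le> B" using AA_bounded[OF assms(3)] by blast
  have "exp (- B) \<le> cover_sum M \<phi> G n e" using B by (intro cover_sum_ge assms) (auto simp: abs_le_iff minus_le_iff)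
  then show ?thesis using exp_gt_zero less_le_trans by blast
qed

lemma cover_sum_antimono:
  assumes "0 < e" "e \<le> e'"
  shows "cover_sum M \<phi> G n e' \<le> cover_sum M \<phi> G n e"
proof (rule cover_sum_greatest[OF assms(1)])
  fix E assume "covers E n e"
  moreover have "bowen M \<phi> n x e \<subseteq> bowen M \<phi> n x e'" for x using assms(2) by (force simp: bowen_def)
  ultimately have "covers E n e'" unfolding covers_def by blast
  then show "cover_sum M \<phi> G n e' \<le> (\<Sum>x\<in>E. exp (G n x))" by (rule cover_sum_le)
qed

definition press :: "(nat \<Rightarrow> 'a \<Rightarrow> real) \<Rightarrow> real \<Rightarrow> ereal" where
  "press G e = limsup (\<lambda>n. ereal (ln (cover_sum M \<phi> G n e) / real n))"

text \<open>A smaller radius admits fewer covers, so the cover sums grow as the radius shrinks and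
  the limit at 0 is a supremum.\<close>

lemma pressure_ereal_SUP:
  assumes ne: "M \<noteq> {}" and G: "AA G"
  shows "pressure_ereal M \<phi> G = (SUP e\<in>{0<..}. press G e)"
proof -
  have anti: "press G e' \<le> press G e" if "0 < e" "e \<le> e'" for e e'
    unfolding press_def
  proof (intro Limsup_mono always_eventually allI)
    fix n
    have "ln (cover_sum M \<phi> G n e') \<le> ln (cover_sum M \<phi> G n e)"
      using cover_sum_antimono[OF that] cover_sum_pos[OF _ ne G] that by (intro ln_mono) auto
    then show "ereal (ln (cover_sum M \<phi> G n e') / real n) \<le> ereal (ln (cover_sum M \<phi> G n e) / real n)"
      by (simp add: divide_right_mono)
  qed
  have "(press G \<longlongrightarrow> (SUP e\<in>{0<..}. press G e)) (at_right 0)"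
  proof (rule order_tendstoI)
    fix a assume "a < (SUP e\<in>{0<..}. press G e)"
    then obtain e where e: "0 < e" "a < press G e" by (auto simp: less_SUP_iff)
    have "\<forall>\<^sub>F x in at_right 0. 0 < x \<and> x < e"
      using e(1) by (simp add: eventually_at_right_less eventually_conj_iff eventually_at_right_field, auto)
    then show "\<forall>\<^sub>F x in at_right 0. a < press G x"
      by eventually_elim (use anti e(2) in \<open>auto intro: less_le_trans\<close>)
  next
    fix a assume a: "(SUP e\<in>{0<..}. press G e) < a"
    have "\<forall>\<^sub>F x in at_right (0::real). 0 < x" by (rule eventually_at_right_less)
    then show "\<forall>\<^sub>F x in at_right 0. press G x < a"
      by eventually_elim (rule le_less_trans[OF SUP_upper a], simp)
  qed
  then show ?thesis unfolding pressure_ereal_def press_def by (intro tendsto_Lim) auto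
qed

lemma pressure_ereal_diff:
  assumes ne: "M \<noteq> {}" and G: "AA G" and H: "AA H"
    and le: "\<forall>\<^sub>F n in sequentially. \<forall>x\<in>M. G n x \<le> H n x + c * real n"
  shows "pressure_ereal M \<phi> G \<le> pressure_ereal M \<phi> H + ereal c"
proof -
  have "press G e \<le> pressure_ereal M \<phi> H + ereal c" if e: "0 < e" for e
  proof -
    have "\<forall>\<^sub>F n in sequentially. ereal (ln (cover_sum M \<phi> G n e) / real n) \<le> ereal (ln (cover_sum M \<phi> H n e) / real n) + ereal c"
      using le eventually_gt_at_top[of 0]
    proof eventually_elim
      case (elim n)
      have "cover_sum M \<phi> G n e \<le> exp (c * real n) * cover_sum M \<phi> H n e"
        using elim by (intro cover_sum_diff e) auto
      then have "ln (cover_sum M \<phi> G n e) \<le> ln (exp (c * real n) * cover_sum M \<phi> H n e)"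
        using cover_sum_pos[OF e ne] G H by (intro ln_mono) auto
      also have "\<dots> = c * real n + ln (cover_sum M \<phi> H n e)"
        using cover_sum_pos[OF e ne H, of n] by (subst ln_mult_pos) auto
      finally have "ln (cover_sum M \<phi> G n e) / real n \<le> (c * real n + ln (cover_sum M \<phi> H n e)) / real n"
        by (rule divide_right_mono) simp
      also have "\<dots> = ln (cover_sum M \<phi> H n e) / real n + c" using elim(2) by (simp add: add_divide_distrib)
      finally show ?case by simp
    qed
    then have "press G e \<le> limsup (\<lambda>n. ereal (ln (cover_sum M \<phi> H n e) / real n) + ereal c)"
      unfolding press_def by (rule Limsup_mono)
    also have "\<dots> = press H e + ereal c" unfolding press_def by (rule Limsup_add_ereal_right) auto
    also have "\<dots> \<le> pressure_ereal M \<phi> H + ereal c"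
      unfolding pressure_ereal_SUP[OF ne H] using e by (intro add_right_mono SUP_upper) auto
    finally show ?thesis .
  qed
  then show ?thesis unfolding pressure_ereal_SUP[OF ne G] by (intro SUP_least) auto
qed

lemma AA_zero: "AA (\<lambda>n x. 0)"
  using AA_birkhoff[of "\<lambda>_. 0"] by (simp add: birkhoff_def[abs_def])

text \<open>Comparison with the zero potential: up to the linear bound \<open>B * real n\<close> the
  pressure is the topological entropy, which is nonnegative because cover sums of the zero potential
  on a nonempty space are at least 1.\<close>

lemma pressure_finite:
  assumes ne: "M \<noteq> {}" and top: "htop M \<phi> < \<infinity>" and G: "AA G"
  shows "pressure_ereal M \<phi> G = ereal (pressure M \<phi> G)"
proof -
  obtain B where B: "0 < B" "\<forall>\<^sub>F n in sequentially. \<forall>x\<in>M. \<bar>G n x\<bar> \<le> B * real n"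
    by (rule AA_linear_bound[OF G]) blast
  have "\<forall>\<^sub>F n in sequentially. \<forall>x\<in>M. G n x \<le> 0 + B * real n" using B(2) by eventually_elim (auto simp: abs_le_iff)
  then have up: "pressure_ereal M \<phi> G \<le> htop M \<phi> + ereal B"
    unfolding htop_def by (intro pressure_ereal_diff ne G AA_zero)
  have "\<forall>\<^sub>F n in sequentially. \<forall>x\<in>M. 0 \<le> G n x + B * real n" using B(2)
    by eventually_elim (auto simp: abs_le_iff algebra_simps)
  then have lo: "htop M \<phi> \<le> pressure_ereal M \<phi> G + ereal B"
    unfolding htop_def by (intro pressure_ereal_diff ne G AA_zero)
  have "press (\<lambda>n x. 0) 1 \<ge> 0"
    unfolding press_def
  proof (rule le_Limsup)
    have "0 \<le> ln (cover_sum M \<phi> (\<lambda>n x. 0) n 1)" for n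
      using cover_sum_ge[OF zero_less_one ne, of 0 "\<lambda>n x. 0" n] by simp
    then show "\<forall>\<^sub>F n in sequentially. 0 \<le> ereal (ln (cover_sum M \<phi> (\<lambda>n x. 0) n 1) / real n)" by simp
  qed simp
  also have "press (\<lambda>n x. 0) 1 \<le> htop M \<phi>"
    unfolding htop_def pressure_ereal_SUP[OF ne AA_zero] by (intro SUP_upper) auto
  finally have "0 \<le> htop M \<phi>" .
  then have "\<bar>pressure_ereal M \<phi> G\<bar> \<noteq> \<infinity>" using up lo top by (cases "pressure_ereal M \<phi> G"; cases "htop M \<phi>") auto
  then show ?thesis unfolding pressure_def by (simp add: ereal_real)
qed

lemma pressure_diff:
  assumes ne: "M \<noteq> {}" and top: "htop M \<phi> < \<infinity>" and G: "AA G" and H: "AA H"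
    and le: "\<forall>\<^sub>F n in sequentially. \<forall>x\<in>M. G n x \<le> H n x + c * real n"
  shows "pressure M \<phi> G \<le> pressure M \<phi> H + c"
  using pressure_ereal_diff[OF ne G H le] pressure_finite[OF ne top G] pressure_finite[OF ne top H] by simp

subsection \<open>Partitions and Kolmogorov-Sinai entropy\<close>

definition cell :: "'a set set \<Rightarrow> 'a \<Rightarrow> 'a set" where
  "cell \<xi> x = (THE A. A \<in> \<xi> \<and> x \<in> A)"

text \<open>Itinerary of \<open>x\<close> under the coding \<open>f\<close>; its fibres are the
  atoms of the join of the first \<open>n\<close> preimages of the partition by
  \<open>f\<close>.\<close>

definition word :: "('a \<Rightarrow> 'b) \<Rightarrow> nat \<Rightarrow> 'a \<Rightarrow> 'b list" where
  "word f n x = map (\<lambda>k. f ((\<phi> ^^ k) x)) [0..<n]"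

lemma cell_eq:
  assumes "disjoint \<xi>" "A \<in> \<xi>" "x \<in> A" shows "cell \<xi> x = A"
  unfolding cell_def using assms by (intro the_equality) (auto simp: disjoint_def)

lemma cell_in:
  assumes "disjoint \<xi>" "x \<in> \<Union>\<xi>" shows "cell \<xi> x \<in> \<xi>" "x \<in> cell \<xi> x"
  using assms cell_eq by blast+

lemma probs_simple_function: "Q \<in> probs M \<Longrightarrow> simple_function Q f = simple_function BM f"
  by (rule simple_function_cong_algebra) (auto simp: probs_sets probs_space)

lemma simple_function_cell:
  assumes Q: "Q \<in> probs M" and xi: "finite_partition Q \<xi>"
  shows "simple_function BM (cell \<xi>)"
proof -
  have xi': "finite \<xi>" "\<xi> \<subseteq> sets BM" "disjoint \<xi>" "\<Union>\<xi> = M"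
    using xi probs_sets[OF Q] probs_space[OF Q] by (auto simp: finite_partition_def)
  have "cell \<xi> -` {A} \<inter> M \<in> sets BM" if "A \<in> cell \<xi> ` M" for A
  proof -
    have A: "A \<in> \<xi>" using that cell_in[OF xi'(3)] xi'(4) by auto
    have "x \<in> cell \<xi> -` {A} \<inter> M \<longleftrightarrow> x \<in> A" for x
      using cell_eq[OF xi'(3) A, of x] cell_in(2)[OF xi'(3), of x] xi'(4) A by auto
    then have "cell \<xi> -` {A} \<inter> M = A" by blast
    then show ?thesis using A xi'(2) by auto
  qed
  moreover have "cell \<xi> ` M \<subseteq> \<xi>" using cell_in[OF xi'(3)] xi'(4) by auto
  ultimately show ?thesis unfolding simple_function_def using finite_subset[OF _ xi'(1)] by auto
qed

lemma simple_function_iter: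
  assumes f: "simple_function BM f" shows "simple_function BM (\<lambda>x. f ((\<phi> ^^ k) x))"
  unfolding simple_function_def space_BM
proof (intro conjI ballI)
  have "(\<lambda>x. f ((\<phi> ^^ k) x)) ` M \<subseteq> f ` M" using iter_in by auto
  then show "finite ((\<lambda>x. f ((\<phi> ^^ k) x)) ` M)" using f finite_subset by (auto simp: simple_function_def)
  fix v
  have "(\<lambda>x. f ((\<phi> ^^ k) x)) -` {v} \<inter> M = (\<phi> ^^ k) -` (f -` {v} \<inter> M) \<inter> M" using iter_in by auto
  then show "(\<lambda>x. f ((\<phi> ^^ k) x)) -` {v} \<inter> M \<in> sets BM"
    using measurable_sets[OF iter_measurable, of "f -` {v} \<inter> M" k] simple_functionD(2)[OF f, of "{v}"] by simp
qed

lemma simple_function_word: "simple_function BM f \<Longrightarrow> simple_function BM (word f n)"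
  unfolding word_def by (intro simple_function_map simple_function_iter)

text \<open>The members of the join are the fibres of the itinerary map, except that the empty set
  may occur as well; it contributes nothing to the entropy.\<close>

lemma part_entropy_join:
  assumes Q: "Q \<in> probs M" and xi: "finite_partition Q \<xi>"
  shows "part_entropy Q (join_part M \<phi> n \<xi>) = Hfun Q (word (cell \<xi>) n)"
proof -
  have xi': "finite \<xi>" "disjoint \<xi>" "\<Union>\<xi> = M"
    using xi probs_space[OF Q] by (auto simp: finite_partition_def)
  have sp: "space Q = M" by (rule probs_space[OF Q])
  let ?w = "word (cell \<xi>) n"
  define fib where "fib v = ?w -` {v} \<inter> M" for v
  have fin: "finite (?w ` M)"
    using simple_function_word[OF simple_function_cell[OF Q xi], of n] by (auto simp: simple_function_def)
  have fib_eq: "M \<inter> (\<Inter>k<n. (\<phi> ^^ k) -` a k) = fib (map a [0..<n])" if a: "\<forall>k<n. a k \<in> \<xi>" for a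
  proof -
    have "(\<phi> ^^ k) x \<in> a k \<longleftrightarrow> cell \<xi> ((\<phi> ^^ k) x) = a k" if "x \<in> M" "k < n" for x k
    proof -
      have "a k \<in> \<xi>" using a that by simp
      moreover have "(\<phi> ^^ k) x \<in> \<Union>\<xi>" using iter_in[OF that(1)] xi'(3) by simp
      ultimately show ?thesis using cell_eq[OF xi'(2)] cell_in[OF xi'(2)] by metis
    qed
    then show ?thesis by (auto simp: fib_def word_def)
  qed
  have join_sub: "join_part M \<phi> n \<xi> \<subseteq> insert {} (fib ` (?w ` M))"
  proof
    fix B assume "B \<in> join_part M \<phi> n \<xi>"
    then obtain a where a: "\<forall>k<n. a k \<in> \<xi>" "B = M \<inter> (\<Inter>k<n. (\<phi> ^^ k) -` a k)" unfolding join_part_def by auto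
    then have B: "B = fib (map a [0..<n])" using fib_eq by simp
    show "B \<in> insert {} (fib ` (?w ` M))"
    proof (cases "B = {}")
      case False
      then obtain x where "x \<in> M" "?w x = map a [0..<n]" unfolding B fib_def by auto
      then show ?thesis unfolding B by (metis imageI insertI2)
    qed simp
  qed
  have fib_sub: "fib ` (?w ` M) \<subseteq> join_part M \<phi> n \<xi>"
  proof
    fix B assume "B \<in> fib ` (?w ` M)"
    then obtain x where x: "x \<in> M" "B = fib (?w x)" by auto
    have "\<forall>k<n. cell \<xi> ((\<phi> ^^ k) x) \<in> \<xi>" using cell_in(1)[OF xi'(2)] iter_in[OF x(1)] xi'(3) by auto
    then show "B \<in> join_part M \<phi> n \<xi>"
      unfolding x(2) join_part_def using fib_eq[of "\<lambda>k. cell \<xi> ((\<phi> ^^ k) x)"] by (auto simp: word_def intro!: exI[of _ "\<lambda>k. cell \<xi> ((\<phi> ^^ k) x)"])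
  qed
  have "(\<Sum>B\<in>join_part M \<phi> n \<xi>. measure Q B * ln (measure Q B)) = (\<Sum>B\<in>fib ` (?w ` M). measure Q B * ln (measure Q B))"
    using join_sub fib_sub fin
    by (intro sum.mono_neutral_right finite_subset[OF join_sub]) auto
  also have "\<dots> = (\<Sum>v\<in>?w ` M. measure Q (fib v) * ln (measure Q (fib v)))"
    by (rule sum.reindex_cong[of fib]) (auto simp: inj_on_def fib_def)
  finally show ?thesis unfolding part_entropy_def Hfun_def sp fib_def by simp
qed

lemma Hfun_iter:
  assumes Q: "Q \<in> inv_probs M \<phi>" and f: "simple_function BM f"
  shows "Hfun Q (\<lambda>x. f ((\<phi> ^^ k) x)) = Hfun Q f"
  using Hfun_distr[of "\<phi> ^^ k" Q BM f] iter_measurable f inv_probs_distr[OF Q, of k]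
  by (simp add: probs_measurable[OF inv_probs_probs[OF Q]] comp_def)

lemma iter_add: "(\<phi> ^^ (m + n)) x = (\<phi> ^^ n) ((\<phi> ^^ m) x)"
  by (metis add.commute comp_apply funpow_add)

text \<open>The itinerary splits at time \<open>m\<close>, and invariance removes the shift from its
  second part.\<close>

lemma Hfun_word_subadditive:
  assumes Q: "Q \<in> inv_probs M \<phi>" and f: "simple_function BM f"
  shows "Hfun Q (word f (m + n)) \<le> Hfun Q (word f m) + Hfun Q (word f n)"
proof -
  note Qp = inv_probs_probs[OF Q]
  note pQ = probs_prob_space[OF Qp]
  have s: "simple_function Q (word f m)" "simple_function Q (\<lambda>x. word f n ((\<phi> ^^ m) x))"
    using simple_function_word[OF f] simple_function_iter by (auto simp: probs_simple_function[OF Qp])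
  have "word f (m + n) x = word f m x @ word f n ((\<phi> ^^ m) x)" for x
  proof -
    have "[0..<m + n] = [0..<m] @ map (\<lambda>k. m + k) [0..<n]"
      by (metis (lifting) ext Groups.add_ac(2) le0 map_add_upt upt_add_eq_append)
    then show ?thesis by (simp add: word_def iter_add)
  qed
  then have "Hfun Q (word f (m + n)) \<le> Hfun Q (\<lambda>x. (word f m x, word f n ((\<phi> ^^ m) x)))"
    by (intro Hfun_mono[OF pQ] simple_function_Pair s) auto
  also have "\<dots> \<le> Hfun Q (word f m) + Hfun Q (\<lambda>x. word f n ((\<phi> ^^ m) x))"
    by (rule Hfun_pair[OF pQ s])
  also have "Hfun Q (\<lambda>x. word f n ((\<phi> ^^ m) x)) = Hfun Q (word f n)"
    by (rule Hfun_iter[OF Q simple_function_word[OF f]])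
  finally show ?thesis .
qed

definition hfun :: "'a measure \<Rightarrow> ('a \<Rightarrow> 'b) \<Rightarrow> real" where
  "hfun Q f = lim (\<lambda>n. Hfun Q (word f n) / real n)"

lemma hfun:
  assumes Q: "Q \<in> inv_probs M \<phi>" and f: "simple_function BM f"
  shows "(\<lambda>n. Hfun Q (word f n) / real n) \<longlonglongrightarrow> hfun Q f"
    and "\<And>n. 1 \<le> n \<Longrightarrow> real n * hfun Q f \<le> Hfun Q (word f n)" and "0 \<le> hfun Q f"
proof -
  note sub = Hfun_word_subadditive[OF Q f]
  have nn: "0 \<le> Hfun Q (word f n)" for n by (rule Hfun_nonneg[OF probs_prob_space[OF inv_probs_probs[OF Q]]])
  show lim: "(\<lambda>n. Hfun Q (word f n) / real n) \<longlonglongrightarrow> hfun Q f"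
    unfolding hfun_def using subadditive_convergent(1)[of "\<lambda>n. Hfun Q (word f n)", OF sub nn] by (simp add: convergent_LIMSEQ_iff)
  show "real n * hfun Q f \<le> Hfun Q (word f n)" if "1 \<le> n" for n
    using subadditive_convergent(2)[of "\<lambda>n. Hfun Q (word f n)", OF sub nn that] that unfolding hfun_def by (simp add: field_simps)
  show "0 \<le> hfun Q f" using nn by (intro tendsto_lowerbound[OF lim]) auto
qed

lemma ks_entropy_eq:
  assumes Q: "Q \<in> probs M"
  shows "ks_entropy M \<phi> Q = (SUP \<xi>\<in>{\<xi>. finite_partition Q \<xi>}. ereal (hfun Q (cell \<xi>)))"
  unfolding ks_entropy_def hfun_def using part_entropy_join[OF Q] by (intro SUP_cong) auto

text \<open>The fibres of \<open>f\<close> form a finite partition whose itineraries determine those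
  of \<open>f\<close>. So codings with values in any type bound the entropy from below.\<close>

lemma hfun_le_ks_entropy:
  assumes Q: "Q \<in> inv_probs M \<phi>" and f: "simple_function BM f"
  shows "ereal (hfun Q f) \<le> ks_entropy M \<phi> Q"
proof -
  note Qp = inv_probs_probs[OF Q]
  define \<xi> where "\<xi> = (\<lambda>v. f -` {v} \<inter> M) ` f ` M"
  have disj: "disjoint \<xi>" unfolding \<xi>_def disjoint_def by auto
  have un: "\<Union>\<xi> = M" unfolding \<xi>_def by auto
  have fp: "finite_partition Q \<xi>"
    using f disj un probs_sets[OF Qp] probs_space[OF Qp]
    unfolding finite_partition_def by (auto simp: \<xi>_def simple_function_def)
  have cell: "cell \<xi> x = f -` {f x} \<inter> M" if "x \<in> M" for x
    using that by (intro cell_eq[OF disj]) (auto simp: \<xi>_def)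
  have "Hfun Q (word f n) \<le> Hfun Q (word (cell \<xi>) n)" for n
  proof (rule Hfun_mono[OF probs_prob_space[OF Qp]])
    show "simple_function Q (word (cell \<xi>) n)"
      unfolding probs_simple_function[OF Qp] by (intro simple_function_word simple_function_cell[OF Qp fp])
    fix x y assume xy: "x \<in> space Q" "y \<in> space Q" "word (cell \<xi>) n x = word (cell \<xi>) n y"
    then have M: "x \<in> M" "y \<in> M" using probs_space[OF Qp] by auto
    have "f ((\<phi> ^^ k) x) = f ((\<phi> ^^ k) y)" if "k < n" for k
    proof -
      have "cell \<xi> ((\<phi> ^^ k) x) = cell \<xi> ((\<phi> ^^ k) y)" using xy(3) that by (auto simp: word_def)
      then have "f -` {f ((\<phi> ^^ k) x)} \<inter> M = f -` {f ((\<phi> ^^ k) y)} \<inter> M" using cell iter_in M by simp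
      then show ?thesis using iter_in[OF M(1), of k] by auto
    qed
    then show "word f n x = word f n y" by (auto simp: word_def)
  qed
  then have "hfun Q f \<le> hfun Q (cell \<xi>)"
    using hfun(1)[OF Q f] hfun(1)[OF Q simple_function_cell[OF Qp fp]]
    by (intro LIMSEQ_le[of "\<lambda>n. Hfun Q (word f n) / real n" _ "\<lambda>n. Hfun Q (word (cell \<xi>) n) / real n"]) (auto intro!: exI[of _ 0] divide_right_mono)
  then have "ereal (hfun Q f) \<le> ereal (hfun Q (cell \<xi>))" by simp
  also have "\<dots> \<le> ks_entropy M \<phi> Q" unfolding ks_entropy_eq[OF Qp] using fp by (intro SUP_upper) auto
  finally show ?thesis .
qed

lemma less_ks_entropyE:
  assumes Q: "Q \<in> inv_probs M \<phi>" and c: "ereal c < ks_entropy M \<phi> Q"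
  obtains \<xi> where "finite_partition Q \<xi>" "simple_function BM (cell \<xi>)" "c < hfun Q (cell \<xi>)"
  using c simple_function_cell[OF inv_probs_probs[OF Q]] that unfolding ks_entropy_eq[OF inv_probs_probs[OF Q]] by (auto simp: less_SUP_iff)

lemma ks_entropy_nonneg:
  assumes Q: "Q \<in> inv_probs M \<phi>" shows "0 \<le> ks_entropy M \<phi> Q"
proof -
  have f: "simple_function BM (\<lambda>_. ())" by simp
  have "0 \<le> ereal (hfun Q (\<lambda>_. ()))" using hfun(3)[OF Q f] by simp
  also have "\<dots> \<le> ks_entropy M \<phi> Q" by (rule hfun_le_ks_entropy[OF Q f])
  finally show ?thesis .
qed

end

text \<open>From ln y \<le> y - 1 at y = 1 / sqrt t. It yields the continuity of t ln t at 0 and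
  later prices the small atoms of a partition.\<close>

lemma abs_mult_ln_le:
  fixes t :: real assumes "0 \<le> t" "t \<le> 1" shows "\<bar>t * ln t\<bar> \<le> 2 * sqrt t"
proof (cases "t = 0")
  case False
  then have t: "0 < t" using assms by simp
  then have s: "0 < sqrt t" by simp
  have "ln (1 / sqrt t) \<le> 1 / sqrt t - 1" using s by (intro ln_le_minus_one) auto
  moreover have "ln (1 / sqrt t) = - ln t / 2" using t by (simp add: ln_div ln_sqrt)
  ultimately have "- ln t \<le> 2 / sqrt t" by linarith
  then have "t * (- ln t) \<le> t * (2 / sqrt t)" using t by (intro mult_left_mono) auto
  also have "\<dots> = 2 * (t / sqrt t)" by simp
  also have "t / sqrt t = sqrt t" using t by (simp add: real_div_sqrt)
  finally have "- (t * ln t) \<le> 2 * sqrt t" by simp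
  moreover have "t * ln t \<le> 0" using t assms by (simp add: mult_nonneg_nonpos)
  ultimately show ?thesis by simp
qed simp

lemma tendsto_mult_ln:
  fixes x :: "nat \<Rightarrow> real"
  assumes x: "x \<longlonglongrightarrow> l" and nn: "\<And>n. 0 \<le> x n"
  shows "(\<lambda>n. x n * ln (x n)) \<longlonglongrightarrow> l * ln l"
proof (cases "l = 0")
  case False
  then show ?thesis using x by (intro tendsto_intros) auto
next
  case True
  have "\<forall>\<^sub>F n in sequentially. x n < 1" using x True by (intro order_tendstoD(2)) auto
  then have ev: "\<forall>\<^sub>F n in sequentially. norm (x n * ln (x n)) \<le> 2 * sqrt (x n)"
    by eventually_elim (use nn abs_mult_ln_le in auto)
  have "(\<lambda>n. 2 * sqrt (x n)) \<longlonglongrightarrow> 2 * sqrt l" using x by (intro tendsto_intros)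
  then have "(\<lambda>n. 2 * sqrt (x n)) \<longlonglongrightarrow> 0" using True by simp
  then have "(\<lambda>n. x n * ln (x n)) \<longlonglongrightarrow> 0" by (rule Lim_null_comparison[OF ev])
  then show ?thesis using True by simp
qed

context dyn_system
begin

subsection \<open>Finitely supported measures\<close>

text \<open>Sum of point masses \<open>w s\<close> at \<open>p s\<close>, written as the image of a
  weighted counting measure; the points \<open>p s\<close> may coincide.\<close>

definition dirac_mix :: "'s set \<Rightarrow> ('s \<Rightarrow> real) \<Rightarrow> ('s \<Rightarrow> 'a) \<Rightarrow> 'a measure" where
  "dirac_mix S w p = distr (point_measure S (\<lambda>s. ennreal (w s))) BM p"

lemma dirac_mix:
  fixes f :: "'a \<Rightarrow> real"
  assumes S: "finite S" and w: "\<And>s. s \<in> S \<Longrightarrow> 0 \<le> w s" "sum w S = 1" and p: "p ` S \<subseteq> M"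
  shows "dirac_mix S w p \<in> probs M"
    and "A \<in> sets BM \<Longrightarrow> emeasure (dirac_mix S w p) A = ennreal (\<Sum>s\<in>S. w s * indicator A (p s))"
    and "A \<in> sets BM \<Longrightarrow> measure (dirac_mix S w p) A = (\<Sum>s\<in>S. w s * indicator A (p s))"
    and "f \<in> borel_measurable BM \<Longrightarrow> (\<integral>x. f x \<partial>dirac_mix S w p) = (\<Sum>s\<in>S. w s * f (p s))"
proof -
  let ?P = "point_measure S (\<lambda>s. ennreal (w s))"
  have pm: "p \<in> measurable ?P BM" using p by (auto simp: measurable_def space_point_measure sets_point_measure)
  show em: "emeasure (dirac_mix S w p) A = ennreal (\<Sum>s\<in>S. w s * indicator A (p s))" if A: "A \<in> sets BM" for A
  proof -
    have "emeasure (dirac_mix S w p) A = emeasure ?P (p -` A \<inter> S)"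
      unfolding dirac_mix_def using emeasure_distr[OF pm A] by (simp add: space_point_measure)
    also have "\<dots> = (\<Sum>s\<in>p -` A \<inter> S. ennreal (w s))" using S by (intro emeasure_point_measure_finite) auto
    also have "\<dots> = ennreal (\<Sum>s\<in>p -` A \<inter> S. w s)" using w by (intro sum_ennreal) auto
    also have "(\<Sum>s\<in>p -` A \<inter> S. w s) = (\<Sum>s\<in>S. w s * indicator A (p s))"
      using S by (intro sum.mono_neutral_cong_left) (auto simp: indicator_def)
    finally show ?thesis .
  qed
  show ms: "measure (dirac_mix S w p) A = (\<Sum>s\<in>S. w s * indicator A (p s))" if A: "A \<in> sets BM"
    unfolding measure_def em[OF A] using w by (intro enn2real_ennreal sum_nonneg) auto
  have M1: "emeasure (dirac_mix S w p) M = 1"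
  proof -
    have "M \<in> sets BM" using sets.top[of BM] by simp
    moreover have "(\<Sum>s\<in>S. w s * indicator M (p s)) = sum w S" using p by (intro sum.cong) auto
    ultimately show ?thesis using em w(2) by simp
  qed
  then show "dirac_mix S w p \<in> probs M"
    unfolding probs_def by (auto simp: dirac_mix_def intro!: prob_spaceI)
  show "(\<integral>x. f x \<partial>dirac_mix S w p) = (\<Sum>s\<in>S. w s * f (p s))" if f: "f \<in> borel_measurable BM" for f :: "'a \<Rightarrow> real"
    unfolding dirac_mix_def integral_distr[OF pm f] using S w(1)
    by (subst lebesgue_integral_point_measure_finite) auto
qed

subsection \<open>Upper half of the variational principle\<close>

text \<open>Cut the itinerary into blocks of length \<open>q\<close> and sum over the \<open>q\<close> possible offsets.\<close>
lemma Hfun_word_blocks: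
  assumes R: "R \<in> probs M" and f: "simple_function BM f" and q: "1 \<le> q"
  shows "real q * Hfun R (word f n) \<le> (\<Sum>i<n. Hfun R (\<lambda>x. word f q ((\<phi> ^^ i) x))) + (real q)\<^sup>2 * ln (card (f ` M))"
proof -
  interpret prob_space R using probs_prob_space[OF R] .
  define g where "g = (\<lambda>(l, i) x. word f l ((\<phi> ^^ i) x))"
  define C where "C = ln (card (f ` M))"
  have sg: "simple_function R (g k)" for k
    unfolding probs_simple_function[OF R] g_def
    by (cases k) (simp add: simple_function_iter[OF simple_function_word[OF f]])
  have ne: "M \<noteq> {}" by (rule nonempty_M[OF R])
  have fin: "finite (f ` M)" using f by (simp add: simple_function_def)
  have C0: "0 \<le> C" unfolding C_def using ne fin by (simp add: Suc_leI card_gt_0_iff)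
  have one: "Hfun R (g (1, k)) \<le> C" for k
  proof -
    have "Hfun R (g (1, k)) \<le> ln (card (g (1, k) ` space R))" by (rule Hfun_le_card[OF prob_space_axioms sg])
    also have "\<dots> \<le> C" unfolding C_def
    proof (rule ln_mono)
      have sub: "g (1, k) ` M \<subseteq> (\<lambda>a. [a]) ` (f ` M)" using iter_in by (auto simp: g_def word_def)
      have "card (g (1, k) ` M) \<le> card ((\<lambda>a. [a]) ` (f ` M))" using fin by (intro card_mono sub) auto
      also have "\<dots> \<le> card (f ` M)" using fin by (rule card_image_le)
      finally show "real (card (g (1, k) ` space R)) \<le> real (card (f ` M))" using probs_space[OF R] by simp
      have "finite (g (1, k) ` M)" using finite_subset[OF sub] fin by simp
      then show "0 < real (card (g (1, k) ` space R))" using ne probs_space[OF R] by (simp add: card_gt_0_iff)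
    qed
    finally show ?thesis .
  qed
  have block: "Hfun R (word f n) \<le> real q * C + (\<Sum>i | i < n \<and> i mod q = j. Hfun R (g (q, i)))" if j: "j < q" for j
  proof -
    \<comment> \<open>Positions below the offset \<open>j\<close> are read singly, the others in
      blocks of length \<open>q\<close> that start at times congruent to \<open>j\<close>. The last
      block may run past \<open>n\<close>, which only refines the itinerary.\<close>
    define ks where "ks = map (\<lambda>k. (1, k)) [0..<j] @ map (\<lambda>i. (q, i)) (filter (\<lambda>i. i mod q = j) [0..<n])"
    have "Hfun R (word f n) \<le> Hfun R (\<lambda>x. map (\<lambda>k. g k x) ks)"
    proof (rule Hfun_mono[OF prob_space_axioms simple_function_map[OF sg]])
      fix x y assume "map (\<lambda>k. g k x) ks = map (\<lambda>k. g k y) ks"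
      then have eq: "g k x = g k y" if "k \<in> set ks" for k using that by simp
      have "f ((\<phi> ^^ k) x) = f ((\<phi> ^^ k) y)" if k: "k < n" for k
      proof (cases "k < j")
        case True
        then have "(1, k) \<in> set ks" by (auto simp: ks_def)
        from eq[OF this] show ?thesis by (simp add: g_def word_def)
      next
        case False
        \<comment> \<open>\<open>i\<close> is the start of the block that contains position
          \<open>k\<close>, and \<open>r\<close> the place of \<open>k\<close> inside it.\<close>
        define r where "r = (k - j) mod q"
        define i where "i = k - r"
        have r: "r \<le> k - j" "r < q" using q by (auto simp: r_def)
        have i: "i = j + q * ((k - j) div q)"
        proof -
          have "k - j = q * ((k - j) div q) + r" by (simp add: r_def)
          then show ?thesis using False r(1) unfolding i_def by linarith
        qed
        have "i mod q = j" using j by (simp add: i)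
        moreover have "i < n" using k by (simp add: i_def)
        ultimately have "(q, i) \<in> set ks" by (auto simp: ks_def)
        from eq[OF this] have "word f q ((\<phi> ^^ i) x) ! r = word f q ((\<phi> ^^ i) y) ! r" by (simp add: g_def)
        then have "f ((\<phi> ^^ r) ((\<phi> ^^ i) x)) = f ((\<phi> ^^ r) ((\<phi> ^^ i) y))" using r(2) by (simp add: word_def)
        moreover have "i + r = k" using r(1) by (simp add: i_def)
        ultimately show ?thesis by (metis iter_add)
      qed
      then show "word f n x = word f n y" by (simp add: word_def)
    qed
    also have "\<dots> \<le> (\<Sum>k\<leftarrow>ks. Hfun R (g k))" by (rule Hfun_map_le[OF prob_space_axioms sg])
    also have "\<dots> = (\<Sum>k<j. Hfun R (g (1, k))) + (\<Sum>i | i < n \<and> i mod q = j. Hfun R (g (q, i)))"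
    proof -
      have "(\<Sum>i\<leftarrow>filter (\<lambda>i. i mod q = j) [0..<n]. Hfun R (g (q, i))) = (\<Sum>i\<in>set (filter (\<lambda>i. i mod q = j) [0..<n]). Hfun R (g (q, i)))"
        by (rule sum_list_distinct_conv_sum_set) simp
      also have "set (filter (\<lambda>i. i mod q = j) [0..<n]) = {i. i < n \<and> i mod q = j}" by auto
      finally have "(\<Sum>i\<leftarrow>filter (\<lambda>i. i mod q = j) [0..<n]. Hfun R (g (q, i))) = (\<Sum>i | i < n \<and> i mod q = j. Hfun R (g (q, i)))" .
      moreover have "(\<Sum>k\<leftarrow>[0..<j]. Hfun R (g (1, k))) = (\<Sum>k<j. Hfun R (g (1, k)))"
        by (simp add: sum_list_distinct_conv_sum_set atLeast0LessThan)
      ultimately show ?thesis by (simp add: ks_def comp_def)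
    qed
    also have "(\<Sum>k<j. Hfun R (g (1, k))) \<le> (\<Sum>k<j. C)" by (intro sum_mono one)
    also have "\<dots> \<le> real q * C" using C0 j by (simp add: mult_right_mono)
    finally show ?thesis by simp
  qed
  have "real q * Hfun R (word f n) = (\<Sum>j<q. Hfun R (word f n))" by simp
  also have "\<dots> \<le> (\<Sum>j<q. real q * C + (\<Sum>i | i < n \<and> i mod q = j. Hfun R (g (q, i))))"
    by (intro sum_mono block) auto
  also have "\<dots> = (real q)\<^sup>2 * C + (\<Sum>j<q. \<Sum>i | i < n \<and> i mod q = j. Hfun R (g (q, i)))"
    by (simp add: sum.distrib power2_eq_square)
  \<comment> \<open>Each start \<open>i\<close> belongs to exactly one offset, so the sum over
    offsets becomes a sum over all times.\<close>
  also have "(\<Sum>j<q. \<Sum>i | i < n \<and> i mod q = j. Hfun R (g (q, i))) = (\<Sum>i<n. Hfun R (g (q, i)))"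
    using sum.group[of "{..<n}" "{..<q}" "\<lambda>i. i mod q" "\<lambda>i. Hfun R (g (q, i))"] q by force
  finally show ?thesis by (simp add: g_def C_def)
qed

text \<open>Misiurewicz's estimate for the orbit average of the Gibbs weights on \<open>E\<close>.
  When itineraries separate \<open>E\<close>, the itinerary fibres carry exactly these weights, so
  entropy plus mean energy equals \<open>ln Z\<close>. Blocks and concavity then pass from the
  weights \<open>\<sigma>\<close> to the time average \<open>\<mu>\<close>.\<close>

lemma separated_entropy_bound:
  fixes f :: "'a \<Rightarrow> 'b" and G :: "'a \<Rightarrow> real"
  assumes n: "1 \<le> n" and E: "finite E" "E \<subseteq> M" "E \<noteq> {}"
  defines "Z \<equiv> \<Sum>x\<in>E. exp (G x)"
  defines "\<mu> \<equiv> dirac_mix (E \<times> {..<n}) (\<lambda>(x, i). exp (G x) / Z / real n) (\<lambda>(x, i). (\<phi> ^^ i) x)"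
  shows "\<mu> \<in> probs M"
    and "\<And>g. continuous_on M g \<Longrightarrow> (\<integral>x. g x \<partial>\<mu>) = (\<Sum>x\<in>E. exp (G x) / Z * birkhoff \<phi> n g x) / real n"
    and "1 \<le> q \<Longrightarrow> simple_function BM f \<Longrightarrow> inj_on (word f n) E \<Longrightarrow>
      ln Z / real n \<le> Hfun \<mu> (word f q) / real q + real q * ln (card (f ` M)) / real n
        + (\<Sum>x\<in>E. exp (G x) / Z * G x) / real n"
proof -
  define w where "w x = exp (G x) / Z" for x
  have Z: "0 < Z" unfolding Z_def using E by (intro sum_pos) auto
  have w: "\<And>x. 0 < w x" "sum w E = 1" using Z by (auto simp: w_def Z_def sum_divide_distrib[symmetric])
  define \<sigma> where "\<sigma> = dirac_mix E w (\<lambda>x. x)"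
  have wn: "0 \<le> w x" for x using w(1)[of x] by simp
  have idM: "(\<lambda>x. x) ` E \<subseteq> M" using E(2) by simp
  note sig = dirac_mix[of E w "\<lambda>x. x", OF E(1) wn w(2) idM, folded \<sigma>_def]
  have mu_eq: "\<mu> = dirac_mix (E \<times> {..<n}) (\<lambda>(x, i). w x / real n) (\<lambda>(x, i). (\<phi> ^^ i) x)"
    unfolding \<mu>_def w_def by simp
  have sum1: "(\<Sum>s\<in>E \<times> {..<n}. (case s of (x, i) \<Rightarrow> w x / real n)) = 1"
    using w(2) n by (simp add: sum.cartesian_product[symmetric])
  have nn: "0 \<le> (case s of (x, i) \<Rightarrow> w x / real n)" for s using wn by (cases s) simp
  have inM: "(\<lambda>(x, i). (\<phi> ^^ i) x) ` (E \<times> {..<n}) \<subseteq> M" using iter_in E(2) by auto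
  have finS: "finite (E \<times> {..<n})" using E(1) by simp
  note mu = dirac_mix[where S="E \<times> {..<n}" and w="\<lambda>(x, i). w x / real n" and p="\<lambda>(x, i). (\<phi> ^^ i) x",
      OF finS nn sum1 inM, folded mu_eq]
  show mup: "\<mu> \<in> probs M" by (rule mu(1))
  show "(\<integral>x. g x \<partial>\<mu>) = (\<Sum>x\<in>E. exp (G x) / Z * birkhoff \<phi> n g x) / real n" if g: "continuous_on M g" for g
  proof -
    have "(\<integral>x. g x \<partial>\<mu>) = (\<Sum>(x, i)\<in>E \<times> {..<n}. w x / real n * g ((\<phi> ^^ i) x))"
      unfolding mu(4)[OF continuous_borel[OF g]] by (rule sum.cong) auto
    also have "\<dots> = (\<Sum>x\<in>E. \<Sum>i<n. w x / real n * g ((\<phi> ^^ i) x))" by (rule sum.cartesian_product[symmetric])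
    also have "\<dots> = (\<Sum>x\<in>E. w x * birkhoff \<phi> n g x) / real n"
      by (simp add: birkhoff_def sum_distrib_left sum_divide_distrib)
    finally show ?thesis by (simp add: w_def)
  qed
  have sp: "space \<sigma> = M" "space \<mu> = M" using probs_space sig(1) mup by auto
  define R where "R i = distr \<sigma> BM (\<phi> ^^ i)" for i
  have im: "(\<phi> ^^ i) \<in> measurable \<sigma> BM" for i using iter_measurable by (simp add: probs_measurable[OF sig(1)])
  show "ln Z / real n \<le> Hfun \<mu> (word f q) / real q + real q * ln (card (f ` M)) / real n
        + (\<Sum>x\<in>E. exp (G x) / Z * G x) / real n"
    if q: "1 \<le> q" and f: "simple_function BM f" and inj: "inj_on (word f n) E"
  proof -
    have sw: "simple_function BM (word f m)" for m by (rule simple_function_word[OF f])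
    have HR: "Hfun (R i) (word f q) = Hfun \<sigma> (\<lambda>x. word f q ((\<phi> ^^ i) x))" for i
      unfolding R_def Hfun_distr[OF im sw] by (simp add: comp_def)
    have mix: "measure \<mu> A = (\<Sum>i<n. (1 / real n) * measure (R i) A)" if A: "A \<in> sets \<mu>" for A
    proof -
      have A': "A \<in> sets BM" using A probs_sets[OF mup] by simp
      have "measure (R i) A = (\<Sum>x\<in>E. w x * indicator A ((\<phi> ^^ i) x))" for i
      proof -
        have "measure (R i) A = measure \<sigma> ((\<phi> ^^ i) -` A \<inter> M)" unfolding R_def using measure_distr[OF im A'] sp by simp
        also have "\<dots> = (\<Sum>x\<in>E. w x * indicator ((\<phi> ^^ i) -` A \<inter> M) x)"
          using measurable_sets[OF iter_measurable A'] by (intro sig(3)) simp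
        also have "\<dots> = (\<Sum>x\<in>E. w x * indicator A ((\<phi> ^^ i) x))" using E(2) by (intro sum.cong) (auto simp: indicator_def)
        finally show ?thesis .
      qed
      moreover have "measure \<mu> A = (\<Sum>x\<in>E. \<Sum>i<n. w x / real n * indicator A ((\<phi> ^^ i) x))"
        unfolding mu(3)[OF A'] by (subst sum.cartesian_product) (auto intro: sum.cong)
      moreover have "\<dots> = (\<Sum>i<n. (1 / real n) * (\<Sum>x\<in>E. w x * indicator A ((\<phi> ^^ i) x)))"
        by (subst sum.swap) (simp add: sum_distrib_left)
      ultimately show ?thesis by simp
    qed
    \<comment> \<open>\<open>\<mu>\<close> is the mean of the shifted measures \<open>R i\<close>,
      so its block entropy is at least the mean of theirs.\<close>
    have conc: "(\<Sum>i<n. (1 / real n) * Hfun (R i) (word f q)) \<le> Hfun \<mu> (word f q)"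
      using n mix sw sp by (intro Hfun_concave) (auto simp: R_def probs_simple_function[OF mup])
    have Hs: "Hfun \<sigma> (word f n) = ln Z - (\<Sum>x\<in>E. w x * G x)"
    proof -
      let ?w = "word f n"
      have m: "measure \<sigma> (?w -` {?w x} \<inter> M) = w x" if x: "x \<in> E" for x
      proof -
        have "measure \<sigma> (?w -` {?w x} \<inter> M) = (\<Sum>y\<in>E. w y * indicator (?w -` {?w x} \<inter> M) y)"
          using simple_functionD(2)[OF sw[of n], of "{?w x}"] by (intro sig(3)) simp
        also have "\<dots> = (\<Sum>y\<in>E. if y = x then w x else 0)"
          using E(2) inj x by (intro sum.cong) (auto simp: indicator_def inj_on_def)
        also have "\<dots> = w x" using E(1) x by simp
        finally show ?thesis .
      qed
      have z: "measure \<sigma> (?w -` {v} \<inter> M) = 0" if v: "v \<notin> ?w ` E" for v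
      proof -
        have "measure \<sigma> (?w -` {v} \<inter> M) = (\<Sum>y\<in>E. w y * indicator (?w -` {v} \<inter> M) y)"
          using simple_functionD(2)[OF sw[of n], of "{v}"] by (intro sig(3)) simp
        also have "\<dots> = 0" using v by (intro sum.neutral) (auto simp: indicator_def)
        finally show ?thesis .
      qed
      have fin: "finite (?w ` M)" using sw[of n] by (simp add: simple_function_def)
      have "Hfun \<sigma> ?w = - (\<Sum>v\<in>?w ` E. measure \<sigma> (?w -` {v} \<inter> M) * ln (measure \<sigma> (?w -` {v} \<inter> M)))"
        unfolding Hfun_def sp using fin E(2) z by (intro arg_cong[where f=uminus] sum.mono_neutral_right) auto
      also have "\<dots> = - (\<Sum>x\<in>E. w x * ln (w x))" using inj m by (simp add: sum.reindex)
      also have "\<dots> = - (\<Sum>x\<in>E. w x * (G x - ln Z))" using Z by (simp add: w_def ln_div)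
      also have "\<dots> = ln Z * sum w E - (\<Sum>x\<in>E. w x * G x)"
        by (simp add: right_diff_distrib sum_subtractf sum_distrib_left mult.commute)
      finally show ?thesis using w(2) by simp
    qed
    have "real q * Hfun \<sigma> (word f n) \<le> (\<Sum>i<n. Hfun (R i) (word f q)) + (real q)\<^sup>2 * ln (card (f ` M))"
      unfolding HR by (rule Hfun_word_blocks[OF sig(1) f q])
    also have "(\<Sum>i<n. Hfun (R i) (word f q)) = real n * (\<Sum>i<n. (1 / real n) * Hfun (R i) (word f q))"
      using n by (simp add: sum_distrib_left)
    also have "\<dots> \<le> real n * Hfun \<mu> (word f q)" by (intro mult_left_mono conc) simp
    finally have main: "real q * (ln Z - (\<Sum>x\<in>E. w x * G x)) \<le> real n * Hfun \<mu> (word f q) + (real q)\<^sup>2 * ln (card (f ` M))"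
      unfolding Hs by simp
    have "(real q * (ln Z - (\<Sum>x\<in>E. w x * G x))) / (real q * real n) \<le> (real n * Hfun \<mu> (word f q) + (real q)\<^sup>2 * ln (card (f ` M))) / (real q * real n)"
      by (rule divide_right_mono[OF main]) simp
    also have "\<dots> = Hfun \<mu> (word f q) / real q + real q * ln (card (f ` M)) / real n"
      using n q by (simp add: add_divide_distrib power2_eq_square)
    finally show ?thesis using q by (simp add: diff_divide_distrib w_def)
  qed
qed

text \<open>Only countably many radii can carry positive mass, while an interval is
  uncountable.\<close>

lemma null_sphere:
  assumes Q: "Q \<in> probs M" and ab: "a < (b::real)"
  obtains r where "a < r" "r < b" "measure Q {x \<in> M. dist x p = r} = 0"
proof -
  interpret prob_space Q using probs_prob_space[OF Q] .
  have m: "(\<lambda>x. dist x p) \<in> measurable Q borel"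
    unfolding probs_measurable[OF Q] by (intro continuous_borel continuous_intros)
  interpret D: prob_space "distr Q borel (\<lambda>x. dist x p)" by (rule prob_space_distr[OF m])
  have "countable {r. measure (distr Q borel (\<lambda>x. dist x p)) {r} \<noteq> 0}" by (rule D.countable_support)
  then obtain r where r: "r \<in> {a<..<b}" "r \<notin> {r. measure (distr Q borel (\<lambda>x. dist x p)) {r} \<noteq> 0}"
    using uncountable_open_interval[of a b] ab countable_subset[of "{a<..<b}"] by (meson subsetI)
  have "measure (distr Q borel (\<lambda>x. dist x p)) {r} = measure Q ((\<lambda>x. dist x p) -` {r} \<inter> space Q)"
    by (rule measure_distr[OF m]) simp
  also have "(\<lambda>x. dist x p) -` {r} \<inter> space Q = {x \<in> M. dist x p = r}" using probs_space[OF Q] by auto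
  finally show ?thesis using r that by auto
qed

text \<open>Off the null set \<open>D\<close> the coding is locally constant, so the boundary of
  every fibre lies in \<open>D\<close> and the mass of the fibre converges; continuity of t ln t
  does the rest.\<close>

lemma Hfun_wconv:
  assumes X: "\<And>n. X n \<in> probs M" and Q: "Q \<in> probs M" and w: "wconv X Q" and u: "simple_function BM u"
    and D: "D \<in> sets BM" "measure Q D = 0"
    and loc: "\<And>x. x \<in> M - D \<Longrightarrow> \<forall>\<^sub>F y in at x within M. u y = u x"
  shows "(\<lambda>n. Hfun (X n) u) \<longlonglongrightarrow> Hfun Q u"
proof -
  interpret prob_space Q using probs_prob_space[OF Q] .
  have "(\<lambda>n. measure (X n) (u -` {v} \<inter> M)) \<longlonglongrightarrow> measure Q (u -` {v} \<inter> M)" for v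
  proof -
    let ?A = "u -` {v} \<inter> M"
    have A: "?A \<in> sets BM" using simple_functionD(2)[OF u, of "{v}"] by simp
    \<comment> \<open>The points of \<open>M\<close> in the closure both of \<open>?A\<close> and of
      its complement, that is, its boundary relative to \<open>M\<close>.\<close>
    let ?B = "(closure ?A - (- closure (M - ?A))) \<inter> M"
    have sub: "?B \<subseteq> D"
    proof (rule ccontr)
      assume "\<not> ?B \<subseteq> D"
      then obtain x where x: "x \<in> closure ?A" "x \<in> closure (M - ?A)" "x \<in> M - D" by auto
      from loc[OF x(3)] obtain d where d: "0 < d" "\<And>y. y \<in> M \<Longrightarrow> dist y x < d \<Longrightarrow> u y = u x"
        unfolding eventually_at by (metis dist_self zero_less_dist_iff)
      obtain y where y: "y \<in> ?A" "dist y x < d" using x(1) d(1) unfolding closure_approachable by blast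
      obtain z where z: "z \<in> M - ?A" "dist z x < d" using x(2) d(1) unfolding closure_approachable by blast
      show False using d(2)[of y] d(2)[of z] y z by auto
    qed
    have "measure Q ?B \<le> measure Q D" using sub D(1) probs_sets[OF Q] by (intro finite_measure_mono) auto
    then have null: "measure Q ?B = 0" using D(2) by (simp add: measure_le_0_iff)
    show ?thesis
    proof (rule wconv_continuity_set[OF X Q w closed_closure _ _ _ A null])
      show "open (- closure (M - ?A))" by (simp add: open_Compl)
      show "- closure (M - ?A) \<inter> M \<subseteq> ?A" using closure_subset[of "M - ?A"] by auto
      show "?A \<subseteq> closure ?A \<inter> M" using closure_subset[of ?A] by auto
    qed
  qed
  then have "(\<lambda>n. - (\<Sum>v\<in>u ` M. measure (X n) (u -` {v} \<inter> M) * ln (measure (X n) (u -` {v} \<inter> M))))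
     \<longlonglongrightarrow> - (\<Sum>v\<in>u ` M. measure Q (u -` {v} \<inter> M) * ln (measure Q (u -` {v} \<inter> M)))"
    by (intro tendsto_minus tendsto_sum tendsto_mult_ln) auto
  then show ?thesis unfolding Hfun_def using probs_space[OF Q] probs_space[OF X] by simp
qed

end

subsection \<open>Counting typical words\<close>

lemma exp_le_quadratic:
  fixes x :: real assumes "\<bar>x\<bar> \<le> 1" shows "exp x \<le> 1 + x + x\<^sup>2"
proof (cases "0 \<le> x")
  case True then show ?thesis using exp_bound assms by simp
next
  case False
  define y where "y = - x"
  have y: "0 < y" using False by (simp add: y_def)
  have "exp x = 1 / exp y" by (simp add: y_def exp_minus field_simps)
  also have "\<dots> \<le> 1 / (1 + y)" using y exp_ge_add_one_self[of y] by (intro divide_left_mono) auto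
  also have "\<dots> \<le> 1 - y + y\<^sup>2"
  proof -
    have "(1 - y + y\<^sup>2) * (1 + y) = 1 + y ^ 3" by (simp add: algebra_simps power2_eq_square power3_eq_cube)
    then have "1 \<le> (1 - y + y\<^sup>2) * (1 + y)" using y by simp
    then show ?thesis using y by (simp add: pos_divide_le_eq)
  qed
  finally show ?thesis by (simp add: y_def)
qed

text \<open>Chernoff's bound: centring makes the exponential moment cost at most
  \<open>\<theta> * \<epsilon> / 2\<close> per letter, against a gain of
  \<open>\<theta> * \<epsilon>\<close>.\<close>

lemma iid_tail:
  fixes p g :: "'e \<Rightarrow> real"
  assumes E: "finite E" and p: "\<And>e. e \<in> E \<Longrightarrow> 0 \<le> p e" "sum p E = 1" and eps: "0 < \<epsilon>"
  shows "\<exists>c>0. \<forall>L. (\<Sum>w\<in>{w \<in> {..<L} \<rightarrow>\<^sub>E E. real L * ((\<Sum>e\<in>E. p e * g e) + \<epsilon>) \<le> (\<Sum>j<L. g (w j))}. \<Prod>j<L. p (w j))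
     \<le> exp (- c * real L)"
proof -
  define m where "m = (\<Sum>e\<in>E. p e * g e)"
  define h where "h e = g e - m" for e
  define B where "B = 1 + (\<Sum>e\<in>E. \<bar>h e\<bar>)"
  have B: "1 \<le> B" by (simp add: B_def sum_nonneg)
  have hB: "\<bar>h e\<bar> \<le> B" if "e \<in> E" for e
    using member_le_sum[of e E "\<lambda>e. \<bar>h e\<bar>"] that E by (simp add: B_def)
  have h0: "(\<Sum>e\<in>E. p e * h e) = 0"
    using p(2) by (simp add: h_def right_diff_distrib sum_subtractf sum_distrib_right[symmetric] m_def)
  \<comment> \<open>The first bound keeps the exponents in [-1, 1], where the quadratic estimate of
    exp holds; the second makes the quadratic term at most half of the gain.\<close>
  define \<theta> where "\<theta> = min (1 / B) (\<epsilon> / (2 * B\<^sup>2))"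
  have th: "0 < \<theta>" "\<theta> * B \<le> 1" "\<theta> * B\<^sup>2 \<le> \<epsilon> / 2"
  proof -
    show "0 < \<theta>" using B eps by (simp add: \<theta>_def)
    have "\<theta> \<le> 1 / B" "\<theta> \<le> \<epsilon> / (2 * B\<^sup>2)" by (simp_all add: \<theta>_def)
    then show "\<theta> * B \<le> 1" "\<theta> * B\<^sup>2 \<le> \<epsilon> / 2" using B by (simp_all add: pos_le_divide_eq mult.assoc mult.left_commute)
  qed
  have mgf: "(\<Sum>e\<in>E. p e * exp (\<theta> * h e)) \<le> exp (\<theta> * \<epsilon> / 2)"
  proof -
    have "(\<Sum>e\<in>E. p e * exp (\<theta> * h e)) \<le> (\<Sum>e\<in>E. p e * (1 + \<theta> * h e + \<theta>\<^sup>2 * B\<^sup>2))"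
    proof (intro sum_mono mult_left_mono p)
      fix e assume e: "e \<in> E"
      have ab: "\<bar>\<theta> * h e\<bar> \<le> \<theta> * B" using hB[OF e] th(1) by (simp add: abs_mult)
      have "exp (\<theta> * h e) \<le> 1 + \<theta> * h e + (\<theta> * h e)\<^sup>2" using ab th(2) by (intro exp_le_quadratic) simp
      also have "(\<theta> * h e)\<^sup>2 \<le> (\<theta> * B)\<^sup>2" using ab by (metis abs_ge_zero power2_abs power_mono)
      finally show "exp (\<theta> * h e) \<le> 1 + \<theta> * h e + \<theta>\<^sup>2 * B\<^sup>2" by (simp add: power_mult_distrib)
    qed
    also have "\<dots> = sum p E * (1 + \<theta>\<^sup>2 * B\<^sup>2) + \<theta> * (\<Sum>e\<in>E. p e * h e)"
      by (simp add: distrib_left sum.distrib sum_distrib_right sum_distrib_left mult.left_commute)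
    also have "\<dots> = 1 + \<theta> * (\<theta> * B\<^sup>2)" using p(2) h0 by (simp add: power2_eq_square mult.assoc)
    also have "\<dots> \<le> 1 + \<theta> * (\<epsilon> / 2)" using th by (intro add_left_mono mult_left_mono) auto
    also have "\<dots> \<le> exp (\<theta> * \<epsilon> / 2)" using exp_ge_add_one_self[of "\<theta> * \<epsilon> / 2"] by simp
    finally show ?thesis .
  qed
  have "(\<Sum>w\<in>{w \<in> {..<L} \<rightarrow>\<^sub>E E. real L * (m + \<epsilon>) \<le> (\<Sum>j<L. g (w j))}. \<Prod>j<L. p (w j)) \<le> exp (- (\<theta> * \<epsilon> / 2) * real L)" for L
  proof -
    let ?W = "{..<L} \<rightarrow>\<^sub>E E"
    let ?T = "{w \<in> ?W. real L * (m + \<epsilon>) \<le> (\<Sum>j<L. g (w j))}"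
    have finW: "finite ?W" using E by (intro finite_PiE) auto
    have pn: "0 \<le> (\<Prod>j<L. p (w j))" if "w \<in> ?W" for w using that p(1) by (intro prod_nonneg) auto
    have "exp (\<theta> * \<epsilon> * real L) * (\<Sum>w\<in>?T. \<Prod>j<L. p (w j)) = (\<Sum>w\<in>?T. (\<Prod>j<L. p (w j)) * exp (\<theta> * \<epsilon> * real L))"
      by (simp add: sum_distrib_left mult.commute)
    also have "\<dots> \<le> (\<Sum>w\<in>?T. (\<Prod>j<L. p (w j)) * exp (\<theta> * (\<Sum>j<L. h (w j))))"
    proof (rule sum_mono)
      fix w assume w: "w \<in> ?T"
      have "\<epsilon> * real L \<le> (\<Sum>j<L. h (w j))" using w by (simp add: h_def sum_subtractf algebra_simps)
      then have "\<theta> * (\<epsilon> * real L) \<le> \<theta> * (\<Sum>j<L. h (w j))" using th(1) by (intro mult_left_mono) auto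
      then show "(\<Prod>j<L. p (w j)) * exp (\<theta> * \<epsilon> * real L) \<le> (\<Prod>j<L. p (w j)) * exp (\<theta> * (\<Sum>j<L. h (w j)))"
        using pn[of w] w by (intro mult_left_mono) (auto simp: mult.assoc)
    qed
    also have "\<dots> \<le> (\<Sum>w\<in>?W. (\<Prod>j<L. p (w j)) * exp (\<theta> * (\<Sum>j<L. h (w j))))"
      using finW pn by (intro sum_mono2) auto
    also have "\<dots> = (\<Sum>w\<in>?W. \<Prod>j<L. p (w j) * exp (\<theta> * h (w j)))"
      by (simp add: prod.distrib exp_sum sum_distrib_left)
    also have "\<dots> = (\<Prod>j<L. \<Sum>e\<in>E. p e * exp (\<theta> * h e))"
      using E by (intro prod_sum_PiE[symmetric]) auto
    also have "\<dots> = (\<Sum>e\<in>E. p e * exp (\<theta> * h e)) ^ L" by simp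
    also have "\<dots> \<le> exp (\<theta> * \<epsilon> / 2) ^ L" using mgf p(1) by (intro power_mono sum_nonneg) auto
    also have "\<dots> = exp (\<theta> * \<epsilon> * real L) * exp (- (\<theta> * \<epsilon> / 2) * real L)"
      by (simp add: exp_of_nat_mult[symmetric] exp_add[symmetric] algebra_simps)
    finally show ?thesis by simp
  qed
  then show ?thesis using th(1) eps unfolding m_def by (intro exI[of _ "\<theta> * \<epsilon> / 2"]) auto
qed

text \<open>Asymptotic equipartition with several observables: atypical words have total mass below
  1/2, and a typical word has mass at most exp (-L (H - \<epsilon>/2)) with H the entropy of
  \<open>p\<close>; so typical words are many.\<close>

lemma iid_words:
  fixes p :: "'e \<Rightarrow> real"
  assumes E: "finite E" and p: "\<And>e. e \<in> E \<Longrightarrow> 0 \<le> p e" "sum p E = 1" and Gs: "finite Gs" and eps: "0 < \<epsilon>"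
  shows "\<forall>\<^sub>F L in sequentially. \<exists>W \<subseteq> {..<L} \<rightarrow>\<^sub>E E.
     exp (real L * (- (\<Sum>e\<in>E. p e * ln (p e)) - \<epsilon>)) \<le> real (card W) \<and>
     (\<forall>w\<in>W. \<forall>g\<in>Gs. \<bar>(\<Sum>j<L. g (w j)) - real L * (\<Sum>e\<in>E. p e * g e)\<bar> \<le> \<epsilon> * real L)"
proof -
  \<comment> \<open>Both signs of each \<open>g\<close> give two-sided estimates; the logarithm of
    \<open>p\<close> bounds the mass of a single word from above.\<close>
  define Hs where "Hs = insert (\<lambda>e. ln (p e)) (Gs \<union> (\<lambda>g e. - g e) ` Gs)"
  have Hs: "finite Hs" using Gs by (simp add: Hs_def)
  define m where "m h = (\<Sum>e\<in>E. p e * h e)" for h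
  define pw where "pw L w = (\<Prod>j<L. p (w j))" for L and w :: "nat \<Rightarrow> 'e"
  define T where "T h L = {w \<in> {..<L} \<rightarrow>\<^sub>E E. real L * (m h + \<epsilon> / 2) \<le> (\<Sum>j<L. h (w j))}" for h L
  have "\<exists>c>0. \<forall>L. (\<Sum>w\<in>T h L. pw L w) \<le> exp (- c * real L)" for h
    unfolding T_def pw_def m_def by (rule iid_tail[OF E p]) (use eps in auto)
  then obtain c where c: "\<And>h. c h > 0" "\<And>h L. (\<Sum>w\<in>T h L. pw L w) \<le> exp (- c h * real L)" by metis
  have "(\<lambda>L. \<Sum>h\<in>Hs. exp (- c h * real L)) \<longlonglongrightarrow> (\<Sum>h\<in>Hs. 0)"
  proof (rule tendsto_sum)
    fix h
    have "filterlim (\<lambda>L. c h * real L) at_top sequentially"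
      using c(1)[of h] by (intro filterlim_tendsto_pos_mult_at_top[OF tendsto_const _ filterlim_real_sequentially]) auto
    then show "(\<lambda>L. exp (- c h * real L)) \<longlonglongrightarrow> 0"
      using filterlim_compose[OF exp_at_bot, of "\<lambda>L. - (c h * real L)"] by (simp add: filterlim_uminus_at_top)
  qed
  then have "\<forall>\<^sub>F L in sequentially. (\<Sum>h\<in>Hs. exp (- c h * real L)) < 1 / 2" by (intro order_tendstoD(2)) auto
  \<comment> \<open>For \<open>L \<ge> N\<close> the slack \<open>L * \<epsilon> / 2\<close> exceeds
    \<open>ln 2\<close> and absorbs the factor 1/2.\<close>
  moreover obtain N :: nat where N: "2 * ln 2 / \<epsilon> < real N" using reals_Archimedean2 by blast
  have "\<forall>\<^sub>F L in sequentially. L \<ge> N" by (rule eventually_ge_at_top)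
  ultimately show ?thesis
  proof eventually_elim
    case (elim L)
    let ?P = "{..<L} \<rightarrow>\<^sub>E E"
    define W where "W = {w \<in> ?P. \<forall>h\<in>Hs. (\<Sum>j<L. h (w j)) < real L * (m h + \<epsilon> / 2)}"
    have finP: "finite ?P" using E by (intro finite_PiE) auto
    have pn: "0 \<le> pw L w" if "w \<in> ?P" for w unfolding pw_def using that p(1) by (intro prod_nonneg) auto
    have tot: "(\<Sum>w\<in>?P. pw L w) = 1"
    proof -
      have "(\<Sum>w\<in>?P. pw L w) = (\<Prod>j<L. \<Sum>e\<in>E. p e)" unfolding pw_def using E by (intro prod_sum_PiE[symmetric]) auto
      then show ?thesis using p(2) by simp
    qed
    have "?P \<subseteq> W \<union> (\<Union>h\<in>Hs. T h L)" by (auto simp: W_def T_def not_less)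
    then have "(\<Sum>w\<in>?P. pw L w) \<le> (\<Sum>w\<in>W \<union> (\<Union>h\<in>Hs. T h L). pw L w)"
      using finP Hs pn by (intro sum_mono2) (auto simp: W_def T_def intro: finite_subset)
    also have "\<dots> \<le> (\<Sum>w\<in>W. pw L w) + (\<Sum>w\<in>(\<Union>h\<in>Hs. T h L). pw L w)"
    proof -
      have "finite W" "finite (\<Union>h\<in>Hs. T h L)" using finP Hs by (auto simp: W_def T_def)
      then have "(\<Sum>w\<in>W \<union> (\<Union>h\<in>Hs. T h L). pw L w) + (\<Sum>w\<in>W \<inter> (\<Union>h\<in>Hs. T h L). pw L w) = (\<Sum>w\<in>W. pw L w) + (\<Sum>w\<in>(\<Union>h\<in>Hs. T h L). pw L w)"
        by (rule sum.union_inter)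
      moreover have "0 \<le> (\<Sum>w\<in>W \<inter> (\<Union>h\<in>Hs. T h L). pw L w)" using pn by (intro sum_nonneg) (auto simp: W_def)
      ultimately show ?thesis by linarith
    qed
    also have "(\<Sum>w\<in>(\<Union>h\<in>Hs. T h L). pw L w) \<le> (\<Sum>h\<in>Hs. \<Sum>w\<in>T h L. pw L w)"
      using Hs pn finP
    proof (induction Hs rule: finite_induct)
      case (insert h H)
      have fin: "finite (T h L)" "finite (\<Union>h\<in>H. T h L)" using insert.hyps insert.prems by (auto simp: T_def)
      have "(\<Sum>w\<in>T h L \<union> (\<Union>h\<in>H. T h L). pw L w) + (\<Sum>w\<in>T h L \<inter> (\<Union>h\<in>H. T h L). pw L w) = (\<Sum>w\<in>T h L. pw L w) + (\<Sum>w\<in>(\<Union>h\<in>H. T h L). pw L w)"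
        by (rule sum.union_inter[OF fin])
      moreover have "0 \<le> (\<Sum>w\<in>T h L \<inter> (\<Union>h\<in>H. T h L). pw L w)" using insert.prems(1) by (intro sum_nonneg) (auto simp: T_def)
      ultimately show ?case using insert.IH[OF insert.prems] insert.hyps by simp
    qed simp
    also have "\<dots> \<le> (\<Sum>h\<in>Hs. exp (- c h * real L))" by (intro sum_mono c(2))
    also have "\<dots> < 1 / 2" by (rule elim(1))
    finally have half: "1 / 2 < (\<Sum>w\<in>W. pw L w)" using tot by simp
    let ?H = "- (\<Sum>e\<in>E. p e * ln (p e))"
    have "(\<Sum>w\<in>W. pw L w) \<le> (\<Sum>w\<in>W. exp (real L * (- ?H + \<epsilon> / 2)))"
    proof (rule sum_mono)
      fix w assume w: "w \<in> W"
      have "pw L w \<le> exp (\<Sum>j<L. ln (p (w j)))"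
      \<comment> \<open>Letters of probability zero are treated apart: with \<open>ln 0 = 0\<close>
        the mass is no longer the exponential of the sum of logarithms, but it vanishes.\<close>
      proof (cases "\<exists>j<L. p (w j) = 0")
        case True
        then have "pw L w = 0" by (auto simp: pw_def)
        then show ?thesis by simp
      next
        case False
        have "0 < p (w j)" if "j < L" for j
        proof -
          have "w j \<in> E" using w that by (auto simp: W_def)
          then show ?thesis using p(1)[of "w j"] False that by (metis less_eq_real_def)
        qed
        then show ?thesis by (simp add: pw_def exp_sum)
      qed
      also have "\<dots> \<le> exp (real L * (- ?H + \<epsilon> / 2))"
      proof -
        have "(\<Sum>j<L. ln (p (w j))) < real L * (m (\<lambda>e. ln (p e)) + \<epsilon> / 2)" using w by (auto simp: W_def Hs_def)
        then show ?thesis by (simp add: m_def)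
      qed
      finally show "pw L w \<le> exp (real L * (- ?H + \<epsilon> / 2))" .
    qed
    also have "\<dots> = real (card W) * exp (real L * (- ?H + \<epsilon> / 2))" by simp
    finally have "1 / 2 < real (card W) * exp (real L * (- ?H + \<epsilon> / 2))" using half by linarith
    moreover have "real L * (- ?H + \<epsilon> / 2) = - (real L * (?H - \<epsilon> / 2))" by (simp add: algebra_simps)
    ultimately have "1 / 2 < real (card W) * exp (- (real L * (?H - \<epsilon> / 2)))" by simp
    then have cardW: "1 / 2 * exp (real L * (?H - \<epsilon> / 2)) < real (card W)"
      unfolding exp_minus by (simp add: field_simps)
    have "exp (real L * (?H - \<epsilon>)) \<le> 1 / 2 * exp (real L * (?H - \<epsilon> / 2))"
    proof -
      have "2 * ln 2 / \<epsilon> < real L" using N elim(2) by linarith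
      then have "ln 2 \<le> real L * (\<epsilon> / 2)" using eps by (simp add: field_simps)
      then have "real L * (?H - \<epsilon>) \<le> - ln 2 + real L * (?H - \<epsilon> / 2)" by (simp add: algebra_simps)
      then have "exp (real L * (?H - \<epsilon>)) \<le> exp (- ln 2 + real L * (?H - \<epsilon> / 2))" by simp
      also have "\<dots> = 1 / 2 * exp (real L * (?H - \<epsilon> / 2))" unfolding exp_add by (simp add: exp_minus)
      finally show ?thesis .
    qed
    then have c1: "exp (real L * (?H - \<epsilon>)) \<le> real (card W)" using cardW by linarith
    have c2: "\<bar>(\<Sum>j<L. g (w j)) - real L * (\<Sum>e\<in>E. p e * g e)\<bar> \<le> \<epsilon> * real L" if w: "w \<in> W" and g: "g \<in> Gs" for w g
    proof -
      have gH: "g \<in> Hs" "(\<lambda>e. - g e) \<in> Hs" using g by (auto simp: Hs_def)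
      have Wh: "\<forall>h\<in>Hs. (\<Sum>j<L. h (w j)) < real L * (m h + \<epsilon> / 2)" using w by (simp add: W_def)
      have up: "(\<Sum>j<L. g (w j)) < real L * m g + real L * (\<epsilon> / 2)" using bspec[OF Wh gH(1)] by (simp add: distrib_left)
      have "m (\<lambda>e. - g e) = - m g" by (simp add: m_def sum_negf)
      then have lo: "- (\<Sum>j<L. g (w j)) < - (real L * m g) + real L * (\<epsilon> / 2)"
        using bspec[OF Wh gH(2)] by (simp add: sum_negf distrib_left right_diff_distrib)
      have "real L * (\<epsilon> / 2) \<le> \<epsilon> * real L" using eps by (simp add: mult.commute)
      then show ?thesis unfolding m_def[symmetric] using up lo by linarith
    qed
    show ?case using c1 c2 by (intro exI[of _ W]) (auto simp: W_def)
  qed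
qed

section \<open>An invariant measure that dominates the pressure at a fixed scale\<close>

context dyn_system
begin

text \<open>\<open>Q\<close> is a weak limit of orbit averages of Gibbs weights on separated sets
  that also cover. A coding with cells of diameter at most \<open>\<epsilon>\<close>, within which
  distances stay strictly below \<open>\<epsilon>\<close>, separates these sets; null boundaries let
  its block entropies pass to the limit.\<close>

lemma press_le_equilibrium:
  assumes ne: "M \<noteq> {}" and G: "AA G" and e: "0 < \<epsilon>"
  shows "\<exists>Q\<in>inv_probs M \<phi>. press G \<epsilon> \<le> ereal (seq_functional G Q) + ks_entropy M \<phi> Q"
proof -
  have "\<exists>E. covers E n \<epsilon> \<and> (\<forall>x\<in>E. \<forall>y\<in>E. x \<noteq> y \<longrightarrow> (\<exists>k<n. \<epsilon> \<le> dist ((\<phi> ^^ k) x) ((\<phi> ^^ k) y)))" for n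
    by (rule covers_separated[OF e, of n]) blast
  then have "\<forall>n. \<exists>E. covers E n \<epsilon> \<and> (\<forall>x\<in>E. \<forall>y\<in>E. x \<noteq> y \<longrightarrow> (\<exists>k<n. \<epsilon> \<le> dist ((\<phi> ^^ k) x) ((\<phi> ^^ k) y)))" by blast
  from choice[OF this] obtain E where Ec: "\<And>n. covers (E n) n \<epsilon>"
    and Es: "\<And>n x y. x \<in> E n \<Longrightarrow> y \<in> E n \<Longrightarrow> x \<noteq> y \<Longrightarrow> \<exists>k<n. \<epsilon> \<le> dist ((\<phi> ^^ k) x) ((\<phi> ^^ k) y)" by blast
  have E: "finite (E n)" "E n \<subseteq> M" "E n \<noteq> {}" for n using Ec[of n] ne by (auto simp: covers_def)
  define Z where "Z n = (\<Sum>x\<in>E n. exp (G n x))" for n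
  define \<mu> where "\<mu> n = dirac_mix (E n \<times> {..<n}) (\<lambda>(x, i). exp (G n x) / Z n / real n) (\<lambda>(x, i). (\<phi> ^^ i) x)" for n
  have SE1: "\<mu> n \<in> probs M" if "1 \<le> n" for n
    unfolding \<mu>_def Z_def by (rule separated_entropy_bound(1)[OF that E])
  have SE2: "(\<integral>x. g x \<partial>\<mu> n) = (\<Sum>x\<in>E n. exp (G n x) / Z n * birkhoff \<phi> n g x) / real n"
    if "1 \<le> n" "continuous_on M g" for n g
    unfolding \<mu>_def Z_def by (rule separated_entropy_bound(2)[OF that(1) E that(2)])
  have SE3: "ln (Z n) / real n \<le> Hfun (\<mu> n) (word f q) / real q + real q * ln (card (f ` M)) / real n
        + (\<Sum>x\<in>E n. exp (G n x) / Z n * G n x) / real n"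
    if "1 \<le> n" "1 \<le> q" "simple_function BM f" "inj_on (word f n) (E n)" for n q and f :: "'a \<Rightarrow> 'a set"
    unfolding \<mu>_def Z_def by (rule separated_entropy_bound(3)[OF that(1) E that(2-4)])
  have Zpos: "0 < Z n" for n unfolding Z_def using E by (intro sum_pos) auto
  have wsum: "(\<Sum>x\<in>E n. exp (G n x) / Z n) = 1" for n using Zpos[of n] by (simp add: Z_def sum_divide_distrib[symmetric])
  have wnn: "0 \<le> exp (G n x) / Z n" for n x using Zpos[of n] by simp
  define u where "u n = ln (cover_sum M \<phi> G n \<epsilon>) / real n" for n
  have uZ: "u n \<le> ln (Z n) / real n" for n
    unfolding u_def Z_def using cover_sum_le[OF Ec] cover_sum_pos[OF e ne G]
    by (intro divide_right_mono ln_mono) auto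
  obtain r0 where r0: "strict_mono (r0 :: nat \<Rightarrow> nat)" "(\<lambda>n. ereal (u (r0 n))) \<longlonglongrightarrow> press G \<epsilon>"
    using limsup_subseq_lim[of "\<lambda>n. ereal (u n)"] unfolding press_def u_def by (auto simp: comp_def)
  \<comment> \<open>The shift keeps every length at least 1, where the orbit average is a
    probability.\<close>
  define s where "s n = r0 (Suc n)" for n
  have s1: "1 \<le> s n" for n using seq_suble[OF r0(1), of "Suc n"] by (simp add: s_def)
  have sm: "strict_mono s" using r0(1) by (auto simp: strict_mono_def s_def)
  obtain r1 Q where r1: "strict_mono (r1 :: nat \<Rightarrow> nat)" and Qp: "Q \<in> probs M" and w0: "wconv ((\<lambda>n. \<mu> (s n)) \<circ> r1) Q"
    using seq_compact_probs[of "\<lambda>n. \<mu> (s n)"] SE1[OF s1] by blast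
  define t where "t n = s (r1 n)" for n
  have t1: "1 \<le> t n" for n using s1 by (simp add: t_def)
  have tm: "strict_mono t" using sm r1 by (auto simp: strict_mono_def t_def)
  have tt: "filterlim t sequentially sequentially" by (rule filterlim_subseq[OF tm])
  define X where "X n = \<mu> (t n)" for n
  have w: "wconv X Q" using w0 by (simp add: comp_def X_def[abs_def] t_def)
  have Xp: "X n \<in> probs M" for n unfolding X_def using SE1 t1 by blast
  have Xi: "(\<integral>x. g x \<partial>X n) = (\<Sum>x\<in>E (t n). exp (G (t n) x) / Z (t n) * birkhoff \<phi> (t n) g x) / real (t n)"
    if "continuous_on M g" for g n unfolding X_def by (rule SE2[OF t1 that])
  have ut: "(\<lambda>n. ereal (u (t n))) \<longlonglongrightarrow> press G \<epsilon>"
    using LIMSEQ_subseq_LIMSEQ[OF LIMSEQ_Suc[OF r0(2)] r1] by (simp add: comp_def t_def s_def)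
  have tinv: "(\<lambda>n. c / real (t n)) \<longlonglongrightarrow> 0" for c :: real
    by (intro tendsto_divide_0[OF tendsto_const] filterlim_compose[OF filterlim_real_sequentially tt] filterlim_at_top_imp_at_infinity)
  have Qi: "Q \<in> inv_probs M \<phi>"
  proof (rule inv_probsI[OF Qp])
    fix f :: "'a \<Rightarrow> real" assume f: "continuous_on M f"
    have f1: "continuous_on M (\<lambda>x. f (\<phi> x))" using comp_iter_cont[OF f, of 1] by simp
    obtain B where B: "0 < B" "\<And>x. x \<in> M \<Longrightarrow> \<bar>f x\<bar> \<le> B" by (rule continuous_bound[OF f]) blast
    \<comment> \<open>Shifting the observable by one step changes the Birkhoff sum only in its two
      end terms, which vanish after division by the length; so the limit is invariant.\<close>
    have diff: "birkhoff \<phi> n (\<lambda>x. f (\<phi> x)) x - birkhoff \<phi> n f x = f ((\<phi> ^^ n) x) - f x" for n x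
      unfolding birkhoff_def sum_subtractf[symmetric] using sum_lessThan_telescope[of "\<lambda>k. f ((\<phi> ^^ k) x)" n] by simp
    have "norm ((\<integral>x. f (\<phi> x) \<partial>X n) - (\<integral>x. f x \<partial>X n)) \<le> (2 * B) / real (t n)" for n
    proof -
      let ?w = "\<lambda>x. exp (G (t n) x) / Z (t n)"
      have "(\<integral>x. f (\<phi> x) \<partial>X n) - (\<integral>x. f x \<partial>X n) = (\<Sum>x\<in>E (t n). ?w x * (f ((\<phi> ^^ t n) x) - f x)) / real (t n)"
        unfolding Xi[OF f] Xi[OF f1] by (simp add: diff_divide_distrib[symmetric] sum_subtractf[symmetric] right_diff_distrib[symmetric] diff)
      moreover have "\<bar>\<Sum>x\<in>E (t n). ?w x * (f ((\<phi> ^^ t n) x) - f x)\<bar> \<le> (\<Sum>x\<in>E (t n). ?w x * (2 * B))"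
      proof (rule order_trans[OF sum_abs sum_mono])
        fix x assume "x \<in> E (t n)"
        then have xM: "x \<in> M" using E by blast
        have "\<bar>f ((\<phi> ^^ t n) x) - f x\<bar> \<le> 2 * B" using B(2)[OF xM] B(2)[OF iter_in[OF xM, of "t n"]] by linarith
        then show "\<bar>?w x * (f ((\<phi> ^^ t n) x) - f x)\<bar> \<le> ?w x * (2 * B)"
          unfolding abs_mult using wnn[of "t n" x] by (simp only: abs_of_nonneg mult_left_mono)
      qed
      moreover have "(\<Sum>x\<in>E (t n). ?w x * (2 * B)) = 2 * B"
        unfolding sum_distrib_right[symmetric] wsum by simp
      ultimately show ?thesis by (simp add: divide_right_mono)
    qed
    then have "(\<lambda>n. (\<integral>x. f (\<phi> x) \<partial>X n) - (\<integral>x. f x \<partial>X n)) \<longlonglongrightarrow> 0"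
      by (intro Lim_null_comparison[OF always_eventually tinv[of "2 * B"]]) blast
    moreover have "(\<lambda>n. (\<integral>x. f (\<phi> x) \<partial>X n) - (\<integral>x. f x \<partial>X n)) \<longlonglongrightarrow> (\<integral>x. f (\<phi> x) \<partial>Q) - (\<integral>x. f x \<partial>Q)"
      using w f f1 unfolding wconv_def by (intro tendsto_diff) auto
    ultimately have "(\<integral>x. f (\<phi> x) \<partial>Q) - (\<integral>x. f x \<partial>Q) = 0" by (rule LIMSEQ_unique[symmetric])
    then show "(\<integral>x. f (\<phi> x) \<partial>Q) = (\<integral>x. f x \<partial>Q)" by simp
  qed
  have e4: "0 < \<epsilon> / 4" using e by simp
  obtain F where F: "finite F" "F \<subseteq> M" "\<And>x. x \<in> M \<Longrightarrow> \<exists>p\<in>F. dist x p < \<epsilon> / 4" by (rule finite_net[OF e4]) blast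
  have Fne: "F \<noteq> {}" using ne F(3) by blast
  \<comment> \<open>Radii above \<open>\<epsilon> / 4\<close> keep the balls a cover, radii below
    \<open>\<epsilon> / 2\<close> keep the cells small; in between, each centre has a sphere without
    mass.\<close>
  have "\<exists>r. \<epsilon> / 4 < r \<and> r < \<epsilon> / 2 \<and> measure Q {x \<in> M. dist x p = r} = 0" for p
    by (rule null_sphere[OF Qp, of "\<epsilon> / 4" "\<epsilon> / 2" p]) (use e in auto)
  then have "\<forall>p. \<exists>r. \<epsilon> / 4 < r \<and> r < \<epsilon> / 2 \<and> measure Q {x \<in> M. dist x p = r} = 0" by blast
  from choice[OF this] obtain rad where rad: "\<And>p. \<epsilon> / 4 < rad p" "\<And>p. rad p < \<epsilon> / 2"
    "\<And>p. measure Q {x \<in> M. dist x p = rad p} = 0" by blast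
  \<comment> \<open>A point is coded by the set of all balls that contain it, so the balls need not
    be made disjoint.\<close>
  define f where "f x = {p \<in> F. dist x p < rad p}" for x
  have dc: "continuous_on M (\<lambda>x. dist x p)" for p by (intro continuous_intros)
  have lm: "{x \<in> M. dist x p < rad p} \<in> sets BM" "{x \<in> M. \<not> dist x p < rad p} \<in> sets BM" "{x \<in> M. dist x p = rad p} \<in> sets BM" for p
    using borel_measurable_less[OF continuous_borel[OF dc] borel_measurable_const[of "rad p" BM], of p]
      borel_measurable_le[OF borel_measurable_const[of "rad p" BM] continuous_borel[OF dc], of p]
      borel_measurable_eq[OF continuous_borel[OF dc] borel_measurable_const[of "rad p" BM], of p]
    by (simp_all add: not_less)
  have sf: "simple_function BM f"
    unfolding simple_function_def space_BM
  proof (intro conjI ballI)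
    have "f ` M \<subseteq> Pow F" by (auto simp: f_def)
    then show "finite (f ` M)" using F(1) by (meson finite_Pow_iff finite_subset)
    fix v assume "v \<in> f ` M"
    then have v: "v \<subseteq> F" by (auto simp: f_def)
    have "f -` {v} \<inter> M = (\<Inter>p\<in>F. (if p \<in> v then {x \<in> M. dist x p < rad p} else {x \<in> M. \<not> dist x p < rad p}))"
      (is "_ = (\<Inter>p\<in>F. ?S p)")
    proof (intro set_eqI iffI)
      fix x assume "x \<in> f -` {v} \<inter> M"
      then have "x \<in> M" "v = {p \<in> F. dist x p < rad p}" by (auto simp: f_def)
      then show "x \<in> (\<Inter>p\<in>F. ?S p)" by auto
    next
      fix x assume x: "x \<in> (\<Inter>p\<in>F. ?S p)"
      have a: "x \<in> ?S p" if "p \<in> F" for p using x that by (rule INT_D)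
      obtain p0 where "p0 \<in> F" using Fne by blast
      from a[OF this] have xM: "x \<in> M" by (auto split: if_splits)
      have "p \<in> v \<longleftrightarrow> dist x p < rad p" if "p \<in> F" for p using a[OF that] by (auto split: if_splits)
      then have "f x = v" using v by (auto simp: f_def)
      then show "x \<in> f -` {v} \<inter> M" using xM by simp
    qed
    also have "\<dots> \<in> sets BM" using F(1) Fne lm by (intro sets.finite_INT) auto
    finally show "f -` {v} \<inter> M \<in> sets BM" .
  qed
  have fclose: "dist x y < \<epsilon>" if xM: "x \<in> M" and fxy: "f x = f y" for x y
  proof -
    obtain p where p: "p \<in> F" "dist x p < \<epsilon> / 4" using F(3)[OF xM] by blast
    then have "p \<in> f x" using rad(1)[of p] by (simp add: f_def)
    then have "dist x p < rad p" "dist y p < rad p" using fxy by (auto simp: f_def)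
    then show ?thesis using rad(2)[of p] dist_triangle2[of x y p] by linarith
  qed
  have inj: "inj_on (word f n) (E n)" for n
  proof (rule inj_onI, rule ccontr)
    fix x y assume xy: "x \<in> E n" "y \<in> E n" "word f n x = word f n y" "x \<noteq> y"
    then obtain k where k: "k < n" "\<epsilon> \<le> dist ((\<phi> ^^ k) x) ((\<phi> ^^ k) y)" using Es by blast
    have "f ((\<phi> ^^ k) x) = f ((\<phi> ^^ k) y)" using xy(3) k(1) by (auto simp: word_def)
    moreover have "(\<phi> ^^ k) x \<in> M" using iter_in E xy(1) by blast
    ultimately show False using fclose k(2) by (meson not_less)
  qed
  have HX: "(\<lambda>n. Hfun (X n) (word f q)) \<longlonglongrightarrow> Hfun Q (word f q)" for q
  proof -
    interpret prob_space Q using probs_prob_space[OF Qp] .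
    \<comment> \<open>The points whose orbit meets one of the spheres before time \<open>q\<close>:
      null by invariance, and off this set the itinerary is locally constant.\<close>
    define D where "D = (\<Union>k\<in>{..<q}. \<Union>p\<in>F. (\<phi> ^^ k) -` {x \<in> M. dist x p = rad p} \<inter> M)"
    have nul: "(\<phi> ^^ k) -` {x \<in> M. dist x p = rad p} \<inter> M \<in> null_sets Q" for k p
      using inv_probs_measure[OF Qi lm(3), of k p] rad(3)[of p] measurable_sets[OF iter_measurable lm(3), of k p] probs_sets[OF Qp]
      by (intro null_setsI) (auto simp: emeasure_eq_measure)
    have "D \<in> null_sets Q" unfolding D_def using F(1) nul
      by (intro null_sets_UN' countable_finite) auto
    then have D: "D \<in> sets BM" "measure Q D = 0" using probs_sets[OF Qp] by (auto simp: null_sets_def measure_def)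
    show ?thesis
    proof (rule Hfun_wconv[OF Xp Qp w simple_function_word[OF sf] D])
      fix x assume x: "x \<in> M - D"
      have "\<forall>\<^sub>F y in at x within M. \<forall>k\<in>{..<q}. \<forall>p\<in>F. dist ((\<phi> ^^ k) y) p < rad p \<longleftrightarrow> dist ((\<phi> ^^ k) x) p < rad p"
      proof (intro eventually_ball_finite ballI F(1) finite_lessThan)
        fix k p assume k: "k \<in> {..<q}" and p: "p \<in> F"
        have lim: "((\<lambda>y. dist ((\<phi> ^^ k) y) p) \<longlongrightarrow> dist ((\<phi> ^^ k) x) p) (at x within M)"
          using comp_iter_cont[OF dc, of k p] x by (auto simp: continuous_on_def)
        have "dist ((\<phi> ^^ k) x) p \<noteq> rad p" using x k p iter_in[of x k] by (auto simp: D_def)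
        then consider "dist ((\<phi> ^^ k) x) p < rad p" | "rad p < dist ((\<phi> ^^ k) x) p" by linarith
        then show "\<forall>\<^sub>F y in at x within M. dist ((\<phi> ^^ k) y) p < rad p \<longleftrightarrow> dist ((\<phi> ^^ k) x) p < rad p"
        proof cases
          case 1
          from order_tendstoD(2)[OF lim 1] show ?thesis by eventually_elim (use 1 in simp)
        next
          case 2
          from order_tendstoD(1)[OF lim 2] show ?thesis by eventually_elim (use 2 in simp)
        qed
      qed
      then show "\<forall>\<^sub>F y in at x within M. word f q y = word f q x"
        by eventually_elim (auto simp: word_def f_def)
    qed
  qed
  \<comment> \<open>The block length \<open>q\<close> is fixed while the orbit length grows, which
    removes the cardinality term. Afterwards the tolerance \<open>d\<close> goes to 0 and
    \<open>q\<close> to infinity.\<close>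
  have key: "press G \<epsilon> \<le> ereal (Hfun Q (word f q) / real q + seq_functional G Q + 2 * d)" if q: "1 \<le> q" and d: "0 < d" for q d
  proof -
    obtain g where g: "continuous_on M g" "\<forall>\<^sub>F n in sequentially. \<forall>x\<in>M. \<bar>G n x - birkhoff \<phi> n g x\<bar> \<le> d * real n"
      using AA_approx[OF G d] by blast
    let ?R = "\<lambda>n. Hfun (X n) (word f q) / real q + (real q * ln (card (f ` M))) / real (t n) + ((\<integral>x. g x \<partial>X n) + d)"
    have "\<forall>\<^sub>F n in sequentially. \<forall>x\<in>M. \<bar>G (t n) x - birkhoff \<phi> (t n) g x\<bar> \<le> d * real (t n)"
      using tt g(2) by (auto simp: filterlim_iff)
    then have le: "\<forall>\<^sub>F n in sequentially. ereal (u (t n)) \<le> ereal (?R n)"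
    proof eventually_elim
      case (elim n)
      let ?w = "\<lambda>x. exp (G (t n) x) / Z (t n)"
      have "(\<Sum>x\<in>E (t n). ?w x * G (t n) x) \<le> (\<Sum>x\<in>E (t n). ?w x * (birkhoff \<phi> (t n) g x + d * real (t n)))"
      proof (intro sum_mono mult_left_mono wnn)
        fix x assume "x \<in> E (t n)"
        then have "x \<in> M" using E by blast
        then show "G (t n) x \<le> birkhoff \<phi> (t n) g x + d * real (t n)" using elim by (auto simp: abs_le_iff algebra_simps)
      qed
      also have "\<dots> = (\<Sum>x\<in>E (t n). ?w x * birkhoff \<phi> (t n) g x) + (\<Sum>x\<in>E (t n). ?w x) * (d * real (t n))"
        by (simp only: distrib_left sum.distrib sum_distrib_right)
      finally have "(\<Sum>x\<in>E (t n). ?w x * G (t n) x) / real (t n) \<le> ((\<Sum>x\<in>E (t n). ?w x * birkhoff \<phi> (t n) g x) + d * real (t n)) / real (t n)"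
        unfolding wsum by (intro divide_right_mono) auto
      also have "\<dots> = (\<integral>x. g x \<partial>X n) + d" unfolding Xi[OF g(1)] using t1[of n] by (simp add: add_divide_distrib)
      finally have "(\<Sum>x\<in>E (t n). ?w x * G (t n) x) / real (t n) \<le> (\<integral>x. g x \<partial>X n) + d" .
      moreover have "ln (Z (t n)) / real (t n) \<le> Hfun (X n) (word f q) / real q + real q * ln (card (f ` M)) / real (t n)
         + (\<Sum>x\<in>E (t n). ?w x * G (t n) x) / real (t n)"
        unfolding X_def by (rule SE3[OF t1 q sf inj])
      ultimately show ?case using uZ[of "t n"] by simp
    qed
    have "(\<lambda>n. ereal (?R n)) \<longlonglongrightarrow> ereal (Hfun Q (word f q) / real q + 0 + ((\<integral>x. g x \<partial>Q) + d))"
      using w g(1) q unfolding wconv_def by (intro tendsto_ereal tendsto_add tinv tendsto_const tendsto_divide HX) auto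
    from tendsto_le[OF sequentially_bot this ut le]
    have "press G \<epsilon> \<le> ereal (Hfun Q (word f q) / real q + ((\<integral>x. g x \<partial>Q) + d))" by simp
    also have "\<dots> \<le> ereal (Hfun Q (word f q) / real q + seq_functional G Q + 2 * d)"
      using seq_functional_close[OF G Qi g] by simp
    finally show ?thesis .
  qed
  have key2: "press G \<epsilon> \<le> ereal (Hfun Q (word f q) / real q + seq_functional G Q)" if q: "1 \<le> q" for q
  proof (rule ereal_le_epsilon)
    fix d :: ereal assume d: "0 < d"
    show "press G \<epsilon> \<le> ereal (Hfun Q (word f q) / real q + seq_functional G Q) + d"
    proof (cases d)
      case (real d')
      then show ?thesis using key[OF q, of "d' / 2"] d by simp
    qed (use d in auto)
  qed
  have lim: "(\<lambda>q. ereal (Hfun Q (word f q) / real q + seq_functional G Q)) \<longlonglongrightarrow> ereal (hfun Q f + seq_functional G Q)"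
    by (intro tendsto_ereal tendsto_add tendsto_const hfun(1)[OF Qi sf])
  have "press G \<epsilon> \<le> ereal (hfun Q f + seq_functional G Q)"
    using key2 by (intro tendsto_lowerbound[OF lim]) (auto simp: eventually_sequentially intro!: exI[of _ 1])
  also have "\<dots> = ereal (seq_functional G Q) + ereal (hfun Q f)" by simp
  also have "\<dots> \<le> ereal (seq_functional G Q) + ks_entropy M \<phi> Q"
    by (intro add_left_mono hfun_le_ks_entropy[OF Qi sf])
  finally show ?thesis using Qi by blast
qed

theorem variational_upper:
  assumes "M \<noteq> {}" "AA G"
    and le: "\<And>Q. Q \<in> inv_probs M \<phi> \<Longrightarrow> ereal (seq_functional G Q) + ks_entropy M \<phi> Q \<le> c"
  shows "pressure_ereal M \<phi> G \<le> c"
  unfolding pressure_ereal_SUP[OF assms(1,2)]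
proof (rule SUP_least)
  fix e :: real assume "e \<in> {0<..}"
  then show "press G e \<le> c" using press_le_equilibrium[OF assms(1,2), of e] le by (auto intro: order_trans)
qed

end

lemma compact_closed_separated:
  fixes S T :: "'a::metric_space set"
  assumes S: "compact S" and T: "closed T" and disj: "S \<inter> T = {}"
  shows "\<exists>d>0. \<forall>x\<in>S. \<forall>y\<in>T. d \<le> dist x y"
proof (cases "S = {} \<or> T = {}")
  case True then show ?thesis by (intro exI[of _ 1]) auto
next
  case False
  have "continuous_on S (\<lambda>x. infdist x T)" by (intro continuous_intros)
  then obtain x0 where x0: "x0 \<in> S" "\<forall>x\<in>S. infdist x0 T \<le> infdist x T"
    using continuous_attains_inf[OF S] False by blast
  have "x0 \<notin> T" using x0(1) disj by auto
  then have "infdist x0 T \<noteq> 0" using T False by (simp add: in_closed_iff_infdist_zero)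
  then have "0 < infdist x0 T" using infdist_nonneg[of x0 T] by simp
  moreover have "infdist x0 T \<le> dist x y" if "x \<in> S" "y \<in> T" for x y
    using x0(2) that infdist_le[OF that(2), of x] by force
  ultimately show ?thesis by (intro exI[of _ "infdist x0 T"]) auto
qed

context dyn_system
begin

subsection \<open>Entropy of codings by Bowen balls\<close>

lemma simple_function_mem:
  assumes "Y \<in> sets BM" shows "simple_function BM (\<lambda>x. x \<in> Y)"
  unfolding simple_function_def space_BM
proof (intro conjI ballI)
  show "finite ((\<lambda>x. x \<in> Y) ` M)" by (rule finite_subset[of _ UNIV]) auto
  fix b
  have "Y \<subseteq> M" using assms sets_BM_iff by blast
  then have "(\<lambda>x. x \<in> Y) -` {b} \<inter> M = (if b then Y else M - Y)" by auto
  moreover have "M - Y \<in> sets BM" using sets.compl_sets[OF assms] by simp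
  ultimately show "(\<lambda>x. x \<in> Y) -` {b} \<inter> M \<in> sets BM" using assms by simp
qed

text \<open>Adding the membership in a set of full measure to a coding costs no entropy, so it
  suffices that \<open>g\<close> determines \<open>f\<close> on \<open>Y\<close>.\<close>

lemma Hfun_mono_AE:
  assumes Q: "Q \<in> probs M" and f: "simple_function BM f" and g: "simple_function BM g"
    and Y: "Y \<in> sets BM" "measure Q Y = 1"
    and fg: "\<And>x y. x \<in> Y \<Longrightarrow> y \<in> Y \<Longrightarrow> g x = g y \<Longrightarrow> f x = f y"
  shows "Hfun Q f \<le> Hfun Q g"
proof -
  interpret prob_space Q using probs_prob_space[OF Q] .
  note sf = probs_simple_function[OF Q]
  have AEY: "AE x in Q. x \<in> Y" using prob_eq_1[of Y] Y probs_sets[OF Q] by simp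
  \<comment> \<open>Collapsed off \<open>Y\<close>, the coding becomes a function of
    \<open>g\<close> and the membership in \<open>Y\<close> on the whole space.\<close>
  define f' where "f' x = (if x \<in> Y then Some (f x) else None)" for x
  have sY: "simple_function BM (\<lambda>x. x \<in> Y)" by (rule simple_function_mem[OF Y(1)])
  have f': "simple_function BM f'"
  proof -
    have "simple_function BM ((\<lambda>(b, v). if b then Some v else None) \<circ> (\<lambda>x. (x \<in> Y, f x)))"
      by (intro simple_function_compose simple_function_Pair sY f)
    then show ?thesis by (simp add: comp_def f'_def[abs_def])
  qed
  have "Hfun Q f \<le> Hfun Q (\<lambda>x. Some (f x))"
    using simple_function_compose[OF f, of Some] by (intro Hfun_mono) (auto simp: sf comp_def prob_space_axioms)
  also have "\<dots> = Hfun Q f'"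
    using AEY simple_function_compose[OF f, of Some] f'
    by (intro Hfun_cong_AE) (auto simp: sf comp_def f'_def prob_space_axioms elim!: eventually_mono)
  also have "\<dots> \<le> Hfun Q (\<lambda>x. (g x, x \<in> Y))"
  proof (rule Hfun_mono[OF prob_space_axioms])
    show "simple_function Q (\<lambda>x. (g x, x \<in> Y))" unfolding sf by (rule simple_function_Pair[OF g sY])
    fix x y assume "(g x, x \<in> Y) = (g y, y \<in> Y)"
    then show "f' x = f' y" using fg[of x y] by (auto simp: f'_def)
  qed
  also have "\<dots> \<le> Hfun Q g + Hfun Q (\<lambda>x. x \<in> Y)"
    using g sY by (intro Hfun_pair prob_space_axioms) (auto simp: sf)
  also have "Hfun Q (\<lambda>x. x \<in> Y) = Hfun Q (\<lambda>x. True)"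
    using AEY sY by (intro Hfun_cong_AE prob_space_axioms) (auto simp: sf elim!: eventually_mono)
  also have "\<dots> = 0" using not_empty prob_space by (simp add: Hfun_def image_constant_conv vimage_const)
  finally show ?thesis by simp
qed

text \<open>Inner regularity gives each atom a closed part \<open>K A\<close> of almost full mass.
  The coding that says \<open>None\<close> on these parts and names the atom elsewhere is almost
  constant, hence has small entropy.\<close>

lemma small_boundary_partition:
  assumes Q: "Q \<in> probs M" and xi: "finite_partition Q \<xi>" and om: "0 < \<omega>"
  obtains K where "\<And>A. A \<in> \<xi> \<Longrightarrow> closed (K A)" "\<And>A. A \<in> \<xi> \<Longrightarrow> K A \<subseteq> A"
    "simple_function BM (\<lambda>x. if x \<in> K (cell \<xi> x) then None else Some (cell \<xi> x))"
    "Hfun Q (\<lambda>x. if x \<in> K (cell \<xi> x) then None else Some (cell \<xi> x)) \<le> \<omega>"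
proof -
  interpret prob_space Q using probs_prob_space[OF Q] .
  have xi': "finite \<xi>" "\<xi> \<subseteq> sets BM" "disjoint \<xi>" "\<Union>\<xi> = M"
    using xi probs_sets[OF Q] probs_space[OF Q] by (auto simp: finite_partition_def)
  have ne: "\<xi> \<noteq> {}" using xi'(4) nonempty_M[OF Q] by auto
  define r where "r = real (card \<xi>)"
  have r: "1 \<le> r" using ne xi'(1) by (simp add: r_def Suc_leI card_gt_0_iff)
  \<comment> \<open>The value \<open>None\<close> contributes at most the missing mass
    \<open>r * \<kappa>\<close>, by -t ln t \<le> 1 - t, and each of the \<open>r\<close> atoms at
    most \<open>2 * sqrt \<kappa>\<close>; either total may use half of
    \<open>\<omega>\<close>.\<close>
  define \<kappa> where "\<kappa> = min 1 (min (\<omega> / (2 * r)) ((\<omega> / (4 * r))\<^sup>2))"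
  have ka: "0 < \<kappa>" "\<kappa> \<le> 1" "r * \<kappa> \<le> \<omega> / 2" "r * (2 * sqrt \<kappa>) \<le> \<omega> / 2"
  proof -
    show "0 < \<kappa>" "\<kappa> \<le> 1" using om r by (auto simp: \<kappa>_def)
    have "\<kappa> \<le> \<omega> / (2 * r)" by (simp add: \<kappa>_def)
    then show "r * \<kappa> \<le> \<omega> / 2" using r by (simp add: field_simps)
    have "\<kappa> \<le> (\<omega> / (4 * r))\<^sup>2" by (simp add: \<kappa>_def)
    then have "sqrt \<kappa> \<le> \<omega> / (4 * r)" using om r by (intro real_le_lsqrt) auto
    then show "r * (2 * sqrt \<kappa>) \<le> \<omega> / 2" using r by (simp add: field_simps)
  qed
  have "\<exists>F. closed F \<and> F \<subseteq> A \<and> measure Q (A - F) < \<kappa>" if A: "A \<in> \<xi>" for A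
  proof -
    have AQ: "A \<in> sets Q" "A \<subseteq> M" using A xi' probs_sets[OF Q] by auto
    obtain F U where FU: "closed F" "open U" "F \<subseteq> A" "A \<subseteq> U" "F \<subseteq> M" "measure Q (U \<inter> M - F) < \<kappa>"
      by (rule regular_approx[OF Q AQ(1) ka(1)]) blast
    have "F \<in> sets BM" using closed_Int_sets[OF FU(1)] FU(5) by (simp add: Int_absorb2)
    then have "U \<inter> M - F \<in> sets Q" using open_Int_sets[OF FU(2)] probs_sets[OF Q] by auto
    moreover have "A - F \<subseteq> U \<inter> M - F" using FU(4) AQ(2) by auto
    ultimately have "measure Q (A - F) \<le> measure Q (U \<inter> M - F)" by (intro finite_measure_mono)
    then show ?thesis using FU by (intro exI[of _ F]) auto
  qed
  then obtain K where K: "\<And>A. A \<in> \<xi> \<Longrightarrow> closed (K A)" "\<And>A. A \<in> \<xi> \<Longrightarrow> K A \<subseteq> A"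
    "\<And>A. A \<in> \<xi> \<Longrightarrow> measure Q (A - K A) < \<kappa>" by metis
  have AM: "A \<subseteq> M" if "A \<in> \<xi>" for A using that xi'(4) by auto
  have Ks: "K A \<in> sets BM" if "A \<in> \<xi>" for A
    using closed_Int_sets[OF K(1)[OF that]] K(2)[OF that] AM[OF that] by (metis Int_absorb2 order_trans)
  define \<rho> where "\<rho> x = (if x \<in> K (cell \<xi> x) then None else Some (cell \<xi> x))" for x
  have cell: "cell \<xi> x = A" if "A \<in> \<xi>" "x \<in> A" for A x by (rule cell_eq[OF xi'(3) that])
  have cin: "cell \<xi> x \<in> \<xi>" "x \<in> cell \<xi> x" if "x \<in> M" for x using cell_in[OF xi'(3)] that xi'(4) by auto
  have fibS: "\<rho> -` {Some A} \<inter> M = A - K A" if A: "A \<in> \<xi>" for A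
  proof (intro equalityI subsetI)
    fix x assume "x \<in> \<rho> -` {Some A} \<inter> M"
    then show "x \<in> A - K A" using cin[of x] by (auto simp: \<rho>_def split: if_splits)
  next
    fix x assume "x \<in> A - K A"
    then show "x \<in> \<rho> -` {Some A} \<inter> M" using cell[OF A, of x] AM[OF A] by (auto simp: \<rho>_def)
  qed
  have fibN: "\<rho> -` {None} \<inter> M = (\<Union>A\<in>\<xi>. K A)"
  proof (intro equalityI subsetI)
    fix x assume "x \<in> \<rho> -` {None} \<inter> M"
    then show "x \<in> (\<Union>A\<in>\<xi>. K A)" using cin[of x] by (auto simp: \<rho>_def split: if_splits)
  next
    fix x assume "x \<in> (\<Union>A\<in>\<xi>. K A)"
    then obtain A where A: "A \<in> \<xi>" "x \<in> K A" by blast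
    then have "x \<in> A" using K(2) by blast
    then show "x \<in> \<rho> -` {None} \<inter> M" using cell[OF A(1), of x] A AM[OF A(1)] by (auto simp: \<rho>_def)
  qed
  let ?T = "insert None (Some ` \<xi>)"
  have ran: "\<rho> ` M \<subseteq> ?T" using cin by (auto simp: \<rho>_def)
  have finT: "finite ?T" using xi'(1) by simp
  have setN: "(\<Union>A\<in>\<xi>. K A) \<in> sets BM" using xi'(1) Ks by (intro sets.finite_UN) auto
  have srho: "simple_function BM \<rho>"
    unfolding simple_function_def space_BM
  proof (intro conjI ballI)
    show "finite (\<rho> ` M)" by (rule finite_subset[OF ran finT])
    fix v assume "v \<in> \<rho> ` M"
    then have "v \<in> ?T" by (rule subsetD[OF ran])
    then show "\<rho> -` {v} \<inter> M \<in> sets BM" using fibN fibS setN Ks xi'(2) by auto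
  qed
  have sp: "space Q = M" by (rule probs_space[OF Q])
  have qN: "1 - r * \<kappa> \<le> measure Q (\<Union>A\<in>\<xi>. K A)"
  proof -
    have m: "A - K A \<in> sets Q" if "A \<in> \<xi>" for A using that Ks xi'(2) probs_sets[OF Q] by auto
    have "M = (\<Union>A\<in>\<xi>. K A) \<union> (\<Union>A\<in>\<xi>. A - K A)"
      using xi'(4) K(2) AM by blast
    then have "measure Q M \<le> measure Q (\<Union>A\<in>\<xi>. K A) + measure Q (\<Union>A\<in>\<xi>. A - K A)"
      using setN m xi'(1) probs_sets[OF Q] measure_Un_le[of "\<Union>A\<in>\<xi>. K A" Q "\<Union>A\<in>\<xi>. A - K A"] by (metis sets.finite_UN)
    moreover have "measure Q (\<Union>A\<in>\<xi>. A - K A) \<le> (\<Sum>A\<in>\<xi>. measure Q (A - K A))"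
      using m xi'(1) by (intro measure_UNION_le) auto
    moreover have "\<dots> \<le> (\<Sum>A\<in>\<xi>. \<kappa>)" using K(3) by (intro sum_mono) (simp add: less_imp_le)
    ultimately show ?thesis using prob_space sp by (simp add: r_def)
  qed
  have "Hfun Q \<rho> = - (\<Sum>v\<in>?T. measure Q (\<rho> -` {v} \<inter> M) * ln (measure Q (\<rho> -` {v} \<inter> M)))"
    using Hfun_superset[OF finT, of \<rho> Q] ran sp by simp
  also have "\<dots> = - (measure Q (\<Union>A\<in>\<xi>. K A) * ln (measure Q (\<Union>A\<in>\<xi>. K A)))
       + (\<Sum>A\<in>\<xi>. - (measure Q (A - K A) * ln (measure Q (A - K A))))"
    using xi'(1) fibN fibS by (subst sum.insert) (auto simp: sum.reindex sum_negf)
  also have "- (measure Q (\<Union>A\<in>\<xi>. K A) * ln (measure Q (\<Union>A\<in>\<xi>. K A))) \<le> r * \<kappa>"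
    using mult_ln_tangent[OF zero_less_one measure_nonneg, of Q "\<Union>A\<in>\<xi>. K A"] qN by simp
  also have "(\<Sum>A\<in>\<xi>. - (measure Q (A - K A) * ln (measure Q (A - K A)))) \<le> (\<Sum>A\<in>\<xi>. 2 * sqrt \<kappa>)"
  proof (rule sum_mono)
    fix A assume A: "A \<in> \<xi>"
    have "\<bar>measure Q (A - K A) * ln (measure Q (A - K A))\<bar> \<le> 2 * sqrt (measure Q (A - K A))"
      by (intro abs_mult_ln_le) auto
    moreover have "sqrt (measure Q (A - K A)) \<le> sqrt \<kappa>" using K(3)[OF A] by simp
    ultimately show "- (measure Q (A - K A) * ln (measure Q (A - K A))) \<le> 2 * sqrt \<kappa>" by linarith
  qed
  finally have "Hfun Q \<rho> \<le> r * \<kappa> + r * (2 * sqrt \<kappa>)" by (simp add: r_def)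
  then have "Hfun Q \<rho> \<le> \<omega>" using ka(3,4) by linarith
  then show ?thesis using that[of K] K(1,2) srho unfolding \<rho>_def[abs_def] by blast
qed

text \<open>The \<open>\<xi>\<close>-itinerary is determined by the coding \<open>u\<close> together with the \<open>\<rho>\<close>-itinerary, where \<open>\<rho>\<close> reveals the cell only off compact subsets of almost full measure and therefore has small entropy.\<close>
lemma bowen_coding_entropy:
  assumes Q: "Q \<in> inv_probs M \<phi>" and c: "ereal c < ks_entropy M \<phi> Q"
  shows "\<exists>\<delta>0>0. \<forall>\<delta> l Y (u :: 'a \<Rightarrow> 'a). \<delta> \<le> \<delta>0 \<longrightarrow> 1 \<le> l \<longrightarrow> simple_function BM u \<longrightarrow> Y \<in> sets BM \<longrightarrow> measure Q Y = 1 \<longrightarrow>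
     (\<forall>x\<in>Y. \<forall>k<l. dist ((\<phi> ^^ k) x) ((\<phi> ^^ k) (u x)) < \<delta>) \<longrightarrow> real l * c \<le> Hfun Q u"
proof -
  note Qp = inv_probs_probs[OF Q]
  interpret prob_space Q using probs_prob_space[OF Qp] .
  obtain \<xi> where xi: "finite_partition Q \<xi>" "simple_function BM (cell \<xi>)" "c < hfun Q (cell \<xi>)"
    by (rule less_ks_entropyE[OF Q c]) blast
  have xi': "finite \<xi>" "disjoint \<xi>" "\<Union>\<xi> = M"
    using xi probs_space[OF Qp] by (auto simp: finite_partition_def)
  have om: "0 < hfun Q (cell \<xi>) - c" using xi(3) by simp
  obtain K where K: "\<And>A. A \<in> \<xi> \<Longrightarrow> closed (K A)" "\<And>A. A \<in> \<xi> \<Longrightarrow> K A \<subseteq> A"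
    and srho0: "simple_function BM (\<lambda>x. if x \<in> K (cell \<xi> x) then None else Some (cell \<xi> x))"
    and Hrho0: "Hfun Q (\<lambda>x. if x \<in> K (cell \<xi> x) then None else Some (cell \<xi> x)) \<le> hfun Q (cell \<xi>) - c"
    by (rule small_boundary_partition[OF Qp xi(1) om]) blast
  define \<rho> where "\<rho> x = (if x \<in> K (cell \<xi> x) then None else Some (cell \<xi> x))" for x
  have srho: "simple_function BM \<rho>" and Hrho: "Hfun Q \<rho> \<le> hfun Q (cell \<xi>) - c"
    using srho0 Hrho0 unfolding \<rho>_def[abs_def] by auto
  have "\<exists>d>0. A \<noteq> B \<longrightarrow> (\<forall>x\<in>K A. \<forall>y\<in>K B. d \<le> dist x y)" if "A \<in> \<xi>" "B \<in> \<xi>" for A B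
  proof (cases "A = B")
    case True then show ?thesis by (intro exI[of _ 1]) auto
  next
    case False
    have "K A \<subseteq> M" using K(2)[OF that(1)] that(1) xi'(3) by blast
    then have "compact (K A)" using K(1)[OF that(1)] cpt by (metis compact_Int_closed inf.absorb2)
    moreover have "K A \<inter> K B = {}"
    proof -
      have "K A \<inter> K B \<subseteq> A \<inter> B" by (intro Int_mono K(2) that)
      also have "A \<inter> B = {}" using xi'(2) that False by (simp add: disjoint_def)
      finally show ?thesis by simp
    qed
    ultimately show ?thesis using compact_closed_separated[of "K A" "K B"] K(1)[OF that(2)] by blast
  qed
  then obtain d where d: "\<And>A B. A \<in> \<xi> \<Longrightarrow> B \<in> \<xi> \<Longrightarrow> 0 < d A B"
    "\<And>A B x y. A \<in> \<xi> \<Longrightarrow> B \<in> \<xi> \<Longrightarrow> A \<noteq> B \<Longrightarrow> x \<in> K A \<Longrightarrow> y \<in> K B \<Longrightarrow> d A B \<le> dist x y" by metis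
  \<comment> \<open>At most half of every distance between different closed parts: two points
    shadowed within \<open>\<delta>0\<close> by the same orbit cannot lie in different ones.\<close>
  define \<delta>0 where "\<delta>0 = Min (insert 1 ((\<lambda>(A, B). d A B) ` (\<xi> \<times> \<xi>))) / 2"
  have fin: "finite (insert 1 ((\<lambda>(A, B). d A B) ` (\<xi> \<times> \<xi>)))" using xi'(1) by simp
  have d0: "0 < \<delta>0" unfolding \<delta>0_def using fin d(1) by (subst zero_less_divide_iff) (auto simp: Min_gr_iff)
  have d0le: "2 * \<delta>0 \<le> d A B" if "A \<in> \<xi>" "B \<in> \<xi>" for A B
    unfolding \<delta>0_def using Min_le[OF fin, of "d A B"] that by auto
  have "real l * c \<le> Hfun Q u"
    if del: "\<delta> \<le> \<delta>0" and l: "1 \<le> l" and u: "simple_function BM u" and Y: "Y \<in> sets BM" "measure Q Y = 1"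
      and close: "\<forall>x\<in>Y. \<forall>k<l. dist ((\<phi> ^^ k) x) ((\<phi> ^^ k) (u x)) < \<delta>" for \<delta> l Y and u :: "'a \<Rightarrow> 'a"
  proof -
    have YM: "Y \<subseteq> M" using Y(1) sets_BM_iff by blast
    have cin: "cell \<xi> x \<in> \<xi>" if "x \<in> M" for x using cell_in[OF xi'(2)] that xi'(3) by auto
    have "real l * hfun Q (cell \<xi>) \<le> Hfun Q (word (cell \<xi>) l)" by (rule hfun(2)[OF Q xi(2) l])
    also have "\<dots> \<le> Hfun Q (\<lambda>x. (u x, word \<rho> l x))"
    proof (rule Hfun_mono_AE[OF Qp simple_function_word[OF xi(2)] simple_function_Pair[OF u simple_function_word[OF srho]] Y])
      fix x y assume xy: "x \<in> Y" "y \<in> Y" "(u x, word \<rho> l x) = (u y, word \<rho> l y)"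
      have "cell \<xi> ((\<phi> ^^ k) x) = cell \<xi> ((\<phi> ^^ k) y)" if k: "k < l" for k
      proof (rule ccontr)
        let ?x = "(\<phi> ^^ k) x" and ?y = "(\<phi> ^^ k) y"
        assume neq: "cell \<xi> ?x \<noteq> cell \<xi> ?y"
        have eq: "\<rho> ?x = \<rho> ?y" using xy(3) k by (auto simp: word_def)
        \<comment> \<open>Equal \<open>\<rho>\<close> with different cells leaves only the value
          \<open>None\<close>, which puts both points in closed parts.\<close>
        then have in_K: "?x \<in> K (cell \<xi> ?x)" "?y \<in> K (cell \<xi> ?y)" using neq by (auto simp: \<rho>_def split: if_splits)
        have M: "?x \<in> M" "?y \<in> M" using xy YM iter_in by blast+
        have "2 * \<delta>0 \<le> dist ?x ?y" using d(2)[OF cin[OF M(1)] cin[OF M(2)] neq in_K] d0le[OF cin[OF M(1)] cin[OF M(2)]] by linarith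
        moreover have "dist ?x ((\<phi> ^^ k) (u x)) < \<delta>" "dist ?y ((\<phi> ^^ k) (u x)) < \<delta>"
          using close xy k by auto
        ultimately show False using del dist_triangle2[of ?x ?y "(\<phi> ^^ k) (u x)"] by linarith
      qed
      then show "word (cell \<xi>) l x = word (cell \<xi>) l y" by (simp add: word_def)
    qed
    also have "\<dots> \<le> Hfun Q u + Hfun Q (word \<rho> l)"
      using u simple_function_word[OF srho] by (intro Hfun_pair prob_space_axioms) (auto simp: probs_simple_function[OF Qp])
    \<comment> \<open>By invariance each letter of the \<open>\<rho>\<close>-itinerary costs at most
      \<open>hfun Q (cell \<xi>) - c\<close>; what remains for \<open>u\<close> is \<open>c\<close>
      per step.\<close>
    also have "Hfun Q (word \<rho> l) \<le> (\<Sum>k\<leftarrow>[0..<l]. Hfun Q (\<lambda>x. \<rho> ((\<phi> ^^ k) x)))"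
      unfolding word_def using simple_function_iter[OF srho]
      by (intro Hfun_map_le prob_space_axioms) (auto simp: probs_simple_function[OF Qp])
    also have "\<dots> = real l * Hfun Q \<rho>"
      unfolding Hfun_iter[OF Q srho] by (simp add: sum_list_triv)
    also have "\<dots> \<le> real l * (hfun Q (cell \<xi>) - c)" using Hrho by (intro mult_left_mono) auto
    finally show ?thesis by (simp add: algebra_simps)
  qed
  then show ?thesis using d0 by blast
qed

subsection \<open>The eventual range\<close>

text \<open>Specification shadows \<open>\<phi>\<^sup>k x\<^sub>i\<close> at the same time \<open>k\<close>, and \<open>\<phi>\<close> need not be surjective: a block can start late only at a point with preimages of every order.\<close>
definition core :: "'a set" where "core = (\<Inter>t. (\<phi> ^^ t) ` M)"

lemma core_preimage: "x \<in> core \<Longrightarrow> \<exists>y\<in>M. (\<phi> ^^ t) y = x"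
  by (auto simp: core_def)

lemma core_sub: "core \<subseteq> M"
proof
  fix x assume "x \<in> core"
  then have "x \<in> (\<phi> ^^ 0) ` M" unfolding core_def by blast
  then show "x \<in> M" by simp
qed

lemma core_sets: "core \<in> sets BM"
proof -
  have "closed ((\<phi> ^^ t) ` M)" for t
    using compact_continuous_image[OF iter_cont cpt] by (rule compact_imp_closed)
  then have "closed core" unfolding core_def by (intro closed_INT) auto
  then show ?thesis using closed_Int_sets[of core] core_sub by (simp add: Int_absorb2)
qed

text \<open>The preimage of the image of \<open>M\<close> under an iterate is all of
  \<open>M\<close>, so invariance gives each image full mass; countably many are
  intersected.\<close>

lemma core_measure:
  assumes Q: "Q \<in> inv_probs M \<phi>" shows "measure Q core = 1"
proof -
  note Qp = inv_probs_probs[OF Q]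
  interpret prob_space Q using probs_prob_space[OF Qp] .
  have s: "(\<phi> ^^ t) ` M \<in> sets BM" for t
  proof -
    have "closed ((\<phi> ^^ t) ` M)" using compact_continuous_image[OF iter_cont cpt] by (rule compact_imp_closed)
    moreover have "(\<phi> ^^ t) ` M \<subseteq> M" using iter_in by auto
    ultimately show ?thesis using closed_Int_sets[of "(\<phi> ^^ t) ` M"] by (simp add: Int_absorb2)
  qed
  have "AE x in Q. x \<in> (\<phi> ^^ t) ` M" for t
  proof -
    have "(\<phi> ^^ t) -` ((\<phi> ^^ t) ` M) \<inter> M = M" by auto
    then have "measure Q ((\<phi> ^^ t) ` M) = 1" using inv_probs_measure[OF Q s, of t t] prob_space probs_space[OF Qp] by simp
    then show ?thesis using prob_eq_1[of "(\<phi> ^^ t) ` M"] s probs_sets[OF Qp] by simp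
  qed
  then have "AE x in Q. x \<in> core" unfolding core_def by (simp add: AE_all_countable)
  then show ?thesis using prob_eq_1[of core] core_sets probs_sets[OF Qp] by simp
qed

lemma bowen_sets: "bowen M \<phi> n x e \<in> sets BM"
proof -
  have "{y \<in> space BM. \<forall>k\<in>{..<n}. dist ((\<phi> ^^ k) y) ((\<phi> ^^ k) x) < e} \<in> sets BM"
  proof (rule sets.sets_Collect_finite_All)
    fix k
    have "continuous_on M (\<lambda>y. dist ((\<phi> ^^ k) y) ((\<phi> ^^ k) x))" by (intro continuous_intros iter_cont)
    from borel_measurable_less[OF continuous_borel[OF this] borel_measurable_const[of e BM]]
    show "{y \<in> space BM. dist ((\<phi> ^^ k) y) ((\<phi> ^^ k) x) < e} \<in> sets BM" .
  qed simp
  moreover have "bowen M \<phi> n x e = {y \<in> space BM. \<forall>k\<in>{..<n}. dist ((\<phi> ^^ k) y) ((\<phi> ^^ k) x) < e}"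
    unfolding bowen_def space_BM by blast
  ultimately show ?thesis by (simp only:)
qed

text \<open>Taking the first set of a list that contains the point makes a coding by overlapping
  sets measurable.\<close>

lemma simple_function_find:
  assumes "\<And>e. e \<in> set es \<Longrightarrow> B e \<in> sets BM"
  shows "simple_function BM (\<lambda>x. find (\<lambda>e. x \<in> B e) es)"
  using assms
proof (induction es)
  case (Cons e es)
  have "{x \<in> space BM. x \<in> B e} = B e" using Cons.prems[of e] sets_BM_iff by auto
  then show ?case using Cons by (auto intro!: simple_function_If)
qed simp

text \<open>The centres are a maximal separated subset of \<open>Y\<close>, and a point goes to the
  first Bowen ball that contains it. Points in no ball receive an arbitrary centre; none of them
  lies in \<open>Y\<close>.\<close>

lemma bowen_coding:
  assumes Y: "Y \<subseteq> M" "Y \<noteq> {}" and d: "0 < \<delta>"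
  obtains E u where "finite E" "E \<subseteq> Y" "simple_function BM u" "\<And>x. u x \<in> E"
    "\<And>x y. x \<in> E \<Longrightarrow> y \<in> E \<Longrightarrow> x \<noteq> y \<Longrightarrow> \<exists>k<l. \<delta> \<le> dist ((\<phi> ^^ k) x) ((\<phi> ^^ k) y)"
    "\<And>x k. x \<in> Y \<Longrightarrow> k < l \<Longrightarrow> dist ((\<phi> ^^ k) x) ((\<phi> ^^ k) (u x)) < \<delta>"
proof -
  obtain E where E: "finite E" "E \<subseteq> Y"
    "\<And>x y. x \<in> E \<Longrightarrow> y \<in> E \<Longrightarrow> x \<noteq> y \<Longrightarrow> \<exists>k<l. \<delta> \<le> dist ((\<phi> ^^ k) x) ((\<phi> ^^ k) y)"
    "\<And>y. y \<in> Y \<Longrightarrow> \<exists>x\<in>E. \<forall>k<l. dist ((\<phi> ^^ k) y) ((\<phi> ^^ k) x) < \<delta>"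
    by (rule max_separated[OF Y(1) d, of l]) blast
  obtain es where es: "set es = E" using finite_list[OF E(1)] by blast
  obtain e0 where e0: "e0 \<in> E" using Y(2) E(4) by blast
  define fn where "fn x = find (\<lambda>e. x \<in> bowen M \<phi> l e \<delta>) es" for x
  define u where "u x = (case fn x of None \<Rightarrow> e0 | Some e \<Rightarrow> e)" for x
  have "simple_function BM fn" unfolding fn_def by (intro simple_function_find bowen_sets)
  then have "simple_function BM (case_option e0 (\<lambda>e. e) \<circ> fn)" by (rule simple_function_compose)
  then have su: "simple_function BM u" by (simp add: comp_def u_def[abs_def])
  have fnS: "e \<in> E \<and> x \<in> bowen M \<phi> l e \<delta>" if "fn x = Some e" for x e
    using that es by (auto simp: fn_def find_Some_iff)
  have uE: "u x \<in> E" for x using fnS e0 by (auto simp: u_def split: option.splits)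
  have "dist ((\<phi> ^^ k) x) ((\<phi> ^^ k) (u x)) < \<delta>" if x: "x \<in> Y" and k: "k < l" for x k
  proof -
    obtain e where "e \<in> E" "\<forall>k<l. dist ((\<phi> ^^ k) x) ((\<phi> ^^ k) e) < \<delta>" using E(4)[OF x] by blast
    then have "e \<in> set es" "x \<in> bowen M \<phi> l e \<delta>" using es x Y(1) by (auto simp: bowen_def)
    then have "fn x \<noteq> None" unfolding fn_def find_None_iff by blast
    then obtain e' where "fn x = Some e'" by blast
    then show ?thesis using fnS[of x e'] k by (auto simp: u_def bowen_def)
  qed
  then show ?thesis using that[of E u] E su uE by blast
qed

end

context dyn_system
begin

subsection \<open>Lower bound by gluing typical orbit segments\<close>

text \<open>Times inside the \<open>L\<close> blocks are compared with the letters of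
  \<open>w\<close>; the remaining times, gaps and tail, cost at most \<open>B\<close> each.\<close>

lemma birkhoff_blocks:
  assumes Lb: "L * b \<le> n" and lb: "l \<le> b" and y: "y \<in> M" and B: "\<And>x. x \<in> M \<Longrightarrow> \<bar>f x\<bar> \<le> B"
    and close: "\<And>j i. j < L \<Longrightarrow> i < l \<Longrightarrow> \<bar>f ((\<phi> ^^ (j * b + i)) y) - f ((\<phi> ^^ i) (w j))\<bar> \<le> \<eta>"
  shows "\<bar>birkhoff \<phi> n f y - (\<Sum>j<L. birkhoff \<phi> l f (w j))\<bar> \<le> real (L * l) * \<eta> + B * (real n - real (L * l))"
proof -
  let ?h = "\<lambda>(j, i). j * b + i :: nat"
  let ?I = "{..<L} \<times> {..<l}"
  define T where "T = ?h ` ?I"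
  have inj: "inj_on ?h ?I"
  proof (rule inj_onI, clarsimp)
    fix j i j' i' assume a: "i < l" "i' < l" "j * b + i = j' * b + i'"
    have ib: "i < b" "i' < b" using a lb by auto
    have "(j * b + i) div b = j" "(j' * b + i') div b = j'" using ib by auto
    then show "j = j' \<and> i = i'" using a(3) by auto
  qed
  have sub: "T \<subseteq> {..<n}"
  proof
    fix k assume "k \<in> T"
    then obtain j i where k: "k = j * b + i" "j < L" "i < l" by (auto simp: T_def)
    have "Suc j * b \<le> L * b" using k(2) by (intro mult_le_mono1) simp
    then show "k \<in> {..<n}" using k lb Lb by simp
  qed
  have card: "card T = L * l" unfolding T_def by (simp add: card_image[OF inj])
  have "birkhoff \<phi> n f y = (\<Sum>k\<in>T. f ((\<phi> ^^ k) y)) + (\<Sum>k\<in>{..<n} - T. f ((\<phi> ^^ k) y))"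
    unfolding birkhoff_def using sum.subset_diff[OF sub, of "\<lambda>k. f ((\<phi> ^^ k) y)"] by simp
  moreover have "(\<Sum>k\<in>T. f ((\<phi> ^^ k) y)) = (\<Sum>j<L. \<Sum>i<l. f ((\<phi> ^^ (j * b + i)) y))"
    unfolding T_def by (subst sum.reindex[OF inj]) (simp add: sum.cartesian_product case_prod_unfold)
  ultimately have eq: "birkhoff \<phi> n f y - (\<Sum>j<L. birkhoff \<phi> l f (w j)) =
      (\<Sum>j<L. \<Sum>i<l. f ((\<phi> ^^ (j * b + i)) y) - f ((\<phi> ^^ i) (w j))) + (\<Sum>k\<in>{..<n} - T. f ((\<phi> ^^ k) y))"
    by (simp add: birkhoff_def sum_subtractf)
  have "\<bar>\<Sum>j<L. \<Sum>i<l. f ((\<phi> ^^ (j * b + i)) y) - f ((\<phi> ^^ i) (w j))\<bar> \<le> (\<Sum>j<L. \<Sum>i<l. \<eta>)"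
    using close by (intro order_trans[OF sum_abs] sum_mono) auto
  moreover have "\<bar>\<Sum>k\<in>{..<n} - T. f ((\<phi> ^^ k) y)\<bar> \<le> (\<Sum>k\<in>{..<n} - T. B)"
    using B iter_in[OF y] by (intro order_trans[OF sum_abs] sum_mono) auto
  moreover have "(\<Sum>k\<in>{..<n} - T. B) = B * (real n - real (L * l))"
  proof -
    have "card ({..<n} - T) = n - L * l" using card sub by (simp add: card_Diff_subset finite_subset)
    moreover have "L * l \<le> n" using card_mono[OF _ sub] card by simp
    ultimately show ?thesis by (simp add: of_nat_diff)
  qed
  moreover have "(\<Sum>j<L. \<Sum>i<l. \<eta>) = real (L * l) * \<eta>" by simp
  ultimately show ?thesis unfolding eq using abs_triangle_ineq order_trans add_mono
    by (smt (verit))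
qed

text \<open>A block meant for time \<open>j * (l + N)\<close> is first replaced by a point whose
  orbit reaches it at that very time; the eventual range provides one. A closed interval of
  \<open>l\<close> integers ends at offset \<open>l - 1\<close>, so consecutive blocks are
  \<open>N + 1\<close> apart.\<close>

lemma specification_glue:
  assumes S: "spec_S M \<phi>" and d: "0 < d"
  obtains N where "\<And>L l w. 1 \<le> l \<Longrightarrow> (\<And>j. j < L \<Longrightarrow> w j \<in> core) \<Longrightarrow>
     \<exists>z\<in>M. \<forall>j<L. \<forall>i<l. dist ((\<phi> ^^ (j * (l + N) + i)) z) ((\<phi> ^^ i) (w j)) < d"
proof -
  obtain N where N: "1 \<le> N" "\<forall>(m::nat) (xs :: nat \<Rightarrow> 'a) (a::nat \<Rightarrow> nat) (b::nat \<Rightarrow> nat).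
     (\<forall>i<m. xs i \<in> M) \<longrightarrow>
     (\<forall>i<m. \<forall>j<m. i \<noteq> j \<longrightarrow> (\<forall>k\<in>{a i..b i}. \<forall>l\<in>{a j..b j}. N \<le> (if k \<le> l then l - k else k - l))) \<longrightarrow>
     (\<exists>x\<in>M. \<forall>i<m. \<forall>k\<in>{a i..b i}. dist ((\<phi> ^^ k) x) ((\<phi> ^^ k) (xs i)) < d)"
    using S d unfolding spec_S_def by metis
  have "\<exists>z\<in>M. \<forall>j<L. \<forall>i<l. dist ((\<phi> ^^ (j * (l + N) + i)) z) ((\<phi> ^^ i) (w j)) < d"
    if l: "1 \<le> l" and w: "\<And>j. j < L \<Longrightarrow> w j \<in> core" for L l w
  proof -
    define b where "b = l + N"
    have "\<forall>j. \<exists>y. j < L \<longrightarrow> y \<in> M \<and> (\<phi> ^^ (j * b)) y = w j" using core_preimage[OF w] by blast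
    from choice[OF this] obtain xs where xs: "\<And>j. j < L \<Longrightarrow> xs j \<in> M" "\<And>j. j < L \<Longrightarrow> (\<phi> ^^ (j * b)) (xs j) = w j" by blast
    have far: "k + N \<le> k'" if "i < j" "k \<in> {i * b..i * b + (l - 1)}" "k' \<in> {j * b..j * b + (l - 1)}" for i j k k'
    proof -
      have "Suc i * b \<le> j * b" using that(1) by (intro mult_le_mono1) simp
      moreover have "k \<le> i * b + (l - 1)" "j * b \<le> k'" using that by auto
      ultimately show ?thesis using l by (simp add: b_def)
    qed
    have gap: "N \<le> (if k \<le> k' then k' - k else k - k')"
      if ij: "i \<noteq> j" and k: "k \<in> {i * b..i * b + (l - 1)}" and k': "k' \<in> {j * b..j * b + (l - 1)}" for i j k k'
    proof (cases "i < j")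
      case True then show ?thesis using far[OF True k k'] by simp
    next
      case False
      then have "j < i" using ij by simp
      from far[OF this k' k] show ?thesis using N(1) by auto
    qed
    obtain z where z: "z \<in> M" "\<forall>i<L. \<forall>k\<in>{i * b..i * b + (l - 1)}. dist ((\<phi> ^^ k) z) ((\<phi> ^^ k) (xs i)) < d"
      using N(2)[rule_format, of L xs "\<lambda>i. i * b" "\<lambda>i. i * b + (l - 1)"] xs(1) gap by blast
    have "dist ((\<phi> ^^ (j * b + i)) z) ((\<phi> ^^ i) (w j)) < d" if ji: "j < L" "i < l" for j i
    proof -
      have "j * b + i \<in> {j * b..j * b + (l - 1)}" using ji by auto
      then have "dist ((\<phi> ^^ (j * b + i)) z) ((\<phi> ^^ (j * b + i)) (xs j)) < d" using z(2) ji(1) by blast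
      moreover have "(\<phi> ^^ (j * b + i)) (xs j) = (\<phi> ^^ i) (w j)" using xs(2)[OF ji(1)] iter_add[of "j * b" i "xs j"] by simp
      ultimately show ?thesis by simp
    qed
    then show ?thesis using z(1) unfolding b_def by blast
  qed
  then show ?thesis using that[of N] by blast
qed

text \<open>Condition (C2) with \<open>K\<close> absorbed into the exponent.\<close>
definition gibbs_lower :: "(nat \<Rightarrow> 'a measure) \<Rightarrow> (nat \<Rightarrow> 'a \<Rightarrow> real) \<Rightarrow> real \<Rightarrow> bool" where
  "gibbs_lower P G p \<longleftrightarrow> (\<forall>\<eta>>0. \<forall>\<^sub>F \<delta> in at_right 0. \<forall>\<^sub>F n in sequentially. \<exists>m. real m \<le> \<eta> * real n \<and>
     (\<forall>x\<in>M. exp (G n x - real n * p - \<eta> * real n) \<le> measure (P n) (bowen M \<phi> (n - m) x \<delta>)))"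

lemma finite_family_bound:
  assumes "finite F" "\<And>f. f \<in> F \<Longrightarrow> continuous_on M f"
  shows "\<exists>B\<ge>1. \<forall>f\<in>F. \<forall>x\<in>M. \<bar>f x\<bar> \<le> (B::real)"
  using assms
proof (induction F rule: finite_induct)
  case empty show ?case by (intro exI[of _ 1]) auto
next
  case (insert f F)
  obtain B where B: "B \<ge> 1" "\<forall>f\<in>F. \<forall>x\<in>M. \<bar>f x\<bar> \<le> B" using insert.IH insert.prems by auto
  obtain C where C: "0 < C" "\<And>x. x \<in> M \<Longrightarrow> \<bar>f x\<bar> \<le> C" by (rule continuous_bound[of f]) (use insert.prems in auto)
  show ?case using B C by (intro exI[of _ "max B C"]) (auto simp: le_max_iff_disj)
qed

lemma finite_family_modulus:
  assumes "finite F" "\<And>f. f \<in> F \<Longrightarrow> continuous_on M f" and \<eta>: "0 < (\<eta>::real)"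
  shows "\<exists>d>0. \<forall>f\<in>F. \<forall>x\<in>M. \<forall>y\<in>M. dist x y < d \<longrightarrow> \<bar>f x - f y\<bar> \<le> \<eta>"
  using assms(1,2)
proof (induction F rule: finite_induct)
  case empty show ?case by (intro exI[of _ 1]) auto
next
  case (insert f F)
  obtain d where d: "d > 0" "\<forall>f\<in>F. \<forall>x\<in>M. \<forall>y\<in>M. dist x y < d \<longrightarrow> \<bar>f x - f y\<bar> \<le> \<eta>" using insert.IH insert.prems by auto
  have "uniformly_continuous_on M f" using insert.prems cpt by (intro compact_uniformly_continuous) auto
  then obtain d' where d': "d' > 0" "\<forall>x\<in>M. \<forall>y\<in>M. dist y x < d' \<longrightarrow> dist (f y) (f x) < \<eta>"
    unfolding uniformly_continuous_on_def using \<eta> by blast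
  have "\<bar>f x - f y\<bar> \<le> \<eta>" if "x \<in> M" "y \<in> M" "dist x y < d'" for x y
    using d'(2) that by (auto simp: dist_real_def dist_commute less_imp_le abs_minus_commute)
  then show ?case using d d'(1) by (intro exI[of _ "min d d'"]) auto
qed

text \<open>The left mean is the integral of the Birkhoff sum along \<open>u x\<close>. On the
  eventual range, of full measure, it differs from the sum along \<open>x\<close> by at most
  \<open>l * \<eta>\<close>, and invariance evaluates the integral of the latter.\<close>

lemma coding_mean:
  assumes Q: "Q \<in> inv_probs M \<phi>" and u: "simple_function BM u" and E: "finite E" "E \<subseteq> M" "\<And>x. u x \<in> E"
    and f: "continuous_on M f"
    and close: "\<And>x k. x \<in> core \<Longrightarrow> k < l \<Longrightarrow> \<bar>f ((\<phi> ^^ k) x) - f ((\<phi> ^^ k) (u x))\<bar> \<le> \<eta>"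
  shows "\<bar>(\<Sum>e\<in>E. measure Q (u -` {e} \<inter> M) * birkhoff \<phi> l f e) - real l * (\<integral>x. f x \<partial>Q)\<bar> \<le> real l * \<eta>"
proof -
  note Qp = inv_probs_probs[OF Q]
  interpret prob_space Q using probs_prob_space[OF Qp] .
  have sp: "space Q = M" by (rule probs_space[OF Qp])
  have fib: "u -` {e} \<inter> M \<in> sets Q" for e using simple_functionD(2)[OF u, of "{e}"] probs_sets[OF Qp] by simp
  let ?s = "\<lambda>x. \<Sum>e\<in>E. birkhoff \<phi> l f e * indicator (u -` {e} \<inter> M) x"
  have ints: "integrable Q ?s" using fib by (intro Bochner_Integration.integrable_sum integrable_mult_right integrable_real_indicator) (auto simp: emeasure_eq_measure)
  have s_eq: "?s x = birkhoff \<phi> l f (u x)" if "x \<in> M" for x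
  proof -
    have "?s x = (\<Sum>e\<in>E. if e = u x then birkhoff \<phi> l f e else 0)" using that by (intro sum.cong) (auto simp: indicator_def)
    then show ?thesis using E by simp
  qed
  have ib: "integrable Q (birkhoff \<phi> l f)" by (rule probs_integrable[OF Qp birkhoff_cont[OF f]])
  have "(\<integral>x. ?s x \<partial>Q) = (\<Sum>e\<in>E. birkhoff \<phi> l f e * measure Q (u -` {e} \<inter> M))"
    using fib sp sets.sets_into_space[OF fib]
    by (subst Bochner_Integration.integral_sum) (auto simp: emeasure_eq_measure Int_absorb1 Int_absorb2 intro!: integrable_mult_right integrable_real_indicator)
  then have "(\<Sum>e\<in>E. measure Q (u -` {e} \<inter> M) * birkhoff \<phi> l f e) - real l * (\<integral>x. f x \<partial>Q) = (\<integral>x. ?s x - birkhoff \<phi> l f x \<partial>Q)"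
    using ints ib by (simp add: inv_probs_birkhoff[OF Q f] mult.commute)
  also have "\<bar>\<dots>\<bar> \<le> (\<integral>x. real l * \<eta> \<partial>Q)"
  proof (rule order_trans[OF integral_abs_bound integral_mono_AE])
    show "integrable Q (\<lambda>x. \<bar>?s x - birkhoff \<phi> l f x\<bar>)" using ints ib by (intro integrable_abs Bochner_Integration.integrable_diff)
    have "AE x in Q. x \<in> core" using core_measure[OF Q] prob_eq_1[of core] core_sets probs_sets[OF Qp] by simp
    then show "AE x in Q. \<bar>?s x - birkhoff \<phi> l f x\<bar> \<le> real l * \<eta>"
    proof eventually_elim
      case (elim x)
      then have xM: "x \<in> M" using core_sub by blast
      have "\<bar>?s x - birkhoff \<phi> l f x\<bar> = \<bar>\<Sum>k<l. f ((\<phi> ^^ k) x) - f ((\<phi> ^^ k) (u x))\<bar>"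
        unfolding s_eq[OF xM] unfolding birkhoff_def by (simp add: sum_subtractf abs_minus_commute)
      also have "\<dots> \<le> (\<Sum>k<l. \<eta>)" using close[OF elim] by (intro order_trans[OF sum_abs] sum_mono) auto
      finally show ?case by simp
    qed
  qed simp
  finally show ?thesis using prob_space by simp
qed

text \<open>Every typical word yields a Bowen ball inside the target event. Up to small exponents
  the balls number at least exp (n c), each has probability at least exp (n (G(Q) - p)), and they
  are disjoint.\<close>

theorem empirical_lower_bound:
  assumes S: "spec_S M \<phi>" and P: "\<And>n. P n \<in> probs M" and G: "AA G" and gib: "gibbs_lower P G p"
    and Q: "Q \<in> inv_probs M \<phi>" and c: "ereal c < ks_entropy M \<phi> Q"
    and Fs: "finite Fs" "\<And>f. f \<in> Fs \<Longrightarrow> continuous_on M f" and eps: "0 < \<epsilon>"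
  shows "\<forall>\<^sub>F n in sequentially. exp (real n * (seq_functional G Q + c - p - \<epsilon>))
     \<le> measure (P n) {x \<in> M. \<forall>f\<in>Fs. \<bar>birkhoff \<phi> n f x / real n - (\<integral>x. f x \<partial>Q)\<bar> < \<epsilon>}"
proof -
  note Qp = inv_probs_probs[OF Q]
  interpret prob_space Q using probs_prob_space[OF Qp] .
  have e8: "0 < \<epsilon> / 8" using eps by simp
  obtain g where g: "continuous_on M g" "\<forall>\<^sub>F n in sequentially. \<forall>x\<in>M. \<bar>G n x - birkhoff \<phi> n g x\<bar> \<le> \<epsilon> / 8 * real n"
    using AA_approx[OF G e8] by blast
  have Gg: "\<bar>seq_functional G Q - (\<integral>x. g x \<partial>Q)\<bar> \<le> \<epsilon> / 8" by (rule seq_functional_close[OF G Q g])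
  \<comment> \<open>The approximant \<open>g\<close> of \<open>G\<close> joins the test functions,
    so that \<open>G n\<close> is controlled on the same glued orbits.\<close>
  define Fg where "Fg = insert g Fs"
  have Fg: "finite Fg" "\<And>f. f \<in> Fg \<Longrightarrow> continuous_on M f" "g \<in> Fg" "Fs \<subseteq> Fg" using Fs g(1) by (auto simp: Fg_def)
  obtain B where B: "1 \<le> B" "\<And>f x. f \<in> Fg \<Longrightarrow> x \<in> M \<Longrightarrow> \<bar>f x\<bar> \<le> B" using finite_family_bound[OF Fg(1,2)] by blast
  \<comment> \<open>\<open>9 * B * \<eta>\<close> will bound the error of the Birkhoff averages and
    \<open>3 * \<eta> * \<bar>c\<bar>\<close> the entropy lost in the gaps; each may use
    \<open>\<epsilon> / 8\<close>.\<close>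
  define \<eta> where "\<eta> = min (1/4) (min (\<epsilon> / (72 * B)) (\<epsilon> / (24 * (\<bar>c\<bar> + 1))))"
  have eta: "0 < \<eta>" "\<eta> \<le> 1/4" "9 * B * \<eta> \<le> \<epsilon> / 8" "3 * \<eta> * \<bar>c\<bar> \<le> \<epsilon> / 8"
  proof -
    have "0 < 72 * B" using B(1) by linarith
    from divide_pos_pos[OF eps this] have 1: "0 < \<epsilon> / (72 * B)" .
    have "0 < 24 * (\<bar>c\<bar> + 1)" by (simp add: add_nonneg_pos)
    from divide_pos_pos[OF eps this] have "0 < \<epsilon> / (24 * (\<bar>c\<bar> + 1))" .
    with 1 show "0 < \<eta>" unfolding \<eta>_def by (simp only: min_less_iff_conj) simp
    show "\<eta> \<le> 1/4" unfolding \<eta>_def by (rule min.cobounded1)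
    have "\<eta> \<le> \<epsilon> / (72 * B)" by (simp add: \<eta>_def)
    then show "9 * B * \<eta> \<le> \<epsilon> / 8" using B(1) by (simp add: field_simps)
    have "\<eta> \<le> \<epsilon> / (24 * (\<bar>c\<bar> + 1))" by (simp add: \<eta>_def)
    then have "\<eta> * (24 * (\<bar>c\<bar> + 1)) \<le> \<epsilon>" by (simp add: pos_le_divide_eq)
    then show "3 * \<eta> * \<bar>c\<bar> \<le> \<epsilon> / 8" using \<open>0 < \<eta>\<close> by (simp add: algebra_simps)
  qed
  have eta2: "2 * \<eta> \<le> \<epsilon> / 8"
  proof -
    have "1 * \<eta> \<le> B * \<eta>" using B(1) eta(1) by (intro mult_right_mono) auto
    then show ?thesis using eta(1,3) by linarith
  qed
  obtain \<delta>0 where d0: "0 < \<delta>0" and ent: "\<And>\<delta> l Y (u :: 'a \<Rightarrow> 'a). \<delta> \<le> \<delta>0 \<Longrightarrow> 1 \<le> l \<Longrightarrow> simple_function BM u \<Longrightarrow> Y \<in> sets BM \<Longrightarrow> measure Q Y = 1 \<Longrightarrow>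
     (\<forall>x\<in>Y. \<forall>k<l. dist ((\<phi> ^^ k) x) ((\<phi> ^^ k) (u x)) < \<delta>) \<Longrightarrow> real l * c \<le> Hfun Q u"
    using bowen_coding_entropy[OF Q c] by blast
  obtain d where d: "0 < d" "\<And>f x y. f \<in> Fg \<Longrightarrow> x \<in> M \<Longrightarrow> y \<in> M \<Longrightarrow> dist x y < d \<Longrightarrow> \<bar>f x - f y\<bar> \<le> \<eta>"
    using finite_family_modulus[OF Fg(1,2) eta(1)] by blast
  have "\<forall>\<^sub>F \<delta>' in at_right 0. 0 < \<delta>' \<and> \<delta>' < min \<delta>0 d / 4 \<and> (\<forall>\<^sub>F n in sequentially. \<exists>m. real m \<le> \<eta> * real n \<and>
     (\<forall>x\<in>M. exp (G n x - real n * p - \<eta> * real n) \<le> measure (P n) (bowen M \<phi> (n - m) x \<delta>')))"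
  proof (intro eventually_conj)
    show "\<forall>\<^sub>F \<delta>' in at_right (0::real). 0 < \<delta>'" by (rule eventually_at_right_less)
    show "\<forall>\<^sub>F \<delta>' in at_right (0::real). \<delta>' < min \<delta>0 d / 4"
      using d0 d(1) by (intro order_tendstoD(2)[OF tendsto_ident_at]) auto
    show "\<forall>\<^sub>F \<delta>' in at_right 0. \<forall>\<^sub>F n in sequentially. \<exists>m. real m \<le> \<eta> * real n \<and>
       (\<forall>x\<in>M. exp (G n x - real n * p - \<eta> * real n) \<le> measure (P n) (bowen M \<phi> (n - m) x \<delta>'))"
      using gib eta(1) by (simp add: gibbs_lower_def)
  qed
  from eventually_happens[OF this] obtain \<delta>' where d': "0 < \<delta>'" "\<delta>' < min \<delta>0 d / 4"
    and gn: "\<forall>\<^sub>F n in sequentially. \<exists>m. real m \<le> \<eta> * real n \<and>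
     (\<forall>x\<in>M. exp (G n x - real n * p - \<eta> * real n) \<le> measure (P n) (bowen M \<phi> (n - m) x \<delta>'))" by auto
  \<comment> \<open>Gluing and the Bowen ball each move an orbit by less than
    \<open>\<delta>'\<close>; together this is half of the separation \<open>\<delta>\<close>
    between letters.\<close>
  define \<delta> where "\<delta> = 4 * \<delta>'"
  have del: "0 < \<delta>" "\<delta> \<le> \<delta>0" "\<delta> < d" "2 * \<delta>' = \<delta> / 2" using d' by (auto simp: \<delta>_def)
  obtain N where glue: "\<And>L l w. 1 \<le> l \<Longrightarrow> (\<And>j. j < L \<Longrightarrow> w j \<in> core) \<Longrightarrow>
     \<exists>z\<in>M. \<forall>j<L. \<forall>i<l. dist ((\<phi> ^^ (j * (l + N) + i)) z) ((\<phi> ^^ i) (w j)) < \<delta>'"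
    by (rule specification_glue[OF S d'(1)]) blast
  \<comment> \<open>Letters so long that the gap \<open>N\<close> is at most the fraction
    \<open>\<eta>\<close> of their length.\<close>
  obtain l0 :: nat where l0: "real N / \<eta> < real l0" using reals_Archimedean2 by blast
  define l where "l = max 1 l0"
  have l: "1 \<le> l" "real N \<le> \<eta> * real l"
  proof -
    show "1 \<le> l" by (simp add: l_def)
    have "real N / \<eta> \<le> real l" using l0 by (simp add: l_def)
    then show "real N \<le> \<eta> * real l" using eta(1) by (simp add: field_simps)
  qed
  define b where "b = l + N"
  have b: "1 \<le> b" "l \<le> b" using l by (auto simp: b_def)
  have core_ne: "core \<noteq> {}" using core_measure[OF Q] by auto
  obtain E u where E: "finite E" "E \<subseteq> core" and su: "simple_function BM u" and uE: "\<And>x. u x \<in> E"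
    and sep: "\<And>x y. x \<in> E \<Longrightarrow> y \<in> E \<Longrightarrow> x \<noteq> y \<Longrightarrow> \<exists>k<l. \<delta> \<le> dist ((\<phi> ^^ k) x) ((\<phi> ^^ k) y)"
    and uclose: "\<And>x k. x \<in> core \<Longrightarrow> k < l \<Longrightarrow> dist ((\<phi> ^^ k) x) ((\<phi> ^^ k) (u x)) < \<delta>"
    by (rule bowen_coding[OF core_sub core_ne del(1), of l]) blast
  have EM: "E \<subseteq> M" using E(2) core_sub by blast
  define q where "q e = measure Q (u -` {e} \<inter> M)" for e
  have sp: "space Q = M" by (rule probs_space[OF Qp])
  have fib: "u -` {e} \<inter> M \<in> sets Q" for e using simple_functionD(2)[OF su, of "{e}"] probs_sets[OF Qp] by simp
  have q1: "sum q E = 1"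
  proof -
    have "(\<Union>e\<in>E. u -` {e} \<inter> M) = M" using uE by auto
    moreover have "measure Q (\<Union>e\<in>E. u -` {e} \<inter> M) = (\<Sum>e\<in>E. measure Q (u -` {e} \<inter> M))"
      using E(1) fib by (intro finite_measure_finite_Union) (auto simp: disjoint_family_on_def)
    ultimately show ?thesis unfolding q_def using prob_space sp by simp
  qed
  have Hq: "real l * c \<le> - (\<Sum>e\<in>E. q e * ln (q e))"
  proof -
    have "real l * c \<le> Hfun Q u" using ent[OF del(2) l(1) su core_sets core_measure[OF Q]] uclose by blast
    also have "Hfun Q u = - (\<Sum>e\<in>E. q e * ln (q e))"
      using Hfun_superset[OF E(1), of u Q] uE sp by (auto simp: q_def)
    finally show ?thesis .
  qed
  define I where "I f = (\<integral>x. f x \<partial>Q)" for f :: "'a \<Rightarrow> real"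
  have IB: "\<bar>I f\<bar> \<le> B" if "f \<in> Fg" for f
    unfolding I_def using B(2)[OF that] continuous_borel[OF Fg(2)[OF that]] by (intro probs_integral_abs_le[OF Qp])
  have mean: "\<bar>(\<Sum>e\<in>E. q e * birkhoff \<phi> l f e) - real l * I f\<bar> \<le> real l * \<eta>" if f: "f \<in> Fg" for f
    unfolding q_def I_def
  proof (rule coding_mean[OF Q su E(1) EM uE Fg(2)[OF f]])
    fix x k assume x: "x \<in> core" and k: "k < l"
    have "u x \<in> M" using uE EM by blast
    then show "\<bar>f ((\<phi> ^^ k) x) - f ((\<phi> ^^ k) (u x))\<bar> \<le> \<eta>"
      using x core_sub iter_in uclose[OF x k] del(3) by (intro d(2)[OF f]) auto
  qed
  have "\<forall>\<^sub>F L in sequentially. \<exists>W \<subseteq> {..<L} \<rightarrow>\<^sub>E E.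
     exp (real L * (- (\<Sum>e\<in>E. q e * ln (q e)) - \<eta>)) \<le> real (card W) \<and>
     (\<forall>w\<in>W. \<forall>h\<in>birkhoff \<phi> l ` Fg. \<bar>(\<Sum>j<L. h (w j)) - real L * (\<Sum>e\<in>E. q e * h e)\<bar> \<le> \<eta> * real L)"
    using E(1) q1 Fg(1) eta(1) by (intro iid_words) (auto simp: q_def)
  then obtain L0 where words: "\<And>L. L \<ge> L0 \<Longrightarrow> \<exists>W \<subseteq> {..<L} \<rightarrow>\<^sub>E E.
     exp (real L * (- (\<Sum>e\<in>E. q e * ln (q e)) - \<eta>)) \<le> real (card W) \<and>
     (\<forall>w\<in>W. \<forall>h\<in>birkhoff \<phi> l ` Fg. \<bar>(\<Sum>j<L. h (w j)) - real L * (\<Sum>e\<in>E. q e * h e)\<bar> \<le> \<eta> * real L)"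
    unfolding eventually_sequentially by blast
  \<comment> \<open>When \<open>Suc L0\<close> blocks fit into \<open>\<eta> * n\<close>, at least
    \<open>L0\<close> blocks are available and one incomplete block is negligible.\<close>
  obtain n1 :: nat where n1: "real (b * Suc L0) / \<eta> < real n1" using reals_Archimedean2 by blast
  show ?thesis
    using gn g(2) eventually_ge_at_top[of "max 1 n1"]
  proof eventually_elim
    case (elim n)
    obtain m where m: "real m \<le> \<eta> * real n"
      and gm: "\<And>x. x \<in> M \<Longrightarrow> exp (G n x - real n * p - \<eta> * real n) \<le> measure (P n) (bowen M \<phi> (n - m) x \<delta>')"
      using elim(1) by blast
    have n: "1 \<le> n" "real (b * Suc L0) \<le> \<eta> * real n"
    proof -
      show "1 \<le> n" using elim(3) by simp
      have "real (b * Suc L0) / \<eta> \<le> real n" using n1 elim(3) by linarith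
      then show "real (b * Suc L0) \<le> \<eta> * real n" using eta(1) by (simp add: pos_divide_le_eq mult.commute)
    qed
    have en: "\<eta> * real n \<le> real n / 4" using eta(2) mult_right_mono[OF eta(2), of "real n"] by simp
    have mn: "m \<le> n" using m en by linarith
    \<comment> \<open>The Gibbs bound controls Bowen balls only up to time \<open>n - m\<close>, so
      the words are placed there while the Birkhoff sums run to \<open>n\<close>.\<close>
    define n' where "n' = n - m"
    define L where "L = n' div b"
    have n'r: "real n' = real n - real m" using mn by (simp add: n'_def of_nat_diff)
    have "real (b * L0) \<le> real n'" 
    proof -
      have "real (b * L0) \<le> real (b * Suc L0)" by simp
      then show ?thesis using n(2) m en n'r by linarith
    qed
    then have "b * L0 \<le> n'" by (simp only: of_nat_le_iff)
    then have LL0: "L0 \<le> L" unfolding L_def using b(1) by (simp add: less_eq_div_iff_mult_less_eq mult.commute)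
    have Lb: "L * b \<le> n'" unfolding L_def by (rule div_times_less_eq_dividend)
    have rem: "n' < L * b + b" unfolding L_def using b(1) dividend_less_times_div[of b n'] by (simp add: mult.commute add.commute)
    have Lln: "real (L * l) \<le> real n"
    proof -
      have "L * l \<le> L * b" using b(2) by simp
      then show ?thesis using Lb n'r by linarith
    qed
    have "L \<le> L * l" using l(1) by simp
    then have Ln: "real L \<le> real (L * l)" by (simp only: of_nat_le_iff)
    \<comment> \<open>The number of times outside the blocks: the lost \<open>m\<close>, the gaps
      \<open>L * N\<close> and the incomplete last block, each at most
      \<open>\<eta> * real n\<close>.\<close>
    define D where "D = real n - real (L * l)"
    have D: "0 \<le> D" "D \<le> 3 * \<eta> * real n"
    proof -
      show "0 \<le> D" using Lln by (simp add: D_def)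
      have "real (L * N) \<le> \<eta> * real (L * l)" using mult_left_mono[OF l(2), of "real L"] by (simp add: mult_ac)
      also have "\<dots> \<le> \<eta> * real n" using Lln eta(1) by (intro mult_left_mono) auto
      finally have LN: "real (L * N) \<le> \<eta> * real n" .
      have bb: "real b \<le> \<eta> * real n"
      proof -
        have "real b \<le> real (b * Suc L0)" by simp
        then show ?thesis using n(2) by linarith
      qed
      have "real n' \<le> real (L * b + b)" using less_imp_le[OF rem] by (simp only: of_nat_le_iff)
      also have "\<dots> = real (L * l) + real (L * N) + real b" by (simp add: b_def algebra_simps)
      finally show "D \<le> 3 * \<eta> * real n" unfolding D_def using n'r LN bb m by linarith
    qed
    obtain W where W: "W \<subseteq> {..<L} \<rightarrow>\<^sub>E E" "exp (real L * (- (\<Sum>e\<in>E. q e * ln (q e)) - \<eta>)) \<le> real (card W)"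
      and Wf: "\<And>w f. w \<in> W \<Longrightarrow> f \<in> Fg \<Longrightarrow> \<bar>(\<Sum>j<L. birkhoff \<phi> l f (w j)) - real L * (\<Sum>e\<in>E. q e * birkhoff \<phi> l f e)\<bar> \<le> \<eta> * real L"
      using words[OF LL0] by blast
    have finW: "finite W" using finite_subset[OF W(1)] E(1) by (simp add: finite_PiE)
    have wE: "w j \<in> E" if "w \<in> W" "j < L" for w j using W(1) that by auto
    have "\<exists>z\<in>M. \<forall>j<L. \<forall>i<l. dist ((\<phi> ^^ (j * b + i)) z) ((\<phi> ^^ i) (w j)) < \<delta>'" if "w \<in> W" for w
      unfolding b_def using wE[OF that] E(2) by (intro glue[OF l(1)]) blast
    then obtain z where z: "\<And>w. w \<in> W \<Longrightarrow> z w \<in> M"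
      and zc: "\<And>w j i. w \<in> W \<Longrightarrow> j < L \<Longrightarrow> i < l \<Longrightarrow> dist ((\<phi> ^^ (j * b + i)) (z w)) ((\<phi> ^^ i) (w j)) < \<delta>'" by metis
    have idx: "j * b + i < n'" if "j < L" "i < l" for j i
    proof -
      have "Suc j * b \<le> L * b" using that(1) by (intro mult_le_mono1) simp
      then show ?thesis using that(2) b(2) Lb by simp
    qed
    have yc: "dist ((\<phi> ^^ (j * b + i)) y) ((\<phi> ^^ i) (w j)) < \<delta> / 2"
      if w: "w \<in> W" and y: "y \<in> bowen M \<phi> n' (z w) \<delta>'" and ji: "j < L" "i < l" for w y j i
    proof -
      have "dist ((\<phi> ^^ (j * b + i)) y) ((\<phi> ^^ (j * b + i)) (z w)) < \<delta>'" using y idx[OF ji] by (simp add: bowen_def)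
      then show ?thesis using zc[OF w ji] dist_triangle_less_add[of "(\<phi> ^^ (j * b + i)) y" "(\<phi> ^^ (j * b + i)) (z w)" \<delta>' "(\<phi> ^^ i) (w j)" \<delta>'] del(4)
        by (simp add: dist_commute)
    qed
    \<comment> \<open>Orbit against letters, typicality and coding mean cost \<open>\<eta>\<close>
      each; the times outside the blocks cost \<open>3 * B * \<eta>\<close> twice, once for the
      orbit and once for the mean. As \<open>1 \<le> B\<close>, the total is at most
      \<open>9 * B * \<eta>\<close> per unit time.\<close>
    have Best: "\<bar>birkhoff \<phi> n f y - real n * I f\<bar> \<le> 9 * B * \<eta> * real n"
      if w: "w \<in> W" and y: "y \<in> bowen M \<phi> n' (z w) \<delta>'" and f: "f \<in> Fg" for w y f
    proof -
      have yM: "y \<in> M" using y by (simp add: bowen_def)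
      have Lbn: "L * b \<le> n" using Lb by (simp add: n'_def)
      have 1: "\<bar>birkhoff \<phi> n f y - (\<Sum>j<L. birkhoff \<phi> l f (w j))\<bar> \<le> real (L * l) * \<eta> + B * D"
        unfolding D_def
      proof (rule birkhoff_blocks[OF Lbn b(2) yM B(2)[OF f]])
        fix j i assume ji: "j < L" "i < l"
        have "w j \<in> M" using wE[OF w ji(1)] EM by blast
        then show "\<bar>f ((\<phi> ^^ (j * b + i)) y) - f ((\<phi> ^^ i) (w j))\<bar> \<le> \<eta>"
          using yc[OF w y ji] del(1,3) yM by (intro d(2)[OF f] iter_in) auto
      qed
      have 2: "\<bar>(\<Sum>j<L. birkhoff \<phi> l f (w j)) - real L * (\<Sum>e\<in>E. q e * birkhoff \<phi> l f e)\<bar> \<le> \<eta> * real L" by (rule Wf[OF w f])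
      have "\<bar>real L * (\<Sum>e\<in>E. q e * birkhoff \<phi> l f e) - real L * (real l * I f)\<bar> = real L * \<bar>(\<Sum>e\<in>E. q e * birkhoff \<phi> l f e) - real l * I f\<bar>"
        by (simp add: right_diff_distrib[symmetric] abs_mult)
      also have "\<dots> \<le> real L * (real l * \<eta>)" using mean[OF f] by (intro mult_left_mono) auto
      finally have 3: "\<bar>real L * (\<Sum>e\<in>E. q e * birkhoff \<phi> l f e) - real (L * l) * I f\<bar> \<le> real (L * l) * \<eta>" by (simp add: mult.assoc)
      have "\<bar>real (L * l) * I f - real n * I f\<bar> = D * \<bar>I f\<bar>" using D(1) by (simp add: D_def left_diff_distrib[symmetric] abs_mult abs_minus_commute)
      also have "\<dots> \<le> D * B" using IB[OF f] D(1) by (intro mult_left_mono)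
      finally have 4: "\<bar>real (L * l) * I f - real n * I f\<bar> \<le> B * D" by (simp add: mult.commute)
      have 5: "real (L * l) * \<eta> \<le> real n * \<eta>" "\<eta> * real L \<le> real n * \<eta>"
        using Lln Ln eta(1) by (auto simp: mult.commute intro!: mult_right_mono)
      have 6: "B * D \<le> 3 * (B * \<eta> * real n)" using mult_left_mono[OF D(2), of B] B(1) by simp
      have 7: "real n * \<eta> \<le> B * \<eta> * real n"
        using mult_right_mono[OF B(1), of "\<eta> * real n"] eta(1) by (simp add: mult_ac)
      show ?thesis using 1 2 3 4 5 6 7 by linarith
    qed
    let ?ball = "\<lambda>w. bowen M \<phi> n' (z w) \<delta>'"
    let ?T = "{x \<in> M. \<forall>f\<in>Fs. \<bar>birkhoff \<phi> n f x / real n - (\<integral>x. f x \<partial>Q)\<bar> < \<epsilon>}"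
    interpret Pn: prob_space "P n" using probs_prob_space[OF P] .
    have Ts: "?T \<in> sets (P n)"
    proof -
      have "{x \<in> space BM. \<forall>f\<in>Fs. \<bar>birkhoff \<phi> n f x / real n - (\<integral>x. f x \<partial>Q)\<bar> < \<epsilon>} \<in> sets BM"
      proof (rule sets.sets_Collect_finite_All[OF _ Fs(1)])
        fix f assume "f \<in> Fs"
        then have "continuous_on M (\<lambda>x. \<bar>birkhoff \<phi> n f x / real n - (\<integral>x. f x \<partial>Q)\<bar>)"
          using n(1) by (intro continuous_intros birkhoff_cont Fs(2)) auto
        from borel_measurable_less[OF continuous_borel[OF this] borel_measurable_const[of \<epsilon> BM]]
        show "{x \<in> space BM. \<bar>birkhoff \<phi> n f x / real n - (\<integral>x. f x \<partial>Q)\<bar> < \<epsilon>} \<in> sets BM" .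
      qed
      then show ?thesis using probs_sets[OF P] by simp
    qed
    have sub: "(\<Union>w\<in>W. ?ball w) \<subseteq> ?T"
    proof
      fix y assume "y \<in> (\<Union>w\<in>W. ?ball w)"
      then obtain w where w: "w \<in> W" "y \<in> ?ball w" by blast
      have "\<bar>birkhoff \<phi> n f y / real n - I f\<bar> < \<epsilon>" if f: "f \<in> Fs" for f
      proof -
        have "\<bar>birkhoff \<phi> n f y - real n * I f\<bar> \<le> 9 * B * \<eta> * real n" using Best[OF w] f Fg(4) by blast
        also have "\<dots> \<le> \<epsilon> / 8 * real n" using eta(3) by (intro mult_right_mono) auto
        finally have "\<bar>birkhoff \<phi> n f y - real n * I f\<bar> / real n \<le> \<epsilon> / 8" using n(1) by (simp add: field_simps)
        moreover have "birkhoff \<phi> n f y / real n - I f = (birkhoff \<phi> n f y - real n * I f) / real n"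
          using n(1) by (simp add: field_simps)
        then have "\<bar>birkhoff \<phi> n f y - real n * I f\<bar> / real n = \<bar>birkhoff \<phi> n f y / real n - I f\<bar>" by simp
        ultimately show ?thesis using eps by linarith
      qed
      then show "y \<in> ?T" using w(2) by (simp add: bowen_def I_def)
    qed
    \<comment> \<open>A common point would be within \<open>\<delta> / 2\<close> of two letters that
      are at least \<open>\<delta>\<close> apart at some time.\<close>
    have disj: "disjoint_family_on ?ball W"
      unfolding disjoint_family_on_def
    proof (intro ballI impI)
      fix w w' assume ww: "w \<in> W" "w' \<in> W" "w \<noteq> w'"
      have "\<exists>j<L. w j \<noteq> w' j"
      proof (rule ccontr)
        assume "\<not> ?thesis"
        then have "w = w'" using W(1) ww by (intro PiE_ext[of w "{..<L}" "\<lambda>_. E" w']) auto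
        then show False using ww(3) by simp
      qed
      then obtain j where j: "j < L" "w j \<noteq> w' j" by blast
      obtain k where k: "k < l" "\<delta> \<le> dist ((\<phi> ^^ k) (w j)) ((\<phi> ^^ k) (w' j))"
        using sep[OF wE[OF ww(1) j(1)] wE[OF ww(2) j(1)] j(2)] by blast
      have False if y: "y \<in> ?ball w" "y \<in> ?ball w'" for y
        using yc[OF ww(1) y(1) j(1) k(1)] yc[OF ww(2) y(2) j(1) k(1)] k(2)
          dist_triangle3[of "(\<phi> ^^ k) (w j)" "(\<phi> ^^ k) (w' j)" "(\<phi> ^^ (j * b + k)) y"] by linarith
      then show "?ball w \<inter> ?ball w' = {}" by blast
    qed
    let ?a = "real n * (I g - 9 * B * \<eta> - \<epsilon> / 8 - p - \<eta>)"
    have each: "exp ?a \<le> measure (P n) (?ball w)" if w: "w \<in> W" for w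
    proof -
      have zz: "z w \<in> ?ball w" using z[OF w] d'(1) by (simp add: bowen_def)
      have "real n * I g - 9 * B * \<eta> * real n \<le> birkhoff \<phi> n g (z w)" using Best[OF w zz Fg(3)] by linarith
      moreover have "birkhoff \<phi> n g (z w) - \<epsilon> / 8 * real n \<le> G n (z w)" 
      proof -
        have "\<bar>G n (z w) - birkhoff \<phi> n g (z w)\<bar> \<le> \<epsilon> / 8 * real n" using elim(2) z[OF w] by blast
        then show ?thesis by linarith
      qed
      ultimately have "?a \<le> G n (z w) - real n * p - \<eta> * real n" by (simp add: algebra_simps)
      then have "exp ?a \<le> exp (G n (z w) - real n * p - \<eta> * real n)" by simp
      also have "\<dots> \<le> measure (P n) (?ball w)" unfolding n'_def by (rule gm[OF z[OF w]])
      finally show ?thesis .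
    qed
    have "real (card W) * exp ?a \<le> (\<Sum>w\<in>W. measure (P n) (?ball w))"
      using sum_mono[of W "\<lambda>_. exp ?a" "\<lambda>w. measure (P n) (?ball w)"] each by simp
    also have "\<dots> = measure (P n) (\<Union>w\<in>W. ?ball w)"
      using finW disj bowen_sets probs_sets[OF P] by (intro Pn.finite_measure_finite_Union[symmetric]) auto
    also have "\<dots> \<le> measure (P n) ?T" using sub Ts by (intro Pn.finite_measure_mono)
    finally have up: "real (card W) * exp ?a \<le> measure (P n) ?T" .
    \<comment> \<open>Five losses of at most \<open>\<epsilon> / 8\<close>: entropy in the gaps,
      \<open>g\<close> against \<open>G\<close> in the mean and along the orbit, the Birkhoff error,
      and the two slacks \<open>\<eta>\<close> from word count and Gibbs bound.\<close>
    have "exp (real n * (seq_functional G Q + c - p - \<epsilon>)) \<le> exp (real L * (real l * c - \<eta>)) * exp ?a"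
    proof -
      have "real n * c - real n * (\<epsilon> / 8) \<le> real (L * l) * c"
      proof -
        have "real n * c - real (L * l) * c = D * c" by (simp add: D_def algebra_simps)
        also have "\<dots> \<le> D * \<bar>c\<bar>" using D(1) by (intro mult_left_mono) auto
        also have "\<dots> \<le> 3 * \<eta> * real n * \<bar>c\<bar>" using D(2) by (intro mult_right_mono) auto
        also have "\<dots> \<le> real n * (\<epsilon> / 8)" using mult_right_mono[OF eta(4), of "real n"] by (simp add: mult_ac)
        finally show ?thesis by linarith
      qed
      moreover have "real L * \<eta> \<le> real n * \<eta>" using Ln Lln eta(1) by (intro mult_right_mono) auto
      moreover have "real n * seq_functional G Q - real n * (\<epsilon> / 8) \<le> real n * I g"
      proof -
        have "seq_functional G Q - \<epsilon> / 8 \<le> I g" using Gg unfolding I_def by linarith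
        from mult_left_mono[OF this, of "real n"] show ?thesis by (simp add: right_diff_distrib)
      qed
      moreover have "real n * (9 * B * \<eta>) \<le> real n * (\<epsilon> / 8)" using eta(3) by (intro mult_left_mono) auto
      moreover have "real n * (2 * \<eta>) \<le> real n * (\<epsilon> / 8)" using eta2 by (intro mult_left_mono) auto
      moreover have "0 \<le> real n * \<epsilon>" using eps by simp
      ultimately have "real n * (seq_functional G Q + c - p - \<epsilon>) \<le> real L * (real l * c - \<eta>) + ?a"
        by (simp add: algebra_simps)
      then show ?thesis by (simp add: exp_add[symmetric])
    qed
    also have "\<dots> \<le> exp (real L * (- (\<Sum>e\<in>E. q e * ln (q e)) - \<eta>)) * exp ?a"
      using Hq by (intro mult_right_mono) (auto intro!: mult_left_mono)
    also have "\<dots> \<le> real (card W) * exp ?a" using W(2) by (intro mult_right_mono) auto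
    also have "\<dots> \<le> measure (P n) ?T" by (rule up)
    finally show ?case .
  qed
qed

end

subsection \<open>Separation of concave functions\<close>

text \<open>The multipliers are read off an almost minimal point \<open>q\<close> of the squared distance \<open>J\<close>: moving from \<open>q\<close> towards any \<open>x\<close> cannot decrease \<open>J\<close> below its infimum.\<close>
lemma concave_separation:
  fixes v :: "'i \<Rightarrow> 'x \<Rightarrow> real" and F :: "'x \<Rightarrow> real"
  assumes X: "X \<noteq> {}"
    and mix: "\<And>x y t. x \<in> X \<Longrightarrow> y \<in> X \<Longrightarrow> 0 \<le> t \<Longrightarrow> t \<le> 1 \<Longrightarrow>
        \<exists>z\<in>X. (\<forall>i\<in>I. v i z = (1 - t) * v i x + t * v i y) \<and> (1 - t) * F x + t * F y \<le> F z"
    and bound: "\<And>x. x \<in> X \<Longrightarrow> (\<Sum>i\<in>I. (v i x)\<^sup>2) + (c - F x)\<^sup>2 \<le> B"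
    and pos: "0 < r0" "\<And>x. x \<in> X \<Longrightarrow> r0 \<le> (\<Sum>i\<in>I. (v i x)\<^sup>2) + (max 0 (c - F x))\<^sup>2"
  obtains l \<mu> \<eta> where "0 \<le> \<mu>" "0 < \<eta>" "\<And>x. x \<in> X \<Longrightarrow> \<eta> \<le> (\<Sum>i\<in>I. l i * v i x) + \<mu> * (c - F x)"
proof -
  define J where "J x = (\<Sum>i\<in>I. (v i x)\<^sup>2) + (max 0 (c - F x))\<^sup>2" for x
  define R where "R = (INF x\<in>X. J x)"
  have bdd: "bdd_below (J ` X)" using pos(2) by (intro bdd_belowI[of _ r0]) (auto simp: J_def)
  have Rle: "R \<le> J x" if "x \<in> X" for x unfolding R_def using bdd that by (rule cINF_lower)
  have "r0 \<le> R" unfolding R_def using X pos(2) by (intro cINF_greatest) (auto simp: J_def)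
  then have R: "0 < R" using pos(1) by simp
  have B: "0 \<le> B"
  proof -
    obtain x where "x \<in> X" using X by blast
    then show ?thesis using order_trans[OF _ bound[of x], of 0] by (simp add: sum_nonneg)
  qed
  \<comment> \<open>Step length at which the second-order term is half of the first-order decrease
    \<open>t * R\<close> of the squared distance.\<close>
  define t where "t = R / (2 * (R + B))"
  have t: "0 < t" "t \<le> 1" "t * (R + B) = R / 2" using R B by (auto simp: t_def field_simps)
  obtain q where q: "q \<in> X" "J q < R + t * R / 2"
    using cINF_less_iff[OF X bdd, of "R + t * R / 2"] R t(1) unfolding R_def by auto
  \<comment> \<open>Half the derivative of the squared distance in the last coordinate; the
    truncation makes the multiplier of \<open>F\<close> nonnegative.\<close>
  define w where "w = max 0 (c - F q)"
  show ?thesis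
  proof (rule that[of w "R / 4" "\<lambda>i. v i q"])
    show "0 \<le> w" by (simp add: w_def)
    show "0 < R / 4" using R by simp
    fix x assume x: "x \<in> X"
    define y where "y = c - F x"
    define A where "A = (\<Sum>i\<in>I. v i q * v i x) + w * y"
    have "R / 4 \<le> A"
    proof (rule ccontr)
      assume "\<not> ?thesis"
      then have A: "A < R / 4" by simp
      obtain z where z: "z \<in> X" "\<forall>i\<in>I. v i z = (1 - t) * v i q + t * v i x" "(1 - t) * F q + t * F x \<le> F z"
        using mix[OF q(1) x, of t] t by auto
      have "R \<le> J z" by (rule Rle[OF z(1)])
      also have "J z \<le> (\<Sum>i\<in>I. ((1 - t) * v i q + t * v i x)\<^sup>2) + ((1 - t) * w + t * y)\<^sup>2"
      proof -
        have "c - F z \<le> (1 - t) * (c - F q) + t * y" using z(3) by (simp add: y_def algebra_simps)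
        also have "\<dots> \<le> (1 - t) * w + t * y" using t by (intro add_right_mono mult_left_mono) (auto simp: w_def)
        finally have "max 0 (c - F z) \<le> \<bar>(1 - t) * w + t * y\<bar>" by simp
        then have "(max 0 (c - F z))\<^sup>2 \<le> ((1 - t) * w + t * y)\<^sup>2" by (metis max.cobounded1 power2_abs power_mono)
        then show ?thesis using z(2) by (simp add: J_def)
      qed
      also have "\<dots> = (1 - t)\<^sup>2 * J q + 2 * (t * (1 - t)) * A + t\<^sup>2 * ((\<Sum>i\<in>I. (v i x)\<^sup>2) + y\<^sup>2)"
      proof -
        have sq: "((1 - t) * a + t * b)\<^sup>2 = (1 - t)\<^sup>2 * a\<^sup>2 + 2 * (t * (1 - t)) * (a * b) + t\<^sup>2 * b\<^sup>2" for a b :: real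
          by (simp add: power2_eq_square algebra_simps)
        show ?thesis unfolding sq sum.distrib sum_distrib_left[symmetric] J_def A_def w_def[symmetric]
          by (simp only: distrib_left add_ac)
      qed
      also have "\<dots> \<le> ((1 - t)\<^sup>2 * R + t * R / 2) + t * (R / 2) + t\<^sup>2 * B"
      proof (intro add_mono)
        have t2: "0 \<le> (1 - t)\<^sup>2" "(1 - t)\<^sup>2 \<le> 1" using t by (auto intro: power_le_one)
        have "(1 - t)\<^sup>2 * J q \<le> (1 - t)\<^sup>2 * (R + t * R / 2)" using q(2) t2 by (intro mult_left_mono) auto
        also have "\<dots> = (1 - t)\<^sup>2 * R + (1 - t)\<^sup>2 * (t * R / 2)" by (simp add: algebra_simps)
        also have "(1 - t)\<^sup>2 * (t * R / 2) \<le> 1 * (t * R / 2)" using t2 t(1) R by (intro mult_right_mono) auto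
        finally show "(1 - t)\<^sup>2 * J q \<le> (1 - t)\<^sup>2 * R + t * R / 2" by simp
        have "2 * (t * (1 - t)) * A \<le> 2 * (t * (1 - t)) * (R / 4)" using A t by (intro mult_left_mono) auto
        also have "\<dots> \<le> 2 * (t * 1) * (R / 4)" using t R by (intro mult_right_mono mult_left_mono) auto
        also have "\<dots> = t * (R / 2)" by simp
        finally show "2 * (t * (1 - t)) * A \<le> t * (R / 2)" .
        show "t\<^sup>2 * ((\<Sum>i\<in>I. (v i x)\<^sup>2) + y\<^sup>2) \<le> t\<^sup>2 * B" using bound[OF x] by (intro mult_left_mono) (auto simp: y_def)
      qed
      also have "\<dots> = R - t * R + t * (t * (R + B))" by (simp add: power2_eq_square algebra_simps)
      also have "\<dots> = R - t * R / 2" unfolding t(3) by (simp add: field_simps)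
      finally show False using mult_pos_pos[OF t(1) R] by linarith
    qed
    then show "R / 4 \<le> (\<Sum>i\<in>I. v i q * v i x) + w * (c - F x)" by (simp add: A_def y_def)
  qed
qed

subsection \<open>Convex combinations of invariant measures\<close>

context dyn_system
begin

text \<open>A Bernoulli choice between the two measures, followed by a draw from the chosen
  one.\<close>

lemma mixture_exists:
  assumes Q1: "Q1 \<in> probs M" and Q2: "Q2 \<in> probs M" and t: "0 \<le> t" "t \<le> 1"
  obtains Q where "Q \<in> probs M"
    "\<And>A. A \<in> sets BM \<Longrightarrow> measure Q A = (1 - t) * measure Q1 A + t * measure Q2 A"
    "\<And>f :: 'a \<Rightarrow> real. continuous_on M f \<Longrightarrow> (\<integral>x. f x \<partial>Q) = (1 - t) * (\<integral>x. f x \<partial>Q1) + t * (\<integral>x. f x \<partial>Q2)"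
proof -
  define K where "K b = (if b then Q2 else Q1)" for b
  interpret Q1: prob_space Q1 using probs_prob_space[OF Q1] .
  interpret Q2: prob_space Q2 using probs_prob_space[OF Q2] .
  have Kp: "prob_space (K b)" "sets (K b) = sets BM" for b
    using probs_prob_space[OF Q1] probs_prob_space[OF Q2] probs_sets[OF Q1] probs_sets[OF Q2] by (auto simp: K_def)
  have Km: "K \<in> measurable (measure_pmf (bernoulli_pmf t)) (subprob_algebra BM)"
    using Kp by (auto simp: measurable_def space_subprob_algebra prob_space_imp_subprob_space)
  define Q where "Q = measure_pmf (bernoulli_pmf t) \<bind> K"
  have Qp: "Q \<in> probs M"
    unfolding probs_def Q_def
    using measure_pmf.prob_space_bind[OF _ Km] Kp sets_bind_measurable[OF Km] by auto
  have Qm: "measure Q A = (1 - t) * measure Q1 A + t * measure Q2 A" if A: "A \<in> sets BM" for A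
  proof -
    have nn: "0 \<le> (1 - t) * measure Q1 A + t * measure Q2 A" using t by (intro add_nonneg_nonneg mult_nonneg_nonneg) auto
    have "emeasure Q A = (\<integral>\<^sup>+b. emeasure (K b) A \<partial>measure_pmf (bernoulli_pmf t))"
      unfolding Q_def using Km A by (intro emeasure_bind) auto
    also have "\<dots> = emeasure Q2 A * ennreal t + emeasure Q1 A * ennreal (1 - t)"
      using t by (simp add: K_def)
    also have "\<dots> = ennreal ((1 - t) * measure Q1 A + t * measure Q2 A)"
      using t unfolding Q1.emeasure_eq_measure Q2.emeasure_eq_measure
      by (simp add: ennreal_mult[symmetric] ennreal_plus[symmetric] mult.commute add.commute del: ennreal_plus)
    finally have eq: "emeasure Q A = ennreal ((1 - t) * measure Q1 A + t * measure Q2 A)" .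
    show ?thesis unfolding measure_def[of Q A] eq by (rule enn2real_ennreal[OF nn])
  qed
  have Qi: "(\<integral>x. f x \<partial>Q) = (1 - t) * (\<integral>x. f x \<partial>Q1) + t * (\<integral>x. f x \<partial>Q2)" if f: "continuous_on M f" for f :: "'a \<Rightarrow> real"
  proof -
    obtain B where B: "0 < B" "\<And>x. x \<in> M \<Longrightarrow> \<bar>f x\<bar> \<le> B" by (rule continuous_bound[OF f]) blast
    \<comment> \<open>The shift makes the integrand nonnegative, so the two-stage integral can be
      computed with nonnegative integrals.\<close>
    define h where "h x = f x + B" for x
    have hc: "continuous_on M h" unfolding h_def using f by (intro continuous_intros)
    have h0: "0 \<le> h x" if "x \<in> M" for x using B(2)[OF that] by (simp add: h_def abs_le_iff)
    have nn: "(\<integral>\<^sup>+x. ennreal (h x) \<partial>R) = ennreal (\<integral>x. h x \<partial>R)" if R: "R \<in> probs M" for R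
      using probs_integrable[OF R hc] h0 probs_space[OF R] by (intro nn_integral_eq_integral) (auto intro!: AE_I2)
    have pos: "0 \<le> (\<integral>x. h x \<partial>R)" if R: "R \<in> probs M" for R
      using h0 probs_space[OF R] by (intro integral_nonneg_AE AE_I2) auto
    have hsum: "(\<integral>x. h x \<partial>R) = (\<integral>x. f x \<partial>R) + B" if R: "R \<in> probs M" for R
    proof -
      interpret R: prob_space R using probs_prob_space[OF R] .
      show ?thesis unfolding h_def using probs_integrable[OF R f] R.prob_space by simp
    qed
    have "ennreal (\<integral>x. h x \<partial>Q) = (\<integral>\<^sup>+x. ennreal (h x) \<partial>Q)" by (simp add: nn[OF Qp])
    also have "\<dots> = (\<integral>\<^sup>+b. (\<integral>\<^sup>+x. ennreal (h x) \<partial>K b) \<partial>measure_pmf (bernoulli_pmf t))"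
      unfolding Q_def using continuous_borel[OF hc] Km by (intro nn_integral_bind[where B=BM]) auto
    also have "\<dots> = ennreal (\<integral>x. h x \<partial>Q2) * ennreal t + ennreal (\<integral>x. h x \<partial>Q1) * ennreal (1 - t)"
      using t by (simp add: K_def nn[OF Q1] nn[OF Q2])
    also have "\<dots> = ennreal ((1 - t) * (\<integral>x. h x \<partial>Q1) + t * (\<integral>x. h x \<partial>Q2))"
      using t pos[OF Q1] pos[OF Q2]
      by (simp add: ennreal_mult[symmetric] ennreal_plus[symmetric] mult.commute add.commute del: ennreal_plus)
    finally have "(\<integral>x. h x \<partial>Q) = (1 - t) * (\<integral>x. h x \<partial>Q1) + t * (\<integral>x. h x \<partial>Q2)"
      using t pos[OF Q1] pos[OF Q2] pos[OF Qp] by (subst (asm) ennreal_inj) auto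
    then show ?thesis unfolding hsum[OF Q1] hsum[OF Q2] hsum[OF Qp] by (simp add: algebra_simps)
  qed
  show ?thesis using that[OF Qp Qm Qi] .
qed

lemma hfun_mono:
  assumes Q: "Q \<in> inv_probs M \<phi>" and f: "simple_function BM f" and g: "simple_function BM g"
    and fg: "\<And>x y. g x = g y \<Longrightarrow> f x = f y"
  shows "hfun Q f \<le> hfun Q g"
proof -
  note Qp = inv_probs_probs[OF Q]
  have "Hfun Q (word f n) \<le> Hfun Q (word g n)" for n
  proof (rule Hfun_mono[OF probs_prob_space[OF Qp]])
    show "simple_function Q (word g n)" unfolding probs_simple_function[OF Qp] by (rule simple_function_word[OF g])
    fix x y assume "word g n x = word g n y"
    then have "g ((\<phi> ^^ k) x) = g ((\<phi> ^^ k) y)" if "k < n" for k using that by (simp add: word_def)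
    then have "f ((\<phi> ^^ k) x) = f ((\<phi> ^^ k) y)" if "k < n" for k using that by (intro fg)
    then show "word f n x = word f n y" unfolding word_def by (intro map_cong refl) auto
  qed
  then show ?thesis
    by (intro LIMSEQ_le[OF hfun(1)[OF Q f] hfun(1)[OF Q g]]) (auto intro!: exI[of _ 0] divide_right_mono)
qed

text \<open>One joint coding is nearly optimal for both measures. Concavity holds for each block
  length and passes to the limit.\<close>

lemma inv_mixture:
  assumes Q1: "Q1 \<in> inv_probs M \<phi>" and Q2: "Q2 \<in> inv_probs M \<phi>" and t: "0 \<le> t" "t \<le> 1"
    and h: "ks_entropy M \<phi> Q1 = ereal h1" "ks_entropy M \<phi> Q2 = ereal h2"
  obtains Q where "Q \<in> inv_probs M \<phi>"
    "\<And>f :: 'a \<Rightarrow> real. continuous_on M f \<Longrightarrow> (\<integral>x. f x \<partial>Q) = (1 - t) * (\<integral>x. f x \<partial>Q1) + t * (\<integral>x. f x \<partial>Q2)"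
    "ereal ((1 - t) * h1 + t * h2) \<le> ks_entropy M \<phi> Q"
proof -
  note Q1p = inv_probs_probs[OF Q1] and Q2p = inv_probs_probs[OF Q2]
  obtain Q where Qp: "Q \<in> probs M"
    and Qm: "\<And>A. A \<in> sets BM \<Longrightarrow> measure Q A = (1 - t) * measure Q1 A + t * measure Q2 A"
    and Qi: "\<And>f :: 'a \<Rightarrow> real. continuous_on M f \<Longrightarrow> (\<integral>x. f x \<partial>Q) = (1 - t) * (\<integral>x. f x \<partial>Q1) + t * (\<integral>x. f x \<partial>Q2)"
    by (rule mixture_exists[OF Q1p Q2p t]) blast
  have Q: "Q \<in> inv_probs M \<phi>"
  proof (rule inv_probsI[OF Qp])
    fix f :: "'a \<Rightarrow> real" assume f: "continuous_on M f"
    have f1: "continuous_on M (\<lambda>x. f (\<phi> x))" using comp_iter_cont[OF f, of 1] by simp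
    show "(\<integral>x. f (\<phi> x) \<partial>Q) = (\<integral>x. f x \<partial>Q)"
      unfolding Qi[OF f] Qi[OF f1]
      using inv_probs_integral[OF Q1 continuous_borel[OF f], of 1] inv_probs_integral[OF Q2 continuous_borel[OF f], of 1] by simp
  qed
  have "ereal ((1 - t) * h1 + t * h2) \<le> ks_entropy M \<phi> Q"
  proof (rule ereal_le_epsilon2)
    fix e :: real assume e: "0 < e"
    have c: "ereal (h1 - e) < ks_entropy M \<phi> Q1" "ereal (h2 - e) < ks_entropy M \<phi> Q2" using h e by auto
    obtain \<xi>1 where x1: "simple_function BM (cell \<xi>1)" "h1 - e < hfun Q1 (cell \<xi>1)"
      by (rule less_ks_entropyE[OF Q1 c(1)]) blast
    obtain \<xi>2 where x2: "simple_function BM (cell \<xi>2)" "h2 - e < hfun Q2 (cell \<xi>2)"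
      by (rule less_ks_entropyE[OF Q2 c(2)]) blast
    define f where "f x = (cell \<xi>1 x, cell \<xi>2 x)" for x
    have f: "simple_function BM f" unfolding f_def by (intro simple_function_Pair x1 x2)
    have f1: "h1 - e < hfun Q1 f" using x1(2) hfun_mono[OF Q1 x1(1) f] by (fastforce simp: f_def)
    have f2: "h2 - e < hfun Q2 f" using x2(2) hfun_mono[OF Q2 x2(1) f] by (fastforce simp: f_def)
    have "(1 - t) * Hfun Q1 (word f n) + t * Hfun Q2 (word f n) \<le> Hfun Q (word f n)" for n
    proof -
      have "(\<Sum>b\<in>UNIV. (if b then t else 1 - t) * Hfun (if b then Q2 else Q1) (word f n)) \<le> Hfun Q (word f n)"
        using t Qm simple_function_word[OF f] probs_space[OF Q1p] probs_space[OF Q2p] probs_space[OF Qp] probs_sets[OF Qp]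
        by (intro Hfun_concave) (auto simp: UNIV_bool probs_simple_function[OF Qp])
      then show ?thesis by (simp add: UNIV_bool add.commute)
    qed
    then have le: "(1 - t) * (Hfun Q1 (word f n) / real n) + t * (Hfun Q2 (word f n) / real n) \<le> Hfun Q (word f n) / real n" for n
      by (simp add: add_divide_distrib[symmetric] divide_right_mono)
    have lim: "(\<lambda>n. (1 - t) * (Hfun Q1 (word f n) / real n) + t * (Hfun Q2 (word f n) / real n))
       \<longlonglongrightarrow> (1 - t) * hfun Q1 f + t * hfun Q2 f"
      by (intro tendsto_add tendsto_mult tendsto_const hfun(1) Q1 Q2 f)
    have "(1 - t) * hfun Q1 f + t * hfun Q2 f \<le> hfun Q f"
      by (rule LIMSEQ_le[OF lim hfun(1)[OF Q f]]) (use le in blast)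
    moreover have "(1 - t) * (h1 - e) + t * (h2 - e) \<le> (1 - t) * hfun Q1 f + t * hfun Q2 f"
      using f1 f2 t by (intro add_mono mult_left_mono) auto
    ultimately have "(1 - t) * h1 + t * h2 \<le> hfun Q f + e" by (simp add: algebra_simps)
    then have "ereal ((1 - t) * h1 + t * h2) \<le> ereal (hfun Q f) + ereal e" by simp
    also have "\<dots> \<le> ks_entropy M \<phi> Q + ereal e" by (intro add_right_mono hfun_le_ks_entropy[OF Q f])
    finally show "ereal ((1 - t) * h1 + t * h2) \<le> ks_entropy M \<phi> Q + ereal e" .
  qed
  then show ?thesis using that[OF Q Qi] by blast
qed

subsection \<open>Empirical measures\<close>

lemma empirical_eq:
  assumes n: "1 \<le> n" and x: "x \<in> M"
  shows "empirical M \<phi> n x = dirac_mix {..<n} (\<lambda>_. 1 / real n) (\<lambda>k. (\<phi> ^^ k) x)"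
proof -
  have im: "(\<lambda>k. (\<phi> ^^ k) x) ` {..<n} \<subseteq> M" using iter_in[OF x] by auto
  have s1: "(\<Sum>k<n. 1 / real n) = 1" using n by simp
  have nn: "0 \<le> 1 / real n" by simp
  note dm = dirac_mix[of "{..<n}" "\<lambda>_. 1 / real n" "\<lambda>k. (\<phi> ^^ k) x", OF finite_lessThan nn s1 im]
  let ?D = "dirac_mix {..<n} (\<lambda>_. 1 / real n) (\<lambda>k. (\<phi> ^^ k) x)"
  have sD: "sets ?D = sets BM" "space ?D = M" using probs_sets[OF dm(1)] probs_space[OF dm(1)] by auto
  have "ennreal (real (card {k \<in> {..<n}. (\<phi> ^^ k) x \<in> A}) / real n) = emeasure ?D A" if "A \<in> sets BM" for A
  proof -
    have "(\<Sum>k<n. 1 / real n * indicator A ((\<phi> ^^ k) x)) = (\<Sum>k\<in>{k \<in> {..<n}. (\<phi> ^^ k) x \<in> A}. 1 / real n)"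
      by (intro sum.mono_neutral_cong_right) (auto simp: indicator_def)
    then show ?thesis unfolding dm(2)[OF that] by simp
  qed
  then have "empirical M \<phi> n x = measure_of M (sets BM) (emeasure ?D)"
    unfolding empirical_def using sets.space_closed[of BM] sets.sigma_sets_eq[of BM] by (intro measure_of_eq) auto
  also have "\<dots> = ?D" using measure_of_of_measure[of ?D] sD by simp
  finally show ?thesis .
qed

lemma empirical_probs: "1 \<le> n \<Longrightarrow> x \<in> M \<Longrightarrow> empirical M \<phi> n x \<in> probs M"
  unfolding empirical_eq using iter_in by (intro dirac_mix(1)) auto

lemma empirical_integral:
  assumes n: "1 \<le> n" and x: "x \<in> M" and f: "continuous_on M f"
  shows "(\<integral>y. f y \<partial>empirical M \<phi> n x) = birkhoff \<phi> n f x / real n"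
proof -
  have "(\<integral>y. f y \<partial>empirical M \<phi> n x) = (\<Sum>k<n. 1 / real n * f ((\<phi> ^^ k) x))"
    unfolding empirical_eq[OF n x] using iter_in[OF x] n by (intro dirac_mix(4) continuous_borel[OF f]) auto
  then show ?thesis by (simp add: birkhoff_def sum_divide_distrib)
qed

text \<open>Integrals against empirical measures are Birkhoff averages, continuous in the point; so
  weakly open sets pull back to relatively open sets, and the rest follows by induction on the
  sigma-algebra.\<close>

lemma empirical_event_sets:
  assumes n: "1 \<le> n" and G: "\<Gamma> \<in> weak_borel M"
  shows "{x \<in> M. empirical M \<phi> n x \<in> \<Gamma>} \<in> sets BM"
  using G unfolding weak_borel_def
proof induction
  case (Basic U)
  let ?A = "{x \<in> M. empirical M \<phi> n x \<in> U}"
  have "\<exists>T. open T \<and> x \<in> T \<and> T \<inter> M \<subseteq> ?A" if x: "x \<in> ?A" for x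
  proof -
    have xM: "x \<in> M" and xU: "empirical M \<phi> n x \<in> U" using x by auto
    obtain Fs e where F: "finite Fs" "\<And>f. f \<in> Fs \<Longrightarrow> continuous_on M f" "0 < (e::real)"
      "\<And>Q'. Q' \<in> probs M \<Longrightarrow> (\<And>f. f \<in> Fs \<Longrightarrow> \<bar>(\<integral>x. f x \<partial>Q') - (\<integral>y. f y \<partial>empirical M \<phi> n x)\<bar> < e) \<Longrightarrow> Q' \<in> U"
      by (rule weak_top_nbhd[OF _ xU]) (use Basic in auto)
    have "\<forall>\<^sub>F y in at x within M. \<forall>f\<in>Fs. \<bar>birkhoff \<phi> n f y / real n - birkhoff \<phi> n f x / real n\<bar> < e"
    proof (intro eventually_ball_finite ballI F(1))
      fix f assume f: "f \<in> Fs"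
      have "continuous_on M (\<lambda>y. birkhoff \<phi> n f y / real n)"
        using n by (intro continuous_intros birkhoff_cont F(2) f) auto
      then have "((\<lambda>y. birkhoff \<phi> n f y / real n) \<longlongrightarrow> birkhoff \<phi> n f x / real n) (at x within M)"
        using xM by (simp add: continuous_on_def)
      from tendstoD[OF this F(3)] show "\<forall>\<^sub>F y in at x within M. \<bar>birkhoff \<phi> n f y / real n - birkhoff \<phi> n f x / real n\<bar> < e"
        by (simp add: dist_real_def)
    qed
    then obtain d where d: "0 < d" "\<And>y. y \<in> M \<Longrightarrow> y \<noteq> x \<Longrightarrow> dist y x < d \<Longrightarrow> \<forall>f\<in>Fs. \<bar>birkhoff \<phi> n f y / real n - birkhoff \<phi> n f x / real n\<bar> < e"
      unfolding eventually_at by blast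
    have "ball x d \<inter> M \<subseteq> ?A"
    proof
      fix y assume y: "y \<in> ball x d \<inter> M"
      show "y \<in> ?A"
      proof (cases "y = x")
        case True then show ?thesis using x by simp
      next
        case False
        have "empirical M \<phi> n y \<in> U"
        proof (rule F(4)[OF empirical_probs[OF n]])
          show "y \<in> M" using y by simp
          fix f assume f: "f \<in> Fs"
          show "\<bar>(\<integral>x. f x \<partial>empirical M \<phi> n y) - (\<integral>y. f y \<partial>empirical M \<phi> n x)\<bar> < e"
            using d(2)[of y] y False f empirical_integral[OF n _ F(2)[OF f], of y] empirical_integral[OF n xM F(2)[OF f]]
            by (simp add: dist_commute)
        qed
        then show ?thesis using y by simp
      qed
    qed
    then show ?thesis using d(1) by (intro exI[of _ "ball x d"]) auto
  qed
  then have "\<exists>T. \<forall>x. x \<in> ?A \<longrightarrow> open (T x) \<and> x \<in> T x \<and> T x \<inter> M \<subseteq> ?A" by (intro choice) blast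
  then obtain T where T: "\<And>x. x \<in> ?A \<Longrightarrow> open (T x)" "\<And>x. x \<in> ?A \<Longrightarrow> x \<in> T x" "\<And>x. x \<in> ?A \<Longrightarrow> T x \<inter> M \<subseteq> ?A" by blast
  define T' where "T' = (\<Union>x\<in>?A. T x)"
  have eq: "?A = T' \<inter> M"
    unfolding T'_def
  proof (intro equalityI subsetI)
    fix x assume x: "x \<in> ?A"
    then show "x \<in> (\<Union>x\<in>?A. T x) \<inter> M" using T(2)[OF x] by blast
  next
    fix x assume "x \<in> (\<Union>x\<in>?A. T x) \<inter> M"
    then obtain y where "y \<in> ?A" "x \<in> T y" "x \<in> M" by blast
    then show "x \<in> ?A" using T(3)[of y] by blast
  qed
  have "open T'" unfolding T'_def by (intro open_UN ballI T(1))
  then show ?case by (subst eq) (rule open_Int_sets)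
next
  case Empty then show ?case by simp
next
  case (Compl a)
  have "{x \<in> M. empirical M \<phi> n x \<in> probs M - a} = M - {x \<in> M. empirical M \<phi> n x \<in> a}"
    using empirical_probs[OF n] by auto
  then show ?case using sets.compl_sets[OF Compl.IH] by simp
next
  case (Union a)
  have "{x \<in> M. empirical M \<phi> n x \<in> (\<Union>i. a i)} = (\<Union>i. {x \<in> M. empirical M \<phi> n x \<in> a i})" by auto
  then show ?case using Union.IH by (simp only: sets.countable_UN image_subset_iff)  auto
qed

end

subsection \<open>Logarithmic asymptotics of probabilities\<close>

lemma elog_le:
  assumes "0 < n" "0 \<le> m" "m \<le> exp (real n * y)"
  shows "elog m / ereal (real n) \<le> ereal y"
proof (cases "m = 0")
  case True then show ?thesis using assms by (simp add: elog_def)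
next
  case False
  then have "ln m \<le> real n * y" using assms ln_mono[of m "exp (real n * y)"] by simp
  then show ?thesis using False assms by (simp add: elog_def field_simps)
qed

lemma elog_ge:
  assumes "0 < n" "exp (real n * y) \<le> m"
  shows "ereal y \<le> elog m / ereal (real n)"
proof -
  have m: "0 < m" using assms(2) exp_gt_zero less_le_trans by blast
  then have "real n * y \<le> ln m" using assms(2) by (simp add: ln_ge_iff)
  then show ?thesis using m assms(1) by (simp add: elog_def field_simps)
qed

context compact_metric
begin

text \<open>Exponential Markov inequality for each \<open>j\<close>, then a union bound; the
  cardinality of \<open>J\<close> and the error in the exponential moments take half of the slack
  \<open>e\<close> each.\<close>

lemma chernoff_upper:
  fixes W :: "'j \<Rightarrow> nat \<Rightarrow> 'a \<Rightarrow> real"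
  assumes P: "\<And>n. P n \<in> probs M" and J: "finite J"
    and W: "\<And>j n. j \<in> J \<Longrightarrow> W j n \<in> borel_measurable BM" "\<And>j n. j \<in> J \<Longrightarrow> integrable (P n) (\<lambda>x. exp (W j n x))"
    and mgf: "\<And>j e. j \<in> J \<Longrightarrow> 0 < e \<Longrightarrow> \<forall>\<^sub>F n in sequentially. (\<integral>x. exp (W j n x) \<partial>P n) \<le> exp (real n * (\<Lambda> j + e))"
    and A: "\<forall>\<^sub>F n in sequentially. A n \<subseteq> (\<Union>j\<in>J. {x \<in> M. real n * (\<Lambda> j + c) \<le> W j n x})"
  shows "limsup (\<lambda>n. elog (measure (P n) (A n)) / ereal (real n)) \<le> ereal (- c)"
proof (rule ereal_le_epsilon2)
  fix e :: real assume e: "0 < e"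
  have e2: "0 < e / 2" using e by simp
  have m: "\<forall>\<^sub>F n in sequentially. \<forall>j\<in>J. (\<integral>x. exp (W j n x) \<partial>P n) \<le> exp (real n * (\<Lambda> j + e / 2))"
    using mgf[OF _ e2] by (intro eventually_ball_finite J) auto
  obtain N :: nat where N: "real (card J) * 2 / e < real N" using reals_Archimedean2 by blast
  have "\<forall>\<^sub>F n in sequentially. elog (measure (P n) (A n)) / ereal (real n) \<le> ereal (- c + e)"
    using m A eventually_ge_at_top[of "max 1 N"]
  proof eventually_elim
    case (elim n)
    interpret prob_space "P n" using probs_prob_space[OF P] .
    let ?B = "\<lambda>j. {x \<in> M. real n * (\<Lambda> j + c) \<le> W j n x}"
    have Bs: "?B j \<in> sets (P n)" if "j \<in> J" for j
      using borel_measurable_le[OF borel_measurable_const W(1)[OF that], of "real n * (\<Lambda> j + c)" n] probs_sets[OF P] by simp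
    have Bm: "measure (P n) (?B j) \<le> exp (real n * (- c + e / 2))" if j: "j \<in> J" for j
    proof -
      have "exp (real n * (\<Lambda> j + c)) * measure (P n) (?B j) = (\<integral>x. exp (real n * (\<Lambda> j + c)) * indicator (?B j) x \<partial>P n)"
        using Bs[OF j] sets.sets_into_space[OF Bs[OF j]] by (simp add: Int_absorb2)
      also have "\<dots> \<le> (\<integral>x. exp (W j n x) \<partial>P n)"
      proof (rule integral_mono[OF _ W(2)[OF j]])
        show "integrable (P n) (\<lambda>x. exp (real n * (\<Lambda> j + c)) * indicator (?B j) x)"
          using Bs[OF j] by (intro integrable_mult_right integrable_real_indicator) (simp_all add: emeasure_eq_measure)
        show "exp (real n * (\<Lambda> j + c)) * indicator (?B j) x \<le> exp (W j n x)" for x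
          by (cases "x \<in> ?B j") simp_all
      qed
      also have "\<dots> \<le> exp (real n * (\<Lambda> j + e / 2))" using elim(1) j by blast
      also have "\<dots> = exp (real n * (\<Lambda> j + c)) * exp (real n * (- c + e / 2))" by (simp add: exp_add[symmetric] algebra_simps)
      finally show ?thesis by simp
    qed
    have "measure (P n) (A n) \<le> measure (P n) (\<Union>j\<in>J. ?B j)"
      using elim(2) Bs J by (intro finite_measure_mono sets.finite_UN) auto
    also have "\<dots> \<le> (\<Sum>j\<in>J. measure (P n) (?B j))" using Bs J by (intro measure_UNION_le) auto
    also have "\<dots> \<le> real (card J) * exp (real n * (- c + e / 2))" using Bm sum_mono[of J "\<lambda>j. measure (P n) (?B j)" "\<lambda>_. exp (real n * (- c + e / 2))"] by simp
    also have "\<dots> \<le> exp (real n * (e / 2)) * exp (real n * (- c + e / 2))"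
    proof (rule mult_right_mono)
      have "real (card J) * 2 / e \<le> real n" using N elim(3) by linarith
      then have "real (card J) \<le> real n * (e / 2)" using e by (simp add: field_simps)
      also have "\<dots> \<le> exp (real n * (e / 2))" using exp_ge_add_one_self[of "real n * (e / 2)"] by linarith
      finally show "real (card J) \<le> exp (real n * (e / 2))" .
    qed simp
    also have "\<dots> = exp (real n * (- c + e))" by (simp add: exp_add[symmetric] algebra_simps)
    finally show ?case using elim(3) by (intro elog_le) auto
  qed
  then have "limsup (\<lambda>n. elog (measure (P n) (A n)) / ereal (real n)) \<le> ereal (- c + e)" by (rule Limsup_bounded)
  then show "limsup (\<lambda>n. elog (measure (P n) (A n)) / ereal (real n)) \<le> ereal (- c) + ereal e" by simp
qed

end

subsection \<open>The variational formula and duality\<close>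

locale ldp_system = dyn_system M \<phi> for M :: "'a::metric_space set" and \<phi> +
  fixes P :: "nat \<Rightarrow> 'a measure" and G :: "nat \<Rightarrow> 'a \<Rightarrow> real"
  assumes spec: "spec_S M \<phi>" and usce: "USCE M \<phi>" and P: "\<And>n. P n \<in> probs M" and G: "AA G"
    and C1: "\<And>V. continuous_on M V \<Longrightarrow> (\<lambda>n. ln (\<integral>x. exp (birkhoff \<phi> n V x) \<partial>(P n)) / real n)
         \<longlonglongrightarrow> pressure M \<phi> (\<lambda>n x. G n x + birkhoff \<phi> n V x) - pressure M \<phi> G"
    and gib: "gibbs_lower P G (pressure M \<phi> G)"
begin

definition p0 :: real where "p0 = pressure M \<phi> G"

definition tilt :: "('a \<Rightarrow> real) \<Rightarrow> nat \<Rightarrow> 'a \<Rightarrow> real" where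
  "tilt V = (\<lambda>n x. G n x + birkhoff \<phi> n V x)"

text \<open>A conversion that sends infinity to 0; it represents the entropy once
  \<open>ks_finite\<close> has excluded infinite values.\<close>

definition ent :: "'a measure \<Rightarrow> real" where "ent Q = real_of_ereal (ks_entropy M \<phi> Q)"

definition F :: "'a measure \<Rightarrow> real" where "F Q = seq_functional G Q + ent Q"

lemma ne: "M \<noteq> {}"
  by (rule nonempty_M[OF P])

lemma top: "htop M \<phi> < \<infinity>"
  using usce by (simp add: USCE_def)

lemma AA_tilt: "continuous_on M V \<Longrightarrow> AA (tilt V)"
  using AA_lin[OF G AA_birkhoff, of V 1 1] by (simp add: tilt_def)

lemma seq_functional_tilt:
  "continuous_on M V \<Longrightarrow> Q \<in> inv_probs M \<phi> \<Longrightarrow> seq_functional (tilt V) Q = seq_functional G Q + (\<integral>x. V x \<partial>Q)"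
  using seq_functional_lin[OF G AA_birkhoff, of V Q 1 1] seq_functional_birkhoff[of V Q] by (simp add: tilt_def)

lemma exp_birkhoff_integrable: "continuous_on M V \<Longrightarrow> integrable (P n) (\<lambda>x. exp (birkhoff \<phi> n V x))"
  by (intro probs_integrable[OF P] continuous_intros birkhoff_cont)

text \<open>The exponential integral is at least its part over the event that the average of
  \<open>V\<close> is near its \<open>Q\<close>-mean. The probability of that event is bounded below
  by gluing, and (C1) identifies the growth rate.\<close>

lemma tilt_lower:
  assumes V: "continuous_on M V" and Q: "Q \<in> inv_probs M \<phi>" and c: "ereal c < ks_entropy M \<phi> Q"
  shows "(\<integral>x. V x \<partial>Q) + seq_functional G Q + c \<le> pressure M \<phi> (tilt V)"
proof (rule field_le_epsilon)
  fix e :: real assume e: "0 < e"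
  let ?I = "\<integral>x. V x \<partial>Q"
  let ?T = "\<lambda>n. {x \<in> M. \<forall>f\<in>{V}. \<bar>birkhoff \<phi> n f x / real n - (\<integral>x. f x \<partial>Q)\<bar> < e / 2}"
  have "\<forall>\<^sub>F n in sequentially. exp (real n * (seq_functional G Q + c - p0 - e / 2)) \<le> measure (P n) (?T n)"
    unfolding p0_def using V e by (intro empirical_lower_bound[OF spec P G gib Q c]) auto
  then have "\<forall>\<^sub>F n in sequentially. ?I + seq_functional G Q + c - p0 - e \<le> ln (\<integral>x. exp (birkhoff \<phi> n V x) \<partial>(P n)) / real n"
    using eventually_gt_at_top[of 0]
  proof eventually_elim
    case (elim n)
    interpret prob_space "P n" using probs_prob_space[OF P] .
    have Ts: "?T n \<in> sets (P n)"
    proof -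
      have "continuous_on M (\<lambda>x. \<bar>birkhoff \<phi> n V x / real n - ?I\<bar>)" using elim(2) by (intro continuous_intros birkhoff_cont V) auto
      from borel_measurable_less[OF continuous_borel[OF this] borel_measurable_const[of "e / 2" BM]]
      show ?thesis using probs_sets[OF P] by simp
    qed
    have "exp (real n * (?I - e / 2)) * measure (P n) (?T n) = (\<integral>x. exp (real n * (?I - e / 2)) * indicator (?T n) x \<partial>P n)"
      using Ts sets.sets_into_space[OF Ts] by (simp add: Int_absorb2)
    also have "\<dots> \<le> (\<integral>x. exp (birkhoff \<phi> n V x) \<partial>P n)"
    proof (rule integral_mono)
      show "integrable (P n) (\<lambda>x. exp (real n * (?I - e / 2)) * indicator (?T n) x)"
        using Ts by (intro integrable_mult_right integrable_real_indicator) (auto simp: emeasure_eq_measure)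
      show "integrable (P n) (\<lambda>x. exp (birkhoff \<phi> n V x))" by (rule exp_birkhoff_integrable[OF V])
      fix x assume "x \<in> space (P n)"
      show "exp (real n * (?I - e / 2)) * indicator (?T n) x \<le> exp (birkhoff \<phi> n V x)"
      proof (cases "x \<in> ?T n")
        case True
        then have "\<bar>birkhoff \<phi> n V x / real n - ?I\<bar> < e / 2" by blast
        then have "?I - e / 2 \<le> birkhoff \<phi> n V x / real n" by linarith
        then have "real n * (?I - e / 2) \<le> birkhoff \<phi> n V x" using elim(2) by (simp add: field_simps)
        then show ?thesis using True by simp
      qed simp
    qed
    finally have le: "exp (real n * (?I - e / 2)) * measure (P n) (?T n) \<le> (\<integral>x. exp (birkhoff \<phi> n V x) \<partial>P n)" .
    have "exp (real n * (?I + seq_functional G Q + c - p0 - e)) = exp (real n * (?I - e / 2)) * exp (real n * (seq_functional G Q + c - p0 - e / 2))"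
      by (simp add: exp_add[symmetric] algebra_simps)
    also have "\<dots> \<le> exp (real n * (?I - e / 2)) * measure (P n) (?T n)" by (intro mult_left_mono elim(1)) simp
    also note le
    finally have E: "exp (real n * (?I + seq_functional G Q + c - p0 - e)) \<le> (\<integral>x. exp (birkhoff \<phi> n V x) \<partial>P n)" .
    then have "0 < (\<integral>x. exp (birkhoff \<phi> n V x) \<partial>P n)" using exp_gt_zero less_le_trans by blast
    then have "real n * (?I + seq_functional G Q + c - p0 - e) \<le> ln (\<integral>x. exp (birkhoff \<phi> n V x) \<partial>P n)" using E by (simp add: ln_ge_iff)
    then show ?case using elim(2) by (simp add: pos_le_divide_eq mult.commute)
  qed
  then have "?I + seq_functional G Q + c - p0 - e \<le> pressure M \<phi> (tilt V) - p0"
    unfolding tilt_def p0_def by (rule tendsto_lowerbound[OF C1[OF V]]) simp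
  then show "?I + seq_functional G Q + c \<le> pressure M \<phi> (tilt V) + e" by simp
qed

lemma tilt_zero: "tilt (\<lambda>_. 0) = G"
  by (simp add: tilt_def birkhoff_def)

text \<open>With \<open>V = 0\<close>, every real below the entropy is at most the pressure minus
  the functional of \<open>G\<close>.\<close>

lemma ks_finite:
  assumes Q: "Q \<in> inv_probs M \<phi>"
  shows "ks_entropy M \<phi> Q = ereal (ent Q)" and "0 \<le> ent Q"
proof -
  have V: "continuous_on M (\<lambda>_. 0 :: real)" by simp
  have "ks_entropy M \<phi> Q \<noteq> \<infinity>"
  proof
    assume "ks_entropy M \<phi> Q = \<infinity>"
    then have "ereal (pressure M \<phi> (tilt (\<lambda>_. 0)) - seq_functional G Q + 1) < ks_entropy M \<phi> Q" by simp
    from tilt_lower[OF V Q this] show False by simp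
  qed
  then show "ks_entropy M \<phi> Q = ereal (ent Q)" "0 \<le> ent Q"
    using ks_entropy_nonneg[OF Q] unfolding ent_def by (cases "ks_entropy M \<phi> Q"; simp)+
qed

lemma F_le_tilt:
  assumes V: "continuous_on M V" and Q: "Q \<in> inv_probs M \<phi>"
  shows "F Q + (\<integral>x. V x \<partial>Q) \<le> pressure M \<phi> (tilt V)"
proof (rule field_le_epsilon)
  fix e :: real assume e: "0 < e"
  have "ereal (ent Q - e) < ks_entropy M \<phi> Q" using ks_finite(1)[OF Q] e by simp
  from tilt_lower[OF V Q this] show "F Q + (\<integral>x. V x \<partial>Q) \<le> pressure M \<phi> (tilt V) + e" by (simp add: F_def)
qed

lemma F_le_p0: "Q \<in> inv_probs M \<phi> \<Longrightarrow> F Q \<le> p0"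
  using F_le_tilt[of "\<lambda>_. 0" Q] by (simp add: tilt_zero p0_def)

lemma pressure_le:
  assumes H: "AA H" and le: "\<And>Q. Q \<in> inv_probs M \<phi> \<Longrightarrow> seq_functional H Q + ent Q \<le> c"
  shows "pressure M \<phi> H \<le> c"
proof -
  have "pressure_ereal M \<phi> H \<le> ereal c"
    using le by (intro variational_upper[OF ne H]) (simp add: ks_finite(1))
  then show ?thesis using pressure_finite[OF ne top H] by simp
qed

lemma inv_probs_nonempty: "inv_probs M \<phi> \<noteq> {}"
  using press_le_equilibrium[OF ne G zero_less_one] by blast

lemma rate_fun_eq: "Q \<in> inv_probs M \<phi> \<Longrightarrow> rate_fun M \<phi> G Q = ereal (p0 - F Q)"
  by (simp add: rate_fun_def ks_finite(1) p0_def F_def)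

text \<open>The approximant \<open>g\<close> of \<open>G\<close> joins the test functions of a
  neighbourhood on which the entropy rises by less than \<open>d / 4\<close>. Three further errors
  of \<open>d / 8\<close> keep the total below \<open>d\<close>.\<close>

lemma F_usc:
  assumes Q: "Q \<in> inv_probs M \<phi>" and c: "F Q < c"
  obtains Fs e where "finite Fs" "\<And>f. f \<in> Fs \<Longrightarrow> continuous_on M f" "0 < (e::real)"
    "\<And>Q'. Q' \<in> inv_probs M \<phi> \<Longrightarrow> (\<And>f. f \<in> Fs \<Longrightarrow> \<bar>(\<integral>x. f x \<partial>Q') - (\<integral>x. f x \<partial>Q)\<bar> < e) \<Longrightarrow> F Q' < c"
proof -
  define d where "d = c - F Q"
  have d: "0 < d" "0 < d / 8" using c by (auto simp: d_def)
  obtain g where g: "continuous_on M g" "\<forall>\<^sub>F n in sequentially. \<forall>x\<in>M. \<bar>G n x - birkhoff \<phi> n g x\<bar> \<le> d / 8 * real n"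
    using AA_approx[OF G d(2)] by blast
  have "ks_entropy M \<phi> Q < ereal (ent Q + d / 4)" using ks_finite(1)[OF Q] d by simp
  then obtain U where U: "openin (weak_top M) U" "Q \<in> U" "\<forall>Q'\<in>U \<inter> inv_probs M \<phi>. ks_entropy M \<phi> Q' < ereal (ent Q + d / 4)"
    using usce Q unfolding USCE_def by blast
  obtain Fs e where Fs: "finite Fs" "\<And>f. f \<in> Fs \<Longrightarrow> continuous_on M f" "0 < (e::real)"
    "\<And>Q'. Q' \<in> probs M \<Longrightarrow> (\<And>f. f \<in> Fs \<Longrightarrow> \<bar>(\<integral>x. f x \<partial>Q') - (\<integral>x. f x \<partial>Q)\<bar> < e) \<Longrightarrow> Q' \<in> U"
    by (rule weak_top_nbhd[OF U(1,2)]) blast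
  show ?thesis
  proof (rule that[of "insert g Fs" "min e (d / 8)"])
    fix Q' assume Q': "Q' \<in> inv_probs M \<phi>"
      and close: "\<And>f. f \<in> insert g Fs \<Longrightarrow> \<bar>(\<integral>x. f x \<partial>Q') - (\<integral>x. f x \<partial>Q)\<bar> < min e (d / 8)"
    have "Q' \<in> U" using close inv_probs_probs[OF Q'] by (intro Fs(4)) auto
    then have "ks_entropy M \<phi> Q' < ereal (ent Q + d / 4)" using U(3) Q' by blast
    then have "ent Q' < ent Q + d / 4" using ks_finite(1)[OF Q'] by simp
    moreover have "\<bar>seq_functional G Q' - (\<integral>x. g x \<partial>Q')\<bar> \<le> d / 8" by (rule seq_functional_close[OF G Q' g])
    moreover have "\<bar>seq_functional G Q - (\<integral>x. g x \<partial>Q)\<bar> \<le> d / 8" by (rule seq_functional_close[OF G Q g])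
    moreover have "\<bar>(\<integral>x. g x \<partial>Q') - (\<integral>x. g x \<partial>Q)\<bar> < d / 8" using close[of g] by simp
    ultimately have "F Q' < F Q + d" unfolding F_def using d(1) by linarith
    then show "F Q' < c" by (simp add: d_def)
  qed (use Fs g d in auto)
qed

lemma F_usc_seq:
  assumes X: "\<And>n. X n \<in> inv_probs M \<phi>" and w: "wconv X Q" and Q: "Q \<in> inv_probs M \<phi>" and c: "F Q < c"
  shows "\<forall>\<^sub>F n in sequentially. F (X n) < c"
proof -
  obtain Fs e where Fs: "finite Fs" "\<And>f. f \<in> Fs \<Longrightarrow> continuous_on M f" "0 < (e::real)"
    "\<And>Q'. Q' \<in> inv_probs M \<phi> \<Longrightarrow> (\<And>f. f \<in> Fs \<Longrightarrow> \<bar>(\<integral>x. f x \<partial>Q') - (\<integral>x. f x \<partial>Q)\<bar> < e) \<Longrightarrow> F Q' < c"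
    by (rule F_usc[OF Q c]) blast
  have "\<forall>\<^sub>F n in sequentially. \<forall>f\<in>Fs. \<bar>(\<integral>x. f x \<partial>X n) - (\<integral>x. f x \<partial>Q)\<bar> < e"
  proof (intro eventually_ball_finite Fs(1) ballI)
    fix f assume "f \<in> Fs"
    then have "(\<lambda>n. \<integral>x. f x \<partial>X n) \<longlonglongrightarrow> (\<integral>x. f x \<partial>Q)" using w Fs(2) by (simp add: wconv_def)
    from tendstoD[OF this Fs(3)] show "\<forall>\<^sub>F n in sequentially. \<bar>(\<integral>x. f x \<partial>X n) - (\<integral>x. f x \<partial>Q)\<bar> < e" by (simp add: dist_real_def)
  qed
  then show ?thesis by eventually_elim (rule Fs(4)[OF X], blast)
qed

text \<open>Entropy is concave, and every functional \<open>seq_functional V\<close> is affine along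
  the mixture because it is approximated by integrals of continuous functions.\<close>

lemma F_mix:
  assumes Q1: "Q1 \<in> inv_probs M \<phi>" and Q2: "Q2 \<in> inv_probs M \<phi>" and t: "0 \<le> t" "t \<le> 1"
  obtains Q where "Q \<in> inv_probs M \<phi>"
    "\<And>f :: 'a \<Rightarrow> real. continuous_on M f \<Longrightarrow> (\<integral>x. f x \<partial>Q) = (1 - t) * (\<integral>x. f x \<partial>Q1) + t * (\<integral>x. f x \<partial>Q2)"
    "\<And>V. AA V \<Longrightarrow> seq_functional V Q = (1 - t) * seq_functional V Q1 + t * seq_functional V Q2"
    "(1 - t) * F Q1 + t * F Q2 \<le> F Q"
proof -
  obtain Q where Q: "Q \<in> inv_probs M \<phi>"
    and Qi: "\<And>f :: 'a \<Rightarrow> real. continuous_on M f \<Longrightarrow> (\<integral>x. f x \<partial>Q) = (1 - t) * (\<integral>x. f x \<partial>Q1) + t * (\<integral>x. f x \<partial>Q2)"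
    and Qh: "ereal ((1 - t) * ent Q1 + t * ent Q2) \<le> ks_entropy M \<phi> Q"
    by (rule inv_mixture[OF Q1 Q2 t ks_finite(1)[OF Q1] ks_finite(1)[OF Q2]]) blast
  have Qs: "seq_functional V Q = (1 - t) * seq_functional V Q1 + t * seq_functional V Q2" if V: "AA V" for V
  proof -
    have "\<bar>seq_functional V Q - ((1 - t) * seq_functional V Q1 + t * seq_functional V Q2)\<bar> \<le> 0"
    proof (rule field_le_epsilon)
      fix e :: real assume e: "0 < e"
      then have e2: "0 < e / 2" by simp
      obtain g where g: "continuous_on M g" "\<forall>\<^sub>F n in sequentially. \<forall>x\<in>M. \<bar>V n x - birkhoff \<phi> n g x\<bar> \<le> e / 2 * real n"
        using AA_approx[OF V e2] by blast
      have "\<bar>(1 - t) * (seq_functional V Q1 - (\<integral>x. g x \<partial>Q1)) + t * (seq_functional V Q2 - (\<integral>x. g x \<partial>Q2))\<bar>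
         \<le> (1 - t) * \<bar>seq_functional V Q1 - (\<integral>x. g x \<partial>Q1)\<bar> + t * \<bar>seq_functional V Q2 - (\<integral>x. g x \<partial>Q2)\<bar>"
        using t by (intro order_trans[OF abs_triangle_ineq]) (simp add: abs_mult)
      also have "\<dots> \<le> (1 - t) * (e / 2) + t * (e / 2)"
        using t seq_functional_close[OF V Q1 g] seq_functional_close[OF V Q2 g] by (intro add_mono mult_left_mono) auto
      also have "\<dots> = e / 2" by (simp only: distrib_right[symmetric]) simp
      finally have "\<bar>((1 - t) * seq_functional V Q1 + t * seq_functional V Q2) - (\<integral>x. g x \<partial>Q)\<bar> \<le> e / 2"
        unfolding Qi[OF g(1)] by (simp add: algebra_simps)
      then show "\<bar>seq_functional V Q - ((1 - t) * seq_functional V Q1 + t * seq_functional V Q2)\<bar> \<le> 0 + e"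
        using seq_functional_close[OF V Q g] by linarith
    qed
    then show ?thesis by simp
  qed
  have "(1 - t) * F Q1 + t * F Q2 \<le> F Q"
    using Qh ks_finite(1)[OF Q] Qs[OF G] by (simp add: F_def algebra_simps)
  then show ?thesis using that[OF Q Qi Qs] by blast
qed

text \<open>Above, \<open>F\<close> is at most \<open>p0\<close>; below, entropy is nonnegative and
  the functional of \<open>G\<close> is bounded. The two-sided bound feeds the separation
  lemma.\<close>

lemma F_lower: "\<exists>B. \<forall>Q\<in>inv_probs M \<phi>. \<bar>F Q\<bar> \<le> B"
proof -
  obtain g where g: "continuous_on M g" "\<forall>\<^sub>F n in sequentially. \<forall>x\<in>M. \<bar>G n x - birkhoff \<phi> n g x\<bar> \<le> 1 * real n"
    using AA_approx[OF G zero_less_one] by blast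
  obtain C where C: "0 < C" "\<And>x. x \<in> M \<Longrightarrow> \<bar>g x\<bar> \<le> C" by (rule continuous_bound[OF g(1)]) blast
  have "\<bar>F Q\<bar> \<le> C + 1 + \<bar>p0\<bar>" if Q: "Q \<in> inv_probs M \<phi>" for Q
  proof -
    have "\<bar>\<integral>x. g x \<partial>Q\<bar> \<le> C" by (rule probs_integral_abs_le[OF inv_probs_probs[OF Q] continuous_borel[OF g(1)] C(2)])
    then have "- C - 1 \<le> F Q" using seq_functional_close[OF G Q g] ks_finite(2)[OF Q] unfolding F_def by linarith
    then show ?thesis using F_le_p0[OF Q] C(1) by linarith
  qed
  then show ?thesis by blast
qed

text \<open>For invariant \<open>Q\<close> the separation involves only the test functions of a
  neighbourhood on which \<open>F\<close> stays below \<open>c1\<close>; for other \<open>Q\<close>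
  a multiple of a coboundary is enough.\<close>

lemma duality:
  assumes Q: "Q \<in> probs M" and c: "ereal c < rate_fun M \<phi> G Q"
  shows "\<exists>V. continuous_on M V \<and> c < (\<integral>x. V x \<partial>Q) - (pressure M \<phi> (tilt V) - p0)"
proof (cases "Q \<in> inv_probs M \<phi>")
  case False
  have "\<exists>f :: 'a \<Rightarrow> real. continuous_on M f \<and> (\<integral>x. f (\<phi> x) \<partial>Q) \<noteq> (\<integral>x. f x \<partial>Q)"
    using inv_probsI[OF Q] False by blast
  then obtain f :: "'a \<Rightarrow> real" where f: "continuous_on M f" "(\<integral>x. f (\<phi> x) \<partial>Q) \<noteq> (\<integral>x. f x \<partial>Q)" by blast
  have f1: "continuous_on M (\<lambda>x. f (\<phi> x))" using comp_iter_cont[OF f(1), of 1] by simp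
  define a where "a = (\<integral>x. f (\<phi> x) \<partial>Q) - (\<integral>x. f x \<partial>Q)"
  have a: "a \<noteq> 0" using f(2) by (simp add: a_def)
  \<comment> \<open>This scaling gives \<open>V\<close> the \<open>Q\<close>-integral
    \<open>c + 1\<close>, while every invariant measure integrates it to 0, so the pressure does not
    rise above \<open>p0\<close>.\<close>
  define k where "k = (c + 1) / a"
  define V where "V x = k * (f (\<phi> x) - f x)" for x
  have V: "continuous_on M V" unfolding V_def using f(1) f1 by (intro continuous_intros)
  have iV: "(\<integral>x. V x \<partial>R) = k * ((\<integral>x. f (\<phi> x) \<partial>R) - (\<integral>x. f x \<partial>R))" if R: "R \<in> probs M" for R
    unfolding V_def using probs_integrable[OF R f(1)] probs_integrable[OF R f1] by simp
  have "pressure M \<phi> (tilt V) \<le> p0"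
  proof (rule pressure_le[OF AA_tilt[OF V]])
    fix R assume R: "R \<in> inv_probs M \<phi>"
    have "(\<integral>x. V x \<partial>R) = 0"
      using iV[OF inv_probs_probs[OF R]] inv_probs_integral[OF R continuous_borel[OF f(1)], of 1] by simp
    then show "seq_functional (tilt V) R + ent R \<le> p0" using seq_functional_tilt[OF V R] F_le_p0[OF R] by (simp add: F_def)
  qed
  moreover have "(\<integral>x. V x \<partial>Q) = c + 1" using iV[OF Q] a by (simp add: a_def[symmetric] k_def)
  ultimately show ?thesis using V by (intro exI[of _ V]) auto
next
  case True
  have "c < p0 - F Q" using c rate_fun_eq[OF True] by simp
  define c2 where "c2 = p0 - c"
  define c1 where "c1 = (F Q + c2) / 2"
  have c12: "F Q < c1" "c1 < c2" using \<open>c < p0 - F Q\<close> by (auto simp: c1_def c2_def)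
  obtain Fs e where Fs: "finite Fs" "\<And>f. f \<in> Fs \<Longrightarrow> continuous_on M f" and e: "0 < (e::real)"
    and nb: "\<And>Q'. Q' \<in> inv_probs M \<phi> \<Longrightarrow> (\<And>f. f \<in> Fs \<Longrightarrow> \<bar>(\<integral>x. f x \<partial>Q') - (\<integral>x. f x \<partial>Q)\<bar> < e) \<Longrightarrow> F Q' < c1"
    by (rule F_usc[OF True c12(1)]) blast
  define v where "v f R = (\<integral>x. f x \<partial>R) - (\<integral>x. f x \<partial>Q)" for f :: "'a \<Rightarrow> real" and R
  obtain B where B: "1 \<le> B" "\<forall>f\<in>Fs. \<forall>x\<in>M. \<bar>f x\<bar> \<le> B" using finite_family_bound[OF Fs] by blast
  obtain C where C: "\<forall>Q\<in>inv_probs M \<phi>. \<bar>F Q\<bar> \<le> C" using F_lower by blast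
  \<comment> \<open>Outside the neighbourhood some test integral deviates by \<open>e\<close>;
    inside it \<open>F\<close> is below \<open>c1\<close>, which leaves a gap
    \<open>c2 - c1\<close>.\<close>
  define r0 where "r0 = min (e\<^sup>2) ((c2 - c1)\<^sup>2)"
  have r0: "0 < r0" using e c12 by (simp add: r0_def)
  have vB: "\<bar>v f R\<bar> \<le> 2 * B" if "f \<in> Fs" "R \<in> inv_probs M \<phi>" for f R
  proof -
    have "\<bar>\<integral>x. f x \<partial>R\<bar> \<le> B" "\<bar>\<integral>x. f x \<partial>Q\<bar> \<le> B"
      using B(2) that Fs(2)[OF that(1)] inv_probs_probs[OF that(2)] Q by (auto intro!: probs_integral_abs_le continuous_borel)
    then show ?thesis unfolding v_def by linarith
  qed
  obtain l \<mu> \<eta> where sep: "0 \<le> \<mu>" "0 < \<eta>" "\<And>R. R \<in> inv_probs M \<phi> \<Longrightarrow> \<eta> \<le> (\<Sum>f\<in>Fs. l f * v f R) + \<mu> * (c2 - F R)"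
  proof (rule concave_separation[of "inv_probs M \<phi>" Fs v F c2 "(\<Sum>f\<in>Fs. (2 * B)\<^sup>2) + (\<bar>c2\<bar> + C)\<^sup>2" r0])
    show "inv_probs M \<phi> \<noteq> {}" by (rule inv_probs_nonempty)
    show "0 < r0" by (rule r0)
    fix R assume R: "R \<in> inv_probs M \<phi>"
    have "(v f R)\<^sup>2 \<le> (2 * B)\<^sup>2" if "f \<in> Fs" for f
      using power_mono[OF vB[OF that R] abs_ge_zero, of 2] by simp
    moreover have "(c2 - F R)\<^sup>2 \<le> (\<bar>c2\<bar> + C)\<^sup>2"
    proof -
      have "\<bar>c2 - F R\<bar> \<le> \<bar>c2\<bar> + C" using C R by fastforce
      from power_mono[OF this abs_ge_zero, of 2] show ?thesis by simp
    qed
    ultimately show "(\<Sum>f\<in>Fs. (v f R)\<^sup>2) + (c2 - F R)\<^sup>2 \<le> (\<Sum>f\<in>Fs. (2 * B)\<^sup>2) + (\<bar>c2\<bar> + C)\<^sup>2"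
      by (intro add_mono sum_mono) auto
    show "r0 \<le> (\<Sum>f\<in>Fs. (v f R)\<^sup>2) + (max 0 (c2 - F R))\<^sup>2"
    proof (cases "\<forall>f\<in>Fs. \<bar>(\<integral>x. f x \<partial>R) - (\<integral>x. f x \<partial>Q)\<bar> < e")
      case True
      then have "F R < c1" using nb[OF R] by blast
      then have "(c2 - c1)\<^sup>2 \<le> (max 0 (c2 - F R))\<^sup>2" using c12 by (intro power_mono) auto
      moreover have "0 \<le> (\<Sum>f\<in>Fs. (v f R)\<^sup>2)" by (intro sum_nonneg) auto
      ultimately show ?thesis by (simp add: r0_def)
    next
      case False
      then obtain f where f: "f \<in> Fs" "e \<le> \<bar>v f R\<bar>" by (auto simp: v_def not_less)
      have "e\<^sup>2 \<le> (v f R)\<^sup>2" using power_mono[OF f(2), of 2] e by simp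
      also have "\<dots> \<le> (\<Sum>f\<in>Fs. (v f R)\<^sup>2)" using f(1) Fs(1) by (intro member_le_sum) auto
      finally show ?thesis by (simp add: r0_def min_le_iff_disj add_increasing2)
    qed
  next
    fix Q1 Q2 t assume Q12: "Q1 \<in> inv_probs M \<phi>" "Q2 \<in> inv_probs M \<phi>" and t: "0 \<le> t" "t \<le> (1::real)"
    obtain R where R: "R \<in> inv_probs M \<phi>"
      "\<And>f :: 'a \<Rightarrow> real. continuous_on M f \<Longrightarrow> (\<integral>x. f x \<partial>R) = (1 - t) * (\<integral>x. f x \<partial>Q1) + t * (\<integral>x. f x \<partial>Q2)"
      "(1 - t) * F Q1 + t * F Q2 \<le> F R"
      by (rule F_mix[OF Q12 t]) blast
    have "v f R = (1 - t) * v f Q1 + t * v f Q2" if "f \<in> Fs" for f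
      unfolding v_def R(2)[OF Fs(2)[OF that]] by (simp add: algebra_simps)
    then show "\<exists>z\<in>inv_probs M \<phi>. (\<forall>i\<in>Fs. v i z = (1 - t) * v i Q1 + t * v i Q2) \<and> (1 - t) * F Q1 + t * F Q2 \<le> F z"
      using R by blast
  qed blast
  have "v f Q = 0" for f by (simp add: v_def)
  then have "\<eta> \<le> \<mu> * (c2 - F Q)" using sep(3)[OF True] by simp
  \<comment> \<open>At \<open>Q\<close> itself all deviations vanish, so a zero multiplier would
    contradict \<open>0 < \<eta>\<close>; division by \<open>\<mu>\<close> then yields
    \<open>V\<close>.\<close>
  then have mu: "0 < \<mu>" using sep(1,2) by (cases "\<mu> = 0") auto
  define V where "V x = (\<Sum>f\<in>Fs. - (l f / \<mu>) * f x)" for x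
  have V: "continuous_on M V" unfolding V_def using Fs(2) by (intro continuous_intros) auto
  have iV: "(\<integral>x. V x \<partial>R) - (\<integral>x. V x \<partial>Q) = - ((\<Sum>f\<in>Fs. l f * v f R) / \<mu>)" if R: "R \<in> probs M" for R
  proof -
    have "(\<integral>x. V x \<partial>R') = (\<Sum>f\<in>Fs. - (l f / \<mu>) * (\<integral>x. f x \<partial>R'))" if R': "R' \<in> probs M" for R'
      unfolding V_def using probs_integrable[OF R' Fs(2)] by (subst Bochner_Integration.integral_sum) auto
    then have "(\<integral>x. V x \<partial>R) - (\<integral>x. V x \<partial>Q) = (\<Sum>f\<in>Fs. - (l f / \<mu>) * v f R)"
      using R Q by (simp add: v_def sum_subtractf[symmetric] right_diff_distrib sum_negf)
    also have "\<dots> = - ((\<Sum>f\<in>Fs. l f * v f R) / \<mu>)" by (simp add: sum_negf sum_divide_distrib)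
    finally show ?thesis .
  qed
  have "pressure M \<phi> (tilt V) \<le> c2 - \<eta> / \<mu> + (\<integral>x. V x \<partial>Q)"
  proof (rule pressure_le[OF AA_tilt[OF V]])
    fix R assume R: "R \<in> inv_probs M \<phi>"
    have "\<eta> / \<mu> \<le> ((\<Sum>f\<in>Fs. l f * v f R) + \<mu> * (c2 - F R)) / \<mu>" using sep(3)[OF R] mu by (intro divide_right_mono) auto
    also have "\<dots> = (\<Sum>f\<in>Fs. l f * v f R) / \<mu> + (c2 - F R)" using mu by (simp add: add_divide_distrib)
    finally have "\<eta> / \<mu> \<le> - ((\<integral>x. V x \<partial>R) - (\<integral>x. V x \<partial>Q)) + (c2 - F R)" using iV[OF inv_probs_probs[OF R]] by simp
    then show "seq_functional (tilt V) R + ent R \<le> c2 - \<eta> / \<mu> + (\<integral>x. V x \<partial>Q)"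
      unfolding seq_functional_tilt[OF V R] by (simp add: F_def)
  qed
  moreover have "0 < \<eta> / \<mu>" using mu sep(2) by simp
  ultimately show ?thesis using V by (intro exI[of _ V]) (auto simp: c2_def)
qed

end

context ldp_system
begin

subsection \<open>Large deviations of the empirical measures\<close>

lemma mgf_bound:
  assumes V: "continuous_on M V" and e: "0 < e"
  shows "\<forall>\<^sub>F n in sequentially. (\<integral>x. exp (birkhoff \<phi> n V x) \<partial>P n) \<le> exp (real n * ((pressure M \<phi> (tilt V) - p0) + e))"
proof -
  have "\<forall>\<^sub>F n in sequentially. ln (\<integral>x. exp (birkhoff \<phi> n V x) \<partial>(P n)) / real n < pressure M \<phi> (tilt V) - p0 + e"
    unfolding tilt_def p0_def using e by (intro order_tendstoD(2)[OF C1[OF V]]) simp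
  then show ?thesis using eventually_gt_at_top[of 0]
  proof eventually_elim
    case (elim n)
    let ?i = "\<integral>x. exp (birkhoff \<phi> n V x) \<partial>(P n)"
    show ?case
    \<comment> \<open>The logarithm carries information only for a positive integral; otherwise the
      bound is trivial.\<close>
    proof (cases "0 < ?i")
      case True
      have "ln ?i \<le> real n * ((pressure M \<phi> (tilt V) - p0) + e)" using elim by (simp add: pos_divide_less_eq mult.commute less_imp_le)
      then have "exp (ln ?i) \<le> exp (real n * ((pressure M \<phi> (tilt V) - p0) + e))" by simp
      then show ?thesis using True by simp
    next
      case False
      then show ?thesis using exp_ge_zero[of "real n * ((pressure M \<phi> (tilt V) - p0) + e)"] by linarith
    qed
  qed
qed

text \<open>Common lower bound for both deviation principles: an event qualifies once it contains a
  neighbourhood in finitely many Birkhoff averages.\<close>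

lemma lower_event:
  assumes Q: "Q \<in> inv_probs M \<phi>" and Fs: "finite Fs" "\<And>f. f \<in> Fs \<Longrightarrow> continuous_on M f" and e: "0 < e"
    and A: "\<forall>\<^sub>F n in sequentially. A n \<in> sets BM \<and> {x \<in> M. \<forall>f\<in>Fs. \<bar>birkhoff \<phi> n f x / real n - (\<integral>x. f x \<partial>Q)\<bar> < e} \<subseteq> A n"
  shows "- rate_fun M \<phi> G Q \<le> liminf (\<lambda>n. elog (measure (P n) (A n)) / ereal (real n))"
proof -
  have "ereal (F Q - p0) \<le> liminf (\<lambda>n. elog (measure (P n) (A n)) / ereal (real n))"
  proof (rule ereal_le_epsilon2)
    fix d :: real assume d: "0 < d"
    define \<epsilon> where "\<epsilon> = min e (d / 2)"
    have eps: "0 < \<epsilon>" "\<epsilon> \<le> e" "\<epsilon> \<le> d / 2" using e d by (auto simp: \<epsilon>_def)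
    have c: "ereal (ent Q - d / 2) < ks_entropy M \<phi> Q" using ks_finite(1)[OF Q] d by simp
    have "\<forall>\<^sub>F n in sequentially. exp (real n * (seq_functional G Q + (ent Q - d / 2) - p0 - \<epsilon>))
       \<le> measure (P n) {x \<in> M. \<forall>f\<in>Fs. \<bar>birkhoff \<phi> n f x / real n - (\<integral>x. f x \<partial>Q)\<bar> < \<epsilon>}"
      unfolding p0_def by (rule empirical_lower_bound[OF spec P G gib Q c Fs eps(1)])
    then have "\<forall>\<^sub>F n in sequentially. ereal (F Q - p0 - d) \<le> elog (measure (P n) (A n)) / ereal (real n)"
      using A eventually_gt_at_top[of 0]
    proof eventually_elim
      case (elim n)
      interpret prob_space "P n" using probs_prob_space[OF P] .
      let ?T = "\<lambda>e. {x \<in> M. \<forall>f\<in>Fs. \<bar>birkhoff \<phi> n f x / real n - (\<integral>x. f x \<partial>Q)\<bar> < e}"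
      have sub: "?T \<epsilon> \<subseteq> ?T e" using eps(2) by force
      have "exp (real n * (F Q - p0 - d)) \<le> exp (real n * (seq_functional G Q + (ent Q - d / 2) - p0 - \<epsilon>))"
        using eps(3) by (simp add: F_def mult_left_mono)
      also have "\<dots> \<le> measure (P n) (?T \<epsilon>)" by (rule elim(1))
      also have "\<dots> \<le> measure (P n) (A n)"
        using elim(2) sub probs_sets[OF P] by (intro finite_measure_mono) auto
      finally show ?case using elim(3) by (intro elog_ge)
    qed
    then have "ereal (F Q - p0 - d) \<le> liminf (\<lambda>n. elog (measure (P n) (A n)) / ereal (real n))" by (rule Liminf_bounded)
    then have "ereal (F Q - p0 - d) + ereal d \<le> liminf (\<lambda>n. elog (measure (P n) (A n)) / ereal (real n)) + ereal d"
      by (rule add_right_mono)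
    then show "ereal (F Q - p0) \<le> liminf (\<lambda>n. elog (measure (P n) (A n)) / ereal (real n)) + ereal d" by simp
  qed
  then show ?thesis using rate_fun_eq[OF Q] by simp
qed

lemma uminus_INF_le:
  fixes f :: "'x \<Rightarrow> ereal"
  assumes "\<And>x. x \<in> S \<Longrightarrow> - f x \<le> L" shows "- (INF x\<in>S. f x) \<le> L"
  unfolding ereal_uminus_le_reorder[of "INF x\<in>S. f x"]
  using assms by (intro INF_greatest) (simp add: ereal_uminus_le_reorder)

text \<open>Passing to real levels below \<open>I\<close> treats finite and infinite rates
  alike.\<close>

lemma le_uminus_INF:
  fixes I :: ereal
  assumes "\<And>c. ereal c < I \<Longrightarrow> L \<le> ereal (- c)" shows "L \<le> - I"
proof -
  have "I \<le> - L"
  proof (rule dense_le)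
    fix x assume x: "x < I"
    show "x \<le> - L"
    proof (cases x)
      case (real c)
      then have "L \<le> - x" using assms[of c] x by simp
      then show ?thesis using ereal_uminus_le_reorder[of "- L" "- x"] by simp
    qed (use x in auto)
  qed
  then show ?thesis using ereal_uminus_le_reorder[of "- I" "- L"] by simp
qed

theorem ldp_empirical:
  assumes Gam: "\<Gamma> \<in> weak_borel M"
  shows "- (INF Q \<in> (weak_top M) interior_of \<Gamma>. rate_fun M \<phi> G Q)
          \<le> liminf (\<lambda>n. elog (measure (P n) {x \<in> M. empirical M \<phi> n x \<in> \<Gamma>}) / ereal (real n))"
    and "limsup (\<lambda>n. elog (measure (P n) {x \<in> M. empirical M \<phi> n x \<in> \<Gamma>}) / ereal (real n))
          \<le> - (INF Q \<in> (weak_top M) closure_of \<Gamma>. rate_fun M \<phi> G Q)"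
proof -
  show "- (INF Q \<in> (weak_top M) interior_of \<Gamma>. rate_fun M \<phi> G Q)
          \<le> liminf (\<lambda>n. elog (measure (P n) {x \<in> M. empirical M \<phi> n x \<in> \<Gamma>}) / ereal (real n))"
  proof (rule uminus_INF_le)
    fix Q assume Q: "Q \<in> (weak_top M) interior_of \<Gamma>"
    show "- rate_fun M \<phi> G Q \<le> liminf (\<lambda>n. elog (measure (P n) {x \<in> M. empirical M \<phi> n x \<in> \<Gamma>}) / ereal (real n))"
    proof (cases "Q \<in> inv_probs M \<phi>")
      case False then show ?thesis by (simp add: rate_fun_def)
    next
      case True
      obtain Fs e where Fs: "finite Fs" "\<And>f. f \<in> Fs \<Longrightarrow> continuous_on M f" "0 < (e::real)"
        "\<And>Q'. Q' \<in> probs M \<Longrightarrow> (\<And>f. f \<in> Fs \<Longrightarrow> \<bar>(\<integral>x. f x \<partial>Q') - (\<integral>x. f x \<partial>Q)\<bar> < e) \<Longrightarrow> Q' \<in> (weak_top M) interior_of \<Gamma>"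
        by (rule weak_top_nbhd[OF openin_interior_of Q]) blast
      show ?thesis
      proof (rule lower_event[OF True Fs(1,2,3)])
        show "\<forall>\<^sub>F n in sequentially. {x \<in> M. empirical M \<phi> n x \<in> \<Gamma>} \<in> sets BM \<and>
          {x \<in> M. \<forall>f\<in>Fs. \<bar>birkhoff \<phi> n f x / real n - (\<integral>x. f x \<partial>Q)\<bar> < e} \<subseteq> {x \<in> M. empirical M \<phi> n x \<in> \<Gamma>}"
          using eventually_ge_at_top[of 1]
        proof eventually_elim
          case (elim n)
          have "empirical M \<phi> n x \<in> \<Gamma>"
            if x: "x \<in> M" and cl: "\<forall>f\<in>Fs. \<bar>birkhoff \<phi> n f x / real n - (\<integral>x. f x \<partial>Q)\<bar> < e" for x
          proof -
            have "empirical M \<phi> n x \<in> (weak_top M) interior_of \<Gamma>"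
              using cl empirical_integral[OF elim x Fs(2)] by (intro Fs(4) empirical_probs[OF elim x]) auto
            then show ?thesis by (rule subsetD[OF interior_of_subset])
          qed
          then show ?case using empirical_event_sets[OF elim Gam] by blast
        qed
      qed
    qed
  qed
  show "limsup (\<lambda>n. elog (measure (P n) {x \<in> M. empirical M \<phi> n x \<in> \<Gamma>}) / ereal (real n))
          \<le> - (INF Q \<in> (weak_top M) closure_of \<Gamma>. rate_fun M \<phi> G Q)"
  proof (rule le_uminus_INF)
    fix c assume c: "ereal c < (INF Q \<in> (weak_top M) closure_of \<Gamma>. rate_fun M \<phi> G Q)"
    let ?C = "(weak_top M) closure_of \<Gamma>"
    have Cp: "?C \<subseteq> probs M" using closure_of_subset_topspace[of "weak_top M" \<Gamma>] by (simp add: topspace_weak_top)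
    define \<Lambda> where "\<Lambda> V = pressure M \<phi> (tilt V) - p0" for V
    obtain D :: "('a \<Rightarrow> real) set" where D: "countable D" "\<And>g. g \<in> D \<Longrightarrow> continuous_on M g"
      "\<And>f e. continuous_on M f \<Longrightarrow> 0 < e \<Longrightarrow> \<exists>g\<in>D. \<forall>x\<in>M. \<bar>f x - g x\<bar> < e"
      by (rule countable_dense_functions) blast
    have Dne: "D \<noteq> {}" using D(3)[of "\<lambda>_. 0" 1] by auto
    define V where "V j = from_nat_into D j" for j
    have Vc: "continuous_on M (V j)" for j unfolding V_def using D(2) from_nat_into[OF Dne] by blast
    have cover: "\<exists>j. c < (\<integral>x. V j x \<partial>Q) - \<Lambda> (V j)" if Q: "Q \<in> ?C" for Q
    proof -
      have Qp: "Q \<in> probs M" using Q Cp by blast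
      have "ereal c < rate_fun M \<phi> G Q" using c INF_lower[OF Q, of "rate_fun M \<phi> G"] by (rule less_le_trans)
      then obtain W where W: "continuous_on M W" "c < (\<integral>x. W x \<partial>Q) - \<Lambda> W" using duality[OF Qp] unfolding \<Lambda>_def by blast
      \<comment> \<open>One third of the slack pays for the change of the integral, one for the
        change of the pressure, and one stays strict.\<close>
      define d where "d = ((\<integral>x. W x \<partial>Q) - \<Lambda> W - c) / 3"
      have d: "0 < d" using W(2) by (simp add: d_def)
      obtain g where g: "g \<in> D" "\<And>x. x \<in> M \<Longrightarrow> \<bar>W x - g x\<bar> < d" using D(3)[OF W(1) d] by blast
      have gc: "continuous_on M g" by (rule D(2)[OF g(1)])
      have "(\<integral>x. W x \<partial>Q) - (\<integral>x. g x \<partial>Q) = (\<integral>x. W x - g x \<partial>Q)" using probs_integrable[OF Qp W(1)] probs_integrable[OF Qp gc] by simp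
      also have "\<dots> \<le> d"
      proof (rule probs_integral_le[OF Qp])
        show "integrable Q (\<lambda>x. W x - g x)" using probs_integrable[OF Qp W(1)] probs_integrable[OF Qp gc] by simp
        show "W x - g x \<le> d" if "x \<in> M" for x using g(2)[OF that] by linarith
      qed
      finally have 1: "(\<integral>x. W x \<partial>Q) - (\<integral>x. g x \<partial>Q) \<le> d" .
      have "pressure M \<phi> (tilt g) \<le> pressure M \<phi> (tilt W) + d"
      proof (rule pressure_diff[OF ne top AA_tilt[OF gc] AA_tilt[OF W(1)]], intro always_eventually allI ballI)
        fix n x assume x: "x \<in> M"
        have "birkhoff \<phi> n g x \<le> (\<Sum>k<n. W ((\<phi> ^^ k) x) + d)"
          unfolding birkhoff_def
        proof (rule sum_mono)
          fix k
          show "g ((\<phi> ^^ k) x) \<le> W ((\<phi> ^^ k) x) + d" using g(2)[OF iter_in[OF x, of k]] by linarith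
        qed
        then show "tilt g n x \<le> tilt W n x + d * real n" by (simp add: tilt_def birkhoff_def sum.distrib mult.commute)
      qed
      then have "c < (\<integral>x. g x \<partial>Q) - \<Lambda> g" using 1 d by (simp add: \<Lambda>_def d_def field_simps)
      moreover obtain j where "V j = g" using from_nat_into_surj[OF D(1) g(1)] unfolding V_def by blast
      ultimately show ?thesis by blast
    qed
    \<comment> \<open>Finite subcover by sequential compactness: measures missed by the first
      \<open>N\<close> test functions for every \<open>N\<close> would have a limit point in the
      closed set that is missed by all of them.\<close>
    have "\<exists>N. \<forall>Q\<in>?C. \<exists>j\<le>N. c < (\<integral>x. V j x \<partial>Q) - \<Lambda> (V j)"
    proof (rule ccontr)
      assume neg: "\<not> ?thesis"
      then have "\<forall>N. \<exists>Q. Q \<in> ?C \<and> (\<forall>j\<le>N. \<not> c < (\<integral>x. V j x \<partial>Q) - \<Lambda> (V j))" by blast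
      from choice[OF this] obtain X where X: "\<And>N. X N \<in> ?C" "\<And>N j. j \<le> N \<Longrightarrow> \<not> c < (\<integral>x. V j x \<partial>X N) - \<Lambda> (V j)" by blast
      have Xp: "X n \<in> probs M" for n using X(1) Cp by blast
      obtain r Q where r: "strict_mono (r :: nat \<Rightarrow> nat)" and Qp: "Q \<in> probs M" and w: "wconv (X \<circ> r) Q"
        by (rule seq_compact_probs[of X]) (use Xp in auto)
      have QC: "Q \<in> ?C" using Xp X(1) by (intro wconv_closure[OF _ w Qp]) auto
      obtain j where j: "c < (\<integral>x. V j x \<partial>Q) - \<Lambda> (V j)" using cover[OF QC] by blast
      have "(\<lambda>n. (\<integral>x. V j x \<partial>(X \<circ> r) n) - \<Lambda> (V j)) \<longlonglongrightarrow> (\<integral>x. V j x \<partial>Q) - \<Lambda> (V j)"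
        using w Vc unfolding wconv_def by (intro tendsto_diff tendsto_const) auto
      then have "\<forall>\<^sub>F n in sequentially. c < (\<integral>x. V j x \<partial>(X \<circ> r) n) - \<Lambda> (V j)" using j by (rule order_tendstoD(1))
      then have "\<forall>\<^sub>F n::nat in sequentially. False" using eventually_ge_at_top[of j]
      proof eventually_elim
        case (elim n)
        have "j \<le> r n" using elim(2) seq_suble[OF r, of n] by linarith
        then show ?case using X(2)[of j "r n"] elim(1) by simp
      qed
      then show False by simp
    qed
    then obtain N where N: "\<And>Q. Q \<in> ?C \<Longrightarrow> \<exists>j\<le>N. c < (\<integral>x. V j x \<partial>Q) - \<Lambda> (V j)" by blast
    show "limsup (\<lambda>n. elog (measure (P n) {x \<in> M. empirical M \<phi> n x \<in> \<Gamma>}) / ereal (real n)) \<le> ereal (- c)"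
    proof (rule chernoff_upper[OF P, where J="{..N}" and W="\<lambda>j n. birkhoff \<phi> n (V j)" and \<Lambda>="\<lambda>j. \<Lambda> (V j)"])
      show "\<forall>\<^sub>F n in sequentially. {x \<in> M. empirical M \<phi> n x \<in> \<Gamma>} \<subseteq> (\<Union>j\<in>{..N}. {x \<in> M. real n * (\<Lambda> (V j) + c) \<le> birkhoff \<phi> n (V j) x})"
        using eventually_ge_at_top[of 1]
      proof eventually_elim
        case (elim n)
        show ?case
        proof
          fix x assume "x \<in> {x \<in> M. empirical M \<phi> n x \<in> \<Gamma>}"
          then have x: "x \<in> M" "empirical M \<phi> n x \<in> \<Gamma>" by auto
          have "empirical M \<phi> n x \<in> ?C"
            using x empirical_probs[OF elim x(1)] by (simp add: closure_of topspace_weak_top)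
          then obtain j where j: "j \<le> N" "c < (\<integral>y. V j y \<partial>empirical M \<phi> n x) - \<Lambda> (V j)" using N by blast
          then have "\<Lambda> (V j) + c < birkhoff \<phi> n (V j) x / real n" using empirical_integral[OF elim x(1) Vc] by simp
          then have "real n * (\<Lambda> (V j) + c) \<le> birkhoff \<phi> n (V j) x" using elim by (simp add: field_simps)
          then show "x \<in> (\<Union>j\<in>{..N}. {x \<in> M. real n * (\<Lambda> (V j) + c) \<le> birkhoff \<phi> n (V j) x})" using j(1) x(1) by auto
        qed
      qed
      show "\<forall>\<^sub>F n in sequentially. (\<integral>x. exp (birkhoff \<phi> n (V j) x) \<partial>P n) \<le> exp (real n * (\<Lambda> (V j) + e))" if "0 < e" for j e
        unfolding \<Lambda>_def by (rule mgf_bound[OF Vc that])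
    qed (auto intro: continuous_borel birkhoff_cont Vc exp_birkhoff_integrable)
  qed
qed

subsection \<open>Large deviations of asymptotically additive observables\<close>

definition shifted :: "(nat \<Rightarrow> 'a \<Rightarrow> real) \<Rightarrow> real \<Rightarrow> nat \<Rightarrow> 'a \<Rightarrow> real" where
  "shifted V \<alpha> = (\<lambda>n x. G n x + \<alpha> * V n x)"

lemma AA_shifted: "AA V \<Longrightarrow> AA (shifted V \<alpha>)"
  using AA_lin[OF G, of V 1 \<alpha>] by (simp add: shifted_def)

lemma seq_functional_shifted:
  "AA V \<Longrightarrow> Q \<in> inv_probs M \<phi> \<Longrightarrow> seq_functional (shifted V \<alpha>) Q = seq_functional G Q + \<alpha> * seq_functional V Q"
  using seq_functional_lin[OF G, of V Q 1 \<alpha>] by (simp add: shifted_def)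

text \<open>For pressure, means and exponential moments, \<open>\<alpha> * V n\<close> is replaced
  by Birkhoff sums of one continuous function, which brings it within reach of (C1).\<close>

lemma shifted_approx:
  assumes V: "AA V" and e: "0 < e"
  obtains g where "continuous_on M g"
    "\<forall>\<^sub>F n in sequentially. \<forall>x\<in>M. \<bar>\<alpha> * V n x - birkhoff \<phi> n g x\<bar> \<le> e * real n"
    "\<And>Q. Q \<in> inv_probs M \<phi> \<Longrightarrow> \<bar>\<alpha> * seq_functional V Q - (\<integral>x. g x \<partial>Q)\<bar> \<le> e"
    "pressure M \<phi> (tilt g) \<le> pressure M \<phi> (shifted V \<alpha>) + e"
proof -
  have A: "AA (\<lambda>n x. \<alpha> * V n x + 0 * V n x)" by (rule AA_lin[OF V V])
  then have A': "AA (\<lambda>n x. \<alpha> * V n x)" by simp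
  obtain g where g: "continuous_on M g" "\<forall>\<^sub>F n in sequentially. \<forall>x\<in>M. \<bar>\<alpha> * V n x - birkhoff \<phi> n g x\<bar> \<le> e * real n"
    using AA_approx[OF A' e] by blast
  have "\<bar>\<alpha> * seq_functional V Q - (\<integral>x. g x \<partial>Q)\<bar> \<le> e" if Q: "Q \<in> inv_probs M \<phi>" for Q
    using seq_functional_close[OF A' Q g] seq_functional_lin[OF V V Q, of \<alpha> 0] by simp
  moreover have "\<forall>\<^sub>F n in sequentially. \<forall>x\<in>M. tilt g n x \<le> shifted V \<alpha> n x + e * real n"
    using g(2) by eventually_elim (auto simp: tilt_def shifted_def abs_le_iff algebra_simps)
  then have "pressure M \<phi> (tilt g) \<le> pressure M \<phi> (shifted V \<alpha>) + e"
    by (rule pressure_diff[OF ne top AA_tilt[OF g(1)] AA_shifted[OF V]])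
  ultimately show ?thesis using that g by blast
qed

lemma F_le_shifted:
  assumes V: "AA V" and Q: "Q \<in> inv_probs M \<phi>"
  shows "F Q + \<alpha> * seq_functional V Q \<le> pressure M \<phi> (shifted V \<alpha>)"
proof (rule field_le_epsilon)
  fix e :: real assume "0 < e"
  then have e2: "0 < e / 2" by simp
  obtain g where g: "continuous_on M g" "\<bar>\<alpha> * seq_functional V Q - (\<integral>x. g x \<partial>Q)\<bar> \<le> e / 2"
    "pressure M \<phi> (tilt g) \<le> pressure M \<phi> (shifted V \<alpha>) + e / 2"
    by (rule shifted_approx[OF V e2, of \<alpha>]) (use Q in blast)
  then show "F Q + \<alpha> * seq_functional V Q \<le> pressure M \<phi> (shifted V \<alpha>) + e"
    using F_le_tilt[OF g(1) Q] by linarith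
qed

lemma exp_AA_integrable:
  assumes V: "AA V" shows "integrable (P n) (\<lambda>x. exp (\<alpha> * V n x))"
proof -
  obtain B where B: "\<And>x. x \<in> M \<Longrightarrow> \<bar>V n x\<bar> \<le> B" using AA_bounded[OF V] by blast
  show ?thesis
  proof (rule probs_integrable_bounded[OF P])
    show "(\<lambda>x. exp (\<alpha> * V n x)) \<in> borel_measurable BM" using AA_measurable[OF V] by simp
    fix x assume "x \<in> M"
    have "\<alpha> * V n x \<le> \<bar>\<alpha> * V n x\<bar>" by simp
    also have "\<dots> \<le> \<bar>\<alpha>\<bar> * B" using B[OF \<open>x \<in> M\<close>] by (simp add: abs_mult mult_left_mono)
    finally show "\<bar>exp (\<alpha> * V n x)\<bar> \<le> exp (\<bar>\<alpha>\<bar> * B)" by simp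
  qed
qed

lemma mgf_shifted:
  assumes V: "AA V" and e: "0 < e"
  shows "\<forall>\<^sub>F n in sequentially. (\<integral>x. exp (\<alpha> * V n x) \<partial>P n) \<le> exp (real n * ((pressure M \<phi> (shifted V \<alpha>) - p0) + e))"
proof -
  have e3: "0 < e / 3" using e by simp
  obtain g where g: "continuous_on M g"
    "\<forall>\<^sub>F n in sequentially. \<forall>x\<in>M. \<bar>\<alpha> * V n x - birkhoff \<phi> n g x\<bar> \<le> e / 3 * real n"
    "pressure M \<phi> (tilt g) \<le> pressure M \<phi> (shifted V \<alpha>) + e / 3"
    by (rule shifted_approx[OF V e3, of \<alpha>]) blast
  show ?thesis using g(2) mgf_bound[OF g(1) e3]
  proof eventually_elim
    case (elim n)
    have "(\<integral>x. exp (\<alpha> * V n x) \<partial>P n) \<le> (\<integral>x. exp (e / 3 * real n) * exp (birkhoff \<phi> n g x) \<partial>P n)"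
    proof (rule integral_mono)
      show "integrable (P n) (\<lambda>x. exp (e / 3 * real n) * exp (birkhoff \<phi> n g x))" using exp_birkhoff_integrable[OF g(1)] by simp
      fix x assume "x \<in> space (P n)"
      then have "\<bar>\<alpha> * V n x - birkhoff \<phi> n g x\<bar> \<le> e / 3 * real n" using elim(1) probs_space[OF P] by blast
      then have "\<alpha> * V n x \<le> e / 3 * real n + birkhoff \<phi> n g x" by linarith
      then show "exp (\<alpha> * V n x) \<le> exp (e / 3 * real n) * exp (birkhoff \<phi> n g x)" by (simp add: exp_add[symmetric])
    qed (rule exp_AA_integrable[OF V])
    also have "\<dots> = exp (e / 3 * real n) * (\<integral>x. exp (birkhoff \<phi> n g x) \<partial>P n)" by simp
    also have "\<dots> \<le> exp (e / 3 * real n) * exp (real n * ((pressure M \<phi> (tilt g) - p0) + e / 3))"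
      by (intro mult_left_mono elim(2)) simp
    also have "\<dots> = exp (real n * ((pressure M \<phi> (tilt g) - p0) + 2 * (e / 3)))" by (simp add: exp_add[symmetric] algebra_simps)
    also have "\<dots> \<le> exp (real n * ((pressure M \<phi> (shifted V \<alpha>) - p0) + e))"
    proof -
      have "(pressure M \<phi> (tilt g) - p0) + 2 * (e / 3) \<le> (pressure M \<phi> (shifted V \<alpha>) - p0) + e" using g(3) by linarith
      then show ?thesis by (simp add: mult_left_mono)
    qed
    finally show ?case .
  qed
qed

text \<open>If no invariant measure nearly satisfied both demands, separation in the plane would
  produce a tilt that violates \<open>lo\<close>. Compactness and semicontinuity of \<open>F\<close>
  turn near solutions into an exact one.\<close>

lemma attained:
  assumes V: "AA V" and lo: "\<And>\<alpha>. c \<le> pressure M \<phi> (shifted V \<alpha>) - \<alpha> * s"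
  shows "\<exists>Q\<in>inv_probs M \<phi>. seq_functional V Q = s \<and> c \<le> F Q"
proof -
  \<comment> \<open>Squared distance of the point (V(Q), F(Q)) from the vertical half-line over
    \<open>s\<close> that starts at height \<open>c\<close>.\<close>
  define J where "J Q = (seq_functional V Q - s)\<^sup>2 + (max 0 (c - F Q))\<^sup>2" for Q
  obtain C where C: "\<forall>Q\<in>inv_probs M \<phi>. \<bar>F Q\<bar> \<le> C" using F_lower by blast
  obtain h where h: "continuous_on M h" "\<forall>\<^sub>F n in sequentially. \<forall>x\<in>M. \<bar>V n x - birkhoff \<phi> n h x\<bar> \<le> 1 * real n"
    using AA_approx[OF V zero_less_one] by blast
  obtain B where B: "0 < B" "\<And>x. x \<in> M \<Longrightarrow> \<bar>h x\<bar> \<le> B" by (rule continuous_bound[OF h(1)]) blast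
  have VB: "\<bar>seq_functional V Q\<bar> \<le> B + 1" if Q: "Q \<in> inv_probs M \<phi>" for Q
    using probs_integral_abs_le[OF inv_probs_probs[OF Q] continuous_borel[OF h(1)] B(2)] seq_functional_close[OF V Q h] by linarith
  have small: "\<exists>Q\<in>inv_probs M \<phi>. J Q < r0" if r0: "0 < r0" for r0
  proof (rule ccontr)
    assume neg: "\<not> ?thesis"
    obtain l \<mu> \<eta> where sep: "0 \<le> \<mu>" "0 < \<eta>"
      "\<And>R. R \<in> inv_probs M \<phi> \<Longrightarrow> \<eta> \<le> (\<Sum>i\<in>{()}. l i * (seq_functional V R - s)) + \<mu> * (c - F R)"
    proof (rule concave_separation[of "inv_probs M \<phi>" "{()}" "\<lambda>_ R. seq_functional V R - s" F c "(B + 1 + \<bar>s\<bar>)\<^sup>2 + (\<bar>c\<bar> + C)\<^sup>2" r0])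
      show "inv_probs M \<phi> \<noteq> {}" by (rule inv_probs_nonempty)
      show "0 < r0" by (rule r0)
      fix R assume R: "R \<in> inv_probs M \<phi>"
      have "\<bar>seq_functional V R - s\<bar> \<le> B + 1 + \<bar>s\<bar>" using VB[OF R] by linarith
      from power_mono[OF this abs_ge_zero, of 2] have 1: "(seq_functional V R - s)\<^sup>2 \<le> (B + 1 + \<bar>s\<bar>)\<^sup>2" by simp
      have "\<bar>c - F R\<bar> \<le> \<bar>c\<bar> + C" using C R by fastforce
      from power_mono[OF this abs_ge_zero, of 2] have 2: "(c - F R)\<^sup>2 \<le> (\<bar>c\<bar> + C)\<^sup>2" by simp
      show "(\<Sum>i\<in>{()}. (seq_functional V R - s)\<^sup>2) + (c - F R)\<^sup>2 \<le> (B + 1 + \<bar>s\<bar>)\<^sup>2 + (\<bar>c\<bar> + C)\<^sup>2" using 1 2 by simp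
      show "r0 \<le> (\<Sum>i\<in>{()}. (seq_functional V R - s)\<^sup>2) + (max 0 (c - F R))\<^sup>2" using neg R by (auto simp: J_def not_less)
    next
      fix Q1 Q2 t assume Q12: "Q1 \<in> inv_probs M \<phi>" "Q2 \<in> inv_probs M \<phi>" and t: "0 \<le> t" "t \<le> (1::real)"
      obtain R where R: "R \<in> inv_probs M \<phi>"
        "\<And>V. AA V \<Longrightarrow> seq_functional V R = (1 - t) * seq_functional V Q1 + t * seq_functional V Q2"
        "(1 - t) * F Q1 + t * F Q2 \<le> F R"
        by (rule F_mix[OF Q12 t]) blast
      show "\<exists>z\<in>inv_probs M \<phi>. (\<forall>i\<in>{()}. seq_functional V z - s = (1 - t) * (seq_functional V Q1 - s) + t * (seq_functional V Q2 - s)) \<and> (1 - t) * F Q1 + t * F Q2 \<le> F z"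
        using R(1,3) R(2)[OF V] by (intro bexI[of _ R]) (auto simp: algebra_simps)
    qed blast
    define k where "k = l ()"
    have sep': "\<eta> \<le> k * (seq_functional V R - s) + \<mu> * (c - F R)" if "R \<in> inv_probs M \<phi>" for R
      using sep(3)[OF that] by (simp add: k_def)
    show False
    proof (cases "\<mu> = 0")
      case False
      then have mu: "0 < \<mu>" using sep(1) by simp
      \<comment> \<open>Solving the separating inequality for \<open>F\<close> turns it into a bound
        on the pressure tilted by this \<open>\<alpha>\<close>.\<close>
      define \<alpha> where "\<alpha> = - k / \<mu>"
      have "pressure M \<phi> (shifted V \<alpha>) \<le> c + \<alpha> * s - \<eta> / \<mu>"
      proof (rule pressure_le[OF AA_shifted[OF V]])
        fix R assume R: "R \<in> inv_probs M \<phi>"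
        have "\<eta> / \<mu> \<le> (k * (seq_functional V R - s) + \<mu> * (c - F R)) / \<mu>" using sep'[OF R] mu by (intro divide_right_mono) auto
        also have "\<dots> = - \<alpha> * (seq_functional V R - s) + (c - F R)" using mu by (simp add: \<alpha>_def add_divide_distrib)
        finally show "seq_functional (shifted V \<alpha>) R + ent R \<le> c + \<alpha> * s - \<eta> / \<mu>"
          unfolding seq_functional_shifted[OF V R] by (simp add: F_def algebra_simps)
      qed
      moreover have "0 < \<eta> / \<mu>" using mu sep(2) by simp
      ultimately show False using lo[of \<alpha>] by linarith
    next
      case True
      \<comment> \<open>A vertical separating line means that \<open>s\<close> stays away from all
        values of \<open>V\<close>. A tilt by a large multiple of \<open>k\<close> then pushes the
        pressure too low; this \<open>t\<close> violates \<open>lo\<close> with margin 1.\<close>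
      define t where "t = (p0 - c + 1) / \<eta>"
      have t: "0 \<le> t" "t * \<eta> = p0 - c + 1"
      proof -
        obtain R where R: "R \<in> inv_probs M \<phi>" using inv_probs_nonempty by blast
        have "c \<le> pressure M \<phi> (shifted V 0)" using lo[of 0] by simp
        also have "\<dots> = p0" by (simp add: shifted_def p0_def)
        finally show "0 \<le> t" using sep(2) by (simp add: t_def)
        show "t * \<eta> = p0 - c + 1" using sep(2) by (simp add: t_def)
      qed
      define \<alpha> where "\<alpha> = - (t * k)"
      have "pressure M \<phi> (shifted V \<alpha>) \<le> p0 + \<alpha> * s - t * \<eta>"
      proof (rule pressure_le[OF AA_shifted[OF V]])
        fix R assume R: "R \<in> inv_probs M \<phi>"
        have "t * \<eta> \<le> t * (k * (seq_functional V R - s))" using sep'[OF R] True t(1) by (intro mult_left_mono) auto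
        then have "\<alpha> * (seq_functional V R - s) \<le> - (t * \<eta>)" by (simp add: \<alpha>_def mult.assoc)
        then show "seq_functional (shifted V \<alpha>) R + ent R \<le> p0 + \<alpha> * s - t * \<eta>"
          unfolding seq_functional_shifted[OF V R] using F_le_p0[OF R] by (simp add: F_def right_diff_distrib)
      qed
      then show False using lo[of \<alpha>] t(2) by linarith
    qed
  qed
  have "\<forall>n. \<exists>Q. Q \<in> inv_probs M \<phi> \<and> J Q < 1 / real (Suc n)"
  proof
    fix n show "\<exists>Q. Q \<in> inv_probs M \<phi> \<and> J Q < 1 / real (Suc n)" using small[of "1 / real (Suc n)"] by auto
  qed
  from choice[OF this] obtain X where X: "\<And>n. X n \<in> inv_probs M \<phi>" "\<And>n. J (X n) < 1 / real (Suc n)" by blast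
  obtain r Q where r: "strict_mono (r :: nat \<Rightarrow> nat)" and Qp: "Q \<in> probs M" and w: "wconv (X \<circ> r) Q"
    by (rule seq_compact_probs[of X]) (use X(1) inv_probs_probs in auto)
  have Xr: "(X \<circ> r) n \<in> inv_probs M \<phi>" for n using X(1) by simp
  have Q: "Q \<in> inv_probs M \<phi>" by (rule wconv_inv_closed[OF Xr Qp w])
  have J0: "(\<lambda>n. J ((X \<circ> r) n)) \<longlonglongrightarrow> 0"
  proof (rule tendsto_sandwich[of "\<lambda>_. 0" _ _ "\<lambda>n. 1 / real (Suc (r n))"])
    show "(\<lambda>n. 1 / real (Suc (r n))) \<longlonglongrightarrow> 0"
      using LIMSEQ_subseq_LIMSEQ[OF LIMSEQ_Suc[OF lim_1_over_n] r] by (simp add: comp_def)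
  qed (use X(2) in \<open>auto simp: J_def less_imp_le\<close>)
  have "seq_functional V Q = s"
  proof -
    have "(\<lambda>n. (seq_functional V ((X \<circ> r) n) - s)\<^sup>2) \<longlonglongrightarrow> 0"
      by (rule tendsto_sandwich[OF _ _ tendsto_const J0]) (auto simp: J_def)
    moreover have "(\<lambda>n. (seq_functional V ((X \<circ> r) n) - s)\<^sup>2) \<longlonglongrightarrow> (seq_functional V Q - s)\<^sup>2"
      by (intro tendsto_intros seq_functional_wconv[OF V Xr Q w])
    ultimately have "(seq_functional V Q - s)\<^sup>2 = 0" by (rule LIMSEQ_unique[symmetric])
    then show ?thesis by simp
  qed
  moreover have "c \<le> F Q"
  proof (rule ccontr)
    assume "\<not> ?thesis"
    then have lt: "F Q < (F Q + c) / 2" and lt2: "(F Q + c) / 2 < c" by auto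
    define d where "d = c - (F Q + c) / 2"
    have d: "0 < d" using lt2 by (simp add: d_def)
    have "\<forall>\<^sub>F n in sequentially. F ((X \<circ> r) n) < (F Q + c) / 2" by (rule F_usc_seq[OF Xr w Q lt])
    moreover have "\<forall>\<^sub>F n in sequentially. J ((X \<circ> r) n) < d\<^sup>2" using d by (intro order_tendstoD(2)[OF J0]) auto
    ultimately have "\<forall>\<^sub>F n::nat in sequentially. False"
    proof eventually_elim
      case (elim n)
      have "d \<le> c - F ((X \<circ> r) n)" using elim(1) unfolding d_def by linarith
      then have "d \<le> max 0 (c - F ((X \<circ> r) n))" by simp
      then have "d\<^sup>2 \<le> (max 0 (c - F ((X \<circ> r) n)))\<^sup>2" using d by (intro power_mono) auto
      also have "\<dots> \<le> J ((X \<circ> r) n)" by (simp add: J_def)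
      finally show ?case using elim(2) by simp
    qed
    then show False by simp
  qed
  ultimately show ?thesis using Q by blast
qed

definition level_rate :: "(nat \<Rightarrow> 'a \<Rightarrow> real) \<Rightarrow> real \<Rightarrow> ereal" where
  "level_rate V s = (INF Q \<in> {Q \<in> inv_probs M \<phi>. seq_functional V Q = s}. rate_fun M \<phi> G Q)"

text \<open>One inequality is the variational lower bound for each tilt. For the other, any real
  above the supremum meets the hypothesis of \<open>attained\<close>, which returns a measure on the
  level \<open>s\<close>.\<close>

lemma legendre:
  assumes V: "AA V"
  shows "level_rate V s = (SUP \<alpha>::real. ereal (\<alpha> * s - (pressure M \<phi> (shifted V \<alpha>) - p0)))"
proof (rule antisym)
  show "(SUP \<alpha>::real. ereal (\<alpha> * s - (pressure M \<phi> (shifted V \<alpha>) - p0))) \<le> level_rate V s"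
    unfolding level_rate_def
  proof (intro SUP_least INF_greatest)
    fix \<alpha> :: real and Q assume "Q \<in> {Q \<in> inv_probs M \<phi>. seq_functional V Q = s}"
    then have Q: "Q \<in> inv_probs M \<phi>" "seq_functional V Q = s" by auto
    have "\<alpha> * s - (pressure M \<phi> (shifted V \<alpha>) - p0) \<le> p0 - F Q" using F_le_shifted[OF V Q(1), of \<alpha>] Q(2) by simp
    then show "ereal (\<alpha> * s - (pressure M \<phi> (shifted V \<alpha>) - p0)) \<le> rate_fun M \<phi> G Q" using rate_fun_eq[OF Q(1)] by simp
  qed
  show "level_rate V s \<le> (SUP \<alpha>::real. ereal (\<alpha> * s - (pressure M \<phi> (shifted V \<alpha>) - p0)))"
  proof (rule dense_ge)
    fix x assume x: "(SUP \<alpha>::real. ereal (\<alpha> * s - (pressure M \<phi> (shifted V \<alpha>) - p0))) < x"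
    show "level_rate V s \<le> x"
    proof (cases x)
      case (real C)
      have le: "p0 - C \<le> pressure M \<phi> (shifted V \<alpha>) - \<alpha> * s" for \<alpha>
      proof -
        have "ereal (\<alpha> * s - (pressure M \<phi> (shifted V \<alpha>) - p0)) \<le> x"
          using x SUP_upper[of \<alpha> UNIV "\<lambda>\<alpha>. ereal (\<alpha> * s - (pressure M \<phi> (shifted V \<alpha>) - p0))"] by auto
        then show ?thesis using real by simp
      qed
      obtain Q where Q: "Q \<in> inv_probs M \<phi>" "seq_functional V Q = s" "p0 - C \<le> F Q" using attained[OF V le] by blast
      have "level_rate V s \<le> rate_fun M \<phi> G Q" unfolding level_rate_def using Q by (intro INF_lower) auto
      also have "\<dots> \<le> ereal C" using rate_fun_eq[OF Q(1)] Q(3) by simp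
      finally show ?thesis using real by simp
    next
      case MInf
      then show ?thesis using x by simp
    qed simp
  qed
qed

lemma level_rate_nonneg: "0 \<le> level_rate V s"
  unfolding level_rate_def using F_le_p0 rate_fun_eq by (intro INF_greatest) auto

text \<open>By the Legendre formula a sublevel set is an intersection of closed sets given by affine
  inequalities. It is bounded because the values of \<open>seq_functional V\<close> are, and an
  empty level has infinite rate.\<close>

lemma level_rate_good:
  assumes V: "AA V" shows "good_rate_function (level_rate V)"
proof -
  obtain h where h: "continuous_on M h" "\<forall>\<^sub>F n in sequentially. \<forall>x\<in>M. \<bar>V n x - birkhoff \<phi> n h x\<bar> \<le> 1 * real n"
    using AA_approx[OF V zero_less_one] by blast
  obtain B where B: "0 < B" "\<And>x. x \<in> M \<Longrightarrow> \<bar>h x\<bar> \<le> B" by (rule continuous_bound[OF h(1)]) blast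
  have VB: "\<bar>seq_functional V Q\<bar> \<le> B + 1" if Q: "Q \<in> inv_probs M \<phi>" for Q
    using probs_integral_abs_le[OF inv_probs_probs[OF Q] continuous_borel[OF h(1)] B(2)] seq_functional_close[OF V Q h] by linarith
  have "compact {s. level_rate V s \<le> ereal c}" for c :: real
  proof -
    have "{s. level_rate V s \<le> ereal c} = (\<Inter>\<alpha>. {s. \<alpha> * s - (pressure M \<phi> (shifted V \<alpha>) - p0) \<le> c})"
      unfolding legendre[OF V] by (auto simp: SUP_le_iff)
    moreover have "closed {s. \<alpha> * s - (pressure M \<phi> (shifted V \<alpha>) - p0) \<le> c}" for \<alpha>
      by (intro closed_Collect_le continuous_intros)
    ultimately have "closed {s. level_rate V s \<le> ereal c}" by auto
    moreover have "bounded {s. level_rate V s \<le> ereal c}"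
      unfolding bounded_iff
    proof (intro exI[of _ "B + 1"] ballI)
      fix s assume "s \<in> {s. level_rate V s \<le> ereal c}"
      then have "level_rate V s \<noteq> \<infinity>" by auto
      moreover have "level_rate V s = \<infinity>" if "{Q \<in> inv_probs M \<phi>. seq_functional V Q = s} = {}"
        unfolding level_rate_def that by (simp add: top_ereal_def)
      ultimately have "{Q \<in> inv_probs M \<phi>. seq_functional V Q = s} \<noteq> {}" by blast
      then show "norm s \<le> B + 1" using VB by auto
    qed
    ultimately show ?thesis by (simp add: compact_eq_bounded_closed)
  qed
  then show ?thesis unfolding good_rate_function_def using level_rate_nonneg by blast
qed

text \<open>By the Legendre formula the rate is a supremum of affine functions of the level.\<close>

lemma level_rate_convex:
  assumes V: "AA V" shows "convex_ereal_fun (level_rate V)"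
  unfolding convex_ereal_fun_def
proof (intro allI impI)
  fix x y t :: real assume t: "0 \<le> t \<and> t \<le> 1"
  define \<Lambda> where "\<Lambda> \<alpha> = pressure M \<phi> (shifted V \<alpha>) - p0" for \<alpha>
  have up: "ereal (\<alpha> * z - \<Lambda> \<alpha>) \<le> level_rate V z" for \<alpha> z
    unfolding legendre[OF V] \<Lambda>_def by (rule SUP_upper) simp
  have "ereal (\<alpha> * (t * x + (1 - t) * y) - \<Lambda> \<alpha>) \<le> ereal t * level_rate V x + ereal (1 - t) * level_rate V y" for \<alpha>
  proof -
    have "ereal (\<alpha> * (t * x + (1 - t) * y) - \<Lambda> \<alpha>) = ereal t * ereal (\<alpha> * x - \<Lambda> \<alpha>) + ereal (1 - t) * ereal (\<alpha> * y - \<Lambda> \<alpha>)"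
      by (simp add: algebra_simps)
    also have "\<dots> \<le> ereal t * level_rate V x + ereal (1 - t) * level_rate V y"
      using t by (intro add_mono ereal_mult_left_mono up) auto
    finally show ?thesis .
  qed
  then show "level_rate V (t * x + (1 - t) * y) \<le> ereal t * level_rate V x + ereal (1 - t) * level_rate V y"
    unfolding legendre[OF V, of "t * x + (1 - t) * y"] \<Lambda>_def[symmetric] by (intro SUP_least) auto
qed

theorem ldp_observable:
  assumes V: "AA V" and Gam: "\<Gamma> \<in> sets (borel :: real measure)"
  shows "- (INF s \<in> interior \<Gamma>. level_rate V s)
      \<le> liminf (\<lambda>n. elog (measure (P n) {x \<in> M. V n x / real n \<in> \<Gamma>}) / ereal (real n))"
    and "limsup (\<lambda>n. elog (measure (P n) {x \<in> M. V n x / real n \<in> \<Gamma>}) / ereal (real n))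
      \<le> - (INF s \<in> closure \<Gamma>. level_rate V s)"
proof -
  have ev: "{x \<in> M. V n x / real n \<in> \<Gamma>} \<in> sets BM" for n
  proof -
    have "(\<lambda>x. V n x / real n) \<in> borel_measurable BM" using AA_measurable[OF V] by simp
    from measurable_sets[OF this Gam] show ?thesis by (simp add: vimage_def Int_def conj_commute)
  qed
  show "- (INF s \<in> interior \<Gamma>. level_rate V s)
      \<le> liminf (\<lambda>n. elog (measure (P n) {x \<in> M. V n x / real n \<in> \<Gamma>}) / ereal (real n))"
  proof (rule uminus_INF_le)
    fix s assume s: "s \<in> interior \<Gamma>"
    show "- level_rate V s \<le> liminf (\<lambda>n. elog (measure (P n) {x \<in> M. V n x / real n \<in> \<Gamma>}) / ereal (real n))"
      unfolding level_rate_def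
    proof (rule uminus_INF_le)
      fix Q assume "Q \<in> {Q \<in> inv_probs M \<phi>. seq_functional V Q = s}"
      then have Q: "Q \<in> inv_probs M \<phi>" "seq_functional V Q = s" by auto
      obtain e where e: "0 < e" "ball s e \<subseteq> \<Gamma>" using s by (auto simp: mem_interior)
      have e3: "0 < e / 3" using e(1) by simp
      obtain g where g: "continuous_on M g" "\<forall>\<^sub>F n in sequentially. \<forall>x\<in>M. \<bar>V n x - birkhoff \<phi> n g x\<bar> \<le> e / 3 * real n"
        using AA_approx[OF V e3] by blast
      have gs: "\<bar>s - (\<integral>x. g x \<partial>Q)\<bar> \<le> e / 3" using seq_functional_close[OF V Q(1) g] Q(2) by simp
      show "- rate_fun M \<phi> G Q \<le> liminf (\<lambda>n. elog (measure (P n) {x \<in> M. V n x / real n \<in> \<Gamma>}) / ereal (real n))"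
      proof (rule lower_event[OF Q(1), where Fs="{g}" and e="e / 3"])
        show "\<forall>\<^sub>F n in sequentially. {x \<in> M. V n x / real n \<in> \<Gamma>} \<in> sets BM \<and>
          {x \<in> M. \<forall>f\<in>{g}. \<bar>birkhoff \<phi> n f x / real n - (\<integral>x. f x \<partial>Q)\<bar> < e / 3} \<subseteq> {x \<in> M. V n x / real n \<in> \<Gamma>}"
          using g(2) eventually_gt_at_top[of 0]
        proof eventually_elim
          case (elim n)
          have "V n x / real n \<in> \<Gamma>" if x: "x \<in> M" and cl: "\<bar>birkhoff \<phi> n g x / real n - (\<integral>x. g x \<partial>Q)\<bar> < e / 3" for x
          proof -
            have "\<bar>V n x - birkhoff \<phi> n g x\<bar> / real n \<le> e / 3" using elim x by (simp add: pos_divide_le_eq)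
            moreover have "\<bar>V n x - birkhoff \<phi> n g x\<bar> / real n = \<bar>V n x / real n - birkhoff \<phi> n g x / real n\<bar>"
              by (simp add: diff_divide_distrib[symmetric] abs_divide)
            ultimately have "\<bar>V n x / real n - s\<bar> < e" using cl gs by linarith
            then have "V n x / real n \<in> ball s e" by (simp add: dist_real_def abs_minus_commute)
            then show ?thesis using e(2) by blast
          qed
          then show ?case using ev by auto
        qed
      qed (use g e3 in auto)
    qed
  qed
  show "limsup (\<lambda>n. elog (measure (P n) {x \<in> M. V n x / real n \<in> \<Gamma>}) / ereal (real n))
      \<le> - (INF s \<in> closure \<Gamma>. level_rate V s)"
  proof (rule le_uminus_INF)
    fix c assume c: "ereal c < (INF s \<in> closure \<Gamma>. level_rate V s)"
    define \<Lambda> where "\<Lambda> \<alpha> = pressure M \<phi> (shifted V \<alpha>) - p0" for \<alpha>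
    obtain B where B: "0 < B" "\<forall>\<^sub>F n in sequentially. \<forall>x\<in>M. \<bar>V n x\<bar> \<le> B * real n" by (rule AA_linear_bound[OF V]) blast
    let ?K = "closure \<Gamma> \<inter> {-B..B}"
    have K: "compact ?K" by (intro closed_Int_compact) auto
    have cov: "?K \<subseteq> (\<Union>\<alpha>\<in>UNIV. {s. c < \<alpha> * s - \<Lambda> \<alpha>})"
    proof
      fix s assume "s \<in> ?K"
      then have "s \<in> closure \<Gamma>" by simp
      have "ereal c < level_rate V s" using c INF_lower[OF \<open>s \<in> closure \<Gamma>\<close>, of "level_rate V"] by (rule less_le_trans)
      then obtain \<alpha> where "ereal c < ereal (\<alpha> * s - \<Lambda> \<alpha>)" unfolding legendre[OF V] \<Lambda>_def by (auto simp: less_SUP_iff)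
      then show "s \<in> (\<Union>\<alpha>\<in>UNIV. {s. c < \<alpha> * s - \<Lambda> \<alpha>})" by auto
    qed
    have op: "\<And>\<alpha>. \<alpha> \<in> UNIV \<Longrightarrow> open {s. c < \<alpha> * s - \<Lambda> \<alpha>}" by (intro open_Collect_less continuous_intros)
    obtain J where J: "finite J" "?K \<subseteq> (\<Union>\<alpha>\<in>J. {s. c < \<alpha> * s - \<Lambda> \<alpha>})"
      by (rule compactE_image[OF K op cov]) blast
    show "limsup (\<lambda>n. elog (measure (P n) {x \<in> M. V n x / real n \<in> \<Gamma>}) / ereal (real n)) \<le> ereal (- c)"
    proof (rule chernoff_upper[OF P J(1), where W="\<lambda>\<alpha> n x. \<alpha> * V n x" and \<Lambda>=\<Lambda>])
      show "\<forall>\<^sub>F n in sequentially. {x \<in> M. V n x / real n \<in> \<Gamma>} \<subseteq> (\<Union>\<alpha>\<in>J. {x \<in> M. real n * (\<Lambda> \<alpha> + c) \<le> \<alpha> * V n x})"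
        using B(2) eventually_gt_at_top[of 0]
      proof eventually_elim
        case (elim n)
        show ?case
        proof
          fix x assume "x \<in> {x \<in> M. V n x / real n \<in> \<Gamma>}"
          then have x: "x \<in> M" "V n x / real n \<in> \<Gamma>" by auto
          have "\<bar>V n x\<bar> \<le> B * real n" using elim(1) x(1) by blast
          then have "\<bar>V n x / real n\<bar> \<le> B" using elim(2) by (simp add: pos_divide_le_eq)
          then have "V n x / real n \<in> {-B..B}" unfolding atLeastAtMost_iff by linarith
          moreover have "V n x / real n \<in> closure \<Gamma>" using x(2) closure_subset by blast
          ultimately obtain \<alpha> where a: "\<alpha> \<in> J" "c < \<alpha> * (V n x / real n) - \<Lambda> \<alpha>" using J(2) by blast
          then have "\<Lambda> \<alpha> + c < \<alpha> * V n x / real n" by simp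
          then have "real n * (\<Lambda> \<alpha> + c) \<le> \<alpha> * V n x" using elim(2) by (simp add: pos_less_divide_eq mult.commute)
          then show "x \<in> (\<Union>\<alpha>\<in>J. {x \<in> M. real n * (\<Lambda> \<alpha> + c) \<le> \<alpha> * V n x})" using a(1) x(1) by auto
        qed
      qed
      show "\<forall>\<^sub>F n in sequentially. (\<integral>x. exp (\<alpha> * V n x) \<partial>P n) \<le> exp (real n * (\<Lambda> \<alpha> + e))" if "0 < e" for \<alpha> e
        unfolding \<Lambda>_def by (rule mgf_shifted[OF V that])
    qed (use AA_measurable[OF V] exp_AA_integrable[OF V] in auto)
  qed
qed

end

lemma (in dyn_system) gibbs_lowerI:
  assumes "\<exists>\<delta>0>0. \<exists>(n0 :: real \<Rightarrow> nat) (K :: real \<Rightarrow> nat \<Rightarrow> real) (m :: real \<Rightarrow> nat \<Rightarrow> nat).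
       (\<forall>\<delta>. 0 < \<delta> \<and> \<delta> < \<delta>0 \<longrightarrow>
          1 \<le> n0 \<delta> \<and> (\<forall>n. 1 \<le> K \<delta> n) \<and>
          (\<forall>x\<in>M. \<forall>n\<ge>n0 \<delta>. exp (G n x - real n * p) / K \<delta> n \<le> measure (P n) (bowen M \<phi> (n - m \<delta> n) x \<delta>))) \<and>
       ((\<lambda>\<delta>. limsup (\<lambda>n. ereal ((ln (K \<delta> n) + real (m \<delta> n)) / real n))) \<longlongrightarrow> 0) (at_right 0)"
  shows "gibbs_lower P G p"
proof -
  obtain \<delta>0 n0 K m where d0: "0 < \<delta>0"
    and K: "\<And>\<delta> n. 0 < \<delta> \<Longrightarrow> \<delta> < \<delta>0 \<Longrightarrow> 1 \<le> K \<delta> n"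
    and b: "\<And>\<delta> x n. 0 < \<delta> \<Longrightarrow> \<delta> < \<delta>0 \<Longrightarrow> x \<in> M \<Longrightarrow> n \<ge> n0 \<delta> \<Longrightarrow>
        exp (G n x - real n * p) / K \<delta> n \<le> measure (P n) (bowen M \<phi> (n - m \<delta> n) x \<delta>)"
    and lim: "((\<lambda>\<delta>. limsup (\<lambda>n. ereal ((ln (K \<delta> n) + real (m \<delta> n)) / real n))) \<longlongrightarrow> 0) (at_right 0)"
    using assms by blast
  show ?thesis unfolding gibbs_lower_def
  proof (intro allI impI)
    fix \<eta> :: real assume eta: "0 < \<eta>"
    have 1: "\<forall>\<^sub>F \<delta> in at_right 0. limsup (\<lambda>n. ereal ((ln (K \<delta> n) + real (m \<delta> n)) / real n)) < ereal \<eta>"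
      using eta by (intro order_tendstoD(2)[OF lim]) auto
    have 2: "\<forall>\<^sub>F \<delta> in at_right (0::real). 0 < \<delta>" by (rule eventually_at_right_less)
    have 3: "\<forall>\<^sub>F \<delta> in at_right (0::real). \<delta> < \<delta>0" using d0 by (rule order_tendstoD(2)[OF tendsto_ident_at])
    from 1 2 3 show "\<forall>\<^sub>F \<delta> in at_right 0. \<forall>\<^sub>F n in sequentially. \<exists>m. real m \<le> \<eta> * real n \<and>
       (\<forall>x\<in>M. exp (G n x - real n * p - \<eta> * real n) \<le> measure (P n) (bowen M \<phi> (n - m) x \<delta>))"
    proof eventually_elim
      case (elim \<delta>)
      from Limsup_lessD[OF elim(1)] eventually_ge_at_top[of "max 1 (n0 \<delta>)"] show ?case
      proof eventually_elim
        case (elim n)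
        have K1: "1 \<le> K \<delta> n" by (rule K[OF \<open>0 < \<delta>\<close> \<open>\<delta> < \<delta>0\<close>])
        have le: "ln (K \<delta> n) + real (m \<delta> n) \<le> \<eta> * real n" using elim by (simp add: pos_divide_less_eq)
        have "0 \<le> ln (K \<delta> n)" using K1 by simp
        then have mle: "real (m \<delta> n) \<le> \<eta> * real n" and Kle: "ln (K \<delta> n) \<le> \<eta> * real n" using le by linarith+
        have "K \<delta> n \<le> exp (\<eta> * real n)" using Kle K1 by (metis exp_le_cancel_iff exp_ln less_le_trans zero_less_one)
        then have "exp (G n x - real n * p - \<eta> * real n) \<le> exp (G n x - real n * p) / K \<delta> n" for x
          using K1 unfolding exp_diff[of "G n x - real n * p" "\<eta> * real n"] by (intro divide_left_mono) auto
        then have "exp (G n x - real n * p - \<eta> * real n) \<le> measure (P n) (bowen M \<phi> (n - m \<delta> n) x \<delta>)" if "x \<in> M" for x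
          using b[OF \<open>0 < \<delta>\<close> \<open>\<delta> < \<delta>0\<close> that, of n] elim(2) order_trans by fastforce
        then show ?case using mle by (intro exI[of _ "m \<delta> n"]) auto
      qed
    qed
  qed
qed

theorem theorem5p2:
  fixes M :: "'a::metric_space set" and \<phi> :: "'a \<Rightarrow> 'a"
    and P :: "nat \<Rightarrow> 'a measure" and G :: "nat \<Rightarrow> 'a \<Rightarrow> real"
  assumes cpt: "compact M"
    and cont: "continuous_on M \<phi>" and maps: "\<phi> ` M \<subseteq> M"
    and S: "spec_S M \<phi>" and usce: "USCE M \<phi>"
    and P: "\<And>n. P n \<in> probs M"
    and G: "asym_add M \<phi> G"
    and C1: "\<And>V. continuous_on M V \<Longrightarrow>
       (\<lambda>n. ln (\<integral>x. exp (birkhoff \<phi> n V x) \<partial>(P n)) / real n)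
         \<longlonglongrightarrow> pressure M \<phi> (\<lambda>n x. G n x + birkhoff \<phi> n V x) - pressure M \<phi> G"
    and C2: "\<exists>\<delta>0>0. \<exists>(n0 :: real \<Rightarrow> nat) (K :: real \<Rightarrow> nat \<Rightarrow> real) (m :: real \<Rightarrow> nat \<Rightarrow> nat).
       (\<forall>\<delta>. 0 < \<delta> \<and> \<delta> < \<delta>0 \<longrightarrow>
          1 \<le> n0 \<delta> \<and> (\<forall>n. 1 \<le> K \<delta> n) \<and>
          (\<forall>x\<in>M. \<forall>n\<ge>n0 \<delta>.
             exp (G n x - real n * pressure M \<phi> G) / K \<delta> n
               \<le> measure (P n) (bowen M \<phi> (n - m \<delta> n) x \<delta>))) \<and>
       ((\<lambda>\<delta>. limsup (\<lambda>n. ereal ((ln (K \<delta> n) + real (m \<delta> n)) / real n))) \<longlongrightarrow> 0) (at_right 0)"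
  shows
    "(\<forall>\<Gamma> \<in> weak_borel M.
        - (INF Q \<in> (weak_top M) interior_of \<Gamma>. rate_fun M \<phi> G Q)
          \<le> liminf (\<lambda>n. elog (measure (P n) {x \<in> M. empirical M \<phi> n x \<in> \<Gamma>}) / ereal (real n))
        \<and> liminf (\<lambda>n. elog (measure (P n) {x \<in> M. empirical M \<phi> n x \<in> \<Gamma>}) / ereal (real n))
          \<le> limsup (\<lambda>n. elog (measure (P n) {x \<in> M. empirical M \<phi> n x \<in> \<Gamma>}) / ereal (real n))
        \<and> limsup (\<lambda>n. elog (measure (P n) {x \<in> M. empirical M \<phi> n x \<in> \<Gamma>}) / ereal (real n))
          \<le> - (INF Q \<in> (weak_top M) closure_of \<Gamma>. rate_fun M \<phi> G Q))
     \<and>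
     (\<forall>V. asym_add M \<phi> V \<longrightarrow>
        (let I = (\<lambda>s::real. INF Q \<in> {Q \<in> inv_probs M \<phi>. seq_functional V Q = s}. rate_fun M \<phi> G Q)
         in good_rate_function I \<and> convex_ereal_fun I
          \<and> (\<forall>s. I s = (SUP \<alpha>::real. ereal (\<alpha> * s
                 - (pressure M \<phi> (\<lambda>n x. G n x + \<alpha> * V n x) - pressure M \<phi> G))))
          \<and> (\<forall>\<Gamma> \<in> sets (borel :: real measure).
               - (INF s \<in> interior \<Gamma>. I s)
                 \<le> liminf (\<lambda>n. elog (measure (P n) {x \<in> M. V n x / real n \<in> \<Gamma>}) / ereal (real n))
               \<and> liminf (\<lambda>n. elog (measure (P n) {x \<in> M. V n x / real n \<in> \<Gamma>}) / ereal (real n))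
                 \<le> limsup (\<lambda>n. elog (measure (P n) {x \<in> M. V n x / real n \<in> \<Gamma>}) / ereal (real n))
               \<and> limsup (\<lambda>n. elog (measure (P n) {x \<in> M. V n x / real n \<in> \<Gamma>}) / ereal (real n))
                 \<le> - (INF s \<in> closure \<Gamma>. I s))))"
proof -
  interpret dyn_system M \<phi> by unfold_locales (fact cpt cont maps)+
  interpret ldp_system M \<phi> P G
  proof
    show "spec_S M \<phi>" by (rule S)
    show "USCE M \<phi>" by (rule usce)
    show "P n \<in> probs M" for n by (rule P)
    show "AA G" by (rule asym_add_AA[OF G])
    show "(\<lambda>n. ln (\<integral>x. exp (birkhoff \<phi> n V x) \<partial>(P n)) / real n)
         \<longlonglongrightarrow> pressure M \<phi> (\<lambda>n x. G n x + birkhoff \<phi> n V x) - pressure M \<phi> G" if "continuous_on M V" for V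
      by (rule C1[OF that])
    show "gibbs_lower P G (pressure M \<phi> G)" by (rule gibbs_lowerI[OF C2])
  qed
  have ll: "liminf u \<le> limsup u" for u :: "nat \<Rightarrow> ereal" by (rule Liminf_le_Limsup) simp
  have obs: "good_rate_function (level_rate V) \<and> convex_ereal_fun (level_rate V)
      \<and> (\<forall>s. level_rate V s = (SUP \<alpha>::real. ereal (\<alpha> * s - (pressure M \<phi> (\<lambda>n x. G n x + \<alpha> * V n x) - pressure M \<phi> G))))
      \<and> (\<forall>\<Gamma> \<in> sets (borel :: real measure).
           - (INF s \<in> interior \<Gamma>. level_rate V s)
             \<le> liminf (\<lambda>n. elog (measure (P n) {x \<in> M. V n x / real n \<in> \<Gamma>}) / ereal (real n))
           \<and> liminf (\<lambda>n. elog (measure (P n) {x \<in> M. V n x / real n \<in> \<Gamma>}) / ereal (real n))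
             \<le> limsup (\<lambda>n. elog (measure (P n) {x \<in> M. V n x / real n \<in> \<Gamma>}) / ereal (real n))
           \<and> limsup (\<lambda>n. elog (measure (P n) {x \<in> M. V n x / real n \<in> \<Gamma>}) / ereal (real n))
             \<le> - (INF s \<in> closure \<Gamma>. level_rate V s))" if "asym_add M \<phi> V" for V
    using level_rate_good level_rate_convex legendre ldp_observable ll asym_add_AA[OF that]
    unfolding shifted_def p0_def by blast
  show ?thesis
    unfolding Let_def
    using ldp_empirical ll obs[unfolded level_rate_def[abs_def]] by blast
qed

end
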